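(* Let $d\ge 3$ and let $H_d$ be the $d$-dimensional Landau Hamiltonian. Then its integrated density of states is given by $$N(\lambda;H_d)=2^{-\frac d2}\,\pi^{1-d}\,P\left(\frac{\lambda-1}{2};d-1,1\right)$$ for $\lambda\ge 1$, and $N(\lambda;H_d)=0$ otherwise.
   Context: Let $D_j=-i\,\partial/\partial x_j$. The Landau Hamiltonian acting in $\mathbb R^d$ is $H_d=(D_1+x_2)^2+D_2^2+\dots+D_d^2$. Its integrated density of states is $$N(\lambda;H_d)=\lim_{L\to\infty}\frac{\tilde N(\lambda;H_L)}{L^d},$$ where $H_L$ is the restriction of $H_d$ to the cube $[0,L]^d$ with periodic boundary conditions in $x_1$ and Dirichlet boundary conditions in $(x_2,\dots,x_d)$, and $\tilde N(\lambda;H_L)$ is the counting function (with multiplicity) of the discrete eigenvalues of $H_L$ not exceeding $\lambda$. For an integer $n\ge 2$ and $\rho\ge 0$ let $\Omega^n(\rho)=\{(x_0,x)\in\mathbb R\times\mathbb R^{n-1}: 0\le x_0\le \rho-|x|^2\}$, and for $1\le k\le n$ let $P(\rho;n,k)$ be the $(n-k)$-dimensional volume of $\Omega^n(\rho)\cap(\mathbb Z^k\times\mathbb R^{n-k})$, where the first coordinate is $x_0$. In particular $P(\rho;n,1)$ is the sum over integers $0\le j\le\rho$ of the $(n-1)$-dimensional volumes of the slices $\{x_0=j\}$ of $\Omega^n(\rho)$. *)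

theory Defs
  imports "HOL-Analysis.Analysis"
begin

section \<open>Closed operators on the space of square integrable functions\<close>

text \<open>
  The space \<open>L\<^sup>2(M)\<close> is not formed as a quotient: its elements are represented by square
  integrable functions, equality being equality almost everywhere.  An unbounded operator is
  represented by its graph, a set of pairs \<open>(f, T f)\<close> of such functions.
\<close>

definition L2_space :: "'a measure \<Rightarrow> ('a \<Rightarrow> complex) set" where
  "L2_space M = {f \<in> borel_measurable M. integrable M (\<lambda>x. (norm (f x))\<^sup>2)}"

definition L2_norm :: "'a measure \<Rightarrow> ('a \<Rightarrow> complex) \<Rightarrow> real" where
  "L2_norm M f = sqrt (\<integral>x. (norm (f x))\<^sup>2 \<partial>M)"

text \<open>The graph of the closure of the operator \<open>A\<close> with initial domain \<open>D\<close>.\<close>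

definition closure_graph ::
  "'a measure \<Rightarrow> ('a \<Rightarrow> complex) set \<Rightarrow> (('a \<Rightarrow> complex) \<Rightarrow> ('a \<Rightarrow> complex))
    \<Rightarrow> (('a \<Rightarrow> complex) \<times> ('a \<Rightarrow> complex)) set" where
  "closure_graph M D A = {(f, g). f \<in> L2_space M \<and> g \<in> L2_space M \<and>
     (\<exists>\<phi>. (\<forall>n::nat. \<phi> n \<in> D) \<and>
          (\<lambda>n. L2_norm M (\<lambda>x. \<phi> n x - f x)) \<longlonglongrightarrow> 0 \<and>
          (\<lambda>n. L2_norm M (\<lambda>x. A (\<phi> n) x - g x)) \<longlonglongrightarrow> 0)}"

definition eigenspace ::
  "(('a \<Rightarrow> complex) \<times> ('a \<Rightarrow> complex)) set \<Rightarrow> complex \<Rightarrow> ('a \<Rightarrow> complex) set" where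
  "eigenspace T z = {f. (f, \<lambda>x. z * f x) \<in> T}"

definition eigenvalue ::
  "'a measure \<Rightarrow> (('a \<Rightarrow> complex) \<times> ('a \<Rightarrow> complex)) set \<Rightarrow> complex \<Rightarrow> bool" where
  "eigenvalue M T z \<longleftrightarrow> (\<exists>f \<in> eigenspace T z. \<not> (AE x in M. f x = 0))"

definition AE_independent :: "'a measure \<Rightarrow> nat \<Rightarrow> (nat \<Rightarrow> 'a \<Rightarrow> complex) \<Rightarrow> bool" where
  "AE_independent M n f \<longleftrightarrow>
     (\<forall>c. (AE x in M. (\<Sum>i<n. c i * f i x) = 0) \<longrightarrow> (\<forall>i<n. c i = 0))"

text \<open>The dimension of the eigenspace in \<open>L\<^sup>2(M)\<close>, possibly infinite.\<close>

definition multiplicity_of ::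
  "'a measure \<Rightarrow> (('a \<Rightarrow> complex) \<times> ('a \<Rightarrow> complex)) set \<Rightarrow> complex \<Rightarrow> enat" where
  "multiplicity_of M T z =
     Sup {enat n | n. \<exists>f. (\<forall>i<n. f i \<in> eigenspace T z) \<and> AE_independent M n f}"

text \<open>
  The point \<open>z\<close> is in the resolvent set if \<open>T - z\<close> is a bijection from its domain onto
  \<open>L\<^sup>2(M)\<close> with bounded inverse; \<open>(T - z) f = g\<close> is written \<open>(f, g + z f) \<in> T\<close>.
\<close>

definition resolvent_set ::
  "'a measure \<Rightarrow> (('a \<Rightarrow> complex) \<times> ('a \<Rightarrow> complex)) set \<Rightarrow> complex set" where
  "resolvent_set M T = {z. \<not> eigenvalue M T z \<and>
     (\<exists>C. \<forall>g \<in> L2_space M. \<exists>f. (f, \<lambda>x. g x + z * f x) \<in> T \<and> L2_norm M f \<le> C * L2_norm M g)}"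

definition spectrum_of ::
  "'a measure \<Rightarrow> (('a \<Rightarrow> complex) \<times> ('a \<Rightarrow> complex)) set \<Rightarrow> complex set" where
  "spectrum_of M T = - resolvent_set M T"

definition discrete_eigenvalue ::
  "'a measure \<Rightarrow> (('a \<Rightarrow> complex) \<times> ('a \<Rightarrow> complex)) set \<Rightarrow> complex \<Rightarrow> bool" where
  "discrete_eigenvalue M T z \<longleftrightarrow>
     eigenvalue M T z \<and> multiplicity_of M T z < \<infinity> \<and> \<not> z islimpt spectrum_of M T"

text \<open>
  The values are in \<open>[0, \<infinity>]\<close>, so that an infinite count is \<open>\<infinity>\<close> and not \<open>0\<close>.
\<close>

definition counting_function ::
  "'a measure \<Rightarrow> (('a \<Rightarrow> complex) \<times> ('a \<Rightarrow> complex)) set \<Rightarrow> real \<Rightarrow> ennreal" where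
  "counting_function M T lam =
     (\<Sum>\<^sub>\<infinity>\<mu> \<in> {\<mu>. discrete_eigenvalue M T (complex_of_real \<mu>) \<and> \<mu> \<le> lam}.
        ennreal_of_enat (multiplicity_of M T (complex_of_real \<mu>)))"


section \<open>The Landau Hamiltonian\<close>

text \<open>
  Coordinates of \<open>\<real>\<^sup>d\<close> are indexed by a finite type of cardinality \<open>d\<close>; the indices \<open>i1\<close> and
  \<open>i2\<close> below (assumed distinct where it matters) play the role of the coordinates \<open>x\<^sub>1\<close>
  and \<open>x\<^sub>2\<close>.
\<close>

definition partial :: "'n \<Rightarrow> (real ^ 'n \<Rightarrow> complex) \<Rightarrow> real ^ 'n::finite \<Rightarrow> complex" where
  "partial j f = (\<lambda>x. frechet_derivative f (at x) (axis j 1))"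

definition D_op :: "'n \<Rightarrow> (real ^ 'n \<Rightarrow> complex) \<Rightarrow> real ^ 'n::finite \<Rightarrow> complex" where
  "D_op j f = (\<lambda>x. - \<i> * partial j f x)"

definition magnetic_D :: "'n \<Rightarrow> 'n \<Rightarrow> (real ^ 'n \<Rightarrow> complex) \<Rightarrow> real ^ 'n::finite \<Rightarrow> complex" where
  "magnetic_D i1 i2 f = (\<lambda>x. D_op i1 f x + complex_of_real (x $ i2) * f x)"

definition landau_op :: "'n \<Rightarrow> 'n \<Rightarrow> (real ^ 'n \<Rightarrow> complex) \<Rightarrow> real ^ 'n::finite \<Rightarrow> complex" where
  "landau_op i1 i2 f = (\<lambda>x. magnetic_D i1 i2 (magnetic_D i1 i2 f) x
                            + (\<Sum>j \<in> UNIV - {i1}. D_op j (D_op j f) x))"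

fun Ck :: "nat \<Rightarrow> (real ^ 'n::finite \<Rightarrow> complex) \<Rightarrow> bool" where
  "Ck 0 f \<longleftrightarrow> continuous_on UNIV f"
| "Ck (Suc k) f \<longleftrightarrow> (\<forall>x. f differentiable (at x)) \<and> (\<forall>j. Ck k (partial j f))"

definition cube :: "real \<Rightarrow> (real ^ 'n::finite) set" where
  "cube L = {x. \<forall>i. 0 \<le> x $ i \<and> x $ i \<le> L}"

definition cube_measure :: "real \<Rightarrow> (real ^ 'n::finite) measure" where
  "cube_measure L = restrict_space lborel (cube L)"

text \<open>
  Smooth functions on the cube with periodic boundary conditions in \<open>x\<^sub>1\<close> are given by smooth
  functions on the whole space that are \<open>L\<close>-periodic in \<open>x\<^sub>1\<close>; the values outside the
  slab \<open>0 \<le> x\<^sub>j \<le> L\<close> (\<open>j \<noteq> 1\<close>) are irrelevant.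
\<close>

definition landau_core :: "'n \<Rightarrow> real \<Rightarrow> (real ^ 'n::finite \<Rightarrow> complex) set" where
  "landau_core i1 L = {f. (\<forall>k. Ck k f) \<and>
     (\<forall>x. f (x + axis i1 L) = f x) \<and>
     (\<forall>x \<in> cube L. \<forall>j. j \<noteq> i1 \<and> (x $ j = 0 \<or> x $ j = L) \<longrightarrow> f x = 0)}"

text \<open>
  The operator is essentially self-adjoint on this core, as the core contains a complete
  orthogonal system of eigenfunctions obtained by separation of variables. Hence the closure is
  the self-adjoint realisation with these boundary conditions.
\<close>

definition landau_cube_graph ::
  "'n \<Rightarrow> 'n \<Rightarrow> real \<Rightarrow> ((real ^ 'n::finite \<Rightarrow> complex) \<times> (real ^ 'n \<Rightarrow> complex)) set" where
  "landau_cube_graph i1 i2 L = closure_graph (cube_measure L) (landau_core i1 L) (landau_op i1 i2)"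

definition landau_counting :: "'n::finite \<Rightarrow> 'n \<Rightarrow> real \<Rightarrow> real \<Rightarrow> ennreal" where
  "landau_counting i1 i2 L lam =
     counting_function (cube_measure L) (landau_cube_graph i1 i2 L) lam"

text \<open>The limit defining the integrated density of states at \<open>lam\<close> exists and equals \<open>c\<close>.\<close>

definition has_landau_ids :: "'n::finite \<Rightarrow> 'n \<Rightarrow> real \<Rightarrow> real \<Rightarrow> bool" where
  "has_landau_ids i1 i2 lam c \<longleftrightarrow>
     0 \<le> c \<and>
     ((\<lambda>L. landau_counting i1 i2 L lam / ennreal (L ^ CARD('n))) \<longlongrightarrow> ennreal c) at_top"


section \<open>Lattice slices of a paraboloid\<close>

text \<open>Points of \<open>\<real>\<^sup>n\<close> are extensional functions on \<open>{..<n}\<close>, index \<open>0\<close> being that of \<open>x\<^sub>0\<close>.\<close>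

definition Omega :: "nat \<Rightarrow> real \<Rightarrow> (nat \<Rightarrow> real) set" where
  "Omega n \<rho> = {x \<in> {..<n} \<rightarrow>\<^sub>E UNIV. 0 \<le> x 0 \<and> x 0 \<le> \<rho> - (\<Sum>i = 1..<n. (x i)\<^sup>2)}"

definition P :: "real \<Rightarrow> nat \<Rightarrow> nat \<Rightarrow> real" where
  "P \<rho> n k = (\<Sum>\<^sub>\<infinity>z \<in> {..<k} \<rightarrow>\<^sub>E \<int>.
     measure (Pi\<^sub>M {k..<n} (\<lambda>_. lborel))
       {y \<in> {k..<n} \<rightarrow>\<^sub>E UNIV. merge {..<k} {k..<n} (z, y) \<in> Omega n \<rho>})"

end

theory Submission
  imports Defs "HOL-Complex_Analysis.Complex_Analysis"
begin

text \<open>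
  The proof is an exact diagonalisation followed by a count.  On the cube, the plane wave
  \<open>exp (i \<xi> x\<^sub>1)\<close> with \<open>\<xi> = 2 \<pi> m / L\<close> turns \<open>D\<^sub>1 + x\<^sub>2\<close> into multiplication by \<open>x\<^sub>2 + \<xi>\<close>, so separation of
  variables leaves the Dirichlet problem of the harmonic oscillator \<open>- u'' + x\<^sup>2 u\<close> on the well
  \<open>[\<xi>, \<xi> + L]\<close>, with eigenvalues \<open>\<mu>\<^sub>k(\<xi>)\<close>, and sines in the remaining \<open>d - 2\<close> directions.  The eigenvalues
  are therefore \<open>\<mu>\<^sub>k(\<xi>) + \<Sum>\<^sub>j (\<pi> n\<^sub>j / L)\<^sup>2\<close>.

  A symmetric operator whose domain contains a complete orthonormal system of eigenfunctions has a
  closure that is diagonal in that system.  Its spectrum then consists of the eigenvalues alone, and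
  the counting function is the number of indices below the bound
  (\<open>orthonormal_eigensystem.counting_function_eq_card\<close>).  Three facts are needed to apply this: the
  symmetry of the operator (\<open>landau_symmetric\<close>), the smoothness of the eigenfunctions, which holds
  because every factor is an entire function, and the completeness of the system (\<open>landau_complete\<close>).
  The last one combines the completeness of trigonometric functions, from the Stone-Weierstrass theorem,
  with that of the oscillator eigenfunctions on a well (\<open>shoot_complete\<close>), from the variational
  principle.

  The oscillator on a well is treated by shooting: \<open>\<mu>\<^sub>k\<close> is the least energy at which the solution
  starting from zero at the left end has \<open>k + 1\<close> further zeros.  Sturm's comparison theorem, applied to
  Hermite functions, gives \<open>2 k + 1 \<le> \<mu>\<^sub>k(\<xi>)\<close> for every well (\<open>dirichlet_ev_ge\<close>), and
  \<open>\<mu>\<^sub>k(\<xi>) \<le> 2 k + 1 + \<epsilon>\<close> as soon as the well contains an interval \<open>[-R, R]\<close> with \<open>R\<close> depending on \<open>k\<close> and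
  \<open>\<epsilon>\<close> only (\<open>dirichlet_ev_le\<close>).  A well contributes to energies up to \<open>E\<close> only if it meets
  \<open>[- sqrt E, sqrt E]\<close>.  Up to an error of order \<open>L\<close>, both conditions leave \<open>L\<^sup>2 / (2 \<pi>)\<close> values
  of \<open>m\<close>.

  For each of them and each Landau level \<open>2 k + 1\<close>, the number of admissible \<open>n\<close> is that of lattice points
  in an orthant of a ball, which is asymptotic to \<open>L\<^bsup>d - 2\<^esup>\<close> times a power of \<open>\<lambda> - (2 k + 1)\<close>
  (\<open>lattice_ball_asymptotics\<close>).  Letting \<open>L\<close> tend to infinity and then \<open>\<epsilon>\<close> to zero gives the density as a
  sum over Landau levels.  Since \<open>\<lambda> - (2 k + 1) = 2 (\<rho> - k)\<close> with \<open>\<rho> = (\<lambda> - 1) / 2\<close>, its terms are, up to a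
  common constant, the volumes of the slices \<open>x\<^sub>0 = k\<close> of the paraboloid.
\<close>

section \<open>Homogeneous linear systems\<close>

text \<open>Gaussian elimination: an equation with a non-zero pivot removes itself and one unknown.\<close>

lemma homogeneous_system_nontrivial:
  fixes a :: "'i \<Rightarrow> 'j \<Rightarrow> 'a::field"
  assumes "finite I" "finite J" "card I < card J"
  shows "\<exists>c. (\<exists>j\<in>J. c j \<noteq> 0) \<and> (\<forall>i\<in>I. (\<Sum>j\<in>J. a i j * c j) = 0)"
  using assms
proof (induction I arbitrary: a J rule: finite_induct)
  case empty
  then obtain j where "j \<in> J" by (metis card.empty card_gt_0_iff equals0I)
  then show ?case by (intro exI[of _ "\<lambda>_. 1"]) auto
next
  case (insert i I)
  show ?case
  proof (cases "\<forall>j\<in>J. a i j = 0")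
    case True
    have "card I < card J" using insert by simp
    from insert.IH[OF insert.prems(1) this, of a] True show ?thesis by auto
  next
    case False
    then obtain p where p: "p \<in> J" "a i p \<noteq> 0" by auto
    let ?b = "\<lambda>k j. a k j - a k p * a i j / a i p"
    have "card I < card (J - {p})" using insert p by simp
    from insert.IH[of "J - {p}" ?b, OF _ this] insert.prems(1)
    obtain c where c: "\<exists>j\<in>J - {p}. c j \<noteq> 0" "\<forall>k\<in>I. (\<Sum>j\<in>J - {p}. ?b k j * c j) = 0"
      by auto
    define s where "s = (\<Sum>j\<in>J - {p}. a i j * c j)"
    define c' where "c' = (\<lambda>j. if j = p then - s / a i p else c j)"
    have split: "(\<Sum>j\<in>J. a k j * c' j) = a k p * (- s / a i p) + (\<Sum>j\<in>J - {p}. a k j * c j)" for k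
    proof -
      have "(\<Sum>j\<in>J. a k j * c' j) = a k p * c' p + (\<Sum>j\<in>J - {p}. a k j * c' j)"
        using p insert.prems(1) by (simp add: sum.remove)
      moreover have "(\<Sum>j\<in>J - {p}. a k j * c' j) = (\<Sum>j\<in>J - {p}. a k j * c j)"
        by (rule sum.cong) (auto simp: c'_def)
      ultimately show ?thesis by (simp add: c'_def)
    qed
    have "(\<Sum>j\<in>J. a k j * c' j) = 0" if "k \<in> insert i I" for k
    proof (cases "k = i")
      case True
      then show ?thesis using p unfolding split by (simp add: s_def)
    next
      case False
      then have "(\<Sum>j\<in>J - {p}. ?b k j * c j) = 0" using that c by auto
      moreover have "(\<Sum>j\<in>J - {p}. ?b k j * c j)
          = (\<Sum>j\<in>J - {p}. a k j * c j) - a k p / a i p * s"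
        unfolding s_def sum_distrib_left sum_subtractf[symmetric]
        by (rule sum.cong) (auto simp: algebra_simps)
      ultimately show ?thesis unfolding split by (simp add: algebra_simps)
    qed
    moreover have "\<exists>j\<in>J. c' j \<noteq> 0" using c(1) by (auto simp: c'_def)
    ultimately show ?thesis by blast
  qed
qed

section \<open>The space of square integrable functions\<close>

lemma borel_measurable_cnj [measurable (raw)]:
  "f \<in> borel_measurable M \<Longrightarrow> (\<lambda>x. cnj (f x)) \<in> borel_measurable M"
  by (rule borel_measurable_continuous_on[OF continuous_on_cnj[OF continuous_on_id]])

definition L2_inner :: "'a measure \<Rightarrow> ('a \<Rightarrow> complex) \<Rightarrow> ('a \<Rightarrow> complex) \<Rightarrow> complex" where
  "L2_inner M f g = (\<integral>x. f x * cnj (g x) \<partial>M)"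

lemma L2_spaceD:
  assumes "f \<in> L2_space M"
  shows "f \<in> borel_measurable M" "integrable M (\<lambda>x. (norm (f x))\<^sup>2)"
  using assms by (auto simp: L2_space_def)

lemma L2_norm_nonneg [simp]: "0 \<le> L2_norm M f"
  by (simp add: L2_norm_def)

lemma L2_norm_power2: "(L2_norm M f)\<^sup>2 = (\<integral>x. (norm (f x))\<^sup>2 \<partial>M)"
  by (simp add: L2_norm_def)

lemma L2_norm_power2_inner: "complex_of_real ((L2_norm M f)\<^sup>2) = L2_inner M f f"
  by (simp add: L2_norm_power2 L2_inner_def complex_norm_square del: of_real_power flip: integral_complex_of_real)

lemma L2_mult_abs_integrable:
  assumes "f \<in> L2_space M" "g \<in> L2_space M"
  shows "integrable M (\<lambda>x. norm (f x) * norm (g x))"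
proof -
  note [measurable] = L2_spaceD(1)[OF assms(1)] L2_spaceD(1)[OF assms(2)]
  have "norm (f x) * norm (g x) \<le> (norm (f x))\<^sup>2 + (norm (g x))\<^sup>2" for x
  proof -
    have "2 * (norm (f x) * norm (g x)) \<le> (norm (f x))\<^sup>2 + (norm (g x))\<^sup>2"
      using sum_squares_bound[of "norm (f x)" "norm (g x)"] by (simp add: mult.assoc)
    moreover have "0 \<le> norm (f x) * norm (g x)" by simp
    ultimately show ?thesis by linarith
  qed
  then show ?thesis
    by (intro Bochner_Integration.integrable_bound[OF Bochner_Integration.integrable_add[OF
          L2_spaceD(2)[OF assms(1)] L2_spaceD(2)[OF assms(2)]]]) auto
qed

lemma L2_mult_integrable:
  assumes "f \<in> L2_space M" "g \<in> L2_space M"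
  shows "integrable M (\<lambda>x. f x * cnj (g x))"
proof -
  note [measurable] = L2_spaceD(1)[OF assms(1)] L2_spaceD(1)[OF assms(2)]
  show ?thesis
    by (intro Bochner_Integration.integrable_bound[OF L2_mult_abs_integrable[OF assms]])
       (auto simp: norm_mult)
qed

lemma L2_add:
  assumes "f \<in> L2_space M" "g \<in> L2_space M"
  shows "(\<lambda>x. f x + g x) \<in> L2_space M"
proof -
  note [measurable] = L2_spaceD(1)[OF assms(1)] L2_spaceD(1)[OF assms(2)]
  have "(norm (f x + g x))\<^sup>2 \<le> 2 * ((norm (f x))\<^sup>2 + (norm (g x))\<^sup>2)" for x
  proof -
    have "(norm (f x + g x))\<^sup>2 \<le> (norm (f x) + norm (g x))\<^sup>2"
      by (intro power_mono norm_triangle_ineq) auto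
    also have "\<dots> \<le> 2 * ((norm (f x))\<^sup>2 + (norm (g x))\<^sup>2)"
      using sum_squares_bound[of "norm (f x)" "norm (g x)"] by (simp add: power2_sum)
    finally show ?thesis .
  qed
  then have "integrable M (\<lambda>x. (norm (f x + g x))\<^sup>2)"
    by (intro Bochner_Integration.integrable_bound[OF integrable_mult_right[OF
       Bochner_Integration.integrable_add[OF
          L2_spaceD(2)[OF assms(1)] L2_spaceD(2)[OF assms(2)]], of 2]]) auto
  then show ?thesis by (simp add: L2_space_def)
qed

lemma L2_scale:
  assumes "f \<in> L2_space M"
  shows "(\<lambda>x. c * f x) \<in> L2_space M"
  using assms by (auto simp: L2_space_def norm_mult power_mult_distrib)

lemma L2_diff:
  assumes "f \<in> L2_space M" "g \<in> L2_space M"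
  shows "(\<lambda>x. f x - g x) \<in> L2_space M"
  using L2_add[OF assms(1) L2_scale[OF assms(2), of "-1"]] by simp

lemma L2_zero [simp]: "(\<lambda>x. 0) \<in> L2_space M"
  by (simp add: L2_space_def)

lemma L2_sum:
  assumes "\<And>i. i \<in> F \<Longrightarrow> f i \<in> L2_space M"
  shows "(\<lambda>x. \<Sum>i\<in>F. c i * f i x) \<in> L2_space M"
  using assms by (induction F rule: infinite_finite_induct) (auto intro!: L2_add L2_scale)

lemma L2_norm_eq_0_AE:
  assumes "f \<in> L2_space M" "L2_norm M f = 0"
  shows "AE x in M. f x = 0"
proof -
  have "(\<integral>x. (norm (f x))\<^sup>2 \<partial>M) = 0" using assms(2) by (simp add: L2_norm_def)
  then have "AE x in M. (norm (f x))\<^sup>2 = 0"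
    by (subst integral_nonneg_eq_0_iff_AE[symmetric]) (auto intro: L2_spaceD(2)[OF assms(1)])
  then show ?thesis by simp
qed

lemma L2_norm_cong_AE:
  assumes "f \<in> L2_space M" "g \<in> L2_space M" "AE x in M. f x = g x"
  shows "L2_norm M f = L2_norm M g"
  unfolding L2_norm_def using L2_spaceD(1)[OF assms(1)] L2_spaceD(1)[OF assms(2)]
  by (intro arg_cong[where f = sqrt] integral_cong_AE) (use assms(3) in auto)

lemma L2_inner_cong_AE:
  assumes "f \<in> L2_space M" "g \<in> L2_space M" "h \<in> L2_space M" "AE x in M. f x = g x"
  shows "L2_inner M f h = L2_inner M g h"
  unfolding L2_inner_def
  using L2_spaceD(1)[OF assms(1)] L2_spaceD(1)[OF assms(2)] L2_spaceD(1)[OF assms(3)]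
  by (intro integral_cong_AE) (use assms(4) in auto)

lemma L2_norm_uminus_diff: "L2_norm M (\<lambda>x. f x - g x) = L2_norm M (\<lambda>x. g x - f x)"
  by (simp add: L2_norm_def norm_minus_commute)

lemma L2_norm_scale: "L2_norm M (\<lambda>x. c * f x) = norm c * L2_norm M f"
  by (simp add: L2_norm_def norm_mult power_mult_distrib real_sqrt_mult)

lemma L2_Cauchy_Schwarz_abs:
  assumes "f \<in> L2_space M" "g \<in> L2_space M"
  shows "(\<integral>x. norm (f x) * norm (g x) \<partial>M) \<le> L2_norm M f * L2_norm M g"
proof (cases "L2_norm M f = 0 \<or> L2_norm M g = 0")
  case True
  then have "AE x in M. norm (f x) * norm (g x) = 0"
    using L2_norm_eq_0_AE[OF assms(1)] L2_norm_eq_0_AE[OF assms(2)] by auto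
  then have "(\<integral>x. norm (f x) * norm (g x) \<partial>M) = 0"
    by (rule integral_eq_zero_AE)
  then show ?thesis by simp
next
  case False
  let ?a = "L2_norm M f" and ?b = "L2_norm M g"
  have pos: "?a > 0" "?b > 0" using False L2_norm_nonneg[of M f] L2_norm_nonneg[of M g] by linarith+
  let ?h = "\<lambda>x. ?b / (2 * ?a) * (norm (f x))\<^sup>2 + ?a / (2 * ?b) * (norm (g x))\<^sup>2"
  note int = L2_spaceD(2)[OF assms(1)] L2_spaceD(2)[OF assms(2)]
  have "norm (f x) * norm (g x) \<le> ?h x" for x
  proof -
    have "0 \<le> (?b * norm (f x) - ?a * norm (g x))\<^sup>2 / (2 * ?a * ?b)" using pos by simp
    also have "\<dots> = ?h x - norm (f x) * norm (g x)"
      using pos by (simp add: field_simps power2_eq_square)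
    finally show ?thesis by simp
  qed
  then have "(\<integral>x. norm (f x) * norm (g x) \<partial>M) \<le> (\<integral>x. ?h x \<partial>M)"
    by (rule integral_mono[OF L2_mult_abs_integrable[OF assms] Bochner_Integration.integrable_add[OF
          integrable_mult_right[OF int(1)] integrable_mult_right[OF int(2)]]])
  also have "\<dots> = ?b / (2 * ?a) * ?a\<^sup>2 + ?a / (2 * ?b) * ?b\<^sup>2"
    unfolding L2_norm_power2
    by (subst Bochner_Integration.integral_add)
       (simp_all only: integrable_mult_right[OF int(1)] integrable_mult_right[OF int(2)] integral_mult_right_zero)
  also have "\<dots> = ?a * ?b" using pos by (simp add: field_simps power2_eq_square)
  finally show ?thesis .
qed

lemma L2_Cauchy_Schwarz:
  assumes "f \<in> L2_space M" "g \<in> L2_space M"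
  shows "norm (L2_inner M f g) \<le> L2_norm M f * L2_norm M g"
proof -
  have "norm (L2_inner M f g) \<le> (\<integral>x. norm (f x * cnj (g x)) \<partial>M)"
    unfolding L2_inner_def by (rule integral_norm_bound)
  also have "\<dots> = (\<integral>x. norm (f x) * norm (g x) \<partial>M)" by (simp add: norm_mult)
  finally show ?thesis using L2_Cauchy_Schwarz_abs[OF assms] by linarith
qed

lemma L2_norm_triangle:
  assumes "f \<in> L2_space M" "g \<in> L2_space M"
  shows "L2_norm M (\<lambda>x. f x + g x) \<le> L2_norm M f + L2_norm M g"
proof (rule power2_le_imp_le)
  note int = L2_spaceD(2)[OF assms(1)] L2_spaceD(2)[OF assms(2)] L2_mult_abs_integrable[OF assms]
  have "(L2_norm M (\<lambda>x. f x + g x))\<^sup>2 = (\<integral>x. (norm (f x + g x))\<^sup>2 \<partial>M)"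
    by (rule L2_norm_power2)
  also have "\<dots> \<le> (\<integral>x. ((norm (f x))\<^sup>2 + (norm (g x))\<^sup>2) + 2 * (norm (f x) * norm (g x)) \<partial>M)"
  proof (rule integral_mono)
    show "(norm (f x + g x))\<^sup>2 \<le> ((norm (f x))\<^sup>2 + (norm (g x))\<^sup>2) + 2 * (norm (f x) * norm (g x))" for x
    proof -
      have "(norm (f x + g x))\<^sup>2 \<le> (norm (f x) + norm (g x))\<^sup>2"
        by (intro power_mono norm_triangle_ineq) auto
      then show ?thesis by (simp add: power2_sum algebra_simps)
    qed
  qed (use int L2_spaceD(2)[OF L2_add[OF assms]] in auto)
  also have "\<dots> = (L2_norm M f)\<^sup>2 + (L2_norm M g)\<^sup>2 + 2 * (\<integral>x. norm (f x) * norm (g x) \<partial>M)"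
    using int by (simp add: L2_norm_power2)
  also have "\<dots> \<le> (L2_norm M f + L2_norm M g)\<^sup>2"
    using L2_Cauchy_Schwarz_abs[OF assms] by (simp add: power2_sum)
  finally show "(L2_norm M (\<lambda>x. f x + g x))\<^sup>2 \<le> (L2_norm M f + L2_norm M g)\<^sup>2" .
qed simp

lemma L2_inner_diff_left:
  assumes "f \<in> L2_space M" "g \<in> L2_space M" "h \<in> L2_space M"
  shows "L2_inner M (\<lambda>x. f x - g x) h = L2_inner M f h - L2_inner M g h"
  unfolding L2_inner_def
  using L2_mult_integrable[OF assms(1,3)] L2_mult_integrable[OF assms(2,3)]
  by (simp add: left_diff_distrib)

lemma L2_inner_scale_left: "L2_inner M (\<lambda>x. c * f x) h = c * L2_inner M f h"
  unfolding L2_inner_def by (simp add: mult.assoc)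

lemma L2_inner_commute: "L2_inner M f g = cnj (L2_inner M g f)"
proof -
  have "(\<lambda>x. f x * cnj (g x)) = (\<lambda>x. cnj (g x * cnj (f x)))" by (simp add: mult.commute)
  then show ?thesis unfolding L2_inner_def by (simp only: Bochner_Integration.integral_cnj)
qed

lemma L2_inner_scale_right: "L2_inner M f (\<lambda>x. c * g x) = cnj c * L2_inner M f g"
  by (subst (1 2) L2_inner_commute) (simp add: L2_inner_scale_left)

lemma L2_inner_sum_left:
  assumes "\<And>i. i \<in> F \<Longrightarrow> f i \<in> L2_space M" "h \<in> L2_space M"
  shows "L2_inner M (\<lambda>x. \<Sum>i\<in>F. c i * f i x) h = (\<Sum>i\<in>F. c i * L2_inner M (f i) h)"
proof -
  have "L2_inner M (\<lambda>x. \<Sum>i\<in>F. c i * f i x) h = (\<integral>x. (\<Sum>i\<in>F. c i * (f i x * cnj (h x))) \<partial>M)"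
    unfolding L2_inner_def by (simp add: sum_distrib_right mult.assoc)
  also have "\<dots> = (\<Sum>i\<in>F. \<integral>x. c i * (f i x * cnj (h x)) \<partial>M)"
    by (rule Bochner_Integration.integral_sum)
       (auto intro!: integrable_mult_right L2_mult_integrable assms)
  also have "\<dots> = (\<Sum>i\<in>F. c i * L2_inner M (f i) h)" by (simp add: L2_inner_def)
  finally show ?thesis .
qed

lemma L2_inner_tendsto:
  assumes "\<And>n. s n \<in> L2_space M" "f \<in> L2_space M" "h \<in> L2_space M"
    and "(\<lambda>n. L2_norm M (\<lambda>x. s n x - f x)) \<longlonglongrightarrow> 0"
  shows "(\<lambda>n. L2_inner M (s n) h) \<longlonglongrightarrow> L2_inner M f h"
proof (rule LIM_zero_cancel, rule Lim_null_comparison)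
  show "\<forall>\<^sub>F n in sequentially. norm (L2_inner M (s n) h - L2_inner M f h)
          \<le> L2_norm M (\<lambda>x. s n x - f x) * L2_norm M h"
    using L2_Cauchy_Schwarz[OF L2_diff[OF assms(1,2)] assms(3)]
    by (simp add: L2_inner_diff_left assms)
  show "(\<lambda>n. L2_norm M (\<lambda>x. s n x - f x) * L2_norm M h) \<longlonglongrightarrow> 0"
    using tendsto_mult_left_zero[OF assms(4)] by simp
qed

lemma L2_norm_tendsto:
  assumes "\<And>n. s n \<in> L2_space M" "f \<in> L2_space M"
    and "(\<lambda>n. L2_norm M (\<lambda>x. s n x - f x)) \<longlonglongrightarrow> 0"
  shows "(\<lambda>n. L2_norm M (s n)) \<longlonglongrightarrow> L2_norm M f"
proof (rule LIM_zero_cancel, rule Lim_null_comparison[OF _ assms(3)])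
  show "\<forall>\<^sub>F n in sequentially. norm (L2_norm M (s n) - L2_norm M f) \<le> L2_norm M (\<lambda>x. s n x - f x)"
  proof (rule always_eventually, rule allI)
    fix n
    have "L2_norm M (s n) \<le> L2_norm M (\<lambda>x. s n x - f x) + L2_norm M f"
      using L2_norm_triangle[OF L2_diff[OF assms(1,2)] assms(2)] by simp
    moreover have "L2_norm M f \<le> L2_norm M (\<lambda>x. f x - s n x) + L2_norm M (s n)"
      using L2_norm_triangle[OF L2_diff[OF assms(2) assms(1)[of n]] assms(1)[of n]] by simp
    ultimately show "norm (L2_norm M (s n) - L2_norm M f) \<le> L2_norm M (\<lambda>x. s n x - f x)"
      by (simp add: L2_norm_uminus_diff[of M f])
  qed
qed

text \<open>
  On a finite measure space an \<open>L\<^sup>2\<close>-Cauchy sequence is \<open>L\<^sup>1\<close>-Cauchy, so that a subsequence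
  converges almost everywhere; by Fatou's lemma its limit is also the limit in \<open>L\<^sup>2\<close>.
\<close>

lemma (in finite_measure) Riesz_Fischer:
  assumes s: "\<And>n. s n \<in> L2_space M"
    and cauchy: "\<And>e. e > 0 \<Longrightarrow> \<exists>N. \<forall>m\<ge>N. \<forall>n\<ge>N. L2_norm M (\<lambda>x. s m x - s n x) < e"
  obtains f where "f \<in> L2_space M" "(\<lambda>n. L2_norm M (\<lambda>x. s n x - f x)) \<longlonglongrightarrow> 0"
proof -
  have meas [measurable]: "s n \<in> borel_measurable M" for n using L2_spaceD(1)[OF s] .
  have one: "(\<lambda>_. 1) \<in> L2_space M" by (simp add: L2_space_def)
  have L1: "(\<integral>x. norm (s m x - s n x) \<partial>M) \<le> L2_norm M (\<lambda>x. s m x - s n x) * L2_norm M (\<lambda>_. 1)" for m n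
    using L2_Cauchy_Schwarz_abs[OF L2_diff[OF s s] one] by simp
  have intg: "integrable M (s n)" for n
    using L2_mult_integrable[OF s one] by simp
  have "\<exists>N. \<forall>i\<ge>N. \<forall>j\<ge>N. (\<integral>x. norm (s i x - s j x) \<partial>M) < e" if "e > 0" for e
  proof -
    let ?c = "L2_norm M (\<lambda>_. 1) + 1"
    have c: "?c > 0" using L2_norm_nonneg[of M "\<lambda>_. 1"] by linarith
    have "e / ?c > 0" using that c by simp
    then obtain N where N: "\<forall>m\<ge>N. \<forall>n\<ge>N. L2_norm M (\<lambda>x. s m x - s n x) < e / ?c"
      using cauchy by blast
    have "(\<integral>x. norm (s i x - s j x) \<partial>M) < e" if "i \<ge> N" "j \<ge> N" for i j
    proof -
      have "(\<integral>x. norm (s i x - s j x) \<partial>M) \<le> L2_norm M (\<lambda>x. s i x - s j x) * ?c"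
        using L1[of i j] by (simp add: distrib_left add_increasing2)
      also have "\<dots> < e / ?c * ?c" using N that c by (intro mult_strict_right_mono) auto
      finally show ?thesis using c by simp
    qed
    then show ?thesis by blast
  qed
  from cauchy_L1_AE_cauchy_subseq[OF intg this]
  obtain r where r: "strict_mono r" "AE x in M. Cauchy (\<lambda>i. s (r i) x)" by blast
  define f where "f = (\<lambda>x. lim (\<lambda>i. s (r i) x))"
  have f_meas [measurable]: "f \<in> borel_measurable M" unfolding f_def by measurable
  have conv: "AE x in M. (\<lambda>i. s (r i) x) \<longlonglongrightarrow> f x"
    using r(2) by eventually_elim (simp add: f_def Cauchy_convergent_iff convergent_LIMSEQ_iff)
  have bound: "(\<integral>\<^sup>+x. ennreal ((norm (s n x - f x))\<^sup>2) \<partial>M) \<le> ennreal (e\<^sup>2)"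
    if N: "\<forall>m\<ge>N. \<forall>n\<ge>N. L2_norm M (\<lambda>x. s m x - s n x) < e" and n: "n \<ge> N" and e: "e > 0" for N n e
  proof -
    have "(\<integral>\<^sup>+x. ennreal ((norm (s n x - f x))\<^sup>2) \<partial>M)
        = (\<integral>\<^sup>+x. liminf (\<lambda>i. ennreal ((norm (s n x - s (r i) x))\<^sup>2)) \<partial>M)"
    proof (rule nn_integral_cong_AE, use conv in eventually_elim)
      fix x assume "(\<lambda>i. s (r i) x) \<longlonglongrightarrow> f x"
      then have "(\<lambda>i. ennreal ((norm (s n x - s (r i) x))\<^sup>2)) \<longlonglongrightarrow> ennreal ((norm (s n x - f x))\<^sup>2)"
        by (intro tendsto_intros)
      then show "ennreal ((norm (s n x - f x))\<^sup>2) = liminf (\<lambda>i. ennreal ((norm (s n x - s (r i) x))\<^sup>2))"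
        by (rule lim_imp_Liminf[OF trivial_limit_sequentially, symmetric])
    qed
    also have "\<dots> \<le> liminf (\<lambda>i. \<integral>\<^sup>+x. ennreal ((norm (s n x - s (r i) x))\<^sup>2) \<partial>M)"
      by (rule nn_integral_liminf) measurable
    also have "\<dots> \<le> limsup (\<lambda>i. \<integral>\<^sup>+x. ennreal ((norm (s n x - s (r i) x))\<^sup>2) \<partial>M)"
      by (intro Liminf_le_Limsup) simp
    also have "\<dots> \<le> ennreal (e\<^sup>2)"
    proof (rule Limsup_bounded, rule eventually_sequentiallyI[of N])
      fix i assume "N \<le> i"
      then have "r i \<ge> N" using seq_suble[OF r(1), of i] by linarith
      then have "L2_norm M (\<lambda>x. s n x - s (r i) x) < e" using N n by blast
      then have "(L2_norm M (\<lambda>x. s n x - s (r i) x))\<^sup>2 \<le> e\<^sup>2"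
        by (intro power_mono) auto
      moreover have "(\<integral>\<^sup>+x. ennreal ((norm (s n x - s (r i) x))\<^sup>2) \<partial>M)
          = ennreal ((L2_norm M (\<lambda>x. s n x - s (r i) x))\<^sup>2)"
        unfolding L2_norm_power2
        by (rule nn_integral_eq_integral[OF L2_spaceD(2)[OF L2_diff[OF s s]]]) simp
      ultimately show "(\<integral>\<^sup>+x. ennreal ((norm (s n x - s (r i) x))\<^sup>2) \<partial>M) \<le> ennreal (e\<^sup>2)"
        by (simp add: ennreal_leI)
    qed
    finally show ?thesis .
  qed
  have in_L2: "(\<lambda>x. s n x - f x) \<in> L2_space M \<and> L2_norm M (\<lambda>x. s n x - f x) \<le> e"
    if N: "\<forall>m\<ge>N. \<forall>n\<ge>N. L2_norm M (\<lambda>x. s m x - s n x) < e" and n: "n \<ge> N" and e: "e > 0" for N n e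
  proof
    note b = bound[OF that]
    have int: "integrable M (\<lambda>x. (norm (s n x - f x))\<^sup>2)"
      by (rule integrableI_bounded) (use le_less_trans[OF b ennreal_less_top] in auto)
    then show "(\<lambda>x. s n x - f x) \<in> L2_space M" by (simp add: L2_space_def)
    have "ennreal (\<integral>x. (norm (s n x - f x))\<^sup>2 \<partial>M) \<le> ennreal (e\<^sup>2)"
      using b nn_integral_eq_integral[OF int] by simp
    then have "(\<integral>x. (norm (s n x - f x))\<^sup>2 \<partial>M) \<le> e\<^sup>2" by (simp add: ennreal_le_iff)
    then show "L2_norm M (\<lambda>x. s n x - f x) \<le> e"
      using e real_sqrt_le_mono unfolding L2_norm_def by fastforce
  qed
  show thesis
  proof
    obtain N where N: "\<forall>m\<ge>N. \<forall>n\<ge>N. L2_norm M (\<lambda>x. s m x - s n x) < 1" using cauchy[of 1] by auto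
    have "(\<lambda>x. s N x - f x) \<in> L2_space M" using in_L2[OF N] by auto
    from L2_diff[OF s[of N] this] show "f \<in> L2_space M" by simp
    show "(\<lambda>n. L2_norm M (\<lambda>x. s n x - f x)) \<longlonglongrightarrow> 0"
    proof (rule LIMSEQ_I)
      fix e :: real assume e: "e > 0"
      obtain N where N: "\<forall>m\<ge>N. \<forall>n\<ge>N. L2_norm M (\<lambda>x. s m x - s n x) < e / 2"
        using cauchy[of "e / 2"] e by auto
      show "\<exists>N. \<forall>n\<ge>N. norm (L2_norm M (\<lambda>x. s n x - f x) - 0) < e"
        using in_L2[OF N] e by (intro exI[of _ N]) fastforce
    qed
  qed
qed

section \<open>Operators with an orthonormal eigenbasis\<close>

text \<open>
  The setting: the domain \<open>D\<close> contains a complete orthonormal system of eigenfunctions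
  \<open>\<phi> \<alpha>\<close> of \<open>A\<close> with real eigenvalues \<open>e \<alpha>\<close>, and only finitely many of them lie below any bound.
  The closure is then diagonal in this system, whatever else the domain contains.
\<close>

locale orthonormal_eigensystem = finite_measure M for M :: "'a measure" +
  fixes D :: "('a \<Rightarrow> complex) set" and A :: "('a \<Rightarrow> complex) \<Rightarrow> 'a \<Rightarrow> complex"
    and I :: "'i set" and \<phi> :: "'i \<Rightarrow> 'a \<Rightarrow> complex" and e :: "'i \<Rightarrow> real"
  assumes D_L2: "\<And>\<psi>. \<psi> \<in> D \<Longrightarrow> \<psi> \<in> L2_space M"
    and A_L2: "\<And>\<psi>. \<psi> \<in> D \<Longrightarrow> A \<psi> \<in> L2_space M"
    and comb_D: "\<And>F c. finite F \<Longrightarrow> F \<subseteq> I \<Longrightarrow> (\<lambda>x. \<Sum>\<alpha>\<in>F. c \<alpha> * \<phi> \<alpha> x) \<in> D"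
    and comb_A: "\<And>F c x. finite F \<Longrightarrow> F \<subseteq> I \<Longrightarrow> x \<in> space M \<Longrightarrow>
          A (\<lambda>x. \<Sum>\<alpha>\<in>F. c \<alpha> * \<phi> \<alpha> x) x = (\<Sum>\<alpha>\<in>F. (c \<alpha> * of_real (e \<alpha>)) * \<phi> \<alpha> x)"
    and symmetric: "\<And>\<psi> \<alpha>. \<psi> \<in> D \<Longrightarrow> \<alpha> \<in> I \<Longrightarrow>
          L2_inner M (A \<psi>) (\<phi> \<alpha>) = of_real (e \<alpha>) * L2_inner M \<psi> (\<phi> \<alpha>)"
    and orthonormal: "\<And>\<alpha> \<beta>. \<alpha> \<in> I \<Longrightarrow> \<beta> \<in> I \<Longrightarrow>
          L2_inner M (\<phi> \<alpha>) (\<phi> \<beta>) = (if \<alpha> = \<beta> then 1 else 0)"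
    and complete: "\<And>f. f \<in> L2_space M \<Longrightarrow> (\<forall>\<alpha>\<in>I. L2_inner M f (\<phi> \<alpha>) = 0) \<Longrightarrow> AE x in M. f x = 0"
    and locally_finite: "\<And>E. finite {\<alpha>\<in>I. e \<alpha> \<le> E}"
begin

abbreviation "T \<equiv> closure_graph M D A"

lemma eigenfunction_D: "\<alpha> \<in> I \<Longrightarrow> \<phi> \<alpha> \<in> D"
  using comb_D[of "{\<alpha>}" "\<lambda>_. 1"] by simp

lemma eigenfunction_L2: "\<alpha> \<in> I \<Longrightarrow> \<phi> \<alpha> \<in> L2_space M"
  using eigenfunction_D D_L2 by blast

lemma comb_L2: "F \<subseteq> I \<Longrightarrow> (\<lambda>x. \<Sum>\<alpha>\<in>F. c \<alpha> * \<phi> \<alpha> x) \<in> L2_space M"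
  using eigenfunction_L2 by (intro L2_sum) auto

lemma inner_comb:
  assumes "finite F" "F \<subseteq> I" "\<beta> \<in> I"
  shows "L2_inner M (\<lambda>x. \<Sum>\<alpha>\<in>F. c \<alpha> * \<phi> \<alpha> x) (\<phi> \<beta>) = (if \<beta> \<in> F then c \<beta> else 0)"
proof -
  have "L2_inner M (\<lambda>x. \<Sum>\<alpha>\<in>F. c \<alpha> * \<phi> \<alpha> x) (\<phi> \<beta>) = (\<Sum>\<alpha>\<in>F. c \<alpha> * L2_inner M (\<phi> \<alpha>) (\<phi> \<beta>))"
    using assms eigenfunction_L2 by (intro L2_inner_sum_left) auto
  also have "\<dots> = (\<Sum>\<alpha>\<in>F. if \<alpha> = \<beta> then c \<alpha> else 0)"
    using assms by (intro sum.cong) (auto simp: orthonormal)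
  finally show ?thesis using assms by simp
qed

lemma norm_comb:
  assumes "finite F" "F \<subseteq> I"
  shows "(L2_norm M (\<lambda>x. \<Sum>\<alpha>\<in>F. c \<alpha> * \<phi> \<alpha> x))\<^sup>2 = (\<Sum>\<alpha>\<in>F. (norm (c \<alpha>))\<^sup>2)"
proof -
  let ?f = "\<lambda>x. \<Sum>\<alpha>\<in>F. c \<alpha> * \<phi> \<alpha> x"
  have sw: "L2_inner M (\<phi> \<alpha>) ?f = cnj (c \<alpha>)" if "\<alpha> \<in> F" for \<alpha>
  proof -
    have "L2_inner M (\<phi> \<alpha>) ?f = cnj (L2_inner M ?f (\<phi> \<alpha>))"
      by (rule L2_inner_commute)
    then show ?thesis using inner_comb[OF assms, of \<alpha> c] assms that by auto
  qed
  have "complex_of_real ((L2_norm M ?f)\<^sup>2) = L2_inner M ?f ?f"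
    by (rule L2_norm_power2_inner)
  also have "\<dots> = (\<Sum>\<alpha>\<in>F. c \<alpha> * L2_inner M (\<phi> \<alpha>) ?f)"
    using assms eigenfunction_L2 by (intro L2_inner_sum_left comb_L2) auto
  also have "\<dots> = (\<Sum>\<alpha>\<in>F. c \<alpha> * cnj (c \<alpha>))"
    using sw by (intro sum.cong) auto
  also have "\<dots> = complex_of_real (\<Sum>\<alpha>\<in>F. (norm (c \<alpha>))\<^sup>2)"
    unfolding of_real_sum by (intro sum.cong) (auto simp: complex_norm_square simp del: of_real_power)
  finally show ?thesis by (simp only: of_real_eq_iff)
qed

lemma Bessel:
  assumes "finite F" "F \<subseteq> I" "f \<in> L2_space M"
  shows "(\<Sum>\<alpha>\<in>F. (norm (L2_inner M f (\<phi> \<alpha>)))\<^sup>2) \<le> (L2_norm M f)\<^sup>2"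
proof -
  let ?c = "\<lambda>\<alpha>. L2_inner M f (\<phi> \<alpha>)"
  let ?p = "\<lambda>x. \<Sum>\<alpha>\<in>F. ?c \<alpha> * \<phi> \<alpha> x"
  let ?S = "\<Sum>\<alpha>\<in>F. (norm (?c \<alpha>))\<^sup>2"
  have p: "?p \<in> L2_space M" using comb_L2[OF assms(2)] .
  have "L2_inner M ?p f = (\<Sum>\<alpha>\<in>F. ?c \<alpha> * L2_inner M (\<phi> \<alpha>) f)"
    using assms eigenfunction_L2 by (intro L2_inner_sum_left) auto
  also have "\<dots> = (\<Sum>\<alpha>\<in>F. ?c \<alpha> * cnj (?c \<alpha>))"
    by (subst L2_inner_commute) simp
  also have "\<dots> = complex_of_real ?S"
    unfolding of_real_sum by (intro sum.cong) (auto simp: complex_norm_square simp del: of_real_power)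
  finally have "L2_inner M ?p f = complex_of_real ?S" .
  then have "\<bar>?S\<bar> \<le> L2_norm M ?p * L2_norm M f"
    using L2_Cauchy_Schwarz[OF p assms(3)] by (simp only: norm_of_real)
  moreover have S: "L2_norm M ?p = sqrt ?S"
    using norm_comb[OF assms(1,2), of ?c] by (metis L2_norm_nonneg real_sqrt_unique)
  moreover have "?S \<ge> 0" by (intro sum_nonneg) auto
  ultimately have le: "sqrt ?S * sqrt ?S \<le> sqrt ?S * L2_norm M f" by simp
  show ?thesis
  proof (cases "?S = 0")
    case False
    then have "sqrt ?S > 0" using \<open>?S \<ge> 0\<close> by simp
    then have "sqrt ?S \<le> L2_norm M f" using le by (simp only: mult_le_cancel_left_pos)
    then have "(sqrt ?S)\<^sup>2 \<le> (L2_norm M f)\<^sup>2" using \<open>sqrt ?S > 0\<close> by (intro power_mono) auto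
    then show ?thesis using \<open>?S \<ge> 0\<close> by simp
  qed simp
qed

lemma graph_L2: "(f, g) \<in> T \<Longrightarrow> f \<in> L2_space M" "(f, g) \<in> T \<Longrightarrow> g \<in> L2_space M"
  by (auto simp: closure_graph_def)

text \<open>Symmetry passes to the closure, so the graph acts diagonally on expansion coefficients.\<close>

lemma graph_coefficient:
  assumes T: "(f, g) \<in> T" and \<alpha>: "\<alpha> \<in> I"
  shows "L2_inner M g (\<phi> \<alpha>) = of_real (e \<alpha>) * L2_inner M f (\<phi> \<alpha>)"
proof -
  obtain s where s: "\<And>n. s n \<in> D" "(\<lambda>n. L2_norm M (\<lambda>x. s n x - f x)) \<longlonglongrightarrow> 0"
      "(\<lambda>n. L2_norm M (\<lambda>x. A (s n) x - g x)) \<longlonglongrightarrow> 0"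
    using T by (auto simp: closure_graph_def)
  have "(\<lambda>n. L2_inner M (A (s n)) (\<phi> \<alpha>)) \<longlonglongrightarrow> L2_inner M g (\<phi> \<alpha>)"
    by (rule L2_inner_tendsto) (use s graph_L2[OF T] A_L2 eigenfunction_L2[OF \<alpha>] in auto)
  moreover have "(\<lambda>n. L2_inner M (s n) (\<phi> \<alpha>)) \<longlonglongrightarrow> L2_inner M f (\<phi> \<alpha>)"
    by (rule L2_inner_tendsto) (use s graph_L2[OF T] D_L2 eigenfunction_L2[OF \<alpha>] in auto)
  then have "(\<lambda>n. L2_inner M (A (s n)) (\<phi> \<alpha>)) \<longlonglongrightarrow> of_real (e \<alpha>) * L2_inner M f (\<phi> \<alpha>)"
    using symmetric[OF s(1) \<alpha>] by (simp add: tendsto_mult_left)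
  ultimately show ?thesis by (rule LIMSEQ_unique)
qed

lemma eigenspace_coefficient:
  assumes "f \<in> eigenspace T z" "\<alpha> \<in> I" "z \<noteq> of_real (e \<alpha>)"
  shows "L2_inner M f (\<phi> \<alpha>) = 0"
proof -
  have "(f, \<lambda>x. z * f x) \<in> T" using assms(1) by (simp add: eigenspace_def)
  from graph_coefficient[OF this assms(2)] show ?thesis
    using assms(3) by (simp add: L2_inner_scale_left)
qed

lemma eigenspace_L2: "f \<in> eigenspace T z \<Longrightarrow> f \<in> L2_space M"
  using graph_L2 by (auto simp: eigenspace_def)

lemma eigenfunction_eigenspace:
  assumes "\<alpha> \<in> I"
  shows "\<phi> \<alpha> \<in> eigenspace T (of_real (e \<alpha>))"
proof -
  have "L2_norm M (\<lambda>x. A (\<phi> \<alpha>) x - of_real (e \<alpha>) * \<phi> \<alpha> x) = L2_norm M (\<lambda>x. 0)"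
    unfolding L2_norm_def
    by (intro arg_cong[where f = sqrt] Bochner_Integration.integral_cong)
       (use comb_A[of "{\<alpha>}" _ "\<lambda>_. 1"] assms in auto)
  then show ?thesis
    using eigenfunction_D[OF assms] eigenfunction_L2[OF assms] L2_scale
    by (auto simp: eigenspace_def closure_graph_def L2_norm_def intro!: exI[of _ "\<lambda>_. \<phi> \<alpha>"])
qed

text \<open>
  By completeness a non-zero eigenfunction of the closure has a non-zero coefficient, and all its
  coefficients off the eigenvalue vanish.
\<close>

lemma eigenvalue_iff: "eigenvalue M T z \<longleftrightarrow> z \<in> (\<lambda>\<alpha>. of_real (e \<alpha>)) ` I"
proof
  assume "eigenvalue M T z"
  then obtain f where f: "f \<in> eigenspace T z" "\<not> (AE x in M. f x = 0)"
    by (auto simp: eigenvalue_def)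
  then obtain \<alpha> where "\<alpha> \<in> I" "L2_inner M f (\<phi> \<alpha>) \<noteq> 0"
    using complete[OF eigenspace_L2[OF f(1)]] by blast
  then show "z \<in> (\<lambda>\<alpha>. of_real (e \<alpha>)) ` I" using eigenspace_coefficient[OF f(1)] by blast
next
  assume "z \<in> (\<lambda>\<alpha>. of_real (e \<alpha>)) ` I"
  then obtain \<alpha> where \<alpha>: "\<alpha> \<in> I" "z = of_real (e \<alpha>)" by auto
  have "\<not> (AE x in M. \<phi> \<alpha> x = 0)"
  proof
    assume "AE x in M. \<phi> \<alpha> x = 0"
    then have "AE x in M. \<phi> \<alpha> x * cnj (\<phi> \<alpha> x) = 0" by eventually_elim simp
    then have "L2_inner M (\<phi> \<alpha>) (\<phi> \<alpha>) = 0" unfolding L2_inner_def by (rule integral_eq_zero_AE)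
    then show False using orthonormal[OF \<alpha>(1) \<alpha>(1)] by simp
  qed
  then show "eigenvalue M T z"
    using eigenfunction_eigenspace[OF \<alpha>(1)] \<alpha>(2) by (auto simp: eigenvalue_def)
qed

text \<open>
  More independent eigenfunctions than indices would admit a non-trivial combination orthogonal to the
  whole system, which vanishes by completeness.
\<close>

lemma multiplicity_eq:
  "multiplicity_of M T (of_real \<mu>) = enat (card {\<alpha>\<in>I. e \<alpha> = \<mu>})"
proof -
  let ?I = "{\<alpha>\<in>I. e \<alpha> = \<mu>}"
  have fin: "finite ?I" by (rule finite_subset[OF _ locally_finite[of \<mu>]]) auto
  let ?P = "\<lambda>n. \<exists>f. (\<forall>i<n. f i \<in> eigenspace T (of_real \<mu>)) \<and> AE_independent M n f"
  have attained: "?P (card ?I)"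
  proof -
    obtain h where h: "bij_betw h {..<card ?I} ?I"
      using ex_bij_betw_nat_finite[OF fin] by (auto simp: atLeast0LessThan)
    have hI: "h i \<in> ?I" if "i < card ?I" for i using h that by (auto simp: bij_betw_def)
    have "AE_independent M (card ?I) (\<lambda>i. \<phi> (h i))"
      unfolding AE_independent_def
    proof (intro allI impI)
      fix c :: "nat \<Rightarrow> complex" and j
      assume ae: "AE x in M. (\<Sum>i<card ?I. c i * \<phi> (h i) x) = 0" and j: "j < card ?I"
      have sumL2: "(\<lambda>x. \<Sum>i<card ?I. c i * \<phi> (h i) x) \<in> L2_space M"
        by (intro L2_sum eigenfunction_L2) (use hI in auto)
      have "0 = L2_inner M (\<lambda>x. 0) (\<phi> (h j))" by (simp add: L2_inner_def)
      also have "\<dots> = L2_inner M (\<lambda>x. \<Sum>i<card ?I. c i * \<phi> (h i) x) (\<phi> (h j))"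
        by (rule L2_inner_cong_AE[symmetric]) (use sumL2 ae hI[OF j] eigenfunction_L2 in auto)
      also have "\<dots> = (\<Sum>i<card ?I. c i * L2_inner M (\<phi> (h i)) (\<phi> (h j)))"
        by (rule L2_inner_sum_left) (use hI j eigenfunction_L2 in auto)
      also have "\<dots> = (\<Sum>i<card ?I. if i = j then c i else 0)"
      proof (rule sum.cong)
        fix i assume "i \<in> {..<card ?I}"
        then have "h i = h j \<longleftrightarrow> i = j" using h j by (auto simp: bij_betw_def inj_on_def)
        then show "c i * L2_inner M (\<phi> (h i)) (\<phi> (h j)) = (if i = j then c i else 0)"
          using orthonormal[of "h i" "h j"] hI \<open>i \<in> _\<close> j by auto
      qed simp
      also have "\<dots> = c j" using j by simp
      finally show "c j = 0" by simp
    qed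
    moreover have "\<forall>i<card ?I. \<phi> (h i) \<in> eigenspace T (of_real \<mu>)"
      using hI eigenfunction_eigenspace by fastforce
    ultimately show ?thesis by (intro exI[of _ "\<lambda>i. \<phi> (h i)"] conjI)
  qed
  have le: "n \<le> card ?I" if n: "?P n" for n
  proof (rule ccontr)
    assume less: "\<not> n \<le> card ?I"
    obtain f where f: "\<And>i. i < n \<Longrightarrow> f i \<in> eigenspace T (of_real \<mu>)" "AE_independent M n f"
      using n by blast
    obtain c where c: "\<exists>j\<in>{..<n}. c j \<noteq> 0"
        "\<forall>\<alpha>\<in>?I. (\<Sum>j\<in>{..<n}. L2_inner M (f j) (\<phi> \<alpha>) * c j) = 0"
      using homogeneous_system_nontrivial[OF fin finite_lessThan[of n],
          of "\<lambda>\<alpha> j. L2_inner M (f j) (\<phi> \<alpha>)"] less by auto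
    have "L2_inner M (\<lambda>x. \<Sum>i<n. c i * f i x) (\<phi> \<alpha>) = 0" if "\<alpha> \<in> I" for \<alpha>
    proof -
      have "L2_inner M (\<lambda>x. \<Sum>i<n. c i * f i x) (\<phi> \<alpha>) = (\<Sum>i<n. c i * L2_inner M (f i) (\<phi> \<alpha>))"
        by (rule L2_inner_sum_left) (use f eigenspace_L2 eigenfunction_L2 that in auto)
      also have "\<dots> = 0"
      proof (cases "e \<alpha> = \<mu>")
        case True
        then show ?thesis using c(2) that by (simp add: mult.commute)
      next
        case False
        then show ?thesis
          using eigenspace_coefficient[OF f(1) that] by (intro sum.neutral) auto
      qed
      finally show ?thesis .
    qed
    then have "AE x in M. (\<Sum>i<n. c i * f i x) = 0"
      by (intro complete L2_sum) (use f eigenspace_L2 in auto)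
    then show False using f(2) c(1) by (auto simp: AE_independent_def)
  qed
  show ?thesis
    unfolding multiplicity_of_def
  proof (rule antisym)
    show "Sup {enat n |n. ?P n} \<le> enat (card ?I)"
    proof (rule Sup_least)
      fix x assume "x \<in> {enat n |n. ?P n}"
      then obtain n where "x = enat n" "?P n" by fast
      then show "x \<le> enat (card ?I)" using le[of n] by simp
    qed
    show "enat (card ?I) \<le> Sup {enat n |n. ?P n}"
      by (rule Sup_upper, rule CollectI) (intro exI[of _ "card ?I"] conjI refl attained)
  qed
qed

text \<open>
  Off the eigenvalues the resolvent is diagonal: its expansion converges because the distances
  \<open>\<bar>e \<alpha> - z\<bar>\<close> are bounded below, only finitely many eigenvalues being close to \<open>z\<close>.
\<close>

lemma resolvent:
  assumes z: "z \<notin> (\<lambda>\<alpha>. of_real (e \<alpha>)) ` I"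
  shows "z \<in> resolvent_set M T"
proof -
  obtain \<delta> where \<delta>: "\<delta> > 0" "\<And>\<alpha>. \<alpha> \<in> I \<Longrightarrow> \<delta> \<le> norm (of_real (e \<alpha>) - z)"
  proof -
    let ?F = "{\<alpha>\<in>I. e \<alpha> \<le> Re z + 1}"
    let ?m = "Min (insert 1 ((\<lambda>\<alpha>. norm (of_real (e \<alpha>) - z)) ` ?F))"
    have fin: "finite (insert 1 ((\<lambda>\<alpha>. norm (of_real (e \<alpha>) - z)) ` ?F))"
      using locally_finite by simp
    have "?m > 0" using fin z by (subst Min_gr_iff) auto
    moreover have "?m \<le> norm (of_real (e \<alpha>) - z)" if "\<alpha> \<in> I" for \<alpha>
    proof (cases "e \<alpha> \<le> Re z + 1")
      case True
      then show ?thesis using fin that by (intro Min_le) auto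
    next
      case False
      have "?m \<le> 1" using fin by (intro Min_le) auto
      also have "1 \<le> Re (of_real (e \<alpha>) - z)" using False by simp
      also have "\<dots> \<le> norm (of_real (e \<alpha>) - z)" by (rule complex_Re_le_cmod)
      finally show ?thesis .
    qed
    ultimately show thesis using that by blast
  qed
  have "\<exists>f. (f, \<lambda>x. g x + z * f x) \<in> T \<and> L2_norm M f \<le> inverse \<delta> * L2_norm M g"
    if g: "g \<in> L2_space M" for g
  proof -
    define c where "c = (\<lambda>\<alpha>. L2_inner M g (\<phi> \<alpha>))"
    define b where "b = (\<lambda>\<alpha>. c \<alpha> / (of_real (e \<alpha>) - z))"
    define F where "F = (\<lambda>n::nat. {\<alpha>\<in>I. e \<alpha> \<le> real n})"
    have F: "finite (F n)" "F n \<subseteq> I" for n using locally_finite by (auto simp: F_def)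
    have F_mono: "m \<le> n \<Longrightarrow> F m \<subseteq> F n" for m n by (auto simp: F_def)
    have b_le: "norm (b \<alpha>) \<le> inverse \<delta> * norm (c \<alpha>)" if "\<alpha> \<in> I" for \<alpha>
    proof -
      have "norm (b \<alpha>) = norm (c \<alpha>) / norm (of_real (e \<alpha>) - z)" by (simp add: b_def norm_divide)
      also have "\<dots> \<le> norm (c \<alpha>) / \<delta>" using \<delta>(1) \<delta>(2)[OF that] by (intro frac_le) auto
      finally show ?thesis by (simp add: field_simps)
    qed
    \<comment> \<open>the squared coefficients have bounded partial sums, so any series dominated by them is Cauchy\<close>
    have lim: "\<exists>f \<in> L2_space M. (\<lambda>n. L2_norm M (\<lambda>x. (\<Sum>\<alpha>\<in>F n. a \<alpha> * \<phi> \<alpha> x) - f x)) \<longlonglongrightarrow> 0"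
      if a: "\<And>\<alpha>. \<alpha> \<in> I \<Longrightarrow> norm (a \<alpha>) \<le> K * norm (c \<alpha>)" and K: "K > 0" for a :: "'i \<Rightarrow> complex" and K
    proof -
      define S where "S = (\<lambda>n. \<Sum>\<alpha>\<in>F n. (norm (c \<alpha>))\<^sup>2)"
      have "incseq S" unfolding S_def incseq_def by (intro allI impI sum_mono2 F F_mono) auto
      moreover have "S n \<le> (L2_norm M g)\<^sup>2" for n
        unfolding S_def c_def by (rule Bessel[OF F g])
      ultimately have "Cauchy S"
        by (metis Cauchy_convergent_iff convergentI incseq_convergent)
      have diff: "(L2_norm M (\<lambda>x. (\<Sum>\<alpha>\<in>F n. a \<alpha> * \<phi> \<alpha> x) - (\<Sum>\<alpha>\<in>F m. a \<alpha> * \<phi> \<alpha> x)))\<^sup>2 \<le> K\<^sup>2 * (S n - S m)"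
        if "m \<le> n" for m n
      proof -
        have "(\<lambda>x. (\<Sum>\<alpha>\<in>F n. a \<alpha> * \<phi> \<alpha> x) - (\<Sum>\<alpha>\<in>F m. a \<alpha> * \<phi> \<alpha> x))
            = (\<lambda>x. \<Sum>\<alpha>\<in>F n - F m. a \<alpha> * \<phi> \<alpha> x)"
          using F F_mono[OF that] by (simp add: sum_diff)
        then have "(L2_norm M (\<lambda>x. (\<Sum>\<alpha>\<in>F n. a \<alpha> * \<phi> \<alpha> x) - (\<Sum>\<alpha>\<in>F m. a \<alpha> * \<phi> \<alpha> x)))\<^sup>2
            = (\<Sum>\<alpha>\<in>F n - F m. (norm (a \<alpha>))\<^sup>2)"
          using norm_comb[of "F n - F m" a] F by auto
        also have "\<dots> \<le> (\<Sum>\<alpha>\<in>F n - F m. (K * norm (c \<alpha>))\<^sup>2)"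
          using a F by (intro sum_mono power_mono) auto
        also have "\<dots> = K\<^sup>2 * (S n - S m)"
          using F F_mono[OF that] by (simp add: S_def sum_diff power_mult_distrib sum_distrib_left right_diff_distrib)
        finally show ?thesis .
      qed
      have "\<exists>N. \<forall>m\<ge>N. \<forall>n\<ge>N. L2_norm M (\<lambda>x. (\<Sum>\<alpha>\<in>F m. a \<alpha> * \<phi> \<alpha> x) - (\<Sum>\<alpha>\<in>F n. a \<alpha> * \<phi> \<alpha> x)) < r"
        if r: "r > 0" for r
      proof -
        have "r\<^sup>2 / K\<^sup>2 > 0" using r K by simp
        from metric_CauchyD[OF \<open>Cauchy S\<close> this]
        obtain N where N: "\<And>m n. m \<ge> N \<Longrightarrow> n \<ge> N \<Longrightarrow> dist (S m) (S n) < r\<^sup>2 / K\<^sup>2" by blast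
        have *: "L2_norm M (\<lambda>x. (\<Sum>\<alpha>\<in>F n. a \<alpha> * \<phi> \<alpha> x) - (\<Sum>\<alpha>\<in>F m. a \<alpha> * \<phi> \<alpha> x)) < r"
          if "m \<ge> N" "n \<ge> N" "m \<le> n" for m n
        proof (rule power_less_imp_less_base)
          have "S n - S m < r\<^sup>2 / K\<^sup>2" using N[OF that(2,1)] by (auto simp: dist_real_def)
          then have "K\<^sup>2 * (S n - S m) < r\<^sup>2" using K by (simp add: field_simps)
          then show "(L2_norm M (\<lambda>x. (\<Sum>\<alpha>\<in>F n. a \<alpha> * \<phi> \<alpha> x) - (\<Sum>\<alpha>\<in>F m. a \<alpha> * \<phi> \<alpha> x)))\<^sup>2 < r\<^sup>2"
            using diff[OF that(3)] by linarith
        qed (use r in simp)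
        show ?thesis
        proof (intro exI allI impI)
          fix m n assume "m \<ge> N" "n \<ge> N"
          then show "L2_norm M (\<lambda>x. (\<Sum>\<alpha>\<in>F m. a \<alpha> * \<phi> \<alpha> x) - (\<Sum>\<alpha>\<in>F n. a \<alpha> * \<phi> \<alpha> x)) < r"
            using *[of m n] *[of n m] L2_norm_uminus_diff[of M "\<lambda>x. \<Sum>\<alpha>\<in>F m. a \<alpha> * \<phi> \<alpha> x"]
            by (cases "m \<le> n") auto
        qed
      qed
      from Riesz_Fischer[OF comb_L2[OF F(2)] this] show ?thesis by blast
    qed
    obtain f where f: "f \<in> L2_space M" "(\<lambda>n. L2_norm M (\<lambda>x. (\<Sum>\<alpha>\<in>F n. b \<alpha> * \<phi> \<alpha> x) - f x)) \<longlonglongrightarrow> 0"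
      using lim[of b "inverse \<delta>"] b_le \<delta>(1) by auto
    obtain g' where g': "g' \<in> L2_space M" "(\<lambda>n. L2_norm M (\<lambda>x. (\<Sum>\<alpha>\<in>F n. c \<alpha> * \<phi> \<alpha> x) - g' x)) \<longlonglongrightarrow> 0"
      using lim[of c 1] by auto
    \<comment> \<open>the expansion of \<open>g\<close> converges to \<open>g\<close>, as the limit has the same coefficients\<close>
    have "AE x in M. g' x - g x = 0"
    proof (rule complete[OF L2_diff[OF g'(1) g]], rule ballI)
      fix \<alpha> assume \<alpha>: "\<alpha> \<in> I"
      have "(\<lambda>n. L2_inner M (\<lambda>x. \<Sum>\<alpha>\<in>F n. c \<alpha> * \<phi> \<alpha> x) (\<phi> \<alpha>)) \<longlonglongrightarrow> L2_inner M g' (\<phi> \<alpha>)"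
        by (rule L2_inner_tendsto[OF comb_L2[OF F(2)] g'(1) eigenfunction_L2[OF \<alpha>] g'(2)])
      moreover have "(\<lambda>n. L2_inner M (\<lambda>x. \<Sum>\<alpha>\<in>F n. c \<alpha> * \<phi> \<alpha> x) (\<phi> \<alpha>)) \<longlonglongrightarrow> c \<alpha>"
      proof (rule tendsto_eventually, rule eventually_sequentiallyI[of "nat \<lceil>e \<alpha>\<rceil>"])
        fix n assume "nat \<lceil>e \<alpha>\<rceil> \<le> n"
        then have "\<alpha> \<in> F n" using \<alpha> by (auto simp: F_def)
        then show "L2_inner M (\<lambda>x. \<Sum>\<alpha>\<in>F n. c \<alpha> * \<phi> \<alpha> x) (\<phi> \<alpha>) = c \<alpha>"
          using inner_comb[OF F \<alpha>] by simp
      qed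
      ultimately have "L2_inner M g' (\<phi> \<alpha>) = c \<alpha>" by (rule LIMSEQ_unique)
      then show "L2_inner M (\<lambda>x. g' x - g x) (\<phi> \<alpha>) = 0"
        by (simp add: L2_inner_diff_left[OF g'(1) g eigenfunction_L2[OF \<alpha>]] c_def)
    qed
    then have "AE x in M. (\<Sum>\<alpha>\<in>F n. c \<alpha> * \<phi> \<alpha> x) - g' x = (\<Sum>\<alpha>\<in>F n. c \<alpha> * \<phi> \<alpha> x) - g x" for n
      by eventually_elim simp
    then have "L2_norm M (\<lambda>x. (\<Sum>\<alpha>\<in>F n. c \<alpha> * \<phi> \<alpha> x) - g' x)
        = L2_norm M (\<lambda>x. (\<Sum>\<alpha>\<in>F n. c \<alpha> * \<phi> \<alpha> x) - g x)" for n
      by (intro L2_norm_cong_AE L2_diff comb_L2 F g'(1) g)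
    with g'(2) have g_lim: "(\<lambda>n. L2_norm M (\<lambda>x. (\<Sum>\<alpha>\<in>F n. c \<alpha> * \<phi> \<alpha> x) - g x)) \<longlonglongrightarrow> 0"
      by (simp only:)
    have "(f, \<lambda>x. g x + z * f x) \<in> T"
      unfolding closure_graph_def
    proof (clarify, intro conjI exI[of _ "\<lambda>n x. \<Sum>\<alpha>\<in>F n. b \<alpha> * \<phi> \<alpha> x"] allI)
      show "(\<lambda>x. \<Sum>\<alpha>\<in>F n. b \<alpha> * \<phi> \<alpha> x) \<in> D" for n by (rule comb_D[OF F])
      show "(\<lambda>n. L2_norm M (\<lambda>x. A (\<lambda>x. \<Sum>\<alpha>\<in>F n. b \<alpha> * \<phi> \<alpha> x) x - (g x + z * f x))) \<longlonglongrightarrow> 0"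
      proof (rule Lim_null_comparison)
        have "L2_norm M (\<lambda>x. A (\<lambda>x. \<Sum>\<alpha>\<in>F n. b \<alpha> * \<phi> \<alpha> x) x - (g x + z * f x))
          \<le> L2_norm M (\<lambda>x. (\<Sum>\<alpha>\<in>F n. c \<alpha> * \<phi> \<alpha> x) - g x)
            + norm z * L2_norm M (\<lambda>x. (\<Sum>\<alpha>\<in>F n. b \<alpha> * \<phi> \<alpha> x) - f x)" for n
        proof -
          have "A (\<lambda>x. \<Sum>\<alpha>\<in>F n. b \<alpha> * \<phi> \<alpha> x) x
              = (\<Sum>\<alpha>\<in>F n. c \<alpha> * \<phi> \<alpha> x) + z * (\<Sum>\<alpha>\<in>F n. b \<alpha> * \<phi> \<alpha> x)" if "x \<in> space M" for x
          proof -
            have "b \<alpha> * of_real (e \<alpha>) * \<phi> \<alpha> x = c \<alpha> * \<phi> \<alpha> x + z * (b \<alpha> * \<phi> \<alpha> x)" if "\<alpha> \<in> F n" for \<alpha>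
            proof -
              have "of_real (e \<alpha>) - z \<noteq> 0" using F z that by auto
              then have "b \<alpha> * (of_real (e \<alpha>) - z) = c \<alpha>" by (simp add: b_def)
              then have "b \<alpha> * of_real (e \<alpha>) = c \<alpha> + z * b \<alpha>" by (simp add: algebra_simps)
              then show ?thesis by (simp only: distrib_right mult.assoc)
            qed
            then show ?thesis
              by (simp add: comb_A[OF F that] sum_distrib_left flip: sum.distrib)
          qed
          then have "L2_norm M (\<lambda>x. A (\<lambda>x. \<Sum>\<alpha>\<in>F n. b \<alpha> * \<phi> \<alpha> x) x - (g x + z * f x))
            = L2_norm M (\<lambda>x. ((\<Sum>\<alpha>\<in>F n. c \<alpha> * \<phi> \<alpha> x) - g x) + z * ((\<Sum>\<alpha>\<in>F n. b \<alpha> * \<phi> \<alpha> x) - f x))"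
            unfolding L2_norm_def
            by (intro arg_cong[where f = sqrt] Bochner_Integration.integral_cong)
               (auto simp: algebra_simps)
          also have "\<dots> \<le> L2_norm M (\<lambda>x. (\<Sum>\<alpha>\<in>F n. c \<alpha> * \<phi> \<alpha> x) - g x)
            + L2_norm M (\<lambda>x. z * ((\<Sum>\<alpha>\<in>F n. b \<alpha> * \<phi> \<alpha> x) - f x))"
            by (intro L2_norm_triangle L2_diff L2_scale comb_L2 F g f(1))
          finally show ?thesis by (simp add: L2_norm_scale)
        qed
        then show "\<forall>\<^sub>F n in sequentially. norm (L2_norm M (\<lambda>x. A (\<lambda>x. \<Sum>\<alpha>\<in>F n. b \<alpha> * \<phi> \<alpha> x) x - (g x + z * f x)))
          \<le> L2_norm M (\<lambda>x. (\<Sum>\<alpha>\<in>F n. c \<alpha> * \<phi> \<alpha> x) - g x)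
            + norm z * L2_norm M (\<lambda>x. (\<Sum>\<alpha>\<in>F n. b \<alpha> * \<phi> \<alpha> x) - f x)" by simp
        show "(\<lambda>n. L2_norm M (\<lambda>x. (\<Sum>\<alpha>\<in>F n. c \<alpha> * \<phi> \<alpha> x) - g x)
            + norm z * L2_norm M (\<lambda>x. (\<Sum>\<alpha>\<in>F n. b \<alpha> * \<phi> \<alpha> x) - f x)) \<longlonglongrightarrow> 0"
          using tendsto_add[OF g_lim tendsto_mult_right_zero[OF f(2)]] by simp
      qed
    qed (use f g L2_add[OF g L2_scale[OF f(1)]] in auto)
    moreover have "L2_norm M f \<le> inverse \<delta> * L2_norm M g"
    proof (rule LIMSEQ_le_const2)
      show "(\<lambda>n. L2_norm M (\<lambda>x. \<Sum>\<alpha>\<in>F n. b \<alpha> * \<phi> \<alpha> x)) \<longlonglongrightarrow> L2_norm M f"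
        by (rule L2_norm_tendsto[OF comb_L2[OF F(2)] f])
      have "L2_norm M (\<lambda>x. \<Sum>\<alpha>\<in>F n. b \<alpha> * \<phi> \<alpha> x) \<le> inverse \<delta> * L2_norm M g" for n
      proof (rule power2_le_imp_le)
        have "(L2_norm M (\<lambda>x. \<Sum>\<alpha>\<in>F n. b \<alpha> * \<phi> \<alpha> x))\<^sup>2 = (\<Sum>\<alpha>\<in>F n. (norm (b \<alpha>))\<^sup>2)"
          by (rule norm_comb[OF F])
        also have "\<dots> \<le> (\<Sum>\<alpha>\<in>F n. (inverse \<delta> * norm (c \<alpha>))\<^sup>2)"
          using b_le F by (intro sum_mono power_mono) auto
        also have "\<dots> = (inverse \<delta>)\<^sup>2 * (\<Sum>\<alpha>\<in>F n. (norm (c \<alpha>))\<^sup>2)"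
          by (simp add: power_mult_distrib sum_distrib_left)
        also have "\<dots> \<le> (inverse \<delta>)\<^sup>2 * (L2_norm M g)\<^sup>2"
          unfolding c_def by (intro mult_left_mono Bessel F g) auto
        finally show "(L2_norm M (\<lambda>x. \<Sum>\<alpha>\<in>F n. b \<alpha> * \<phi> \<alpha> x))\<^sup>2 \<le> (inverse \<delta> * L2_norm M g)\<^sup>2"
          by (simp add: power_mult_distrib)
      qed (use \<delta>(1) in simp)
      then show "\<exists>N. \<forall>n\<ge>N. L2_norm M (\<lambda>x. \<Sum>\<alpha>\<in>F n. b \<alpha> * \<phi> \<alpha> x) \<le> inverse \<delta> * L2_norm M g" by blast
    qed
    ultimately show ?thesis by blast
  qed
  moreover have "\<not> eigenvalue M T z" using z by (simp add: eigenvalue_iff)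
  ultimately show ?thesis unfolding resolvent_set_def by blast
qed

text \<open>
  The spectrum is contained in the set of the \<open>e \<alpha>\<close>, which has no limit point by local finiteness.
\<close>

lemma discrete_eigenvalue_iff:
  "discrete_eigenvalue M T (of_real \<mu>) \<longleftrightarrow> \<mu> \<in> e ` I"
proof -
  let ?S = "(\<lambda>\<alpha>. complex_of_real (e \<alpha>)) ` I"
  have "spectrum_of M T \<subseteq> ?S" using resolvent by (auto simp: spectrum_of_def)
  moreover have "\<not> complex_of_real \<mu> islimpt ?S"
  proof
    assume "complex_of_real \<mu> islimpt ?S"
    then have "infinite (?S \<inter> ball (complex_of_real \<mu>) 1)" by (simp add: islimpt_eq_infinite_ball)
    moreover have "?S \<inter> ball (complex_of_real \<mu>) 1 \<subseteq> (\<lambda>\<alpha>. complex_of_real (e \<alpha>)) ` {\<alpha>\<in>I. e \<alpha> \<le> \<mu> + 1}"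
      by (auto simp: dist_of_real dist_real_def)
    ultimately show False using locally_finite by (meson finite_imageI finite_subset)
  qed
  ultimately have "\<not> complex_of_real \<mu> islimpt spectrum_of M T" using islimpt_subset by blast
  then show ?thesis
    unfolding discrete_eigenvalue_def eigenvalue_iff multiplicity_eq by auto
qed

text \<open>The sum of the multiplicities counts the indices grouped by their eigenvalue.\<close>

theorem counting_function_eq_card:
  "counting_function M T lam = of_nat (card {\<alpha>\<in>I. e \<alpha> \<le> lam})"
proof -
  let ?J = "{\<alpha>\<in>I. e \<alpha> \<le> lam}"
  have set: "{\<mu>. discrete_eigenvalue M T (complex_of_real \<mu>) \<and> \<mu> \<le> lam} = e ` ?J"
    by (auto simp: discrete_eigenvalue_iff)
  have "counting_function M T lam = (\<Sum>\<mu>\<in>e ` ?J. of_nat (card {\<alpha>\<in>I. e \<alpha> = \<mu>}))"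
    unfolding counting_function_def set using locally_finite
    by (subst infsum_finite) (auto simp: multiplicity_eq intro!: sum.cong)
  also have "\<dots> = of_nat (\<Sum>\<mu>\<in>e ` ?J. card {\<alpha>\<in>?J. e \<alpha> = \<mu>})"
    unfolding of_nat_sum by (intro sum.cong arg_cong[where f = of_nat] arg_cong[where f = card]) auto
  also have "(\<Sum>\<mu>\<in>e ` ?J. card {\<alpha>\<in>?J. e \<alpha> = \<mu>}) = card ?J"
    using sum.image_gen[OF locally_finite[of lam], of "\<lambda>_. 1::nat" e] by simp
  finally show ?thesis .
qed

end

section \<open>Entire solutions of the harmonic oscillator equation\<close>

text \<open>
  With \<open>u = exp (- x\<^sup>2 / 2) w\<close> the equation \<open>u'' = (x\<^sup>2 - E) u\<close> becomes Hermite's equation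
  \<open>w'' - 2 x w' + (E - 1) w = 0\<close>, whose power series has a two-term recursion.
\<close>

fun hermite_coeff :: "real \<Rightarrow> real \<Rightarrow> real \<Rightarrow> nat \<Rightarrow> real" where
  "hermite_coeff E c0 c1 0 = c0"
| "hermite_coeff E c0 c1 (Suc 0) = c1"
| "hermite_coeff E c0 c1 (Suc (Suc n)) =
     (2 * real n + 1 - E) / ((real n + 1) * (real n + 2)) * hermite_coeff E c0 c1 n"

lemma nat_induct2 [case_names 0 1 step]:
  fixes n :: nat
  assumes "Q 0" "Q (Suc 0)" "\<And>n. Q n \<Longrightarrow> Q (Suc (Suc n))"
  shows "Q n"
proof -
  have "Q n \<and> Q (Suc n)" using assms by (induction n) auto
  then show ?thesis ..
qed

text \<open>
  A majorant uniform in the energy on bounded sets; it yields continuity in \<open>E\<close> and \<open>x\<close> jointly.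
\<close>

lemma hermite_coeff_abs_le:
  assumes "\<bar>E\<bar> \<le> K" "\<bar>c0\<bar> \<le> 1" "\<bar>c1\<bar> \<le> 1"
  shows "\<bar>hermite_coeff E c0 c1 n\<bar> \<le> hermite_coeff (- K) 1 1 n"
proof (induction n rule: nat_induct2)
  case (step n)
  have "\<bar>2 * real n + 1 - E\<bar> / ((real n + 1) * (real n + 2)) * \<bar>hermite_coeff E c0 c1 n\<bar>
      \<le> (2 * real n + 1 + K) / ((real n + 1) * (real n + 2)) * hermite_coeff (- K) 1 1 n"
    using step assms(1) by (intro mult_mono divide_right_mono) auto
  then show ?case by (simp add: abs_mult)
qed (use assms in auto)

text \<open>
  From some index on, two steps of the recursion multiply the terms by at most \<open>1 / 4\<close>.
\<close>

lemma summable_hermite_majorant: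
  fixes r :: real
  assumes K: "K \<ge> 0" and r: "r \<ge> 0"
  shows "summable (\<lambda>n. hermite_coeff (- K) 1 1 n * r ^ n)"
proof -
  let ?h = "hermite_coeff (- K) 1 1"
  let ?b = "\<lambda>n. ?h n * r ^ n"
  have h_nonneg: "?h n \<ge> 0" for n
    using hermite_coeff_abs_le[of 0 K 0 0 n] K by auto
  have "(\<lambda>n. (2 * real n + 1 + K) / ((real n + 1) * (real n + 2)) * r\<^sup>2) \<longlonglongrightarrow> 0"
    by real_asymp
  then have "\<forall>\<^sub>F n in sequentially. (2 * real n + 1 + K) / ((real n + 1) * (real n + 2)) * r\<^sup>2 < 1 / 4"
    by (rule order_tendstoD) simp
  then obtain N where N: "\<And>n. n \<ge> N \<Longrightarrow> (2 * real n + 1 + K) / ((real n + 1) * (real n + 2)) * r\<^sup>2 \<le> 1 / 4"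
    unfolding eventually_sequentially by (meson less_imp_le)
  have quarter: "?b (Suc (Suc n)) \<le> ?b n / 4" if "n \<ge> N" for n
  proof -
    have "?b (Suc (Suc n)) = ((2 * real n + 1 + K) / ((real n + 1) * (real n + 2)) * r\<^sup>2) * ?b n"
      by (simp add: power2_eq_square)
    also have "\<dots> \<le> 1 / 4 * ?b n"
      by (intro mult_right_mono N that mult_nonneg_nonneg h_nonneg) (use r in auto)
    finally show ?thesis by simp
  qed
  define C where "C = max (?b N) (2 * ?b (Suc N))"
  have decay: "?b (N + k) \<le> C * (1 / 2) ^ k" for k
  proof (induction k rule: nat_induct2)
    case (step k)
    have "?b (N + Suc (Suc k)) \<le> ?b (N + k) / 4" using quarter[of "N + k"] by simp
    also have "\<dots> \<le> C * (1 / 2) ^ k / 4" using step by simp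
    finally show ?case by simp
  qed (auto simp: C_def)
  have nonneg: "?b n \<ge> 0" for n using h_nonneg r by simp
  have "summable (\<lambda>k. ?b (N + k))"
  proof (rule summable_comparison_test')
    show "summable (\<lambda>k. C * (1 / 2) ^ k)" by (intro summable_mult summable_geometric) simp
    show "norm (?b (N + k)) \<le> C * (1 / 2) ^ k" if "k \<ge> 0" for k
      using decay[of k] by (simp only: real_norm_def abs_of_nonneg[OF nonneg])
  qed
  then show ?thesis by (simp add: add.commute[of N] summable_iff_shift[of ?b])
qed

lemma summable_hermite:
  fixes z :: "'a::{real_normed_field,banach}"
  shows "summable (\<lambda>n. of_real (hermite_coeff E c0 c1 n) * z ^ n)"
proof -
  define s where "s = \<bar>c0\<bar> + \<bar>c1\<bar> + 1"
  have s: "s > 0" by (simp add: s_def)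
  have scale: "hermite_coeff E c0 c1 n = s * hermite_coeff E (c0 / s) (c1 / s) n" for n
    using s by (induction n rule: nat_induct2) auto
  have "norm (of_real (hermite_coeff E c0 c1 n) * z ^ n) \<le> s * (hermite_coeff (- \<bar>E\<bar>) 1 1 n * norm z ^ n)" for n
  proof -
    have "\<bar>hermite_coeff E (c0 / s) (c1 / s) n\<bar> \<le> hermite_coeff (- \<bar>E\<bar>) 1 1 n"
      by (rule hermite_coeff_abs_le) (use s in \<open>auto simp: s_def abs_divide divide_le_eq_1\<close>)
    then have "s * \<bar>hermite_coeff E (c0 / s) (c1 / s) n\<bar> * norm z ^ n \<le> s * hermite_coeff (- \<bar>E\<bar>) 1 1 n * norm z ^ n"
      using s by (intro mult_right_mono mult_left_mono) auto
    then show ?thesis using s by (simp add: scale norm_mult norm_power abs_mult mult.assoc)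
  qed
  then show ?thesis
    by (intro summable_comparison_test'[OF summable_mult[OF summable_hermite_majorant[of "\<bar>E\<bar>" "norm z"], of s], of 0]) auto
qed

definition hermite_series :: "real \<Rightarrow> real \<Rightarrow> real \<Rightarrow> 'a::{real_normed_field,banach} \<Rightarrow> 'a" where
  "hermite_series E c0 c1 z = (\<Sum>n. of_real (hermite_coeff E c0 c1 n) * z ^ n)"

definition hermite_series_deriv :: "real \<Rightarrow> real \<Rightarrow> real \<Rightarrow> 'a::{real_normed_field,banach} \<Rightarrow> 'a" where
  "hermite_series_deriv E c0 c1 z = (\<Sum>n. diffs (\<lambda>n. of_real (hermite_coeff E c0 c1 n)) n * z ^ n)"

lemma hermite_series_has_deriv:
  "(hermite_series E c0 c1 has_field_derivative hermite_series_deriv E c0 c1 z) (at z)"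
  unfolding hermite_series_def[abs_def] hermite_series_deriv_def
  by (rule termdiffs_strong_converges_everywhere[OF summable_hermite])

lemma hermite_series_deriv_has_deriv:
  "(hermite_series_deriv E c0 c1 has_field_derivative
      2 * z * hermite_series_deriv E c0 c1 z - of_real (E - 1) * hermite_series E c0 c1 z) (at z)"
proof -
  let ?a = "\<lambda>n. of_real (hermite_coeff E c0 c1 n) :: 'a"
  have sd: "summable (\<lambda>n. diffs ?a n * y ^ n)" for y
    by (rule termdiff_converges_all[OF summable_hermite])
  have "(hermite_series_deriv E c0 c1 has_field_derivative (\<Sum>n. diffs (diffs ?a) n * z ^ n)) (at z)"
    unfolding hermite_series_deriv_def[abs_def]
    by (rule termdiffs_strong_converges_everywhere[OF sd])
  moreover have "(\<Sum>n. diffs (diffs ?a) n * z ^ n)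
      = 2 * z * hermite_series_deriv E c0 c1 z - of_real (E - 1) * hermite_series E c0 c1 z"
  proof -
    have "(\<lambda>n. of_nat n * ?a n * z ^ (n - Suc 0)) sums hermite_series_deriv E c0 c1 z"
      unfolding hermite_series_deriv_def by (rule diffs_equiv[OF sd])
    then have "(\<lambda>n. 2 * z * (of_nat n * ?a n * z ^ (n - Suc 0))) sums (2 * z * hermite_series_deriv E c0 c1 z)"
      by (rule sums_mult)
    moreover have "(\<lambda>n. of_real (E - 1) * (?a n * z ^ n)) sums (of_real (E - 1) * hermite_series E c0 c1 z)"
      unfolding hermite_series_def by (intro sums_mult summable_sums summable_hermite)
    ultimately have "(\<lambda>n. 2 * z * (of_nat n * ?a n * z ^ (n - Suc 0)) - of_real (E - 1) * (?a n * z ^ n))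
        sums (2 * z * hermite_series_deriv E c0 c1 z - of_real (E - 1) * hermite_series E c0 c1 z)"
      by (rule sums_diff)
    moreover have "2 * z * (of_nat n * ?a n * z ^ (n - Suc 0)) - of_real (E - 1) * (?a n * z ^ n)
        = diffs (diffs ?a) n * z ^ n" for n
    proof -
      have "2 * z * (of_nat n * ?a n * z ^ (n - Suc 0)) = 2 * (of_nat n * ?a n * (z * z ^ (n - Suc 0)))"
        by (simp only: mult_ac)
      also have "\<dots> = 2 * of_nat n * ?a n * z ^ n" by (cases n) auto
      finally have A: "2 * z * (of_nat n * ?a n * z ^ (n - Suc 0)) = 2 * of_nat n * ?a n * z ^ n" .
      have "hermite_coeff E c0 c1 (Suc (Suc n)) * ((real n + 1) * (real n + 2))
          = (2 * real n + 1 - E) * hermite_coeff E c0 c1 n"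
        by simp
      then have "of_real (hermite_coeff E c0 c1 (Suc (Suc n)) * ((real n + 1) * (real n + 2)))
          = (of_real ((2 * real n + 1 - E) * hermite_coeff E c0 c1 n) :: 'a)" by (simp only:)
      then have "?a (Suc (Suc n)) * ((of_nat n + 1) * (of_nat n + 2)) = (2 * of_nat n + 1 - of_real E) * ?a n"
        by (simp del: hermite_coeff.simps)
      then have B: "diffs (diffs ?a) n = (2 * of_nat n + 1 - of_real E) * ?a n"
        unfolding diffs_def by (simp add: algebra_simps del: hermite_coeff.simps)
      show ?thesis unfolding A B by (simp add: algebra_simps)
    qed
    ultimately show ?thesis by (simp add: sums_iff)
  qed
  ultimately show ?thesis by simp
qed

text \<open>
  The solution of \<open>u'' = (z\<^sup>2 - E) u\<close> with \<open>u 0 = c0\<close>, \<open>u' 0 = c1\<close>, and its derivative.  The same series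
  serves for real \<open>z\<close>, where zeros are counted, and for complex \<open>z\<close>, where it is an entire function.
\<close>

definition osc :: "real \<Rightarrow> real \<Rightarrow> real \<Rightarrow> 'a::{real_normed_field,banach} \<Rightarrow> 'a" where
  "osc E c0 c1 z = exp (- (z\<^sup>2) / 2) * hermite_series E c0 c1 z"

definition osc' :: "real \<Rightarrow> real \<Rightarrow> real \<Rightarrow> 'a::{real_normed_field,banach} \<Rightarrow> 'a" where
  "osc' E c0 c1 z = exp (- (z\<^sup>2) / 2) * (hermite_series_deriv E c0 c1 z - z * hermite_series E c0 c1 z)"

lemma osc_deriv: "(osc E c0 c1 has_field_derivative osc' E c0 c1 z) (at z)"
  unfolding osc_def[abs_def] osc'_def
  by (rule derivative_eq_intros hermite_series_has_deriv refl | simp)+ (simp add: algebra_simps)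

lemma osc'_deriv: "(osc' E c0 c1 has_field_derivative (z\<^sup>2 - of_real E) * osc E c0 c1 z) (at z)"
  unfolding osc_def osc'_def[abs_def]
  by (rule derivative_eq_intros hermite_series_has_deriv hermite_series_deriv_has_deriv refl | simp)+
     (simp add: algebra_simps power2_eq_square)

lemma osc_0 [simp]: "osc E c0 c1 0 = of_real c0"
  by (simp add: osc_def hermite_series_def)

lemma osc'_0 [simp]: "osc' E c0 c1 0 = of_real c1"
  by (simp add: osc'_def hermite_series_deriv_def diffs_def)

lemma osc_of_real: "osc E c0 c1 (of_real x :: 'a::{real_normed_field,banach}) = of_real (osc E c0 c1 x)"
proof -
  have "hermite_series E c0 c1 (of_real x :: 'a) = of_real (hermite_series E c0 c1 x)"
    unfolding hermite_series_def
    by (subst suminf_of_real) (use summable_hermite[of E c0 c1 x] in simp_all)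
  then show ?thesis by (simp add: osc_def exp_of_real[symmetric])
qed

lemma continuous_on_hermite_coeff: "continuous_on UNIV (\<lambda>E. hermite_coeff E c0 c1 n)"
  by (induction n rule: nat_induct2) (auto intro!: continuous_intros)

lemma continuous_on_series_of_majorant:
  fixes a :: "real \<Rightarrow> nat \<Rightarrow> real"
  assumes le: "\<And>K E n. \<bar>E\<bar> \<le> K \<Longrightarrow> \<bar>a E n\<bar> \<le> B K n"
    and sum: "\<And>K r. K \<ge> 0 \<Longrightarrow> r \<ge> 0 \<Longrightarrow> summable (\<lambda>n. B K n * r ^ n)"
    and cont: "\<And>n. continuous_on UNIV (\<lambda>E. a E n)"
  shows "continuous_on UNIV (\<lambda>(E, x). \<Sum>n. a E n * x ^ n)"
proof -
  have *: "continuous_on ({-K<..<K} \<times> {-r<..<r}) (\<lambda>(E, x). \<Sum>n. a E n * x ^ n)"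
    if "K \<ge> 0" "r \<ge> 0" for K r :: real
  proof -
    have "uniform_limit ({-K<..<K} \<times> {-r<..<r}) (\<lambda>n p. \<Sum>i<n. a (fst p) i * snd p ^ i)
        (\<lambda>p. \<Sum>i. a (fst p) i * snd p ^ i) sequentially"
    proof (rule Weierstrass_m_test[OF _ sum[OF that]])
      fix n p assume p: "p \<in> {-K<..<K} \<times> {-r<..<r}"
      have "\<bar>a (fst p) n\<bar> * \<bar>snd p\<bar> ^ n \<le> B K n * r ^ n"
        by (intro mult_mono le power_mono order.trans[OF _ le[of "fst p" K n]]) (use p in auto)
      then show "norm (a (fst p) n * snd p ^ n) \<le> B K n * r ^ n"
        by (simp add: abs_mult power_abs)
    qed
    moreover have "continuous_on ({-K<..<K} \<times> {-r<..<r}) (\<lambda>p. \<Sum>i<n. a (fst p) i * snd p ^ i)" for n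
      by (intro continuous_intros continuous_on_compose2[OF cont]) auto
    ultimately show ?thesis
      unfolding case_prod_unfold by (intro uniform_limit_theorem[where F = sequentially]) auto
  qed
  have "continuous (at p) (\<lambda>(E, x). \<Sum>n. a E n * x ^ n)" for p
  proof -
    let ?S = "{- (\<bar>fst p\<bar> + 1)<..<\<bar>fst p\<bar> + 1} \<times> {- (\<bar>snd p\<bar> + 1)<..<\<bar>snd p\<bar> + 1}"
    have "p \<in> ?S" by (cases p) auto
    moreover have "open ?S" by (intro open_Times) auto
    ultimately show ?thesis
      using *[of "\<bar>fst p\<bar> + 1" "\<bar>snd p\<bar> + 1"] continuous_on_eq_continuous_at by auto
  qed
  then show ?thesis by (simp add: continuous_at_imp_continuous_on)
qed

lemma continuous_on_hermite_series:
  assumes "\<bar>c0\<bar> \<le> 1" "\<bar>c1\<bar> \<le> 1"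
  shows "continuous_on UNIV (\<lambda>(E, x::real). hermite_series E c0 c1 x)"
    and "continuous_on UNIV (\<lambda>(E, x::real). hermite_series_deriv E c0 c1 x)"
proof -
  have nonneg: "K \<ge> 0 \<Longrightarrow> hermite_coeff (- K) 1 1 n \<ge> 0" for K n
    using hermite_coeff_abs_le[of 0 K 0 0 n] by auto
  show "continuous_on UNIV (\<lambda>(E, x::real). hermite_series E c0 c1 x)"
    unfolding hermite_series_def
    using continuous_on_series_of_majorant[OF hermite_coeff_abs_le[OF _ assms]
        summable_hermite_majorant continuous_on_hermite_coeff] by simp
  have summ: "summable (\<lambda>n. diffs (hermite_coeff (- K) 1 1) n * r ^ n)" for K r :: real
    using termdiff_converges_all[of "hermite_coeff (- K) 1 1" r] summable_hermite[of "- K" 1 1, where ?'a = real]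
    by simp
  have "\<bar>diffs (hermite_coeff E c0 c1) n\<bar> \<le> diffs (hermite_coeff (- K) 1 1) n" if "\<bar>E\<bar> \<le> K" for E K n
    unfolding diffs_def using hermite_coeff_abs_le[OF that assms, of "Suc n"]
    by (simp add: abs_mult mult_left_mono del: hermite_coeff.simps)
  moreover have "continuous_on UNIV (\<lambda>E. diffs (hermite_coeff E c0 c1) n)" for n
    unfolding diffs_def by (intro continuous_intros continuous_on_hermite_coeff)
  ultimately show "continuous_on UNIV (\<lambda>(E, x::real). hermite_series_deriv E c0 c1 x)"
    unfolding hermite_series_deriv_def
    using continuous_on_series_of_majorant[of "\<lambda>E. diffs (hermite_coeff E c0 c1)"
        "\<lambda>K. diffs (hermite_coeff (- K) 1 1)"] summ by simp
qed

text \<open>Joint continuity lets zeros be followed while the energy varies.\<close>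

lemma continuous_on_osc:
  assumes "\<bar>c0\<bar> \<le> 1" "\<bar>c1\<bar> \<le> 1"
  shows "continuous_on UNIV (\<lambda>(E, x::real). osc E c0 c1 x)"
    and "continuous_on UNIV (\<lambda>(E, x::real). osc' E c0 c1 x)"
  using continuous_on_hermite_series[OF assms]
  unfolding osc_def osc'_def case_prod_unfold
  by (auto intro!: continuous_intros)

section \<open>Sturm theory\<close>

definition osc_solution :: "real \<Rightarrow> (real \<Rightarrow> real) \<Rightarrow> (real \<Rightarrow> real) \<Rightarrow> bool" where
  "osc_solution E u u' \<longleftrightarrow>
     (\<forall>x. (u has_real_derivative u' x) (at x) \<and> (u' has_real_derivative (x\<^sup>2 - E) * u x) (at x))"

lemma osc_solutionD:
  assumes "osc_solution E u u'"
  shows "(u has_real_derivative u' x) (at x)" "(u' has_real_derivative (x\<^sup>2 - E) * u x) (at x)"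
  using assms by (auto simp: osc_solution_def)

lemma osc_solution_osc: "osc_solution E (osc E c0 c1) (osc' E c0 c1)"
  unfolding osc_solution_def using osc_deriv[where ?'a = real] osc'_deriv[where ?'a = real] by simp

lemma osc_solution_reflect:
  assumes "osc_solution E u u'"
  shows "osc_solution E (\<lambda>x. u (- x)) (\<lambda>x. - u' (- x))"
proof -
  have m: "((\<lambda>x::real. - x) has_real_derivative - 1) (at x)" for x
    by (auto intro!: derivative_eq_intros)
  note d = DERIV_chain2[OF osc_solutionD(1)[OF assms] m] DERIV_chain2[OF osc_solutionD(2)[OF assms] m]
  show ?thesis
    unfolding osc_solution_def
    by (intro allI conjI DERIV_cong[OF d(1)] DERIV_cong[OF DERIV_minus[OF d(2)]]) auto
qed

lemma osc_solution_cmult: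
  assumes "osc_solution E u u'"
  shows "osc_solution E (\<lambda>x. c * u x) (\<lambda>x. c * u' x)"
  unfolding osc_solution_def
  by (auto intro!: derivative_eq_intros osc_solutionD[OF assms])

lemma Wronskian_const:
  assumes "osc_solution E u u'" "osc_solution E v v'"
  shows "u x * v' x - u' x * v x = u y * v' y - u' y * v y"
proof (rule DERIV_zero_connected_constant[of UNIV "{}" "\<lambda>x. u x * v' x - u' x * v x"])
  show "\<forall>x\<in>UNIV - {}. ((\<lambda>x. u x * v' x - u' x * v x) has_real_derivative 0) (at x)"
    by (auto intro!: derivative_eq_intros osc_solutionD[OF assms(1)] osc_solutionD[OF assms(2)]
        simp: algebra_simps)
  then show "continuous_on UNIV (\<lambda>x. u x * v' x - u' x * v x)"
    by (auto intro!: continuous_at_imp_continuous_on DERIV_isCont)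
qed auto

text \<open>A solution with vanishing Cauchy data has vanishing Wronskian with a fundamental system.\<close>

lemma osc_solution_unique:
  assumes u: "osc_solution E u u'" and "u x0 = 0" "u' x0 = 0"
  shows "u x = 0"
proof -
  let ?c = "osc E 1 0" and ?c' = "osc' E 1 0" and ?s = "osc E 0 1" and ?s' = "osc' E 0 1"
  have 1: "u x * ?c' x - u' x * ?c x = 0"
    using Wronskian_const[OF u osc_solution_osc[of E 1 0], of x x0] assms by simp
  have 2: "u x * ?s' x - u' x * ?s x = 0"
    using Wronskian_const[OF u osc_solution_osc[of E 0 1], of x x0] assms by simp
  have 3: "?c x * ?s' x - ?c' x * ?s x = 1"
    using Wronskian_const[OF osc_solution_osc[of E 1 0] osc_solution_osc[of E 0 1], of x 0] by simp
  have "u x = u x * (?c x * ?s' x - ?c' x * ?s x)" by (simp add: 3)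
  also have "\<dots> = ?c x * (u x * ?s' x - u' x * ?s x) - ?s x * (u x * ?c' x - u' x * ?c x)"
    by (simp add: algebra_simps)
  finally show ?thesis by (simp add: 1 2)
qed

lemma connected_nonzero_sign:
  fixes f :: "real \<Rightarrow> real"
  assumes "connected S" "continuous_on S f" and nz: "\<And>x. x \<in> S \<Longrightarrow> f x \<noteq> 0"
  obtains s :: real where "s \<in> {-1, 1}" "\<And>x. x \<in> S \<Longrightarrow> 0 < s * f x"
proof (cases "S = {}")
  case False
  then obtain m where m: "m \<in> S" by blast
  have "connected (f ` S)" by (intro connected_continuous_image assms)
  then have "{f x..f y} \<subseteq> f ` S" if "x \<in> S" "y \<in> S" for x y
    using that by (intro connected_contains_Icc imageI)
  moreover have "0 \<notin> f ` S" using nz by fastforce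
  ultimately have same: "\<not> (f x < 0 \<and> 0 < f y)" if "x \<in> S" "y \<in> S" for x y
    using that by (meson atLeastAtMost_iff less_imp_le subsetD)
  have "0 < (if f m < 0 then -1 else 1) * f x" if "x \<in> S" for x
    using nz[OF that] nz[OF m] same[OF m that] same[OF that m] by auto
  then show thesis using that[of "if f m < 0 then -1 else 1"] by auto
qed (use that[of 1] in simp)

text \<open>
  Sturm comparison: the Wronskian \<open>u' v - u v'\<close> would increase strictly over a nodal interval of
  \<open>u\<close> on which \<open>v\<close> has no zero, but its boundary values have the wrong signs.
\<close>

lemma Sturm_nodal_interval:
  fixes u u' v v' p q :: "real \<Rightarrow> real"
  assumes "a < b" "u a = 0" "u b = 0" and nz: "\<And>x. a < x \<Longrightarrow> x < b \<Longrightarrow> u x \<noteq> 0"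
    and du: "\<And>x. (u has_real_derivative u' x) (at x)"
    and ddu: "\<And>x. (u' has_real_derivative p x * u x) (at x)"
    and dv: "\<And>x. (v has_real_derivative v' x) (at x)"
    and ddv: "\<And>x. (v' has_real_derivative q x * v x) (at x)"
    and less: "\<And>x. a < x \<Longrightarrow> x < b \<Longrightarrow> q x < p x"
  shows "\<exists>x. a < x \<and> x < b \<and> v x = 0"
proof (rule ccontr)
  assume no: "\<not> ?thesis"
  have cu: "continuous_on S u" and cv: "continuous_on S v" for S
    by (intro continuous_at_imp_continuous_on ballI DERIV_isCont[OF du] DERIV_isCont[OF dv])+
  obtain s where s: "s \<in> {-1, 1}" "\<And>x. x \<in> {a<..<b} \<Longrightarrow> 0 < s * u x"
    using connected_nonzero_sign[OF connected_Ioo[of a b] cu] nz greaterThanLessThan_iff by blast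
  obtain t where t: "t \<in> {-1, 1}" "\<And>x. x \<in> {a<..<b} \<Longrightarrow> 0 < t * v x"
    using connected_nonzero_sign[OF connected_Ioo[of a b] cv] no greaterThanLessThan_iff by blast
  have tv: "0 \<le> t * v x" if "x \<in> {a, b}" for x
  proof (rule continuous_ge_on_closure[where S = "{a<..<b}" and f = "\<lambda>x. t * v x"])
    show "continuous_on (closure {a<..<b}) (\<lambda>x. t * v x)" by (intro continuous_intros cv)
  qed (use that \<open>a < b\<close> t in \<open>auto simp: less_imp_le\<close>)
  let ?W = "\<lambda>x. s * t * (u' x * v x - u x * v' x)"
  have W': "(?W has_real_derivative (p x - q x) * ((s * u x) * (t * v x))) (at x)" for x
    by (auto intro!: derivative_eq_intros du ddu dv ddv simp: algebra_simps)
  have "?W a < ?W b"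
  proof (rule DERIV_pos_imp_increasing_open[OF \<open>a < b\<close>])
    fix x assume x: "a < x" "x < b"
    have "(p x - q x) * ((s * u x) * (t * v x)) > 0"
      using less[OF x] s(2)[of x] t(2)[of x] x by simp
    then show "\<exists>y. (?W has_real_derivative y) (at x) \<and> 0 < y" using W' by blast
  qed (intro continuous_at_imp_continuous_on ballI DERIV_isCont[OF W'])
  moreover have "0 \<le> s * u' a"
  proof (rule ccontr)
    assume "\<not> 0 \<le> s * u' a"
    moreover have "((\<lambda>x. s * u x) has_real_derivative s * u' a) (at a)" by (intro DERIV_cmult du)
    ultimately obtain d where d: "d > 0" "\<And>h. 0 < h \<Longrightarrow> h < d \<Longrightarrow> s * u (a + h) < s * u a"
      using DERIV_neg_dec_right[of "\<lambda>x. s * u x" "s * u' a" a] by auto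
    define h where "h = min (d / 2) ((b - a) / 2)"
    have h: "0 < h" "h < d" "h < b - a" using d(1) \<open>a < b\<close> by (auto simp: h_def min_def)
    show False using d(2)[OF h(1,2)] s(2)[of "a + h"] h \<open>u a = 0\<close> by simp
  qed
  moreover have "s * u' b \<le> 0"
  proof (rule ccontr)
    assume "\<not> s * u' b \<le> 0"
    moreover have "((\<lambda>x. s * u x) has_real_derivative s * u' b) (at b)" by (intro DERIV_cmult du)
    ultimately obtain d where d: "d > 0" "\<And>h. 0 < h \<Longrightarrow> h < d \<Longrightarrow> s * u (b - h) < s * u b"
      using DERIV_pos_inc_left[of "\<lambda>x. s * u x" "s * u' b" b] by auto
    define h where "h = min (d / 2) ((b - a) / 2)"
    have h: "0 < h" "h < d" "h < b - a" using d(1) \<open>a < b\<close> by (auto simp: h_def min_def)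
    show False using d(2)[OF h(1,2)] s(2)[of "b - h"] h \<open>u b = 0\<close> by simp
  qed
  ultimately have "0 \<le> (s * u' a) * (t * v a)" "(s * u' b) * (t * v b) \<le> 0"
    using tv by (auto intro: mult_nonneg_nonneg mult_nonpos_nonneg)
  moreover have "?W a = (s * u' a) * (t * v a)" "?W b = (s * u' b) * (t * v b)"
    using \<open>u a = 0\<close> \<open>u b = 0\<close> by (auto simp: algebra_simps)
  ultimately show False using \<open>?W a < ?W b\<close> by linarith
qed

lemma nonzero_deriv_isolated_right:
  assumes "(u has_real_derivative D) (at a)" "D \<noteq> 0" "u a = 0"
  obtains d where "d > 0" "\<And>x. a < x \<Longrightarrow> x < a + d \<Longrightarrow> u x \<noteq> 0"
proof -
  have "\<exists>d>0. \<forall>h>0. h < d \<longrightarrow> u (a + h) \<noteq> u a"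
  proof (cases "D > 0")
    case True
    then obtain d where "d > 0" "\<forall>h>0. h < d \<longrightarrow> u a < u (a + h)"
      using DERIV_pos_inc_right[OF assms(1)] by blast
    then show ?thesis by (intro exI[of _ d]) (simp add: less_imp_neq[symmetric])
  next
    case False
    then have "D < 0" using assms(2) by simp
    then obtain d where "d > 0" "\<forall>h>0. h < d \<longrightarrow> u (a + h) < u a"
      using DERIV_neg_dec_right[OF assms(1)] by blast
    then show ?thesis by (intro exI[of _ d]) (simp add: less_imp_neq)
  qed
  then obtain d where d: "d > 0" "\<And>h. 0 < h \<Longrightarrow> h < d \<Longrightarrow> u (a + h) \<noteq> u a" by blast
  then have "u x \<noteq> 0" if "a < x" "x < a + d" for x
    using d(2)[of "x - a"] that assms(3) by simp
  with d(1) show thesis using that by blast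
qed

text \<open>
  The zero at \<open>a\<close> is simple, so that \<open>u\<close> has a first zero after \<open>a\<close>; this gives a nodal interval.
\<close>

lemma Sturm_comparison:
  fixes u u' v v' p q :: "real \<Rightarrow> real"
  assumes "a < b" "u a = 0" "u b = 0" "u' a \<noteq> 0"
    and du: "\<And>x. (u has_real_derivative u' x) (at x)"
    and ddu: "\<And>x. (u' has_real_derivative p x * u x) (at x)"
    and dv: "\<And>x. (v has_real_derivative v' x) (at x)"
    and ddv: "\<And>x. (v' has_real_derivative q x * v x) (at x)"
    and less: "\<And>x. a < x \<Longrightarrow> x < b \<Longrightarrow> q x < p x"
  shows "\<exists>x. a < x \<and> x < b \<and> v x = 0"
proof -
  obtain d where d: "d > 0" "\<And>x. a < x \<Longrightarrow> x < a + d \<Longrightarrow> u x \<noteq> 0"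
    using nonzero_deriv_isolated_right[OF du assms(4,2)] by blast
  let ?Z = "{x\<in>{a + d/2..b}. u x = 0}"
  have d_le: "a + d \<le> b" using d(2)[of b] assms(1,3) by force
  have "closed ?Z"
    using continuous_closed_preimage_constant[of "{a + d/2..b}" u 0]
      continuous_at_imp_continuous_on[of "{a + d/2..b}" u] DERIV_isCont[OF du] by simp
  moreover have "b \<in> ?Z" using d d_le assms by auto
  ultimately have b': "Inf ?Z \<in> ?Z" by (intro closed_contains_Inf bdd_belowI[of _ "a + d/2"]) auto
  have nz: "u x \<noteq> 0" if "a < x" "x < Inf ?Z" for x
  proof (cases "x < a + d")
    case False
    show ?thesis
    proof
      assume "u x = 0"
      then have "x \<in> ?Z" using that False b' d by auto
      then have "Inf ?Z \<le> x" by (intro cInf_lower bdd_belowI[of _ "a + d/2"]) auto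
      then show False using that by simp
    qed
  qed (use d that in auto)
  have "\<exists>x. a < x \<and> x < Inf ?Z \<and> v x = 0"
    by (rule Sturm_nodal_interval[OF _ assms(2) _ nz du ddu dv ddv less]) (use b' d in auto)
  then show ?thesis using b' by fastforce
qed

section \<open>Dirichlet eigenvalues by shooting\<close>

lemma chain_less:
  fixes z :: "nat \<Rightarrow> real"
  assumes "\<And>i. i < n \<Longrightarrow> z i < z (Suc i)" "i < j" "j \<le> n"
  shows "z i < z j"
  using assms(2,3)
proof (induction j)
  case (Suc j)
  show ?case
  proof (cases "i = j")
    case True
    then show ?thesis using assms(1)[of j] Suc by simp
  next
    case False
    then have "z i < z j" using Suc by simp
    also have "z j < z (Suc j)" using assms(1)[of j] Suc by simp
    finally show ?thesis .
  qed
qed simp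

lemma chain_le:
  fixes z :: "nat \<Rightarrow> real"
  assumes "\<And>i. i < n \<Longrightarrow> z i < z (Suc i)" "i \<le> j" "j \<le> n"
  shows "z i \<le> z j"
  using chain_less[of n z i j] assms by (cases "i = j") auto

text \<open>Sets of zeros are turned into chains, because comparison theorems speak of consecutive zeros.\<close>

lemma finite_set_chain:
  fixes a :: real
  assumes "finite F" "card F = n" "F \<subseteq> {a<..}"
  shows "\<exists>z. z 0 = a \<and> (\<forall>i<n. z i < z (Suc i)) \<and> z ` {1..n} = F"
  using assms
proof (induction n arbitrary: F)
  case 0
  then show ?case by (intro exI[of _ "\<lambda>_. a"]) auto
next
  case (Suc n)
  then have ne: "F \<noteq> {}" by auto
  define m where "m = Max F"
  have m: "m \<in> F" using Max_in[OF Suc.prems(1) ne] by (simp add: m_def)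
  obtain z where z: "z 0 = a" "\<forall>i<n. z i < z (Suc i)" "z ` {1..n} = F - {m}"
    using Suc.IH[of "F - {m}"] Suc.prems m by (auto simp: card_Diff_singleton)
  have zn: "z n < m"
  proof (cases n)
    case 0
    then show ?thesis using z(1) m Suc.prems(3) by auto
  next
    case (Suc k)
    then have "z n \<in> F - {m}" using z(3) by auto
    then show ?thesis using Max_ge[OF Suc.prems(1), of "z n"] by (auto simp: m_def)
  qed
  show ?case
  proof (intro exI[of _ "z(Suc n := m)"] conjI allI impI)
    fix i assume "i < Suc n"
    then show "(z(Suc n := m)) i < (z(Suc n := m)) (Suc i)"
      using z(2) zn by (cases "i = n") auto
  next
    have "(z(Suc n := m)) ` {1..Suc n} = insert m (z ` {1..n})"
      by (auto simp: atLeastAtMostSuc_conv image_def)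
    then show "(z(Suc n := m)) ` {1..Suc n} = F" using z(3) m by auto
  qed (use z in auto)
qed

lemma chain_card_image:
  fixes z :: "nat \<Rightarrow> real"
  assumes "\<And>i. i < n \<Longrightarrow> z i < z (Suc i)"
  shows "card (z ` {1..n}) = n"
proof -
  have "inj_on z {1..n}"
    by (rule linorder_inj_onI) (use chain_less[of n z] assms in fastforce)+
  then show ?thesis by (simp add: card_image)
qed

lemma points_in_gaps:
  fixes z :: "nat \<Rightarrow> real"
  assumes z: "\<And>i. i < n \<Longrightarrow> z i < z (Suc i)"
    and gap: "\<And>i. i < n \<Longrightarrow> \<exists>x. z i < x \<and> x < z (Suc i) \<and> Q x"
  shows "\<exists>F. finite F \<and> card F = n \<and> F \<subseteq> {z 0<..<z n} \<and> (\<forall>x\<in>F. Q x)"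
proof -
  obtain y where y: "\<And>i. i < n \<Longrightarrow> z i < y i \<and> y i < z (Suc i) \<and> Q (y i)"
    using gap by metis
  have less: "y i < y j" if "i < j" "j < n" for i j
  proof -
    have "y i < z (Suc i)" using y that by simp
    also have "z (Suc i) \<le> z j" using chain_le[of n z "Suc i" j] z that by simp
    also have "z j < y j" using y that by simp
    finally show ?thesis .
  qed
  have "inj_on y {..<n}"
    by (rule linorder_inj_onI) (use less in \<open>auto simp: less_imp_neq\<close>)
  then have "card (y ` {..<n}) = n" by (simp add: card_image)
  moreover have "z 0 < y i \<and> y i < z n" if "i < n" for i
    using y[OF that] chain_le[of n z 0 i] chain_le[of n z "Suc i" n] z that by force
  ultimately show ?thesis using y by (intro exI[of _ "y ` {..<n}"]) auto
qed

lemma Sturm_zeros: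
  assumes u: "osc_solution E u u'" and v: "osc_solution E' v v'" and "E < E'"
    and z: "\<And>i. i < n \<Longrightarrow> z i < z (Suc i)"
    and zero: "\<And>i. i \<le> n \<Longrightarrow> u (z i) = 0" and simple: "\<And>i. i \<le> n \<Longrightarrow> u' (z i) \<noteq> 0"
  shows "\<exists>F. finite F \<and> card F = n \<and> F \<subseteq> {z 0<..<z n} \<and> (\<forall>x\<in>F. v x = 0)"
proof (rule points_in_gaps)
  show "z i < z (Suc i)" if "i < n" for i using z[OF that] .
next
  fix i assume i: "i < n"
  show "\<exists>x. z i < x \<and> x < z (Suc i) \<and> v x = 0"
    by (rule Sturm_comparison[where u = u and u' = u' and v = v and v' = v'
          and p = "\<lambda>x. x\<^sup>2 - E" and q = "\<lambda>x. x\<^sup>2 - E'"])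
       (use z[OF i] zero[of i] zero[of "Suc i"] simple[of i] i \<open>E < E'\<close> osc_solutionD[OF u] osc_solutionD[OF v]
        in auto)
qed

text \<open>
  The solution of \<open>u'' = (z\<^sup>2 - E) u\<close> with \<open>u a = 0\<close> and \<open>u' a = 1\<close>, by Cramer's rule; the Wronskian of the
  two basic solutions is \<open>1\<close>.
\<close>

definition shoot :: "real \<Rightarrow> real \<Rightarrow> 'a::{real_normed_field,banach} \<Rightarrow> 'a" where
  "shoot a E z = of_real (osc E 1 0 a) * osc E 0 1 z - of_real (osc E 0 1 a) * osc E 1 0 z"

definition shoot' :: "real \<Rightarrow> real \<Rightarrow> 'a::{real_normed_field,banach} \<Rightarrow> 'a" where
  "shoot' a E z = of_real (osc E 1 0 a) * osc' E 0 1 z - of_real (osc E 0 1 a) * osc' E 1 0 z"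

lemma shoot_deriv:
  "(shoot a E has_field_derivative shoot' a E z) (at z)"
  unfolding shoot_def[abs_def] shoot'_def by (intro DERIV_diff DERIV_cmult osc_deriv)

lemma shoot'_deriv:
  "(shoot' a E has_field_derivative (z\<^sup>2 - of_real E) * shoot a E z) (at z)"
proof -
  have "(shoot' a E has_field_derivative of_real (osc E 1 0 a) * ((z\<^sup>2 - of_real E) * osc E 0 1 z)
      - of_real (osc E 0 1 a) * ((z\<^sup>2 - of_real E) * osc E 1 0 z)) (at z)"
    unfolding shoot'_def[abs_def] by (intro DERIV_diff DERIV_cmult osc'_deriv)
  then show ?thesis by (simp add: shoot_def algebra_simps)
qed

lemma shoot_of_real: "shoot a E (of_real x :: 'a::{real_normed_field,banach}) = of_real (shoot a E x)"
  by (simp add: shoot_def osc_of_real)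

lemma shoot_solution: "osc_solution E (shoot a E) (shoot' a E)"
  unfolding osc_solution_def using shoot_deriv[where ?'a = real] shoot'_deriv[where ?'a = real] by simp

lemma shoot_start [simp]: "shoot a E a = 0"
  by (simp add: shoot_def)

lemma shoot'_start [simp]: "shoot' a E a = 1"
  using Wronskian_const[OF osc_solution_osc[of E 1 0] osc_solution_osc[of E 0 1], of a 0]
  by (simp add: shoot'_def mult.commute)

lemma shoot_simple_zero:
  assumes "shoot a E (x::real) = 0"
  shows "shoot' a E x \<noteq> 0"
proof
  assume "shoot' a E x = 0"
  then have "shoot a E y = 0" for y :: real
    using osc_solution_unique[OF shoot_solution assms] by blast
  then have "shoot a E = (\<lambda>y::real. 0)" by auto
  then have "((\<lambda>y::real. 0) has_real_derivative shoot' a E a) (at a)" using shoot_deriv[of a E a] by simp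
  then have "shoot' a E a = 0" using DERIV_unique DERIV_const by blast
  then show False by simp
qed

lemma tendsto_of_continuous_on_pair:
  fixes f :: "real \<times> real \<Rightarrow> real"
  assumes "continuous_on UNIV f" "(s \<longlongrightarrow> l) F" "(t \<longlongrightarrow> m) F"
  shows "((\<lambda>j. f (s j, t j)) \<longlongrightarrow> f (l, m)) F"
  using continuous_on_tendsto_compose[OF assms(1) tendsto_Pair[OF assms(2,3)]] by simp

lemma tendsto_shoot:
  fixes t :: "_ \<Rightarrow> real"
  assumes "(s \<longlongrightarrow> E) F" "(t \<longlongrightarrow> x) F"
  shows "((\<lambda>j. shoot a (s j) (t j)) \<longlongrightarrow> shoot a E x) F"
    and "((\<lambda>j. shoot' a (s j) (t j)) \<longlongrightarrow> shoot' a E x) F"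
proof -
  have c: "((\<lambda>j. osc (s j) c0 c1 (r j)) \<longlongrightarrow> osc E c0 c1 y) F"
       "((\<lambda>j. osc' (s j) c0 c1 (r j)) \<longlongrightarrow> osc' E c0 c1 y) F"
    if "\<bar>c0\<bar> \<le> 1" "\<bar>c1\<bar> \<le> 1" "(r \<longlongrightarrow> y) F" for c0 c1 y and r :: "_ \<Rightarrow> real"
    using tendsto_of_continuous_on_pair[OF continuous_on_osc(1)[OF that(1,2)] assms(1) that(3)]
      tendsto_of_continuous_on_pair[OF continuous_on_osc(2)[OF that(1,2)] assms(1) that(3)] by simp_all
  show "((\<lambda>j. shoot a (s j) (t j)) \<longlongrightarrow> shoot a E x) F"
       "((\<lambda>j. shoot' a (s j) (t j)) \<longlongrightarrow> shoot' a E x) F"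
    unfolding shoot_def shoot'_def
    by (intro tendsto_diff tendsto_mult tendsto_of_real c assms(2) tendsto_const; simp)+
qed

text \<open>
  The condition of having at least \<open>n\<close> zeros after \<open>a\<close>.  The end point \<open>b\<close> is included, which makes the
  condition closed in \<open>E\<close>.
\<close>

definition shoot_zeros :: "real \<Rightarrow> real \<Rightarrow> nat \<Rightarrow> real \<Rightarrow> bool" where
  "shoot_zeros a b n E \<longleftrightarrow>
     (\<exists>F. finite F \<and> card F = n \<and> F \<subseteq> {a<..b} \<and> (\<forall>x\<in>F. shoot a E x = 0))"

lemma shoot_zeros_chain:
  assumes "shoot_zeros a b n E"
  obtains z where "z 0 = a" "\<And>i. i < n \<Longrightarrow> z i < z (Suc i)" "\<And>i. i \<le> n \<Longrightarrow> shoot a E (z i) = 0"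
    "\<And>i. 1 \<le> i \<Longrightarrow> i \<le> n \<Longrightarrow> z i \<in> {a<..b}"
proof -
  obtain F where F: "finite F" "card F = n" "F \<subseteq> {a<..b}" "\<forall>x\<in>F. shoot a E x = 0"
    using assms by (auto simp: shoot_zeros_def)
  have "F \<subseteq> {a<..}" using F(3) by auto
  from finite_set_chain[OF F(1,2) this]
  obtain z where z: "z 0 = a" "\<forall>i<n. z i < z (Suc i)" "z ` {1..n} = F" by blast
  have mem: "z i \<in> F" if "1 \<le> i" "i \<le> n" for i using z(3) that by auto
  have "shoot a E (z i) = 0" if "i \<le> n" for i
    using mem[of i] F(4) z(1) that by (cases i) auto
  then show thesis using that[of z] z mem F(3) by blast
qed

lemma shoot_zeros_of_chain:
  assumes "z 0 = a" "\<And>i. i < n \<Longrightarrow> z i < z (Suc i)" "\<And>i. i \<le> n \<Longrightarrow> shoot a E (z i) = 0" "n = 0 \<or> z n \<le> b"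
  shows "shoot_zeros a b n E"
  unfolding shoot_zeros_def
proof (intro exI[of _ "z ` {1..n}"] conjI ballI)
  show "card (z ` {1..n}) = n" using chain_card_image assms(2) by blast
  show "z ` {1..n} \<subseteq> {a<..b}"
  proof safe
    fix i assume "i \<in> {1..n}"
    then show "z i \<in> {a<..b}"
      using chain_less[of n z 0 i] chain_le[of n z i n] assms by force
  qed
qed (use assms(3) in auto)

text \<open>
  Every gap between consecutive zeros, the one starting at \<open>a\<close> included, contains a zero of \<open>v\<close>.
\<close>

lemma shoot_zeros_increase:
  assumes "shoot_zeros a b n E" "E < E'" "osc_solution E' v v'"
  shows "\<exists>F. finite F \<and> card F = n \<and> F \<subseteq> {a<..<b} \<and> (\<forall>x\<in>F. v x = 0)"
proof (cases "n = 0")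
  case False
  obtain z where z: "z 0 = a" "\<And>i. i < n \<Longrightarrow> z i < z (Suc i)" "\<And>i. i \<le> n \<Longrightarrow> shoot a E (z i) = 0"
    "\<And>i. 1 \<le> i \<Longrightarrow> i \<le> n \<Longrightarrow> z i \<in> {a<..b}"
    using shoot_zeros_chain[OF assms(1)] by blast
  have "\<exists>F. finite F \<and> card F = n \<and> F \<subseteq> {z 0<..<z n} \<and> (\<forall>x\<in>F. v x = 0)"
    by (rule Sturm_zeros[where n = n and z = z, OF shoot_solution assms(3,2)])
       (use z(2) z(3) shoot_simple_zero in blast)+
  then obtain F where F: "finite F" "card F = n" "F \<subseteq> {z 0<..<z n}" "\<forall>x\<in>F. v x = 0" by blast
  have "{z 0<..<z n} \<subseteq> {a<..<b}" using z(1) z(4)[of n] False by auto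
  with F(3) have "F \<subseteq> {a<..<b}" by (rule subset_trans)
  with F show ?thesis by blast
qed (intro exI[of _ "{}"], simp)

lemma Icc_subseq:
  fixes f :: "nat \<Rightarrow> real"
  assumes "\<And>j. f j \<in> {a..b}"
  obtains l r where "l \<in> {a..b}" "strict_mono r" "(\<lambda>j. f (r j)) \<longlonglongrightarrow> l"
proof -
  have "seq_compact {a..b}" by (intro compact_imp_seq_compact compact_Icc)
  moreover have "\<forall>n. f n \<in> {a..b}" using assms by blast
  ultimately obtain l r where "l \<in> {a..b}" "strict_mono r" "(f \<circ> r) \<longlonglongrightarrow> l"
    by (rule seq_compactE)
  then show thesis by (intro that[of l r]) (simp_all add: o_def)
qed

lemma bounded_tuple_subseq:
  fixes z :: "nat \<Rightarrow> nat \<Rightarrow> real"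
  assumes "\<And>j i. i \<le> n \<Longrightarrow> z j i \<in> {a..b}"
  shows "\<exists>r l. strict_mono r \<and> (\<forall>i\<le>n. l i \<in> {a..b} \<and> (\<lambda>j. z (r j) i) \<longlonglongrightarrow> l i)"
  using assms
proof (induction n)
  case 0
  have "z j 0 \<in> {a..b}" for j using 0 by blast
  then obtain l r where "l \<in> {a..b}" "strict_mono r" "(\<lambda>j. z (r j) 0) \<longlonglongrightarrow> l"
    by (rule Icc_subseq)
  then show ?case by (intro exI[of _ r] exI[of _ "\<lambda>_. l"]) simp
next
  case (Suc n)
  have "z j i \<in> {a..b}" if "i \<le> n" for j i using Suc.prems that by simp
  from Suc.IH[OF this] obtain r l
    where r: "strict_mono r" "\<forall>i\<le>n. l i \<in> {a..b} \<and> (\<lambda>j. z (r j) i) \<longlonglongrightarrow> l i"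
    by blast
  have "z (r j) (Suc n) \<in> {a..b}" for j using Suc.prems by blast
  then obtain m q where q: "m \<in> {a..b}" "strict_mono q" "(\<lambda>j. z (r (q j)) (Suc n)) \<longlonglongrightarrow> m"
    by (rule Icc_subseq)
  have "(l(Suc n := m)) i \<in> {a..b} \<and> (\<lambda>j. z ((r \<circ> q) j) i) \<longlonglongrightarrow> (l(Suc n := m)) i" if "i \<le> Suc n" for i
  proof (cases "i = Suc n")
    case True
    then show ?thesis using q by (simp add: o_def)
  next
    case False
    then have i: "i \<le> n" using that by simp
    then have "((\<lambda>j. z (r j) i) \<circ> q) \<longlonglongrightarrow> l i" using r q(2) by (intro LIMSEQ_subseq_LIMSEQ) auto
    then show ?thesis using i r(2) by (simp add: o_def)
  qed
  then show ?case
    by (intro exI[of _ "r \<circ> q"] exI[of _ "l(Suc n := m)"] conjI strict_mono_o[OF r(1) q(2)]) blast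
qed

text \<open>
  In the limit zeros stay distinct: otherwise Rolle's theorem would produce a double zero of the
  limiting solution.
\<close>

lemma shoot_zeros_closed:
  assumes ab: "a \<le> b" and lim: "s \<longlonglongrightarrow> E" and zs: "\<And>j. shoot_zeros a b n (s j)"
  shows "shoot_zeros a b n E"
proof -
  have "\<exists>z. z 0 = a \<and> (\<forall>i<n. z i < z (Suc i)) \<and> (\<forall>i\<le>n. shoot a (s j) (z i) = 0)
      \<and> (\<forall>i. 1 \<le> i \<longrightarrow> i \<le> n \<longrightarrow> z i \<in> {a<..b})" for j
    by (rule shoot_zeros_chain[OF zs[of j]]) blast
  then obtain z where z: "\<And>j. z j 0 = a" "\<And>j i. i < n \<Longrightarrow> z j i < z j (Suc i)"
      "\<And>j i. i \<le> n \<Longrightarrow> shoot a (s j) (z j i) = 0"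
      "\<And>j i. 1 \<le> i \<Longrightarrow> i \<le> n \<Longrightarrow> z j i \<in> {a<..b}" by metis
  have "z j i \<in> {a..b}" if "i \<le> n" for j i
    using z(1)[of j] z(4)[of i j] ab that by (cases i) auto
  from bounded_tuple_subseq[of n z, OF this]
  obtain r l where r: "strict_mono r" and l: "\<And>i. i \<le> n \<Longrightarrow> l i \<in> {a..b}"
      "\<And>i. i \<le> n \<Longrightarrow> (\<lambda>j. z (r j) i) \<longlonglongrightarrow> l i" by blast
  have sr: "(\<lambda>j. s (r j)) \<longlonglongrightarrow> E" using LIMSEQ_subseq_LIMSEQ[OF lim r] by (simp add: o_def)
  have zero: "shoot a E (l i) = 0" if "i \<le> n" for i
  proof -
    have "(\<lambda>j. shoot a (s (r j)) (z (r j) i)) \<longlonglongrightarrow> shoot a E (l i)"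
      by (rule tendsto_shoot(1)[OF sr l(2)[OF that]])
    then show ?thesis using z(3)[OF that] by (simp add: LIMSEQ_const_iff)
  qed
  have l0: "l 0 = a" using l(2)[of 0] z(1) by (simp add: LIMSEQ_const_iff)
  have less: "l i < l (Suc i)" if i: "i < n" for i
  proof -
    have le: "l i \<le> l (Suc i)"
      by (rule LIMSEQ_le[OF l(2) l(2)]) (use i z(2) in \<open>auto intro: less_imp_le\<close>)
    moreover have "l i \<noteq> l (Suc i)"
    proof
      assume eq: "l i = l (Suc i)"
      have "\<exists>x. z j i < x \<and> x < z j (Suc i) \<and> shoot' a (s j) x = 0" for j
      proof -
        have "\<exists>x>z j i. x < z j (Suc i) \<and> (shoot a (s j) has_real_derivative 0) (at x)"
        proof (rule Rolle)
          show "z j i < z j (Suc i)" using z(2)[OF i] .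
          show "shoot a (s j) (z j i) = shoot a (s j) (z j (Suc i))" using z(3)[of i j] z(3)[of "Suc i" j] i by simp
          show "continuous_on {z j i..z j (Suc i)} (shoot a (s j))"
            by (intro continuous_at_imp_continuous_on ballI DERIV_isCont[OF shoot_deriv])
          show "shoot a (s j) differentiable (at x)" for x :: real
            using shoot_deriv[of a "s j" x] real_differentiable_def by blast
        qed
        then show ?thesis using DERIV_unique shoot_deriv by blast
      qed
      then obtain x where x: "\<And>j. z j i < x j" "\<And>j. x j < z j (Suc i)" "\<And>j. shoot' a (s j) (x j) = 0"
        by metis
      have "(\<lambda>j. x (r j)) \<longlonglongrightarrow> l i"
        by (rule tendsto_sandwich[OF _ _ l(2)[of i] l(2)[of "Suc i", folded eq]])
           (use x i in \<open>auto intro: less_imp_le always_eventually\<close>)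
      then have "(\<lambda>j. shoot' a (s (r j)) (x (r j))) \<longlonglongrightarrow> shoot' a E (l i)"
        by (rule tendsto_shoot(2)[OF sr])
      then have "shoot' a E (l i) = 0" using x(3) by (simp add: LIMSEQ_const_iff)
      then show False using shoot_simple_zero[OF zero[of i]] i by simp
    qed
    ultimately show ?thesis by simp
  qed
  show ?thesis by (rule shoot_zeros_of_chain[of l, OF l0 less zero]) (use l(1)[of n] in auto)
qed

text \<open>A simple zero comes with a change of sign, which survives small changes of the energy.\<close>

lemma shoot_zero_persists:
  assumes "shoot a E (x::real) = 0" "r > 0"
  shows "\<forall>\<^sub>F E' in at E. \<exists>y. \<bar>y - x\<bar> < r \<and> shoot a E' y = 0"
proof -
  let ?u = "shoot a E" and ?D = "shoot' a E x"
  have D: "?D \<noteq> 0" by (rule shoot_simple_zero[OF assms(1)])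
  define s where "s = sgn ?D"
  have s: "s * ?D > 0" "s = 1 \<or> s = -1" using D by (auto simp: s_def sgn_if)
  have d: "((\<lambda>y. s * ?u y) has_real_derivative s * ?D) (at x)" by (intro DERIV_cmult shoot_deriv)
  obtain d1 where d1: "d1 > 0" "\<And>h. 0 < h \<Longrightarrow> h < d1 \<Longrightarrow> s * ?u x < s * ?u (x + h)"
    using DERIV_pos_inc_right[OF d s(1)] by blast
  obtain d2 where d2: "d2 > 0" "\<And>h. 0 < h \<Longrightarrow> h < d2 \<Longrightarrow> s * ?u (x - h) < s * ?u x"
    using DERIV_pos_inc_left[OF d s(1)] by blast
  define h where "h = min (r / 2) (min (d1 / 2) (d2 / 2))"
  have h: "0 < h" "h < r" "h < d1" "h < d2" using assms(2) d1(1) d2(1) by (auto simp: h_def)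
  have pos: "0 < s * ?u (x + h)" using d1(2)[OF h(1,3)] assms(1) by simp
  have neg: "s * ?u (x - h) < 0" using d2(2)[OF h(1,4)] assms(1) by simp
  have t: "((\<lambda>E'. s * shoot a E' y) \<longlongrightarrow> s * shoot a E y) (at E)" for y :: real
    by (intro tendsto_mult tendsto_const tendsto_shoot(1) tendsto_ident_at)
  have "\<forall>\<^sub>F E' in at E. 0 < s * shoot a E' (x + h)" by (rule order_tendstoD(1)[OF t pos])
  moreover have "\<forall>\<^sub>F E' in at E. s * shoot a E' (x - h) < 0" by (rule order_tendstoD(2)[OF t neg])
  ultimately show ?thesis
  proof eventually_elim
    case (elim E')
    have "\<exists>y\<ge>x - h. y \<le> x + h \<and> s * shoot a E' y = 0"
      by (rule IVT') (use elim h in \<open>auto intro!: continuous_intros continuous_at_imp_continuous_on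
            DERIV_isCont[OF shoot_deriv] simp: less_imp_le\<close>)
    then obtain y where "x - h \<le> y" "y \<le> x + h" "s * shoot a E' y = 0" by blast
    then show ?case using s(2) h by (intro exI[of _ y]) auto
  qed
qed

text \<open>
  Interior zeros leave room for lowering the energy; hence at the least energy with \<open>n\<close> zeros one of
  them sits at \<open>b\<close>.
\<close>

lemma shoot_zeros_below:
  assumes F: "finite F" "card F = n" "F \<subseteq> {a<..<b}" "\<And>x. x \<in> F \<Longrightarrow> shoot a E x = 0"
  shows "\<exists>E'<E. shoot_zeros a b n E'"
proof -
  have "finite (insert a (insert b F))" using F by simp
  obtain r where r: "r > 0" "\<And>x y. x \<in> insert a (insert b F) \<Longrightarrow> y \<in> insert a (insert b F) \<Longrightarrow> x \<noteq> y \<Longrightarrow> 2 * r \<le> dist x y"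
  proof -
    let ?G = "insert a (insert b F)"
    let ?D = "insert 1 ((\<lambda>(x, y). dist x y) ` {p \<in> ?G \<times> ?G. fst p \<noteq> snd p})"
    have fin: "finite ?D" using F by (intro finite.insertI finite_imageI finite_Collect_conjI) auto
    have "Min ?D > 0" using fin by (subst Min_gr_iff) auto
    moreover have "Min ?D \<le> dist x y" if "x \<in> ?G" "y \<in> ?G" "x \<noteq> y" for x y
      using that by (intro Min_le[OF fin]) force
    ultimately show thesis by (intro that[of "Min ?D / 2"]) auto
  qed
  have "\<forall>\<^sub>F E' in at E. \<forall>x\<in>F. \<exists>y. \<bar>y - x\<bar> < r \<and> shoot a E' y = 0"
    using F by (intro eventually_ball_finite ballI shoot_zero_persists r(1)) auto
  then have "\<forall>\<^sub>F E' in at_left E. \<forall>x\<in>F. \<exists>y. \<bar>y - x\<bar> < r \<and> shoot a E' y = 0"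
    by (simp add: eventually_at_split)
  moreover have "\<forall>\<^sub>F E' in at_left E. E' < E" by (simp add: eventually_at_filter)
  ultimately have "\<forall>\<^sub>F E' in at_left E. E' < E \<and> (\<forall>x\<in>F. \<exists>y. \<bar>y - x\<bar> < r \<and> shoot a E' y = 0)"
    by eventually_elim simp
  then obtain E' where E': "E' < E" "\<forall>x\<in>F. \<exists>y. \<bar>y - x\<bar> < r \<and> shoot a E' y = 0"
    using eventually_happens'[OF trivial_limit_at_left_real] by blast
  then obtain y where y: "\<And>x. x \<in> F \<Longrightarrow> \<bar>y x - x\<bar> < r \<and> shoot a E' (y x) = 0" by metis
  have "inj_on y F"
  proof (rule inj_onI, rule ccontr)
    fix p q assume pq: "p \<in> F" "q \<in> F" "y p = y q" "p \<noteq> q"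
    then have "2 * r \<le> dist p q" using r(2) by blast
    then show False
      using conjunct1[OF y[OF pq(1)]] conjunct1[OF y[OF pq(2)]] pq(3) unfolding dist_real_def by linarith
  qed
  moreover have "y x \<in> {a<..b}" if x: "x \<in> F" for x
  proof -
    have "a < x" "x < b" using F(3) x by auto
    moreover from this have "2 * r \<le> x - a" "2 * r \<le> b - x"
      using r(2)[of a x] r(2)[of x b] x by (auto simp: dist_real_def)
    moreover have "\<bar>y x - x\<bar> < r" using y[OF x] by simp
    ultimately have "a < y x" "y x \<le> b" using r(1) by linarith+
    then show ?thesis by simp
  qed
  ultimately have "shoot_zeros a b n E'"
    unfolding shoot_zeros_def using y F
    by (intro exI[of _ "y ` F"]) (auto simp: card_image)
  then show ?thesis using E'(1) by blast
qed

text \<open>Comparison with a sine whose zeros are equally spaced.\<close>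

lemma shoot_zeros_exist:
  assumes "a < b"
  shows "\<exists>E. shoot_zeros a b n E"
proof -
  \<comment> \<open>\<open>sin (k (x - a))\<close> has \<open>n\<close> gaps between its zeros in \<open>[a, b]\<close>, and \<open>x\<^sup>2 - E < - k\<^sup>2\<close> there\<close>
  define k where "k = pi * real n / (b - a)"
  define E where "E = a\<^sup>2 + b\<^sup>2 + k\<^sup>2 + 1"
  let ?z = "\<lambda>i. a + real i * (b - a) / real n"
  show ?thesis
  proof (cases "n = 0")
    case False
    then have n: "real n > 0" and k: "k > 0" using assms by (auto simp: k_def)
    have sin0: "sin (k * (?z i - a)) = 0" for i
    proof -
      have "k * (?z i - a) = real i * pi" using n assms by (simp add: k_def)
      then show ?thesis by (simp only: sin_npi)
    qed
    have cos0: "cos (k * (?z i - a)) \<noteq> 0" for i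
      using sin0[of i] sin_cos_squared_add[of "k * (?z i - a)"] by auto
    have "\<exists>F. finite F \<and> card F = n \<and> F \<subseteq> {?z 0<..<?z n} \<and> (\<forall>x\<in>F. shoot a E x = 0)"
    proof (rule points_in_gaps)
      show less: "?z i < ?z (Suc i)" for i
        using n assms by (simp add: divide_strict_right_mono)
      fix i assume i: "i < n"
      show "\<exists>x. ?z i < x \<and> x < ?z (Suc i) \<and> shoot a E x = 0"
      proof (rule Sturm_comparison[where u = "\<lambda>x. sin (k * (x - a))" and u' = "\<lambda>x. k * cos (k * (x - a))"
            and v = "shoot a E" and v' = "shoot' a E" and p = "\<lambda>x. - (k\<^sup>2)" and q = "\<lambda>x. x\<^sup>2 - E"])
        show "((\<lambda>x. sin (k * (x - a))) has_real_derivative k * cos (k * (x - a))) (at x)" for x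
          by (auto intro!: derivative_eq_intros)
        show "((\<lambda>x. k * cos (k * (x - a))) has_real_derivative - (k\<^sup>2) * sin (k * (x - a))) (at x)" for x
          by (auto intro!: derivative_eq_intros simp: power2_eq_square)
        fix x assume "?z i < x" "x < ?z (Suc i)"
        moreover have "a \<le> ?z i" using assms n by simp
        moreover have "?z (Suc i) \<le> b"
        proof -
          have "real (Suc i) * (b - a) \<le> real n * (b - a)" using i assms by (intro mult_right_mono) auto
          then have "real (Suc i) * (b - a) / real n \<le> b - a" using n by (simp add: divide_le_eq mult.commute)
          then show ?thesis by simp
        qed
        ultimately have "a < x" "x < b" by linarith+
        then have "x\<^sup>2 \<le> a\<^sup>2 + b\<^sup>2"
        proof (cases "x \<ge> 0")
          case True
          then have "x\<^sup>2 \<le> b\<^sup>2" using \<open>x < b\<close> by (intro power_mono) auto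
          then show ?thesis by (simp add: add_increasing)
        next
          case False
          then have "(- x)\<^sup>2 \<le> (- a)\<^sup>2" using \<open>a < x\<close> by (intro power_mono) auto
          then show ?thesis by (simp add: add_increasing2)
        qed
        then show "x\<^sup>2 - E < - (k\<^sup>2)" by (simp add: E_def)
      qed (use less sin0[of i] sin0[of "Suc i"] cos0[of i] k osc_solutionD[OF shoot_solution] in auto)
    qed
    then obtain F where F: "finite F" "card F = n" "F \<subseteq> {?z 0<..<?z n}" "\<forall>x\<in>F. shoot a E x = 0"
      by blast
    have "{?z 0<..<?z n} \<subseteq> {a<..b}" using n by auto
    with F(3) have "F \<subseteq> {a<..b}" by (rule subset_trans)
    with F show ?thesis unfolding shoot_zeros_def by blast
  qed (unfold shoot_zeros_def, intro exI[of _ 0] exI[of _ "{}"], simp)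
qed

text \<open>Comparison with the constant solution of \<open>v'' = 0\<close>.\<close>

lemma no_zeros_below_potential:
  assumes pot: "\<And>x. a < x \<Longrightarrow> x < b \<Longrightarrow> E < x\<^sup>2"
  shows "\<not> shoot_zeros a b (Suc n) E"
proof
  assume "shoot_zeros a b (Suc n) E"
  then obtain F where F: "card F = Suc n" "F \<subseteq> {a<..b}" "\<forall>x\<in>F. shoot a E x = 0"
    by (auto simp: shoot_zeros_def)
  then obtain c where c: "a < c" "c \<le> b" "shoot a E c = 0" by (metis card.empty ex_in_conv greaterThanAtMost_iff nat.distinct(1) subsetD)
  have "\<exists>x. a < x \<and> x < c \<and> (1::real) = 0"
    by (rule Sturm_comparison[where u = "shoot a E" and u' = "shoot' a E" and v = "\<lambda>_. 1" and v' = "\<lambda>_. 0"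
          and p = "\<lambda>x. x\<^sup>2 - E" and q = "\<lambda>_. 0"])
       (use c pot osc_solutionD[OF shoot_solution] in auto)
  then show False by simp
qed

text \<open>
  The Dirichlet eigenvalues of \<open>- u'' + x\<^sup>2 u\<close> on \<open>[a, b]\<close>, numbered from \<open>0\<close>: the eigenfunction
  number \<open>n\<close> has \<open>n\<close> interior zeros and a further one at \<open>b\<close>.
\<close>

definition dirichlet_ev :: "real \<Rightarrow> real \<Rightarrow> nat \<Rightarrow> real" where
  "dirichlet_ev a b n = Inf {E. shoot_zeros a b (Suc n) E}"

lemma bdd_below_shoot_zeros: "bdd_below {E. shoot_zeros a b (Suc n) E}"
proof (rule bdd_belowI[of _ 0])
  fix E assume "E \<in> {E. shoot_zeros a b (Suc n) E}"
  then show "0 \<le> E" using no_zeros_below_potential[of a b E n] by (force simp: not_le intro: less_le_trans)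
qed

lemma dirichlet_ev_least: "shoot_zeros a b (Suc n) E \<Longrightarrow> dirichlet_ev a b n \<le> E"
  unfolding dirichlet_ev_def by (rule cInf_lower[OF _ bdd_below_shoot_zeros]) simp

lemma dirichlet_ev_zeros:
  assumes "a < b"
  shows "shoot_zeros a b (Suc n) (dirichlet_ev a b n)"
proof -
  have "closed {E. shoot_zeros a b (Suc n) E}"
    unfolding closed_sequential_limits using shoot_zeros_closed[of a b] assms by (auto simp: less_imp_le)
  moreover have "{E. shoot_zeros a b (Suc n) E} \<noteq> {}" using shoot_zeros_exist[OF assms, of "Suc n"] by simp
  ultimately show ?thesis
    using closed_contains_Inf[OF _ bdd_below_shoot_zeros] unfolding dirichlet_ev_def by blast
qed

text \<open>
  One more interior zero would persist at a lower energy, against the minimality of the eigenvalue.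
\<close>

lemma dirichlet_ev_interior_zeros:
  "finite {x\<in>{a<..<b}. shoot a (dirichlet_ev a b n) x = 0}
     \<and> card {x\<in>{a<..<b}. shoot a (dirichlet_ev a b n) x = 0} \<le> n"
proof (rule finite_if_finite_subsets_card_bdd)
  fix G assume G: "G \<subseteq> {x\<in>{a<..<b}. shoot a (dirichlet_ev a b n) x = 0}" "finite G"
  show "card G \<le> n"
  proof (rule ccontr)
    assume "\<not> card G \<le> n"
    then obtain F where F: "F \<subseteq> G" "card F = Suc n" "finite F"
      using obtain_subset_with_card_n[of "Suc n" G] by (metis Suc_leI not_le)
    then obtain E' where "E' < dirichlet_ev a b n" "shoot_zeros a b (Suc n) E'"
      using shoot_zeros_below[OF F(3,2), of a b "dirichlet_ev a b n"] G by blast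
    then show False using dirichlet_ev_least[of a b n E'] by simp
  qed
qed

text \<open>Of the \<open>n + 1\<close> zeros at most \<open>n\<close> lie in the interior.\<close>

lemma dirichlet_ev_boundary:
  assumes "a < b"
  shows "shoot a (dirichlet_ev a b n) b = 0"
proof (rule ccontr)
  assume nz: "shoot a (dirichlet_ev a b n) b \<noteq> 0"
  obtain F where F: "finite F" "card F = Suc n" "F \<subseteq> {a<..b}" "\<forall>x\<in>F. shoot a (dirichlet_ev a b n) x = 0"
    using dirichlet_ev_zeros[OF assms, of n] by (auto simp: shoot_zeros_def)
  have "b \<notin> F" using nz F(4) by blast
  then have "F \<subseteq> {x\<in>{a<..<b}. shoot a (dirichlet_ev a b n) x = 0}"
    using F(3,4) by (auto simp: order.order_iff_strict)
  then have "card F \<le> n" using dirichlet_ev_interior_zeros[of a b n] card_mono le_trans by blast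
  then show False using F(2) by simp
qed

text \<open>
  The next eigenfunction has \<open>n + 1\<close> interior zeros, too many for the eigenvalue number \<open>n\<close>.
\<close>

lemma dirichlet_ev_strict:
  assumes "a < b"
  shows "dirichlet_ev a b n < dirichlet_ev a b (Suc n)"
proof -
  obtain F where F: "finite F" "card F = Suc (Suc n)" "F \<subseteq> {a<..b}"
      "\<forall>x\<in>F. shoot a (dirichlet_ev a b (Suc n)) x = 0"
    using dirichlet_ev_zeros[OF assms, of "Suc n"] by (auto simp: shoot_zeros_def)
  then obtain G where G: "G \<subseteq> F - {b}" "card G = Suc n" "finite G"
    using obtain_subset_with_card_n[of "Suc n" "F - {b}"] card_Diff1_le[of F b]
    by (metis Suc_le_mono card_Diff_singleton_if diff_Suc_1 le_SucI order_refl)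
  have sub: "G \<subseteq> {x\<in>{a<..<b}. shoot a (dirichlet_ev a b (Suc n)) x = 0}"
  proof
    fix x assume "x \<in> G"
    then have x: "x \<in> F" "x \<noteq> b" using G(1) by auto
    then have "x \<in> {a<..b}" using F(3) by blast
    then show "x \<in> {x\<in>{a<..<b}. shoot a (dirichlet_ev a b (Suc n)) x = 0}"
      using x F(4) by simp
  qed
  then have "shoot_zeros a b (Suc n) (dirichlet_ev a b (Suc n))"
    unfolding shoot_zeros_def using G by (intro exI[of _ G]) auto
  then have "dirichlet_ev a b n \<le> dirichlet_ev a b (Suc n)" by (rule dirichlet_ev_least)
  moreover have "dirichlet_ev a b n \<noteq> dirichlet_ev a b (Suc n)"
  proof
    assume "dirichlet_ev a b n = dirichlet_ev a b (Suc n)"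
    then have "G \<subseteq> {x\<in>{a<..<b}. shoot a (dirichlet_ev a b n) x = 0}" using sub by simp
    then have "card G \<le> n" using dirichlet_ev_interior_zeros[of a b n] card_mono le_trans by blast
    then show False using G(2) by simp
  qed
  ultimately show ?thesis by simp
qed

lemma dirichlet_ev_strict_mono: "a < b \<Longrightarrow> strict_mono (dirichlet_ev a b)"
  by (simp add: strict_mono_Suc_iff dirichlet_ev_strict)

lemma dirichlet_ev_gt_potential:
  assumes "a < b" "\<And>x. a < x \<Longrightarrow> x < b \<Longrightarrow> E < x\<^sup>2"
  shows "E < dirichlet_ev a b n"
proof (rule ccontr)
  assume "\<not> E < dirichlet_ev a b n"
  then have "\<not> shoot_zeros a b (Suc n) (dirichlet_ev a b n)"
    using assms(2) by (intro no_zeros_below_potential) (meson le_less_trans not_le)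
  then show False using dirichlet_ev_zeros[OF assms(1)] by blast
qed

section \<open>Comparison with the harmonic oscillator on the line\<close>

text \<open>The Hermite function of degree \<open>n\<close>, up to a constant factor.\<close>

definition hermite_fun :: "nat \<Rightarrow> real \<Rightarrow> real" where
  "hermite_fun n = osc (2 * real n + 1) (if even n then 1 else 0) (if even n then 0 else 1)"

definition hermite_fun' :: "nat \<Rightarrow> real \<Rightarrow> real" where
  "hermite_fun' n = osc' (2 * real n + 1) (if even n then 1 else 0) (if even n then 0 else 1)"

lemma hermite_fun_solution: "osc_solution (2 * real n + 1) (hermite_fun n) (hermite_fun' n)"
  unfolding hermite_fun_def hermite_fun'_def by (rule osc_solution_osc)

text \<open>For \<open>E = 2 n + 1\<close> and initial data of the parity of \<open>n\<close> the Hermite series breaks off.\<close>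

lemma hermite_coeff_terminates:
  fixes n k :: nat
  defines "c \<equiv> hermite_coeff (2 * real n + 1) (if even n then 1 else 0) (if even n then 0 else 1)"
  shows "(even k \<noteq> even n \<longrightarrow> c k = 0) \<and> (n < k \<longrightarrow> c k = 0)"
proof (induction k rule: nat_induct2)
  case (step k)
  show ?case
  proof (intro conjI impI)
    assume "even (Suc (Suc k)) \<noteq> even n"
    then have "c k = 0" using step by simp
    then show "c (Suc (Suc k)) = 0" by (simp add: c_def)
  next
    assume "n < Suc (Suc k)"
    then consider "n < k" | "n = k" | "n = Suc k" by linarith
    then show "c (Suc (Suc k)) = 0"
    proof cases
      case 1
      then show ?thesis using step by (simp add: c_def)
    next
      case 2
      then show ?thesis by (simp add: c_def)
    next
      case 3
      then have "c k = 0" using step by simp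
      then show ?thesis by (simp add: c_def)
    qed
  qed
qed (auto simp: c_def)

definition hermite_poly_coeff :: "nat \<Rightarrow> nat \<Rightarrow> real" where
  "hermite_poly_coeff n = hermite_coeff (2 * real n + 1) (if even n then 1 else 0) (if even n then 0 else 1)"

lemma hermite_fun_eq:
  "hermite_fun n x = exp (- (x\<^sup>2) / 2) * (\<Sum>k\<le>n. hermite_poly_coeff n k * x ^ k)"
proof -
  have "hermite_series (2 * real n + 1) (if even n then 1 else 0) (if even n then 0 else 1) x
      = (\<Sum>k\<le>n. hermite_poly_coeff n k * x ^ k)"
    unfolding hermite_series_def hermite_poly_coeff_def of_real_eq_id id_apply
    by (rule suminf_finite) (use hermite_coeff_terminates[of _ n] in \<open>auto simp: not_le\<close>)
  then show ?thesis by (simp add: hermite_fun_def osc_def)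
qed

lemma hermite_fun_zeros: "finite {x. hermite_fun n x = 0} \<and> card {x. hermite_fun n x = 0} \<le> n"
proof -
  let ?k = "if even n then 0 else 1 :: nat"
  have "hermite_poly_coeff n ?k \<noteq> 0" "?k \<le> n"
    by (auto simp: hermite_poly_coeff_def One_nat_def intro: Suc_leI odd_pos)
  then have "\<exists>k\<le>n. hermite_poly_coeff n k \<noteq> 0" by blast
  from polyfun_rootbound[OF this] show ?thesis
    by (simp add: hermite_fun_eq)
qed

lemma hermite_fun_simple:
  assumes "hermite_fun n x = 0"
  shows "hermite_fun' n x \<noteq> 0"
proof
  assume "hermite_fun' n x = 0"
  then have "hermite_fun n y = 0" for y
    using osc_solution_unique[OF hermite_fun_solution assms] by blast
  then have "{x. hermite_fun n x = 0} = UNIV" by auto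
  then show False using hermite_fun_zeros[of n] infinite_UNIV_char_0[where ?'a = real] by metis
qed

lemma hermite_fun_bounded: "\<exists>M>0. \<forall>x. (hermite_fun n x)\<^sup>2 \<le> M"
proof -
  have mono: "exp (- (x\<^sup>2) / 2) * \<bar>x\<bar> ^ k \<le> fact k * exp (1 / 2)" for x :: real and k
  proof -
    have "(\<Sum>i\<in>{k}. \<bar>x\<bar> ^ i /\<^sub>R fact i) \<le> (\<Sum>i. \<bar>x\<bar> ^ i /\<^sub>R fact i)"
      by (rule sum_le_suminf[OF summable_exp_generic]) auto
    then have "\<bar>x\<bar> ^ k / fact k \<le> exp \<bar>x\<bar>" by (simp add: exp_def divide_inverse mult.commute)
    then have "\<bar>x\<bar> ^ k \<le> fact k * exp \<bar>x\<bar>" by (simp add: divide_le_eq mult.commute)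
    then have "exp (- (x\<^sup>2) / 2) * \<bar>x\<bar> ^ k \<le> exp (- (x\<^sup>2) / 2) * (fact k * exp \<bar>x\<bar>)"
      by (intro mult_left_mono) auto
    also have "\<dots> = fact k * exp (- (x\<^sup>2) / 2 + \<bar>x\<bar>)" by (simp only: exp_add mult_ac)
    also have "\<dots> \<le> fact k * exp (1 / 2)"
    proof -
      have "0 \<le> (\<bar>x\<bar> - 1)\<^sup>2" by simp
      then have "- (x\<^sup>2) / 2 + \<bar>x\<bar> \<le> 1 / 2" by (simp add: power2_diff)
      then show ?thesis by simp
    qed
    finally show ?thesis .
  qed
  define B where "B = (\<Sum>k\<le>n. \<bar>hermite_poly_coeff n k\<bar> * (fact k * exp (1 / 2)))"
  have le: "\<bar>hermite_fun n x\<bar> \<le> B" for x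
  proof -
    have "\<bar>hermite_fun n x\<bar> = \<bar>\<Sum>k\<le>n. hermite_poly_coeff n k * (exp (- (x\<^sup>2) / 2) * x ^ k)\<bar>"
      by (simp add: hermite_fun_eq sum_distrib_left mult.left_commute)
    also have "\<dots> \<le> (\<Sum>k\<le>n. \<bar>hermite_poly_coeff n k * (exp (- (x\<^sup>2) / 2) * x ^ k)\<bar>)" by (rule sum_abs)
    also have "\<dots> \<le> B"
      unfolding B_def abs_mult power_abs abs_exp_cancel
      by (intro sum_mono mult_left_mono mono) auto
    finally show ?thesis .
  qed
  have "(hermite_fun n x)\<^sup>2 \<le> B\<^sup>2 + 1" for x
    using power_mono[OF le[of x], of 2] by simp
  then show ?thesis by (intro exI[of _ "B\<^sup>2 + 1"]) (simp add: add_nonneg_pos)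
qed

text \<open>An eigenfunction below the level \<open>2 n + 1\<close> would force too many zeros on the Hermite function.\<close>

lemma dirichlet_ev_ge:
  assumes "a < b"
  shows "2 * real n + 1 \<le> dirichlet_ev a b n"
proof (rule ccontr)
  assume "\<not> 2 * real n + 1 \<le> dirichlet_ev a b n"
  then obtain F where F: "finite F" "card F = Suc n" "\<forall>x\<in>F. hermite_fun n x = 0"
    using shoot_zeros_increase[OF dirichlet_ev_zeros[OF assms] _ hermite_fun_solution, of n n]
    by (auto simp: not_le)
  then have "card F \<le> card {x. hermite_fun n x = 0}"
    using hermite_fun_zeros[of n] by (intro card_mono) auto
  then show False using F(2) hermite_fun_zeros[of n] by simp
qed

text \<open>
  Let \<open>h > 0\<close> on \<open>(z, \<infinity>)\<close> and let \<open>u\<close> belong to a larger energy.  If \<open>u\<close> stayed positive, the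
  Wronskian \<open>h u' - h' u = h\<^sup>2 (u / h)'\<close> would become negative and decrease from then on; as \<open>h\<close> is
  bounded, \<open>u / h\<close> would fall at least linearly and reach zero at a point that depends on \<open>h\<close> only.
\<close>

lemma half_line_zero:
  assumes h: "osc_solution E0 h h'" and M: "M > 0" "\<And>x. (h x)\<^sup>2 \<le> M"
    and hpos: "\<And>x. z < x \<Longrightarrow> 0 < h x" and less: "E0 < E"
  obtains R where "z < R"
    "\<And>u u'. osc_solution E u u' \<Longrightarrow> h z * u' z - h' z * u z \<le> 0 \<Longrightarrow> \<exists>x. z < x \<and> x < R \<and> u x \<le> 0"
proof -
  define p where "p = z + 1 / 2"
  define a where "a = z + 1"
  have zpa: "z < p" "p < a" "a - p = 1 / 2" by (auto simp: p_def a_def)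
  have ch: "continuous_on S h" for S
    by (intro continuous_at_imp_continuous_on ballI DERIV_isCont[OF osc_solutionD(1)[OF h]])
  obtain w where w: "w \<in> {p..a}" "\<And>x. x \<in> {p..a} \<Longrightarrow> h w \<le> h x"
    using continuous_attains_inf[OF compact_Icc _ ch, of p a] zpa by force
  define m where "m = (h w)\<^sup>2"
  have hw: "h w > 0" using hpos w(1) zpa by auto
  then have m: "m > 0" by (simp add: m_def)
  have m_le: "m \<le> (h x)\<^sup>2" if "x \<in> {p..a}" for x
    unfolding m_def using w(2)[OF that] hw by (intro power_mono) auto
  define \<kappa> where "\<kappa> = (E - E0) * m / 2"
  have \<kappa>: "\<kappa> > 0" using less m by (simp add: \<kappa>_def)
  define R where "R = a + M / \<kappa> + 1"
  have R: "a < R" using M(1) \<kappa> by (simp add: R_def add_pos_pos)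
  show thesis
  proof (rule that[of R])
    show "z < R" using R zpa by simp
    fix u u' assume u: "osc_solution E u u'" and W0: "h z * u' z - h' z * u z \<le> 0"
    show "\<exists>x. z < x \<and> x < R \<and> u x \<le> 0"
    proof (rule ccontr)
      assume "\<not> ?thesis"
      then have upos: "0 < u x" if "z < x" "x < R" for x using that by force
      define W where "W = (\<lambda>x. h x * u' x - h' x * u x)"
      have W': "(W has_real_derivative - ((E - E0) * (h x * u x))) (at x)" for x
        unfolding W_def
        by (auto intro!: derivative_eq_intros osc_solutionD[OF u] osc_solutionD[OF h] simp: algebra_simps)
      have W_dec: "W y < W x" if "z \<le> x" "x < y" "y < R" for x y
      proof (rule DERIV_neg_imp_decreasing_open[OF that(2)])
        fix t assume "x < t" "t < y"
        then have "0 < (E - E0) * (h t * u t)"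
          using hpos[of t] upos[of t] less that by simp
        then show "\<exists>y. (W has_real_derivative y) (at t) \<and> y < 0" using W'[of t] by (intro exI conjI) auto
      qed (intro continuous_at_imp_continuous_on ballI DERIV_isCont[OF W'])
      have W_neg: "W x < 0" if "z < x" "x < R" for x
        using W_dec[of z x] W0 that by (simp add: W_def)
      define r where "r = (\<lambda>x. u x / h x)"
      have r': "(r has_real_derivative W x / (h x)\<^sup>2) (at x)" if "z < x" for x
      proof -
        have "(r has_real_derivative (u' x * h x - u x * h' x) / (h x * h x)) (at x)"
          unfolding r_def using hpos[OF that]
          by (intro DERIV_divide osc_solutionD[OF u] osc_solutionD[OF h]) auto
        then show ?thesis by (simp add: W_def power2_eq_square mult.commute)
      qed
      have r_dec: "r y < r x" if "z < x" "x < y" "y < R" for x y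
      proof (rule DERIV_neg_imp_decreasing[OF that(2)])
        fix t assume t: "x \<le> t" "t \<le> y"
        have "W t / (h t)\<^sup>2 < 0"
          using W_neg[of t] hpos[of t] t that by (intro divide_neg_pos) auto
        then show "\<exists>y. (r has_real_derivative y) (at t) \<and> y < 0" using r'[of t] t that by (intro exI conjI) auto
      qed
      have r_pos: "0 < r x" if "z < x" "x < R" for x using hpos[of x] upos[of x] that by (simp add: r_def)
      \<comment> \<open>on \<open>[p, a]\<close> the ratio is at least \<open>r a\<close>, so the Wronskian loses at least \<open>\<kappa> * r a\<close> there\<close>
      have Wa: "W a \<le> - (\<kappa> * r a)"
      proof -
        obtain \<xi> where \<xi>: "p < \<xi>" "\<xi> < a" "W a - W p = (a - p) * - ((E - E0) * (h \<xi> * u \<xi>))"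
          using MVT2[OF zpa(2), of W "\<lambda>x. - ((E - E0) * (h x * u x))"] W' by blast
        have "r a \<le> r \<xi>" using r_dec[of \<xi> a] \<xi> zpa R by simp
        then have "r a * h \<xi> \<le> u \<xi>" using hpos[of \<xi>] \<xi> zpa by (simp add: r_def pos_le_divide_eq)
        then have "r a * h \<xi> * h \<xi> \<le> u \<xi> * h \<xi>" using hpos[of \<xi>] \<xi> zpa by (intro mult_right_mono) auto
        moreover have "r a * m \<le> r a * (h \<xi>)\<^sup>2"
          using m_le[of \<xi>] r_pos[of a] \<xi> zpa R by (intro mult_left_mono) auto
        ultimately have "r a * m \<le> h \<xi> * u \<xi>" by (simp add: power2_eq_square mult_ac)
        then have "(E - E0) * (r a * m) \<le> (E - E0) * (h \<xi> * u \<xi>)" using less by (intro mult_left_mono) auto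
        moreover have "W p \<le> 0" using W_neg[of p] zpa R by simp
        moreover have "W a = W p - (E - E0) * (h \<xi> * u \<xi>) / 2" using \<xi>(3) zpa(3) by simp
        moreover have "\<kappa> * r a = (E - E0) * (r a * m) / 2" by (simp add: \<kappa>_def)
        ultimately show ?thesis by linarith
      qed
      define x where "x = a + M / \<kappa>"
      have x: "a < x" "x < R" using M(1) \<kappa> by (auto simp: x_def R_def)
      have "\<exists>t. a < t \<and> t < x \<and> r x - r a = (x - a) * (W t / (h t)\<^sup>2)"
        by (rule MVT2[OF x(1)]) (use r' zpa in simp)
      then obtain t where t: "a < t" "t < x" "r x - r a = (x - a) * (W t / (h t)\<^sup>2)" by blast
      have Wt: "W t \<le> - (\<kappa> * r a)" using W_dec[of a t] Wa t x zpa by simp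
      have ht: "0 < (h t)\<^sup>2" using hpos[of t] t zpa by simp
      have \<kappa>r: "0 < \<kappa> * r a" using \<kappa> r_pos[of a] zpa R by simp
      have "W t / (h t)\<^sup>2 \<le> - (\<kappa> * r a) / (h t)\<^sup>2" using Wt ht by (intro divide_right_mono) auto
      also have "\<dots> \<le> - (\<kappa> * r a) / M"
      proof -
        have "\<kappa> * r a / M \<le> \<kappa> * r a / (h t)\<^sup>2" using M ht \<kappa>r by (intro divide_left_mono) auto
        then show ?thesis by simp
      qed
      finally have "(x - a) * (W t / (h t)\<^sup>2) \<le> (x - a) * (- (\<kappa> * r a) / M)"
        using x by (intro mult_left_mono) auto
      also have "\<dots> = - r a" using M(1) \<kappa> by (simp add: x_def)
      finally have "r x \<le> 0" using t(3) by simp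
      then show False using r_pos[of x] x zpa by simp
    qed
  qed
qed

text \<open>Reflection and sign normalisation turn the previous lemma into a two-sided statement.\<close>

lemma half_line_zero_right:
  assumes h: "osc_solution E0 h h'" and M: "M > 0" "\<And>x. (h x)\<^sup>2 \<le> M"
    and hz: "h z = 0" and nz: "\<And>x. z < x \<Longrightarrow> h x \<noteq> 0" and less: "E0 < E"
  obtains R where "z < R" "\<And>u u'. osc_solution E u u' \<Longrightarrow> \<exists>x. z < x \<and> x < R \<and> u x = 0"
proof -
  have ch: "continuous_on S h" for S
    by (intro continuous_at_imp_continuous_on ballI DERIV_isCont[OF osc_solutionD(1)[OF h]])
  obtain s where s: "s \<in> {-1, 1}" "\<And>x. x \<in> {z<..} \<Longrightarrow> 0 < s * h x"
    using connected_nonzero_sign[OF connected_Ioi[of z] ch] nz greaterThan_iff by blast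
  note sh = osc_solution_cmult[OF h, of s]
  have bound: "(s * h x)\<^sup>2 \<le> M" for x using M(2)[of x] s(1) by (auto simp: power_mult_distrib)
  have hp: "0 < s * h x" if "z < x" for x using s(2) that by simp
  obtain R where R: "z < R" "\<And>u u'. osc_solution E u u' \<Longrightarrow> (s * h z) * u' z - (s * h' z) * u z \<le> 0 \<Longrightarrow>
      \<exists>x. z < x \<and> x < R \<and> u x \<le> 0"
    using half_line_zero[OF sh M(1) bound hp less] by blast
  have sh': "0 \<le> s * h' z"
  proof (rule ccontr)
    assume "\<not> 0 \<le> s * h' z"
    then obtain d where d: "d > 0" "\<And>k. 0 < k \<Longrightarrow> k < d \<Longrightarrow> s * h (z + k) < s * h z"
      using DERIV_neg_dec_right[OF osc_solutionD(1)[OF sh, of z]] by (metis not_le)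
    have "s * h (z + d / 2) < 0" using d(2)[of "d / 2"] d(1) hz by simp
    then show False using hp[of "z + d / 2"] d(1) by simp
  qed
  show thesis
  proof (rule that[OF R(1)], rule ccontr)
    fix u u' assume u: "osc_solution E u u'" and no: "\<not> (\<exists>x. z < x \<and> x < R \<and> u x = 0)"
    have cu: "continuous_on S u" for S
      by (intro continuous_at_imp_continuous_on ballI DERIV_isCont[OF osc_solutionD(1)[OF u]])
    obtain t where t: "t \<in> {-1, 1}" "\<And>x. x \<in> {z<..<R} \<Longrightarrow> 0 < t * u x"
      using connected_nonzero_sign[OF connected_Ioo[of z R] cu] no greaterThanLessThan_iff by blast
    have "0 \<le> t * u z"
    proof (rule continuous_ge_on_closure[where S = "{z<..<R}" and f = "\<lambda>x. t * u x"])
      show "continuous_on (closure {z<..<R}) (\<lambda>x. t * u x)" by (intro continuous_intros cu)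
    qed (use R(1) t(2) in \<open>auto simp: less_imp_le\<close>)
    then have "(s * h z) * (t * u' z) - (s * h' z) * (t * u z) \<le> 0" using sh' hz by simp
    from R(2)[OF osc_solution_cmult[OF u] this] obtain x where "z < x" "x < R" "t * u x \<le> 0" by blast
    then show False using t(2)[of x] by simp
  qed
qed

lemma half_line_zero_left:
  assumes h: "osc_solution E0 h h'" and M: "M > 0" "\<And>x. (h x)\<^sup>2 \<le> M"
    and hz: "h z = 0" and nz: "\<And>x. x < z \<Longrightarrow> h x \<noteq> 0" and less: "E0 < E"
  obtains R where "R < z" "\<And>u u'. osc_solution E u u' \<Longrightarrow> \<exists>x. R < x \<and> x < z \<and> u x = 0"
proof -
  obtain R where R: "- z < R" "\<And>u u'. osc_solution E u u' \<Longrightarrow> \<exists>x. - z < x \<and> x < R \<and> u x = 0"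
    by (rule half_line_zero_right[OF osc_solution_reflect[OF h], of M "- z" E])
       (use M hz nz less in auto)
  show thesis
  proof (rule that[of "- R"])
    fix u u' assume "osc_solution E u u'"
    from R(2)[OF osc_solution_reflect[OF this]] obtain x where "- z < x" "x < R" "u (- x) = 0" by blast
    then show "\<exists>x. - R < x \<and> x < z \<and> u x = 0" by (intro exI[of _ "- x"]) auto
  qed (use R(1) in simp)
qed

text \<open>
  For \<open>n = 0\<close> the comparison function \<open>exp (- x\<^sup>2 / 2)\<close> has no zero to start from; the sign of the
  Wronskian at the origin decides on which side the zero of \<open>u\<close> is found.
\<close>

lemma ground_state_zero:
  assumes less: "1 < E"
  obtains R where "R > 0" "\<And>u u'. osc_solution E u u' \<Longrightarrow> \<exists>x. - R < x \<and> x < R \<and> u x = 0"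
proof -
  have h: "osc_solution 1 (hermite_fun 0) (hermite_fun' 0)" using hermite_fun_solution[of 0] by simp
  have pos: "0 < hermite_fun 0 x" for x by (simp add: hermite_fun_eq hermite_poly_coeff_def)
  obtain M where M: "M > 0" "\<And>x. (hermite_fun 0 x)\<^sup>2 \<le> M" using hermite_fun_bounded[of 0] by blast
  obtain R where R: "0 < R" "\<And>u u'. osc_solution E u u' \<Longrightarrow>
      hermite_fun 0 0 * u' 0 - hermite_fun' 0 0 * u 0 \<le> 0 \<Longrightarrow> \<exists>x. 0 < x \<and> x < R \<and> u x \<le> 0"
    by (rule half_line_zero[OF h M pos less, of 0]) blast
  have h0: "hermite_fun 0 0 = 1" "hermite_fun' 0 0 = 0" by (auto simp: hermite_fun_def hermite_fun'_def)
  show thesis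
  proof (rule that[OF R(1)], rule ccontr)
    fix u u' assume u: "osc_solution E u u'" and no: "\<not> (\<exists>x. - R < x \<and> x < R \<and> u x = 0)"
    have cu: "continuous_on S u" for S
      by (intro continuous_at_imp_continuous_on ballI DERIV_isCont[OF osc_solutionD(1)[OF u]])
    obtain t where t: "t \<in> {-1, 1}" "\<And>x. x \<in> {-R<..<R} \<Longrightarrow> 0 < t * u x"
      using connected_nonzero_sign[OF connected_Ioo[of "-R" R] cu] no greaterThanLessThan_iff by blast
    note tu = osc_solution_cmult[OF u, of t]
    show False
    proof (cases "t * u' 0 \<le> 0")
      case True
      then obtain x where "0 < x" "x < R" "t * u x \<le> 0" using R(2)[OF tu] h0 by auto
      then show False using t(2)[of x] by simp
    next
      case False
      then obtain x where "0 < x" "x < R" "t * u (- x) \<le> 0"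
        using R(2)[OF osc_solution_reflect[OF tu]] h0 by auto
      then show False using t(2)[of "- x"] by simp
    qed
  qed
qed

text \<open>
  By Sturm's theorem a solution above the level has a zero in every gap between zeros of the Hermite
  function, and by the half-line lemmas one more on either side, at a distance that does not depend on
  the solution.
\<close>

lemma oscillation_above_level:
  assumes many: "n \<le> card {x. hermite_fun n x = 0}" and less: "2 * real n + 1 < E"
  shows "\<exists>R>0. \<forall>u u'. osc_solution E u u' \<longrightarrow>
      (\<exists>F. finite F \<and> card F = Suc n \<and> F \<subseteq> {-R<..<R} \<and> (\<forall>x\<in>F. u x = 0))"
proof (cases "n = 0")
  case True
  then obtain R where R: "R > 0" "\<And>u u'. osc_solution E u u' \<Longrightarrow> \<exists>x. - R < x \<and> x < R \<and> u x = 0"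
    using ground_state_zero[of E] less by auto
  have "\<exists>F. finite F \<and> card F = Suc n \<and> F \<subseteq> {-R<..<R} \<and> (\<forall>x\<in>F. u x = 0)" if u: "osc_solution E u u'" for u u'
  proof -
    obtain x where "- R < x" "x < R" "u x = 0" using R(2)[OF u] by blast
    then show ?thesis using True by (intro exI[of _ "{x}"]) auto
  qed
  then show ?thesis using R(1) by blast
next
  case False
  let ?h = "hermite_fun n"
  let ?Z = "{x. ?h x = 0}"
  note h = hermite_fun_solution[of n]
  have fin: "finite ?Z" using hermite_fun_zeros by blast
  have ne: "?Z \<noteq> {}"
  proof
    assume "?Z = {}"
    then have "card ?Z = 0" by simp
    then show False using many False by simp
  qed
  define l where "l = Min ?Z"
  define g where "g = Max ?Z"
  have l: "?h l = 0" "\<And>x. x < l \<Longrightarrow> ?h x \<noteq> 0"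
    using Min_in[OF fin ne] Min_le[OF fin] by (auto simp: l_def not_less[symmetric])
  have g: "?h g = 0" "\<And>x. g < x \<Longrightarrow> ?h x \<noteq> 0"
    using Max_in[OF fin ne] Max_ge[OF fin] by (auto simp: g_def not_less[symmetric])
  obtain M where M: "M > 0" "\<And>x. (?h x)\<^sup>2 \<le> M" using hermite_fun_bounded[of n] by blast
  obtain R1 where R1: "g < R1" "\<And>u u'. osc_solution E u u' \<Longrightarrow> \<exists>x. g < x \<and> x < R1 \<and> u x = 0"
    using half_line_zero_right[OF h M g less] by blast
  obtain R2 where R2: "R2 < l" "\<And>u u'. osc_solution E u u' \<Longrightarrow> \<exists>x. R2 < x \<and> x < l \<and> u x = 0"
    using half_line_zero_left[OF h M l less] by blast
  define m where "m = card ?Z - 1"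
  have m: "card ?Z = Suc m" "n \<le> Suc m" using many False by (auto simp: m_def)
  have lZ: "l \<in> ?Z" using l(1) by simp
  have "card (?Z - {l}) = m" using m(1) lZ fin by (simp add: card_Diff_singleton)
  moreover have "?Z - {l} \<subseteq> {l<..}" using l(2) by force
  ultimately obtain z where z: "z 0 = l" "\<forall>i<m. z i < z (Suc i)" "z ` {1..m} = ?Z - {l}"
    using finite_set_chain[of "?Z - {l}" m l] fin by blast
  have zZ: "?h (z i) = 0" if "i \<le> m" for i
  proof (cases "i = 0")
    case False
    then have "z i \<in> z ` {1..m}" using that by auto
    then show ?thesis unfolding z(3) by simp
  qed (use z(1) l(1) in simp)
  have zg: "z m \<le> g" using zZ[of m] Max_ge[OF fin, of "z m"] by (simp add: g_def)
  define R where "R = \<bar>R1\<bar> + \<bar>R2\<bar> + 1"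
  have "\<exists>F. finite F \<and> card F = Suc n \<and> F \<subseteq> {-R<..<R} \<and> (\<forall>x\<in>F. u x = 0)"
    if u: "osc_solution E u u'" for u u'
  proof -
    have "\<exists>F. finite F \<and> card F = m \<and> F \<subseteq> {z 0<..<z m} \<and> (\<forall>x\<in>F. u x = 0)"
      by (rule Sturm_zeros[where n = m and z = z, OF h u less])
         (use z(2) zZ hermite_fun_simple in blast)+
    then obtain F where F: "finite F" "card F = m" "F \<subseteq> {z 0<..<z m}" "\<forall>x\<in>F. u x = 0" by blast
    obtain x where x: "g < x" "x < R1" "u x = 0" using R1(2)[OF u] by blast
    obtain y where y: "R2 < y" "y < l" "u y = 0" using R2(2)[OF u] by blast
    have lg: "l \<le> g" using Max_ge[OF fin lZ] by (simp add: g_def)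
    have bd: "t \<in> {l<..<g}" if "t \<in> F" for t
      using subsetD[OF F(3) that] z(1) zg by simp
    let ?F = "insert x (insert y F)"
    have "x \<notin> F" "y \<notin> F" "x \<noteq> y" using bd[of x] bd[of y] x(1) y(2) lg by auto
    then have "card ?F = Suc (Suc m)" using F(1,2) by simp
    then obtain G where G: "G \<subseteq> ?F" "card G = Suc n" "finite G"
      using obtain_subset_with_card_n[of "Suc n" ?F] m(2) by auto
    have "?F \<subseteq> {-R<..<R}"
    proof
      fix t assume "t \<in> ?F"
      then have "R2 < t \<and> t < R1" using bd[of t] x y lg by auto
      then show "t \<in> {-R<..<R}" by (auto simp: R_def)
    qed
    with G(1) have "G \<subseteq> {-R<..<R}" by (rule subset_trans)
    moreover have "\<forall>t\<in>G. u t = 0" using G(1) F(4) x(3) y(3) by blast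
    ultimately show ?thesis using G(2,3) by blast
  qed
  moreover have "R > 0" by (simp add: R_def)
  ultimately show ?thesis by blast
qed

text \<open>
  Induction on \<open>n\<close>: the next Hermite function is itself a solution above the level number \<open>n\<close>.
\<close>

lemma hermite_fun_many_zeros: "n \<le> card {x. hermite_fun n x = 0}"
proof (induction n)
  case (Suc n)
  have "2 * real n + 1 < 2 * real (Suc n) + 1" by simp
  from oscillation_above_level[OF Suc.IH this] hermite_fun_solution[of "Suc n"]
  obtain F where F: "card F = Suc n" "\<forall>x\<in>F. hermite_fun (Suc n) x = 0" by blast
  then have "F \<subseteq> {x. hermite_fun (Suc n) x = 0}" by auto
  then have "card F \<le> card {x. hermite_fun (Suc n) x = 0}"
    using hermite_fun_zeros by (intro card_mono) auto
  then show ?case using F(1) by simp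
qed simp

text \<open>
  A wide well contains the \<open>n + 1\<close> zeros which every solution above the level has near the origin.
\<close>

lemma dirichlet_ev_le:
  assumes "\<epsilon> > 0"
  shows "\<exists>R>0. \<forall>a b. a \<le> - R \<longrightarrow> R \<le> b \<longrightarrow> dirichlet_ev a b n \<le> 2 * real n + 1 + \<epsilon>"
proof -
  have "2 * real n + 1 < 2 * real n + 1 + \<epsilon>" using assms by simp
  from oscillation_above_level[OF hermite_fun_many_zeros this]
  obtain R where R: "R > 0" "\<And>u u'. osc_solution (2 * real n + 1 + \<epsilon>) u u' \<Longrightarrow>
      (\<exists>F. finite F \<and> card F = Suc n \<and> F \<subseteq> {-R<..<R} \<and> (\<forall>x\<in>F. u x = 0))" by blast
  have "dirichlet_ev a b n \<le> 2 * real n + 1 + \<epsilon>" if ab: "a \<le> - R" "R \<le> b" for a b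
  proof (rule dirichlet_ev_least)
    obtain F where F: "finite F" "card F = Suc n" "F \<subseteq> {-R<..<R}"
        "\<forall>x\<in>F. shoot a (2 * real n + 1 + \<epsilon>) x = 0"
      using R(2)[OF shoot_solution] by blast
    have "{-R<..<R} \<subseteq> {a<..b}" using ab by auto
    with F(3) have "F \<subseteq> {a<..b}" by (rule subset_trans)
    with F show "shoot_zeros a b (Suc n) (2 * real n + 1 + \<epsilon>)" unfolding shoot_zeros_def by blast
  qed
  then show ?thesis using R(1) by blast
qed

section \<open>Completeness of the Dirichlet eigenfunctions\<close>

text \<open>The \<open>C\<^sup>1\<close> part of the form domain of the Dirichlet problem; the derivative is carried along.\<close>

definition dirichlet_fun :: "real \<Rightarrow> real \<Rightarrow> (real \<Rightarrow> real) \<Rightarrow> (real \<Rightarrow> real) \<Rightarrow> bool" where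
  "dirichlet_fun a b f f' \<longleftrightarrow>
     (\<forall>x. (f has_real_derivative f' x) (at x)) \<and> continuous_on UNIV f' \<and> f a = 0 \<and> f b = 0"

text \<open>The quadratic form of \<open>- u'' + (x\<^sup>2 - E) u\<close>.\<close>

definition energy_form ::
  "real \<Rightarrow> real \<Rightarrow> real \<Rightarrow> (real \<Rightarrow> real) \<Rightarrow> (real \<Rightarrow> real) \<Rightarrow> (real \<Rightarrow> real) \<Rightarrow> (real \<Rightarrow> real) \<Rightarrow> real" where
  "energy_form a b E f f' g g' = integral {a..b} (\<lambda>x. f' x * g' x + (x\<^sup>2 - E) * (f x * g x))"

lemma dirichlet_funD:
  assumes "dirichlet_fun a b f f'"
  shows "(f has_real_derivative f' x) (at x)" "continuous_on S f" "continuous_on S f'" "f a = 0" "f b = 0"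
proof -
  have d: "(f has_real_derivative f' x) (at x)" for x using assms by (simp add: dirichlet_fun_def)
  show "(f has_real_derivative f' x) (at x)" by (rule d)
  show "continuous_on S f" by (intro continuous_at_imp_continuous_on ballI DERIV_isCont[OF d])
  show "continuous_on S f'" using assms continuous_on_subset by (auto simp: dirichlet_fun_def)
qed (use assms in \<open>auto simp: dirichlet_fun_def\<close>)

lemma dirichlet_fun_sum:
  assumes "\<And>j. j \<in> J \<Longrightarrow> dirichlet_fun a b (w j) (w' j)"
  shows "dirichlet_fun a b (\<lambda>x. \<Sum>j\<in>J. c j * w j x) (\<lambda>x. \<Sum>j\<in>J. c j * w' j x)"
  unfolding dirichlet_fun_def
proof (intro conjI allI)
  show "((\<lambda>x. \<Sum>j\<in>J. c j * w j x) has_real_derivative (\<Sum>j\<in>J. c j * w' j x)) (at x)" for x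
    by (intro DERIV_sum DERIV_cmult dirichlet_funD(1)[OF assms])
  show "continuous_on UNIV (\<lambda>x. \<Sum>j\<in>J. c j * w' j x)"
    by (intro continuous_intros dirichlet_funD(3)[OF assms])
qed (use dirichlet_funD(4,5)[OF assms] in auto)

lemma dirichlet_fun_shoot:
  assumes "a < b"
  shows "dirichlet_fun a b (shoot a (dirichlet_ev a b n)) (shoot' a (dirichlet_ev a b n))"
  unfolding dirichlet_fun_def
  using shoot_deriv[where ?'a = real] dirichlet_ev_boundary[OF assms]
    DERIV_isCont[OF shoot'_deriv[where ?'a = real]]
  by (simp add: continuous_at_imp_continuous_on)

lemma energy_form_integrable:
  assumes "dirichlet_fun a b f f'" "dirichlet_fun a b g g'"
  shows "(\<lambda>x. f' x * g' x + (x\<^sup>2 - E) * (f x * g x)) integrable_on {a..b}"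
  by (intro integrable_continuous_interval continuous_intros dirichlet_funD(2,3)[OF assms(1)]
      dirichlet_funD(2,3)[OF assms(2)])

lemma energy_form_commute: "energy_form a b E f f' g g' = energy_form a b E g g' f f'"
  by (simp add: energy_form_def mult.commute)

lemma energy_form_sum_left:
  assumes "\<And>j. j \<in> J \<Longrightarrow> dirichlet_fun a b (w j) (w' j)" "dirichlet_fun a b g g'" "finite J"
  shows "energy_form a b E (\<lambda>x. \<Sum>j\<in>J. c j * w j x) (\<lambda>x. \<Sum>j\<in>J. c j * w' j x) g g'
      = (\<Sum>j\<in>J. c j * energy_form a b E (w j) (w' j) g g')"
proof -
  have "(\<lambda>x. (\<Sum>j\<in>J. c j * w' j x) * g' x + (x\<^sup>2 - E) * ((\<Sum>j\<in>J. c j * w j x) * g x))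
      = (\<lambda>x. \<Sum>j\<in>J. c j * (w' j x * g' x + (x\<^sup>2 - E) * (w j x * g x)))"
    unfolding sum_distrib_left sum_distrib_right sum.distrib[symmetric]
    by (intro ext sum.cong) (auto simp: algebra_simps)
  then have "energy_form a b E (\<lambda>x. \<Sum>j\<in>J. c j * w j x) (\<lambda>x. \<Sum>j\<in>J. c j * w' j x) g g'
      = (\<Sum>j\<in>J. integral {a..b} (\<lambda>x. c j * (w' j x * g' x + (x\<^sup>2 - E) * (w j x * g x))))"
    unfolding energy_form_def
    using integral_sum[OF assms(3), of "\<lambda>j x. c j * (w' j x * g' x + (x\<^sup>2 - E) * (w j x * g x))" "{a..b}"]
      integrable_on_mult_right[OF energy_form_integrable[OF assms(1,2)]] by simp
  then show ?thesis by (simp add: energy_form_def)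
qed

lemma energy_form_diagonal:
  fixes c :: "'j \<Rightarrow> real"
  assumes w: "\<And>j. j \<in> J \<Longrightarrow> dirichlet_fun a b (w j) (w' j)" and "finite J"
    and orth: "\<And>i j. i \<in> J \<Longrightarrow> j \<in> J \<Longrightarrow> i \<noteq> j \<Longrightarrow> energy_form a b E (w i) (w' i) (w j) (w' j) = 0"
  defines "g \<equiv> \<lambda>x. \<Sum>j\<in>J. c j * w j x" and "g' \<equiv> \<lambda>x. \<Sum>j\<in>J. c j * w' j x"
  shows "energy_form a b E g g' g g' = (\<Sum>j\<in>J. (c j)\<^sup>2 * energy_form a b E (w j) (w' j) (w j) (w' j))"
proof -
  have g: "dirichlet_fun a b g g'" unfolding g_def g'_def by (rule dirichlet_fun_sum[OF w])
  have "energy_form a b E (w j) (w' j) g g' = c j * energy_form a b E (w j) (w' j) (w j) (w' j)"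
    if j: "j \<in> J" for j
  proof -
    have "energy_form a b E (w j) (w' j) g g' = energy_form a b E g g' (w j) (w' j)"
      by (rule energy_form_commute)
    also have "\<dots> = (\<Sum>i\<in>J. c i * energy_form a b E (w i) (w' i) (w j) (w' j))"
      unfolding g_def g'_def by (rule energy_form_sum_left[OF w w[OF j] assms(2)])
    also have "\<dots> = (\<Sum>i\<in>J. if i = j then c j * energy_form a b E (w j) (w' j) (w j) (w' j) else 0)"
      using orth j by (intro sum.cong) auto
    finally show ?thesis using j assms(2) by simp
  qed
  moreover have "energy_form a b E g g' g g' = (\<Sum>j\<in>J. c j * energy_form a b E (w j) (w' j) g g')"
    using energy_form_sum_left[OF w g assms(2), where c = c and E = E] unfolding g_def g'_def by simp
  ultimately show ?thesis by (simp add: power2_eq_square mult.assoc)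
qed

text \<open>Integration by parts against an eigenfunction.\<close>

lemma energy_form_solution:
  assumes f: "dirichlet_fun a b f f'" and u: "osc_solution E u u'" and "a \<le> b"
  shows "energy_form a b E' f f' u u' = (E - E') * integral {a..b} (\<lambda>x. f x * u x)"
proof -
  have cu: "continuous_on S u" for S
    by (intro continuous_at_imp_continuous_on ballI DERIV_isCont[OF osc_solutionD(1)[OF u]])
  have cu': "continuous_on S u'" for S
    by (intro continuous_at_imp_continuous_on ballI DERIV_isCont[OF osc_solutionD(2)[OF u]])
  have "((\<lambda>x. f' x * u' x + f x * ((x\<^sup>2 - E) * u x)) has_integral f b * u' b - f a * u' a) {a..b}"
  proof (rule fundamental_theorem_of_calculus[OF \<open>a \<le> b\<close>])
    fix x
    have "((\<lambda>x. f x * u' x) has_real_derivative f' x * u' x + f x * ((x\<^sup>2 - E) * u x)) (at x)"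
      using DERIV_mult[OF dirichlet_funD(1)[OF f] osc_solutionD(2)[OF u]] by (simp add: mult.commute)
    then show "((\<lambda>x. f x * u' x) has_vector_derivative f' x * u' x + f x * ((x\<^sup>2 - E) * u x)) (at x within {a..b})"
      using has_real_derivative_iff_has_vector_derivative has_vector_derivative_at_within by blast
  qed
  then have 1: "((\<lambda>x. f' x * u' x + f x * ((x\<^sup>2 - E) * u x)) has_integral 0) {a..b}"
    using dirichlet_funD(4,5)[OF f] by simp
  have "(\<lambda>x. f x * u x) integrable_on {a..b}"
    by (intro integrable_continuous_interval continuous_intros cu dirichlet_funD(2)[OF f])
  then have 2: "((\<lambda>x. (E - E') * (f x * u x)) has_integral (E - E') * integral {a..b} (\<lambda>x. f x * u x)) {a..b}"
    by (intro has_integral_mult_right integrable_integral)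
  have "(\<lambda>x. f' x * u' x + f x * ((x\<^sup>2 - E) * u x) + (E - E') * (f x * u x))
      = (\<lambda>x. f' x * u' x + (x\<^sup>2 - E') * (f x * u x))"
    by (simp add: algebra_simps)
  with has_integral_add[OF 1 2] show ?thesis
    unfolding energy_form_def by (simp add: integral_unique)
qed

text \<open>
  Picone's identity: where \<open>u \<noteq> 0\<close>, the derivative of \<open>g\<^sup>2 u' / u\<close> is
  \<open>g'\<^sup>2 + (x\<^sup>2 - E) g\<^sup>2 - (g' - g u' / u)\<^sup>2\<close>; at a common zero \<open>g\<^sup>2 u' / u\<close> extends continuously by \<open>0\<close>,
  which is also its value as the quotient by \<open>0\<close>.
\<close>

lemma energy_form_nonneg_of_zeros:
  assumes g: "dirichlet_fun a b g g'" and u: "osc_solution E u u'" and "a \<le> b"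
    and fin: "finite {x\<in>{a..b}. u x = 0}"
    and simple: "\<And>x. u x = 0 \<Longrightarrow> u' x \<noteq> 0"
    and zeros: "\<And>x. x \<in> {a..b} \<Longrightarrow> u x = 0 \<Longrightarrow> g x = 0"
  shows "0 \<le> energy_form a b E g g' g g'"
proof -
  define \<Phi> where "\<Phi> = (\<lambda>x. (g x)\<^sup>2 * u' x / u x)"
  define r where "r = (\<lambda>x. (g' x - g x * u' x / u x)\<^sup>2)"
  let ?k = "\<lambda>x. g' x * g' x + (x\<^sup>2 - E) * (g x * g x)"
  let ?S = "{x\<in>{a..b}. u x = 0}"
  note du = osc_solutionD[OF u] and dg = dirichlet_funD(1)[OF g]
  have deriv: "(\<Phi> has_real_derivative ?k x - r x) (at x)" if "u x \<noteq> 0" for x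
  proof -
    have "(\<Phi> has_real_derivative ((2 * g x * g' x * u' x + (g x)\<^sup>2 * ((x\<^sup>2 - E) * u x)) * u x
        - (g x)\<^sup>2 * u' x * u' x) / (u x * u x)) (at x)"
      unfolding \<Phi>_def using that
      by (auto intro!: derivative_eq_intros du dg simp: algebra_simps)
    also have "((2 * g x * g' x * u' x + (g x)\<^sup>2 * ((x\<^sup>2 - E) * u x)) * u x
        - (g x)\<^sup>2 * u' x * u' x) / (u x * u x) = ?k x - r x"
      unfolding r_def using that by (simp add: field_simps power2_eq_square)
    finally show ?thesis .
  qed
  have cont: "isCont \<Phi> x" if "x \<in> {a..b}" for x
  proof (cases "u x = 0")
    case False
    then show ?thesis using deriv DERIV_isCont by blast
  next
    case True
    have gx: "g x = 0" using zeros[OF that True] .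
    have 1: "((\<lambda>y. g y / (y - x)) \<longlongrightarrow> g' x) (at x)"
      using dg[of x] gx by (simp add: has_field_derivative_iff)
    have 2: "((\<lambda>y. u y / (y - x)) \<longlongrightarrow> u' x) (at x)"
      using du(1)[of x] True by (simp add: has_field_derivative_iff)
    have 3: "(u' \<longlongrightarrow> u' x) (at x)" using DERIV_isCont[OF du(2)] by (simp add: isCont_def)
    have "((\<lambda>y. (y - x) * (g y / (y - x))\<^sup>2 * u' y / (u y / (y - x))) \<longlongrightarrow> (x - x) * (g' x)\<^sup>2 * u' x / u' x) (at x)"
      by (intro tendsto_intros 1 2 3 simple[OF True])
    then have "((\<lambda>y. (y - x) * (g y / (y - x))\<^sup>2 * u' y / (u y / (y - x))) \<longlongrightarrow> 0) (at x)" by simp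
    moreover have "\<forall>\<^sub>F y in at x. (y - x) * (g y / (y - x))\<^sup>2 * u' y / (u y / (y - x)) = \<Phi> y"
      unfolding \<Phi>_def by (auto simp: eventually_at_filter power2_eq_square)
    ultimately have "(\<Phi> \<longlongrightarrow> 0) (at x)" by (rule Lim_transform_eventually)
    then show ?thesis using True by (simp add: isCont_def \<Phi>_def)
  qed
  have "((\<lambda>x. ?k x - r x) has_integral (\<Phi> b - \<Phi> a)) {a..b}"
  proof (rule fundamental_theorem_of_calculus_strong[OF fin \<open>a \<le> b\<close>])
    show "(\<Phi> has_vector_derivative ?k x - r x) (at x)" if "x \<in> {a..b} - ?S" for x
      using deriv[of x] that has_real_derivative_iff_has_vector_derivative by auto
    show "continuous_on {a..b} \<Phi>" using cont by (simp add: continuous_at_imp_continuous_on)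
  qed
  then have 1: "((\<lambda>x. ?k x - r x) has_integral 0) {a..b}"
    using dirichlet_funD(4,5)[OF g] by (simp add: \<Phi>_def)
  have 2: "(?k has_integral energy_form a b E g g' g g') {a..b}"
    unfolding energy_form_def by (intro integrable_integral energy_form_integrable g)
  have "(r has_integral energy_form a b E g g' g g') {a..b}"
    using has_integral_diff[OF 2 1] by simp
  then show ?thesis by (rule has_integral_nonneg) (simp add: r_def)
qed

lemma dirichlet_ev_zeros_finite:
  "finite {x\<in>{a..b}. shoot a (dirichlet_ev a b n) x = 0}"
proof -
  have "{x\<in>{a..b}. shoot a (dirichlet_ev a b n) x = 0}
      \<subseteq> {a, b} \<union> {x\<in>{a<..<b}. shoot a (dirichlet_ev a b n) x = 0}" by auto
  then show ?thesis using dirichlet_ev_interior_zeros[of a b n] by (meson finite.simps finite_UnI finite_subset)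
qed

abbreviation shoot_inner :: "real \<Rightarrow> real \<Rightarrow> (real \<Rightarrow> real) \<Rightarrow> nat \<Rightarrow> real" where
  "shoot_inner a b f k \<equiv> integral {a..b} (\<lambda>x. f x * shoot a (dirichlet_ev a b k) x)"

lemma shoot_orthogonal:
  assumes "a < b" "i \<noteq> j"
  shows "shoot_inner a b (shoot a (dirichlet_ev a b i)) j = 0"
proof -
  let ?\<mu> = "dirichlet_ev a b"
  have "energy_form a b (?\<mu> i) (shoot a (?\<mu> i)) (shoot' a (?\<mu> i)) (shoot a (?\<mu> j)) (shoot' a (?\<mu> j))
      = (?\<mu> j - ?\<mu> i) * shoot_inner a b (shoot a (?\<mu> i)) j"
    by (rule energy_form_solution[OF dirichlet_fun_shoot[OF assms(1)] shoot_solution]) (use assms in simp)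
  moreover have "energy_form a b (?\<mu> i) (shoot a (?\<mu> j)) (shoot' a (?\<mu> j)) (shoot a (?\<mu> i)) (shoot' a (?\<mu> i)) = 0"
    using energy_form_solution[OF dirichlet_fun_shoot[OF assms(1)] shoot_solution] assms by simp
  moreover have "?\<mu> j \<noteq> ?\<mu> i"
    using strict_mono_eq[OF dirichlet_ev_strict_mono[OF assms(1)]] assms(2) by simp
  ultimately show ?thesis
    using energy_form_commute[of a b "?\<mu> i" "shoot a (?\<mu> i)" "shoot' a (?\<mu> i)"] by simp
qed

lemma shoot_norm_pos:
  assumes "a < b"
  shows "0 < shoot_inner a b (shoot a (dirichlet_ev a b k)) k"
proof -
  let ?u = "shoot a (dirichlet_ev a b k) :: real \<Rightarrow> real"
  have c: "continuous_on {a..b} (\<lambda>x. ?u x * ?u x)"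
    by (intro continuous_intros dirichlet_funD(2)[OF dirichlet_fun_shoot[OF assms]])
  have "0 \<le> shoot_inner a b ?u k"
    by (intro integral_nonneg integrable_continuous_interval c) simp
  moreover have "shoot_inner a b ?u k \<noteq> 0"
  proof
    assume "shoot_inner a b ?u k = 0"
    then have "\<forall>x\<in>{a..b}. ?u x * ?u x = 0"
      using integral_eq_0_iff[OF c assms] by simp
    then have "{x\<in>{a..b}. ?u x = 0} = {a..b}" by auto
    then show False using dirichlet_ev_zeros_finite[of a b k] assms infinite_Icc by metis
  qed
  ultimately show ?thesis by simp
qed

text \<open>
  The variational principle: a combination of \<open>f\<close> and the first \<open>n\<close> eigenfunctions can be made to
  vanish at the at most \<open>n\<close> zeros of the next eigenfunction, where Picone's identity applies, and the
  eigenfunctions themselves contribute non-positively.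
\<close>

lemma energy_form_nonneg_of_orthogonal:
  assumes "a < b" and f: "dirichlet_fun a b f f'" and orth: "\<And>k. k < n \<Longrightarrow> shoot_inner a b f k = 0"
  shows "0 \<le> energy_form a b (dirichlet_ev a b n) f f' f f'"
proof -
  let ?\<mu> = "dirichlet_ev a b"
  let ?Z = "{x\<in>{a<..<b}. shoot a (?\<mu> n) x = 0}"
  define w where "w = (\<lambda>j. if j < n then shoot a (?\<mu> j) else f)"
  define w' where "w' = (\<lambda>j. if j < n then shoot' a (?\<mu> j) else f')"
  have w: "dirichlet_fun a b (w j) (w' j)" for j
    using f dirichlet_fun_shoot[OF assms(1)] by (simp add: w_def w'_def)
  have Z: "finite ?Z" "card ?Z < card {..n}" using dirichlet_ev_interior_zeros[of a b n] by auto
  obtain c where c: "\<exists>j\<in>{..n}. c j \<noteq> 0" "\<forall>x\<in>?Z. (\<Sum>j\<in>{..n}. w j x * c j) = 0"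
    using homogeneous_system_nontrivial[OF Z(1) _ Z(2), of "\<lambda>x j. w j x"] by auto
  define g where "g = (\<lambda>x. \<Sum>j\<in>{..n}. c j * w j x)"
  define g' where "g' = (\<lambda>x. \<Sum>j\<in>{..n}. c j * w' j x)"
  have g: "dirichlet_fun a b g g'" unfolding g_def g'_def by (rule dirichlet_fun_sum[OF w])
  have form_u: "energy_form a b (?\<mu> n) v v' (w j) (w' j) = (?\<mu> j - ?\<mu> n) * shoot_inner a b v j"
    if "dirichlet_fun a b v v'" "j < n" for v v' j
    using energy_form_solution[OF that(1) shoot_solution] assms(1) that(2) by (simp add: w_def w'_def)
  have w_orth: "shoot_inner a b (w i) j = 0" if "i \<noteq> j" "j < n" for i j
    using shoot_orthogonal[OF assms(1) that(1)] orth[OF that(2)] by (simp add: w_def)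
  have "energy_form a b (?\<mu> n) (w i) (w' i) (w j) (w' j) = 0" if "i \<in> {..n}" "j \<in> {..n}" "i \<noteq> j" for i j
  proof (cases "j < n")
    case True
    then show ?thesis using form_u[OF w] w_orth[of i j] that by simp
  next
    case False
    then have "i < n" using that by simp
    then show ?thesis using form_u[OF w] w_orth[of j i] that
      by (subst energy_form_commute) simp
  qed
  then have expand: "energy_form a b (?\<mu> n) g g' g g'
      = (\<Sum>j\<in>{..n}. (c j)\<^sup>2 * energy_form a b (?\<mu> n) (w j) (w' j) (w j) (w' j))"
    unfolding g_def g'_def by (intro energy_form_diagonal w) auto
  have neg: "energy_form a b (?\<mu> n) (w j) (w' j) (w j) (w' j) < 0" if "j < n" for j
  proof -
    have "?\<mu> j < ?\<mu> n" using dirichlet_ev_strict_mono[OF assms(1)] that by (simp add: strict_mono_less)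
    moreover have "0 < shoot_inner a b (w j) j" using shoot_norm_pos[OF assms(1)] that by (simp add: w_def)
    ultimately show ?thesis using form_u[OF w that, of j] by (simp add: mult_neg_pos)
  qed
  have "0 \<le> energy_form a b (?\<mu> n) g g' g g'"
  proof (rule energy_form_nonneg_of_zeros[OF g shoot_solution])
    fix x assume x: "x \<in> {a..b}" "shoot a (?\<mu> n) x = 0"
    show "g x = 0"
    proof (cases "x = a \<or> x = b")
      case True
      then show ?thesis using dirichlet_funD(4,5)[OF g] by auto
    next
      case False
      then have "x \<in> ?Z" using x by auto
      then show ?thesis using c(2) by (simp add: g_def mult.commute)
    qed
  qed (use assms(1) dirichlet_ev_zeros_finite shoot_simple_zero in auto)
  then have pos: "0 \<le> (\<Sum>j<n. (c j)\<^sup>2 * energy_form a b (?\<mu> n) (w j) (w' j) (w j) (w' j))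
      + (c n)\<^sup>2 * energy_form a b (?\<mu> n) f f' f f'"
    unfolding expand by (simp add: lessThan_Suc_atMost[symmetric] w_def w'_def)
  have le0: "(\<Sum>j<n. (c j)\<^sup>2 * energy_form a b (?\<mu> n) (w j) (w' j) (w j) (w' j)) \<le> 0"
    using neg by (intro sum_nonpos mult_nonneg_nonpos) (auto simp: less_imp_le)
  have "c n \<noteq> 0"
  proof
    assume cn: "c n = 0"
    then obtain j where j: "j < n" "c j \<noteq> 0" using c(1) by (metis atMost_iff le_neq_implies_less)
    have "(\<Sum>j<n. (c j)\<^sup>2 * energy_form a b (?\<mu> n) (w j) (w' j) (w j) (w' j)) < (\<Sum>j<n. 0)"
    proof (rule sum_strict_mono_ex1)
      show "\<forall>j\<in>{..<n}. (c j)\<^sup>2 * energy_form a b (?\<mu> n) (w j) (w' j) (w j) (w' j) \<le> 0"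
        using neg by (auto intro!: mult_nonneg_nonpos simp: less_imp_le)
      show "\<exists>j\<in>{..<n}. (c j)\<^sup>2 * energy_form a b (?\<mu> n) (w j) (w' j) (w j) (w' j) < 0"
        using neg[OF j(1)] j by (intro bexI[of _ j]) (auto intro!: mult_pos_neg)
    qed simp
    then show False using pos cn by simp
  qed
  then have "0 < (c n)\<^sup>2" by simp
  moreover have "0 \<le> (c n)\<^sup>2 * energy_form a b (?\<mu> n) f f' f f'" using pos le0 by linarith
  ultimately show ?thesis by (simp add: zero_le_mult_iff)
qed

text \<open>
  The remainder \<open>h\<close> of the eigenfunction expansion is orthogonal to the first \<open>n\<close> eigenfunctions, so that
  its energy is at least the \<open>n\<close>-th eigenvalue times its squared norm.  Its energy is also at most that of \<open>f\<close>,
  while the eigenvalues grow without bound.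
\<close>

lemma shoot_complete:
  assumes "a < b" and f: "dirichlet_fun a b f f'" and "\<epsilon> > 0"
  shows "\<exists>n c. integral {a..b} (\<lambda>x. (f x - (\<Sum>k<n. c k * shoot a (dirichlet_ev a b k) x))\<^sup>2) < \<epsilon>"
proof -
  let ?\<mu> = "dirichlet_ev a b"
  let ?u = "\<lambda>k. shoot a (?\<mu> k) :: real \<Rightarrow> real"
  let ?u' = "\<lambda>k. shoot' a (?\<mu> k) :: real \<Rightarrow> real"
  define c where "c = (\<lambda>k. shoot_inner a b f k / shoot_inner a b (?u k) k)"
  define K where "K = energy_form a b 0 f f' f f'"
  have bound: "(2 * real n + 1) * integral {a..b} (\<lambda>x. (f x - (\<Sum>k<n. c k * ?u k x))\<^sup>2) \<le> K" for n
  proof -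
    define h where "h = (\<lambda>x. f x - (\<Sum>k<n. c k * ?u k x))"
    define h' where "h' = (\<lambda>x. f' x - (\<Sum>k<n. c k * ?u' k x))"
    define w where "w = (\<lambda>j. if j < n then ?u j else h)"
    define w' where "w' = (\<lambda>j. if j < n then ?u' j else h')"
    define d where "d = (\<lambda>j. if j < n then c j else 1)"
    have sum_u: "dirichlet_fun a b (\<lambda>x. \<Sum>k<n. c k * ?u k x) (\<lambda>x. \<Sum>k<n. c k * ?u' k x)"
      by (rule dirichlet_fun_sum[OF dirichlet_fun_shoot[OF assms(1)]])
    have h: "dirichlet_fun a b h h'"
      unfolding dirichlet_fun_def h_def h'_def
      by (intro conjI allI DERIV_diff dirichlet_funD(1)[OF f] dirichlet_funD(1)[OF sum_u]
            continuous_on_diff dirichlet_funD(3)[OF f] dirichlet_funD(3)[OF sum_u])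
         (use dirichlet_funD(4,5)[OF f] dirichlet_funD(4,5)[OF sum_u] in simp_all)
    have w: "dirichlet_fun a b (w j) (w' j)" for j
      using h dirichlet_fun_shoot[OF assms(1)] by (simp add: w_def w'_def)
    have form_u: "energy_form a b 0 v v' (?u j) (?u' j) = ?\<mu> j * shoot_inner a b v j"
      if "dirichlet_fun a b v v'" for v v' j
      using energy_form_solution[OF that shoot_solution] assms(1) by simp
    have h_orth: "shoot_inner a b h j = 0" if j: "j < n" for j
    proof -
      have i1: "(\<lambda>x. f x * ?u j x) integrable_on {a..b}"
        by (intro integrable_continuous_interval continuous_intros dirichlet_funD(2)[OF f]
            dirichlet_funD(2)[OF dirichlet_fun_shoot[OF assms(1)]])
      have i2: "(\<lambda>x. c k * (?u k x * ?u j x)) integrable_on {a..b}" for k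
        by (intro integrable_continuous_interval continuous_intros
            dirichlet_funD(2)[OF dirichlet_fun_shoot[OF assms(1)]])
      have "(\<lambda>x. h x * ?u j x) = (\<lambda>x. f x * ?u j x - (\<Sum>k<n. c k * (?u k x * ?u j x)))"
        by (simp add: h_def left_diff_distrib sum_distrib_right mult.assoc)
      then have "shoot_inner a b h j = shoot_inner a b f j - (\<Sum>k<n. c k * shoot_inner a b (?u k) j)"
        using integral_diff[OF i1 integrable_sum[OF finite_lessThan i2]]
          integral_sum[OF finite_lessThan i2] by simp
      also have "(\<Sum>k<n. c k * shoot_inner a b (?u k) j) = (\<Sum>k<n. if k = j then c j * shoot_inner a b (?u j) j else 0)"
        using shoot_orthogonal[OF assms(1)] by (intro sum.cong) auto
      also have "\<dots> = shoot_inner a b f j"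
        using j shoot_norm_pos[OF assms(1), of j] by (simp add: c_def)
      finally show ?thesis by simp
    qed
    have "energy_form a b 0 (w i) (w' i) (w j) (w' j) = 0" if "i \<in> {..n}" "j \<in> {..n}" "i \<noteq> j" for i j
    proof -
      have *: "energy_form a b 0 (w i) (w' i) (w j) (w' j) = 0" if "j < n" "i \<noteq> j" for i j
        using form_u[OF w, of i j] that h_orth[of j] shoot_orthogonal[OF assms(1), of i j]
        by (simp add: w_def w'_def)
      show ?thesis
      proof (cases "j < n")
        case False
        then have "i < n" using that by simp
        then show ?thesis using *[of i j] that by (subst energy_form_commute) simp
      qed (use * that in simp)
    qed
    then have "energy_form a b 0 (\<lambda>x. \<Sum>j\<in>{..n}. d j * w j x) (\<lambda>x. \<Sum>j\<in>{..n}. d j * w' j x)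
        (\<lambda>x. \<Sum>j\<in>{..n}. d j * w j x) (\<lambda>x. \<Sum>j\<in>{..n}. d j * w' j x)
        = (\<Sum>j\<in>{..n}. (d j)\<^sup>2 * energy_form a b 0 (w j) (w' j) (w j) (w' j))"
      by (intro energy_form_diagonal w) auto
    moreover have "(\<lambda>x. \<Sum>j\<in>{..n}. d j * w j x) = f" "(\<lambda>x. \<Sum>j\<in>{..n}. d j * w' j x) = f'"
      by (auto simp: lessThan_Suc_atMost[symmetric] d_def w_def w'_def h_def h'_def)
    ultimately have "K = (\<Sum>j\<in>{..n}. (d j)\<^sup>2 * energy_form a b 0 (w j) (w' j) (w j) (w' j))"
      by (simp add: K_def)
    also have "\<dots> = (\<Sum>j<n. (c j)\<^sup>2 * (?\<mu> j * shoot_inner a b (?u j) j)) + energy_form a b 0 h h' h h'"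
      using form_u[OF dirichlet_fun_shoot[OF assms(1)]]
      by (simp add: lessThan_Suc_atMost[symmetric] d_def w_def w'_def)
    finally have K: "K = (\<Sum>j<n. (c j)\<^sup>2 * (?\<mu> j * shoot_inner a b (?u j) j)) + energy_form a b 0 h h' h h'" .
    have \<mu>_pos: "0 < ?\<mu> j" for j using dirichlet_ev_ge[OF assms(1), of j] by simp
    have "0 \<le> (\<Sum>j<n. (c j)\<^sup>2 * (?\<mu> j * shoot_inner a b (?u j) j))"
      using \<mu>_pos shoot_norm_pos[OF assms(1)] by (intro sum_nonneg mult_nonneg_nonneg) (auto simp: less_imp_le)
    then have "energy_form a b 0 h h' h h' \<le> K" using K by simp
    moreover have "0 \<le> energy_form a b (?\<mu> n) h h' h h'"
      by (rule energy_form_nonneg_of_orthogonal[OF assms(1) h h_orth])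
    moreover have ih: "(\<lambda>x. (h x)\<^sup>2) integrable_on {a..b}"
      by (intro integrable_continuous_interval continuous_intros dirichlet_funD(2)[OF h])
    have "energy_form a b (?\<mu> n) h h' h h' = energy_form a b 0 h h' h h' - ?\<mu> n * integral {a..b} (\<lambda>x. (h x)\<^sup>2)"
    proof -
      have "(\<lambda>x. h' x * h' x + (x\<^sup>2 - ?\<mu> n) * (h x * h x))
          = (\<lambda>x. (h' x * h' x + (x\<^sup>2 - 0) * (h x * h x)) - ?\<mu> n * (h x)\<^sup>2)"
        by (simp add: algebra_simps power2_eq_square)
      then show ?thesis
        unfolding energy_form_def
        using integral_diff[OF energy_form_integrable[OF h h, of 0] integrable_on_mult_right[OF ih, of "?\<mu> n"]]
        by simp
    qed
    moreover have "(2 * real n + 1) * integral {a..b} (\<lambda>x. (h x)\<^sup>2) \<le> ?\<mu> n * integral {a..b} (\<lambda>x. (h x)\<^sup>2)"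
      by (intro mult_right_mono dirichlet_ev_ge[OF assms(1)] integral_nonneg ih) simp
    ultimately show ?thesis by (simp add: h_def)
  qed
  obtain n :: nat where n: "K / \<epsilon> < real n" using reals_Archimedean2 by blast
  have "K < \<epsilon> * real n" using n \<open>\<epsilon> > 0\<close> by (simp add: divide_less_eq mult.commute)
  moreover have "0 \<le> \<epsilon> * real n" using \<open>\<epsilon> > 0\<close> by simp
  moreover have "\<epsilon> * (2 * real n + 1) = \<epsilon> * real n + \<epsilon> * real n + \<epsilon>" by (simp add: algebra_simps)
  ultimately have "K < \<epsilon> * (2 * real n + 1)" using \<open>\<epsilon> > 0\<close> by linarith
  then have "(2 * real n + 1) * integral {a..b} (\<lambda>x. (f x - (\<Sum>k<n. c k * ?u k x))\<^sup>2) < (2 * real n + 1) * \<epsilon>"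
    using le_less_trans[OF bound[of n]] by (simp only: mult.commute)
  then have "integral {a..b} (\<lambda>x. (f x - (\<Sum>k<n. c k * ?u k x))\<^sup>2) < \<epsilon>"
    by (rule mult_left_less_imp_less) simp
  then show ?thesis by (intro exI[of _ n] exI[of _ c])
qed

section \<open>Calculus on the cube\<close>

definition smooth :: "(real ^ 'n::finite \<Rightarrow> complex) \<Rightarrow> bool" where
  "smooth f \<longleftrightarrow> (\<forall>k. Ck k f)"

lemma smooth_differentiable: "smooth f \<Longrightarrow> f differentiable (at x)"
  unfolding smooth_def by (metis Ck.simps(2))

lemma smooth_partial: "smooth f \<Longrightarrow> smooth (partial j f)"
  unfolding smooth_def by (metis Ck.simps(2))

lemma smooth_continuous: "smooth f \<Longrightarrow> continuous_on S f"
  unfolding smooth_def by (metis Ck.simps(1) continuous_on_subset subset_UNIV)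

lemma partial_eq:
  assumes "(f has_derivative f') (at x)"
  shows "partial j f x = f' (axis j 1)"
  using frechet_derivative_at[OF assms] by (simp add: partial_def)

lemma partial_has_derivative:
  "f differentiable (at x) \<Longrightarrow> (f has_derivative frechet_derivative f (at x)) (at x)"
  using frechet_derivative_works by blast

lemma partial_mult:
  assumes "f differentiable (at x)" "g differentiable (at x)"
  shows "partial j (\<lambda>x. f x * g x) x = partial j f x * g x + f x * partial j g x"
proof -
  note d = has_derivative_mult[OF partial_has_derivative[OF assms(1)] partial_has_derivative[OF assms(2)]]
  show ?thesis using partial_eq[OF d] by (simp add: partial_def add.commute)
qed

lemma partial_add:
  assumes "f differentiable (at x)" "g differentiable (at x)"
  shows "partial j (\<lambda>x. f x + g x) x = partial j f x + partial j g x"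
proof -
  note d = has_derivative_add[OF partial_has_derivative[OF assms(1)] partial_has_derivative[OF assms(2)]]
  show ?thesis using partial_eq[OF d] by (simp add: partial_def)
qed

lemma partial_diff:
  assumes "f differentiable (at x)" "g differentiable (at x)"
  shows "partial j (\<lambda>x. f x - g x) x = partial j f x - partial j g x"
proof -
  note d = has_derivative_diff[OF partial_has_derivative[OF assms(1)] partial_has_derivative[OF assms(2)]]
  show ?thesis using partial_eq[OF d] by (simp add: partial_def)
qed

lemma partial_cmult:
  assumes "f differentiable (at x)"
  shows "partial j (\<lambda>x. c * f x) x = c * partial j f x"
proof -
  note d = has_derivative_mult_right[OF partial_has_derivative[OF assms(1)], of c]
  show ?thesis using partial_eq[OF d] by (simp add: partial_def)
qed

lemma differentiable_cnj: "f differentiable (at x) \<Longrightarrow> (\<lambda>x. cnj (f x)) differentiable (at x)"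
  using bounded_linear.has_derivative[OF bounded_linear_cnj] unfolding differentiable_def by blast

lemma partial_cnj:
  assumes "f differentiable (at x)"
  shows "partial j (\<lambda>x. cnj (f x)) x = cnj (partial j f x)"
proof -
  note d = bounded_linear.has_derivative[OF bounded_linear_cnj partial_has_derivative[OF assms(1)]]
  show ?thesis using partial_eq[OF d] by (simp add: partial_def)
qed

lemma coordinate_has_derivative:
  "((\<lambda>x::real^'n::finite. complex_of_real (x $ i)) has_derivative (\<lambda>h. complex_of_real (h $ i))) F"
  by (rule bounded_linear_imp_has_derivative[OF bounded_linear_compose[OF bounded_linear_of_real bounded_linear_vec_nth]])

lemma coordinate_differentiable: "(\<lambda>x::real^'n::finite. complex_of_real (x $ i)) differentiable F"
  using coordinate_has_derivative unfolding differentiable_def by blast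

lemma partial_coordinate:
  "partial j (\<lambda>x::real^'n::finite. complex_of_real (x $ i)) x = (if i = j then 1 else 0)"
  by (subst partial_eq[OF coordinate_has_derivative]) (simp add: axis_def)

lemma partial_sum:
  assumes "\<And>i. i \<in> F \<Longrightarrow> f i differentiable (at x)"
  shows "partial j (\<lambda>x. \<Sum>i\<in>F. f i x) x = (\<Sum>i\<in>F. partial j (f i) x)"
proof -
  have d: "((\<lambda>x. \<Sum>i\<in>F. f i x) has_derivative (\<lambda>h. \<Sum>i\<in>F. frechet_derivative (f i) (at x) h)) (at x)"
    by (intro has_derivative_sum partial_has_derivative assms)
  show ?thesis using partial_eq[OF d] by (simp add: partial_def)
qed

lemma smooth_lincomb:
  fixes f :: "'i \<Rightarrow> real ^ 'n::finite \<Rightarrow> complex"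
  assumes "\<And>i. i \<in> F \<Longrightarrow> smooth (f i)"
  shows "smooth (\<lambda>x. \<Sum>i\<in>F. c i * f i x)"
    and "partial j (\<lambda>x. \<Sum>i\<in>F. c i * f i x) = (\<lambda>x. \<Sum>i\<in>F. c i * partial j (f i) x)"
proof -
  have p: "partial j (\<lambda>x. \<Sum>i\<in>F. c i * f i x) = (\<lambda>x. \<Sum>i\<in>F. c i * partial j (f i) x)"
    if "\<And>i. i \<in> F \<Longrightarrow> smooth (f i)" for f :: "'i \<Rightarrow> real ^ 'n \<Rightarrow> complex" and j
  proof
    fix x
    have "partial j (\<lambda>x. \<Sum>i\<in>F. c i * f i x) x = (\<Sum>i\<in>F. partial j (\<lambda>x. c i * f i x) x)"
      by (rule partial_sum) (use smooth_differentiable[OF that] in auto)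
    also have "\<dots> = (\<Sum>i\<in>F. c i * partial j (f i) x)"
      by (intro sum.cong refl partial_cmult smooth_differentiable that)
    finally show "partial j (\<lambda>x. \<Sum>i\<in>F. c i * f i x) x = (\<Sum>i\<in>F. c i * partial j (f i) x)" .
  qed
  show "partial j (\<lambda>x. \<Sum>i\<in>F. c i * f i x) = (\<lambda>x. \<Sum>i\<in>F. c i * partial j (f i) x)" by (rule p[OF assms])
  have ck: "Ck k (\<lambda>x. \<Sum>i\<in>F. c i * f i x)" if "\<And>i. i \<in> F \<Longrightarrow> smooth (f i)" for k and f :: "'i \<Rightarrow> real ^ 'n \<Rightarrow> complex"
    using that
  proof (induction k arbitrary: f)
    case 0
    show ?case
      by (simp only: Ck.simps) (intro continuous_on_sum continuous_on_mult continuous_on_const smooth_continuous[OF 0])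
  next
    case (Suc k)
    have "Ck k (\<lambda>x. \<Sum>i\<in>F. c i * partial j (f i) x)" for j
      by (rule Suc.IH) (use Suc.prems smooth_partial in blast)
    moreover have "(\<lambda>x. \<Sum>i\<in>F. c i * f i x) differentiable (at x)" for x
      by (cases "finite F")
         (simp_all, intro differentiable_sum ballI differentiable_mult differentiable_const
            smooth_differentiable[OF Suc.prems])
    ultimately show ?case using p[OF Suc.prems] by simp
  qed
  show "smooth (\<lambda>x. \<Sum>i\<in>F. c i * f i x)" unfolding smooth_def by (intro allI ck[OF assms])
qed

text \<open>
  As the two directions are distinct, \<open>D\<^sub>1\<close> commutes with the multiplication by \<open>x\<^sub>2\<close>.
\<close>

lemma landau_op_smooth:
  assumes f: "smooth f" and "i1 \<noteq> i2"
  shows "landau_op i1 i2 f x = - (\<Sum>j\<in>UNIV. partial j (partial j f) x)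
      - 2 * \<i> * complex_of_real (x $ i2) * partial i1 f x + (complex_of_real (x $ i2))\<^sup>2 * f x"
proof -
  note d = smooth_differentiable[OF f] smooth_differentiable[OF smooth_partial[OF f]] coordinate_differentiable
  have DD: "D_op j (D_op j f) x = - partial j (partial j f) x" for j
    unfolding D_op_def partial_cmult[OF d(2)] by (simp add: mult.assoc[symmetric])
  have "partial i1 (\<lambda>x. - (\<i> * partial i1 f x)) x = - (\<i> * partial i1 (partial i1 f) x)"
    using partial_cmult[OF d(2), where c = "- \<i>"] by simp
  then have "partial i1 (magnetic_D i1 i2 f) x
      = - \<i> * partial i1 (partial i1 f) x + complex_of_real (x $ i2) * partial i1 f x"
    unfolding magnetic_D_def D_op_def using assms(2)
    by (subst partial_add) (auto intro!: derivative_intros d simp: partial_cmult partial_mult d partial_coordinate)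
  then have "magnetic_D i1 i2 (magnetic_D i1 i2 f) x
      = - partial i1 (partial i1 f) x - 2 * \<i> * complex_of_real (x $ i2) * partial i1 f x
        + (complex_of_real (x $ i2))\<^sup>2 * f x"
    by (simp add: magnetic_D_def[of _ _ "magnetic_D i1 i2 f"] D_op_def)
       (simp add: magnetic_D_def D_op_def algebra_simps power2_eq_square)
  moreover have "(\<Sum>j\<in>UNIV. partial j (partial j f) x)
      = partial i1 (partial i1 f) x + (\<Sum>j\<in>UNIV - {i1}. partial j (partial j f) x)"
    by (simp add: sum.remove)
  ultimately show ?thesis unfolding landau_op_def DD by (simp add: sum_negf)
qed

lemma smooth_landau_op_continuous:
  assumes "smooth f" "i1 \<noteq> i2"
  shows "continuous_on S (landau_op i1 i2 f)"
proof -
  have "landau_op i1 i2 f = (\<lambda>x. - (\<Sum>j\<in>UNIV. partial j (partial j f) x)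
      - 2 * \<i> * complex_of_real (x $ i2) * partial i1 f x + (complex_of_real (x $ i2))\<^sup>2 * f x)"
    using landau_op_smooth[OF assms] by auto
  then show ?thesis
    by (simp only:) (intro continuous_intros smooth_continuous smooth_partial assms)
qed

lemma landau_op_lincomb:
  assumes "\<And>i. i \<in> F \<Longrightarrow> smooth (f i)" "i1 \<noteq> i2"
  shows "landau_op i1 i2 (\<lambda>x. \<Sum>i\<in>F. c i * f i x) x = (\<Sum>i\<in>F. c i * landau_op i1 i2 (f i) x)"
proof -
  have "landau_op i1 i2 (\<lambda>x. \<Sum>i\<in>F. c i * f i x) x
      = - (\<Sum>j\<in>UNIV. \<Sum>i\<in>F. c i * partial j (partial j (f i)) x)
      - 2 * \<i> * complex_of_real (x $ i2) * (\<Sum>i\<in>F. c i * partial i1 (f i) x)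
      + (complex_of_real (x $ i2))\<^sup>2 * (\<Sum>i\<in>F. c i * f i x)"
    by (simp add: landau_op_smooth[OF smooth_lincomb(1)[OF assms(1)] assms(2)] smooth_lincomb(2)
        assms(1) smooth_partial)
  also have "\<dots> = (\<Sum>i\<in>F. c i * (- (\<Sum>j\<in>UNIV. partial j (partial j (f i)) x)
      - 2 * \<i> * complex_of_real (x $ i2) * partial i1 (f i) x + (complex_of_real (x $ i2))\<^sup>2 * f i x))"
    by (subst sum.swap)
       (simp add: sum_distrib_left sum.distrib sum_subtractf sum_negf distrib_left right_diff_distrib mult_ac)
  also have "\<dots> = (\<Sum>i\<in>F. c i * landau_op i1 i2 (f i) x)"
    by (intro sum.cong refl) (simp add: landau_op_smooth[OF assms(1) assms(2)])
  finally show ?thesis .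
qed

subsection \<open>Lebesgue measure in coordinates\<close>

lemma vec_lambda_measurable:
  "(\<lambda>f. \<chi> i. f i) \<in> Pi\<^sub>M UNIV (\<lambda>_::'n::finite. lborel) \<rightarrow>\<^sub>M (borel :: (real ^ 'n) measure)"
proof (subst borel_measurable_euclidean_space, rule ballI)
  fix b :: "real ^ 'n" assume "b \<in> Basis"
  then obtain i where b: "b = axis i 1" by (auto simp: Basis_vec_def)
  have "(\<lambda>f::'n \<Rightarrow> real. (\<chi> i. f i) \<bullet> b) = (\<lambda>f. f i)" by (simp add: b inner_axis)
  then show "(\<lambda>f. (\<chi> i. f i) \<bullet> b) \<in> borel_measurable (Pi\<^sub>M UNIV (\<lambda>_::'n. lborel))"
    using measurable_component_singleton[of i UNIV "\<lambda>_. lborel"] by simp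
qed

text \<open>Makes Fubini's theorem available for one coordinate against the others.\<close>

lemma lborel_vec_eq:
  "(lborel :: (real ^ 'n::finite) measure) = distr (Pi\<^sub>M UNIV (\<lambda>_::'n. lborel)) borel (\<lambda>f. \<chi> i. f i)"
proof (rule lborel_eqI)
  interpret product_sigma_finite "\<lambda>_::'n. lborel :: real measure" ..
  fix l u :: "real ^ 'n" assume le: "\<And>b. b \<in> Basis \<Longrightarrow> l \<bullet> b \<le> u \<bullet> b"
  have le': "l $ i \<le> u $ i" for i using le[of "axis i 1"] by (simp add: inner_axis axis_in_Basis_iff)
  have "(\<lambda>f. \<chi> i. f i) -` box l u \<inter> space (Pi\<^sub>M UNIV (\<lambda>_::'n. lborel)) = PiE UNIV (\<lambda>i. {l $ i<..<u $ i})"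
    by (auto simp: space_PiM mem_box_cart PiE_iff)
  then have "emeasure (distr (Pi\<^sub>M UNIV (\<lambda>_::'n. lborel)) borel (\<lambda>f. \<chi> i. f i)) (box l u)
      = (\<Prod>i\<in>UNIV. emeasure lborel {l $ i<..<u $ i})"
    by (subst emeasure_distr[OF vec_lambda_measurable]) (auto intro!: emeasure_PiM)
  also have "\<dots> = ennreal (\<Prod>i\<in>UNIV. (u - l) $ i)"
    using le' by (simp add: prod_ennreal)
  also have "(\<Prod>i\<in>UNIV. (u - l) $ i) = (\<Prod>b\<in>Basis. (u - l) \<bullet> b)"
  proof -
    have Basis: "Basis = range (\<lambda>i::'n. axis i (1::real))" by (auto simp: Basis_vec_def)
    have inj: "inj (\<lambda>i::'n. axis i (1::real))" by (auto simp: inj_on_def axis_eq_axis)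
    have "(\<Prod>b\<in>Basis. (u - l) \<bullet> b) = (\<Prod>i\<in>UNIV. (u - l) \<bullet> axis i 1)"
      unfolding Basis by (simp only: prod.reindex[OF inj] o_def)
    then show ?thesis by (simp add: inner_axis)
  qed
  finally show "emeasure (distr (Pi\<^sub>M UNIV (\<lambda>_::'n. lborel)) borel (\<lambda>f. \<chi> i. f i)) (box l u)
      = ennreal (\<Prod>b\<in>Basis. (u - l) \<bullet> b)" .
qed simp

lemma cube_eq_cbox: "cube L = cbox 0 (\<chi> i. L)"
  by (auto simp: cube_def mem_box_cart)

lemma compact_cube: "compact (cube L)"
  by (simp add: cube_eq_cbox)

lemma cube_sets [measurable]: "cube L \<in> sets borel"
  by (simp add: cube_eq_cbox)

lemma space_cube_measure [simp]: "space (cube_measure L) = cube L"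
  by (simp add: cube_measure_def space_restrict_space)

lemma finite_measure_cube: "finite_measure (cube_measure L)"
proof
  show "emeasure (cube_measure L) (space (cube_measure L)) \<noteq> \<infinity>"
    unfolding space_cube_measure unfolding cube_measure_def
    by (subst emeasure_restrict_space) (auto simp: cube_eq_cbox emeasure_lborel_cbox_eq)
qed

lemma integral_cube:
  fixes f :: "real ^ 'n::finite \<Rightarrow> 'b::{banach, second_countable_topology}"
  shows "integral\<^sup>L (cube_measure L) f = (\<integral>x. indicator (cube L) x *\<^sub>R f x \<partial>lborel)"
  unfolding cube_measure_def by (subst integral_restrict_space) auto

lemma borel_measurable_cube:
  fixes f :: "real ^ 'n::finite \<Rightarrow> complex"
  assumes "continuous_on (cube L) f"
  shows "f \<in> borel_measurable (cube_measure L)"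
  unfolding cube_measure_def
  using borel_measurable_continuous_on_restrict[OF assms]
  by (simp cong: measurable_cong_sets add: sets_restrict_space)

lemma integrable_cube:
  fixes f :: "real ^ 'n::finite \<Rightarrow> 'b::{banach, second_countable_topology}"
  assumes "continuous_on (cube L) f"
  shows "integrable (cube_measure L) f"
  unfolding cube_measure_def
  using borel_integrable_compact[OF compact_cube assms]
  by (subst integrable_restrict_space) (auto simp: set_integrable_def)

lemma continuous_L2_cube:
  assumes "continuous_on (cube L) f"
  shows "f \<in> L2_space (cube_measure L)"
  unfolding L2_space_def
  using borel_measurable_cube[OF assms] integrable_cube[OF continuous_on_power[OF continuous_on_norm[OF assms]]]
  by auto

lemma integral_cube_PiM:
  fixes f :: "real ^ 'n::finite \<Rightarrow> complex"
  assumes "f \<in> borel_measurable borel"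
  shows "integral\<^sup>L (cube_measure L) f
      = (\<integral>y. indicator (cube L) (\<chi> i. y i) *\<^sub>R f (\<chi> i. y i) \<partial>(Pi\<^sub>M UNIV (\<lambda>_::'n. lborel)))"
proof -
  have "(\<lambda>x. indicator (cube L) x *\<^sub>R f x) \<in> borel_measurable borel" using assms by measurable
  then show ?thesis
    unfolding integral_cube by (subst lborel_vec_eq) (rule integral_distr[OF vec_lambda_measurable])
qed

lemma integral_cube_prod:
  fixes h :: "'n::finite \<Rightarrow> real \<Rightarrow> complex"
  assumes "\<And>j. continuous_on UNIV (h j)"
  shows "integral\<^sup>L (cube_measure L) (\<lambda>x::real^'n. \<Prod>j\<in>UNIV. h j (x $ j))
      = (\<Prod>j\<in>UNIV. \<integral>t. indicator {0..L} t *\<^sub>R h j t \<partial>lborel)"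
proof -
  interpret product_sigma_finite "\<lambda>_::'n. lborel :: real measure" ..
  have "continuous_on UNIV (\<lambda>x::real^'n. \<Prod>j\<in>UNIV. h j (x $ j))"
    by (intro continuous_on_prod continuous_on_compose2[OF assms] continuous_intros) auto
  then have "integral\<^sup>L (cube_measure L) (\<lambda>x::real^'n. \<Prod>j\<in>UNIV. h j (x $ j))
    = (\<integral>y. indicator (cube L) (\<chi> i. y i) *\<^sub>R (\<Prod>j\<in>UNIV. h j (y j)) \<partial>(Pi\<^sub>M UNIV (\<lambda>_::'n. lborel)))"
    by (subst integral_cube_PiM) (auto intro: borel_measurable_continuous_onI)
  also have "(\<lambda>y. indicator (cube L) (\<chi> i. y i) *\<^sub>R (\<Prod>j\<in>UNIV. h j (y j)))
      = (\<lambda>y. \<Prod>j\<in>UNIV. indicator {0..L} (y j) *\<^sub>R h j (y j))"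
  proof
    fix y :: "'n \<Rightarrow> real"
    have "indicator (cube L) (\<chi> i. y i) = (\<Prod>j\<in>UNIV. indicator {0..L} (y j) :: real)"
    proof (cases "(\<chi> i. y i) \<in> cube L")
      case True
      then show ?thesis by (simp add: cube_def)
    next
      case False
      then obtain j where "y j \<notin> {0..L}" by (auto simp: cube_def)
      then have "(\<Prod>j\<in>UNIV. indicator {0..L} (y j) :: real) = 0" by (intro prod_zero bexI[of _ j]) auto
      then show ?thesis using False by simp
    qed
    then show "indicator (cube L) (\<chi> i. y i) *\<^sub>R (\<Prod>j\<in>UNIV. h j (y j))
        = (\<Prod>j\<in>UNIV. indicator {0..L} (y j) *\<^sub>R h j (y j))"
      by (simp add: scaleR_conv_of_real prod.distrib)
  qed
  also have "(\<integral>y. (\<Prod>j\<in>UNIV. indicator {0..L} (y j) *\<^sub>R h j (y j)) \<partial>(Pi\<^sub>M UNIV (\<lambda>_::'n. lborel)))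
      = (\<Prod>j\<in>UNIV. \<integral>t. indicator {0..L} t *\<^sub>R h j t \<partial>lborel)"
    by (rule product_integral_prod)
       (auto intro!: borel_integrable_compact continuous_on_subset[OF assms])
  finally show ?thesis .
qed

text \<open>
  The divergence theorem in one direction: by Fubini the integral of \<open>\<partial>\<^sub>j G\<close> is that of the difference of
  the values on opposite faces.
\<close>

lemma integral_cube_partial:
  fixes G :: "real ^ 'n::finite \<Rightarrow> complex"
  assumes "L > 0" and diff: "\<And>x. G differentiable (at x)" and cont: "continuous_on UNIV (partial j G)"
    and faces: "\<And>x. x \<in> cube L \<Longrightarrow> x $ j = 0 \<Longrightarrow> G (x + axis j L) = G x"
  shows "integral\<^sup>L (cube_measure L) (partial j G) = 0"
proof -
  interpret product_sigma_finite "\<lambda>_::'n. lborel :: real measure" ..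
  let ?J = "UNIV - {j}"
  let ?g = "\<lambda>y::'n \<Rightarrow> real. indicator (cube L) (\<chi> i. y i) *\<^sub>R partial j G (\<chi> i. y i)"
  have "integrable lborel (\<lambda>x. indicator (cube L) x *\<^sub>R partial j G x)"
    by (rule borel_integrable_compact[OF compact_cube continuous_on_subset[OF cont subset_UNIV]])
  then have int: "integrable (Pi\<^sub>M UNIV (\<lambda>_::'n. lborel)) ?g"
    by (subst (asm) lborel_vec_eq, subst (asm) integrable_distr_eq[OF vec_lambda_measurable])
       (auto intro!: borel_measurable_scaleR borel_measurable_indicator borel_measurable_continuous_onI cont)
  have ins: "UNIV = insert j ?J" by auto
  have "integral\<^sup>L (cube_measure L) (partial j G) = integral\<^sup>L (Pi\<^sub>M (insert j ?J) (\<lambda>_::'n. lborel)) ?g"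
    using integral_cube_PiM[OF borel_measurable_continuous_onI[OF cont]] ins by simp
  also have "\<dots> = (\<integral>y. (\<integral>t. ?g (y(j := t)) \<partial>lborel) \<partial>(Pi\<^sub>M ?J (\<lambda>_::'n. lborel :: real measure)))"
    by (rule product_integral_insert) (use int ins in auto)
  also have "\<dots> = (\<integral>y. 0 \<partial>(Pi\<^sub>M ?J (\<lambda>_::'n. lborel :: real measure)))"
  proof (rule Bochner_Integration.integral_cong[OF refl])
    fix y :: "'n \<Rightarrow> real"
    show "(\<integral>t. ?g (y(j := t)) \<partial>lborel) = 0"
    proof (cases "\<forall>i\<in>?J. 0 \<le> y i \<and> y i \<le> L")
      case False
      then have out: "(\<chi> i. (y(j := t)) i) \<notin> cube L" for t by (auto simp: cube_def)
      have "?g (y(j := t)) = 0" for t unfolding indicator_simps(2)[OF out] by simp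
      then show ?thesis by (simp only: Bochner_Integration.integral_zero)
    next
      case True
      let ?p = "\<lambda>t. (\<chi> i. (y(j := t)) i) :: real ^ 'n"
      have p: "?p t = ?p 0 + t *\<^sub>R axis j 1" for t by (auto simp: vec_eq_iff axis_def)
      have dp: "(?p has_vector_derivative axis j 1) (at t within S)" for t S
        by (subst p) (auto intro!: derivative_eq_intros)
      have dG: "((\<lambda>t. G (?p t)) has_vector_derivative partial j G (?p t)) (at t within S)" for t S
        using vector_derivative_diff_chain_within[OF dp has_derivative_at_withinI[OF partial_has_derivative[OF diff]]]
        by (simp add: o_def partial_def)
      have "?g (y(j := t)) = indicator {0..L} t *\<^sub>R partial j G (?p t)" for t
        using True by (auto simp: cube_def indicator_def)
      then have "(\<integral>t. ?g (y(j := t)) \<partial>lborel) = (\<integral>t. indicator {0..L} t *\<^sub>R partial j G (?p t) \<partial>lborel)" by (simp only:)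
      also have "\<dots> = G (?p L) - G (?p 0)"
      proof (rule integral_FTC_Icc[OF _ dG])
        have "continuous_on {0..L} ?p"
          unfolding continuous_on_eq_continuous_within using has_vector_derivative_continuous[OF dp] by blast
        then show "continuous_on {0..L} (\<lambda>t. partial j G (?p t))"
          by (rule continuous_on_compose2[OF cont]) auto
      qed (use \<open>L > 0\<close> in simp)
      also have "?p L = ?p 0 + axis j L" by (auto simp: vec_eq_iff axis_def)
      also have "G (?p 0 + axis j L) = G (?p 0)"
        by (rule faces) (use True \<open>L > 0\<close> in \<open>auto simp: cube_def\<close>)
      finally show ?thesis by simp
    qed
  qed
  finally show ?thesis by simp
qed

subsection \<open>Symmetry of the Landau operator\<close>

lemma partial_periodic:
  assumes "smooth f" "\<And>x. f (x + v) = f x"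
  shows "partial j f (x + v) = partial j f x"
proof -
  have "(f has_derivative frechet_derivative f (at (x + v))) (at (x + v))"
    by (rule partial_has_derivative[OF smooth_differentiable[OF assms(1)]])
  moreover have "((\<lambda>x. x + v) has_derivative (\<lambda>h. h)) (at x)" by (auto intro!: derivative_eq_intros)
  ultimately have "((\<lambda>x. f (x + v)) has_derivative frechet_derivative f (at (x + v))) (at x)"
    using has_derivative_compose[of "\<lambda>x. x + v" "\<lambda>h. h" x UNIV f] by simp
  then have "(f has_derivative frechet_derivative f (at (x + v))) (at x)" using assms(2) by simp
  from partial_eq[OF this] show ?thesis by (simp add: partial_def)
qed

lemma landau_coreD:
  assumes "f \<in> landau_core i1 L"
  shows "smooth f" "f (x + axis i1 L) = f x"
    "x \<in> cube L \<Longrightarrow> j \<noteq> i1 \<Longrightarrow> x $ j = 0 \<or> x $ j = L \<Longrightarrow> f x = 0"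
  using assms by (auto simp: landau_core_def smooth_def)

text \<open>Green's identity: the boundary terms cancel by periodicity in \<open>x\<^sub>1\<close> and the Dirichlet conditions.\<close>

lemma landau_symmetric:
  fixes i1 i2 :: "'n::finite"
  assumes L: "L > 0" and ne: "i1 \<noteq> i2" and f: "f \<in> landau_core i1 L" and g: "g \<in> landau_core i1 L"
  shows "L2_inner (cube_measure L) (landau_op i1 i2 f) g = L2_inner (cube_measure L) f (landau_op i1 i2 g)"
proof -
  note sf = landau_coreD(1)[OF f] and sg = landau_coreD(1)[OF g]
  define b where "b = (\<lambda>j. if j = i1 then 2 * \<i> else 0)"
  define H where "H = (\<lambda>j x. (partial j f x * cnj (g x) - f x * cnj (partial j g x))
      + b j * (complex_of_real (x $ i2) * (f x * cnj (g x))))"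
  note d = smooth_differentiable[OF sf] smooth_differentiable[OF smooth_partial[OF sf]]
    smooth_differentiable[OF sg] smooth_differentiable[OF smooth_partial[OF sg]] coordinate_differentiable
    differentiable_cnj[OF smooth_differentiable[OF sg]]
    differentiable_cnj[OF smooth_differentiable[OF smooth_partial[OF sg]]]
  have dH: "H j differentiable (at x)" for j x
    unfolding H_def by (intro derivative_intros d)
  have pH: "partial j (H j) x = partial j (partial j f) x * cnj (g x) - f x * cnj (partial j (partial j g) x)
      + b j * (complex_of_real (x $ i2) * (partial j f x * cnj (g x) + f x * cnj (partial j g x)))" for j x
  proof -
    have z: "b j * (if i2 = j then 1 else 0) = 0" using ne by (simp add: b_def)
    have "partial j (H j) x = partial j (\<lambda>x. partial j f x * cnj (g x)) x - partial j (\<lambda>x. f x * cnj (partial j g x)) x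
        + b j * partial j (\<lambda>x. complex_of_real (x $ i2) * (f x * cnj (g x))) x"
      unfolding H_def
      by (subst partial_add partial_diff partial_cmult; (intro derivative_intros d)?)+ simp
    also have "\<dots> = (partial j (partial j f) x * cnj (g x) + partial j f x * cnj (partial j g x))
        - (partial j f x * cnj (partial j g x) + f x * cnj (partial j (partial j g) x))
        + b j * ((if i2 = j then 1 else 0) * (f x * cnj (g x))
          + complex_of_real (x $ i2) * (partial j f x * cnj (g x) + f x * cnj (partial j g x)))"
      by (simp add: partial_mult partial_cnj partial_coordinate d derivative_intros)
    finally show ?thesis using z by (simp add: distrib_left mult.assoc[symmetric])
  qed
  have cH: "continuous_on UNIV (partial j (H j))" for j
    unfolding pH[abs_def] by (intro continuous_intros smooth_continuous smooth_partial sf sg)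
  have "landau_op i1 i2 f x * cnj (g x) - f x * cnj (landau_op i1 i2 g x) = - (\<Sum>j\<in>UNIV. partial j (H j) x)" for x
  proof -
    let ?y = "complex_of_real (x $ i2)"
    have "(\<Sum>j\<in>UNIV. partial j (H j) x) = (\<Sum>j\<in>UNIV. partial j (partial j f) x) * cnj (g x)
        - f x * cnj (\<Sum>j\<in>UNIV. partial j (partial j g) x)
        + (\<Sum>j\<in>UNIV. b j * (?y * (partial j f x * cnj (g x) + f x * cnj (partial j g x))))"
      unfolding pH sum.distrib sum_subtractf by (simp add: sum_distrib_left sum_distrib_right)
    also have "(\<Sum>j\<in>UNIV. b j * (?y * (partial j f x * cnj (g x) + f x * cnj (partial j g x))))
        = (\<Sum>j\<in>UNIV. if j = i1 then 2 * \<i> * (?y * (partial i1 f x * cnj (g x) + f x * cnj (partial i1 g x))) else 0)"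
      by (intro sum.cong) (auto simp: b_def)
    also have "\<dots> = 2 * \<i> * (?y * (partial i1 f x * cnj (g x) + f x * cnj (partial i1 g x)))"
      by simp
    finally have eq: "(\<Sum>j\<in>UNIV. partial j (H j) x) = (\<Sum>j\<in>UNIV. partial j (partial j f) x) * cnj (g x)
        - f x * cnj (\<Sum>j\<in>UNIV. partial j (partial j g) x)
        + 2 * \<i> * (?y * (partial i1 f x * cnj (g x) + f x * cnj (partial i1 g x)))" .
    show ?thesis unfolding eq landau_op_smooth[OF sf ne] landau_op_smooth[OF sg ne]
      by (simp add: algebra_simps)
  qed
  then have "(\<integral>x. landau_op i1 i2 f x * cnj (g x) - f x * cnj (landau_op i1 i2 g x) \<partial>cube_measure L)
      = - (\<Sum>j\<in>UNIV. integral\<^sup>L (cube_measure L) (partial j (H j)))"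
    by (simp add: Bochner_Integration.integral_sum integrable_cube continuous_on_subset[OF cH])
  also have "\<dots> = 0"
  proof -
    have "integral\<^sup>L (cube_measure L) (partial j (H j)) = 0" for j
    proof (rule integral_cube_partial[OF L dH cH])
      fix x :: "real ^ 'n" assume x: "x \<in> cube L" "x $ j = 0"
      show "H j (x + axis j L) = H j x"
      proof (cases "j = i1")
        case True
        have "partial i1 f (x + axis i1 L) = partial i1 f x" "partial i1 g (x + axis i1 L) = partial i1 g x"
          using partial_periodic sf sg landau_coreD(2)[OF f] landau_coreD(2)[OF g] by blast+
        moreover have "(x + axis i1 L) $ i2 = x $ i2" using ne by (simp add: axis_def)
        ultimately show ?thesis
          using landau_coreD(2)[OF f] landau_coreD(2)[OF g] by (simp add: H_def True)
      next
        case False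
        have "x + axis j L \<in> cube L" using x L by (auto simp: cube_def axis_def)
        moreover have "(x + axis j L) $ j = L" using x by (simp add: axis_def)
        ultimately have "f (x + axis j L) = 0" "g (x + axis j L) = 0"
          using landau_coreD(3)[OF f _ False] landau_coreD(3)[OF g _ False] by auto
        moreover have "f x = 0" "g x = 0"
          using landau_coreD(3)[OF f x(1) False] landau_coreD(3)[OF g x(1) False] x(2) by auto
        ultimately show ?thesis by (simp add: H_def)
      qed
    qed
    then show ?thesis by simp
  qed
  finally have "(\<integral>x. landau_op i1 i2 f x * cnj (g x) - f x * cnj (landau_op i1 i2 g x) \<partial>cube_measure L) = 0" .
  moreover have "integrable (cube_measure L) (\<lambda>x. landau_op i1 i2 f x * cnj (g x))"
       "integrable (cube_measure L) (\<lambda>x. f x * cnj (landau_op i1 i2 g x))"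
    by (intro integrable_cube continuous_intros smooth_landau_op_continuous sf sg ne smooth_continuous)+
  ultimately show ?thesis unfolding L2_inner_def by simp
qed

subsection \<open>Products of entire functions of the coordinates\<close>

text \<open>A class of functions that is closed under partial derivatives, so that its members are smooth.\<close>

definition tensor :: "('n::finite \<Rightarrow> complex \<Rightarrow> complex) \<Rightarrow> real ^ 'n \<Rightarrow> complex" where
  "tensor g x = (\<Prod>j\<in>UNIV. g j (complex_of_real (x $ j)))"

lemma tensor_has_derivative:
  assumes "\<And>j. g j holomorphic_on UNIV"
  shows "(tensor g has_derivative (\<lambda>h. \<Sum>i\<in>UNIV. deriv (g i) (complex_of_real (x $ i)) * complex_of_real (h $ i) *
            (\<Prod>j\<in>UNIV - {i}. g j (complex_of_real (x $ j))))) (at x)"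
  unfolding tensor_def[abs_def]
proof (rule has_derivative_prod)
  fix i
  have "(g i has_field_derivative deriv (g i) (complex_of_real (x $ i))) (at (complex_of_real (x $ i)))"
    by (rule holomorphic_derivI[OF assms]) auto
  then show "((\<lambda>x. g i (complex_of_real (x $ i))) has_derivative
      (\<lambda>h. deriv (g i) (complex_of_real (x $ i)) * complex_of_real (h $ i))) (at x)"
    using has_derivative_compose[OF coordinate_has_derivative has_field_derivative_imp_has_derivative] by blast
qed

lemma partial_tensor:
  assumes "\<And>j. g j holomorphic_on UNIV"
  shows "partial j (tensor g) = tensor (g(j := deriv (g j)))"
proof
  fix x
  have "partial j (tensor g) x = (\<Sum>i\<in>UNIV. if i = j then deriv (g j) (complex_of_real (x $ j)) *
            (\<Prod>i\<in>UNIV - {j}. g i (complex_of_real (x $ i))) else 0)"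
    unfolding partial_eq[OF tensor_has_derivative[OF assms]]
    by (intro sum.cong) (auto simp: axis_def)
  also have "\<dots> = deriv (g j) (complex_of_real (x $ j)) * (\<Prod>i\<in>UNIV - {j}. g i (complex_of_real (x $ i)))"
    by simp
  also have "\<dots> = tensor (g(j := deriv (g j))) x"
    unfolding tensor_def by (subst prod.remove[of UNIV j]) (auto intro!: prod.cong)
  finally show "partial j (tensor g) x = tensor (g(j := deriv (g j))) x" .
qed

lemma smooth_tensor:
  assumes "\<And>j. g j holomorphic_on UNIV"
  shows "smooth (tensor g)"
proof -
  have "Ck k (tensor g)" if "\<And>j. g j holomorphic_on UNIV" for k and g :: "'a \<Rightarrow> complex \<Rightarrow> complex"
    using that
  proof (induction k arbitrary: g)
    case 0
    then have "tensor g differentiable (at x)" for x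
      using tensor_has_derivative[where g = g, OF 0] unfolding differentiable_def by blast
    then show ?case by (simp add: continuous_at_imp_continuous_on differentiable_imp_continuous_within)
  next
    case (Suc k)
    have "tensor g differentiable (at x)" for x
      using tensor_has_derivative[where g = g, OF Suc.prems] unfolding differentiable_def by blast
    moreover have "Ck k (tensor (g(j := deriv (g j))))" for j
      by (rule Suc.IH) (use Suc.prems in \<open>auto intro: holomorphic_deriv\<close>)
    ultimately show ?case by (simp add: partial_tensor[OF Suc.prems])
  qed
  then show ?thesis using assms by (simp add: smooth_def)
qed

lemma L2_inner_tensor:
  assumes "\<And>j. g j holomorphic_on UNIV" "\<And>j. h j holomorphic_on UNIV"
  shows "L2_inner (cube_measure L) (tensor g) (tensor h)
      = (\<Prod>j\<in>UNIV. \<integral>t. indicator {0..L} t *\<^sub>R (g j (complex_of_real t) * cnj (h j (complex_of_real t))) \<partial>lborel)"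
proof -
  have c: "continuous_on UNIV (\<lambda>t. g j (complex_of_real t) * cnj (h j (complex_of_real t)))" for j
    by (intro continuous_intros continuous_on_compose2[OF holomorphic_on_imp_continuous_on[OF assms(1)]]
        continuous_on_compose2[OF holomorphic_on_imp_continuous_on[OF assms(2)]]) auto
  show ?thesis
    unfolding L2_inner_def tensor_def
    using integral_cube_prod[of "\<lambda>j t. g j (complex_of_real t) * cnj (h j (complex_of_real t))", OF c]
    by (simp add: prod.distrib)
qed

section \<open>Lattice points in an orthant of a ball\<close>

text \<open>The values outside \<open>A\<close> are fixed, so that a point is determined by its coordinates on \<open>A\<close>.\<close>

definition positive_lattice :: "'i set \<Rightarrow> ('i \<Rightarrow> nat) set" where
  "positive_lattice A = {n. (\<forall>j\<in>A. 1 \<le> n j) \<and> (\<forall>j. j \<notin> A \<longrightarrow> n j = 0)}"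

definition lattice_ball :: "'i set \<Rightarrow> real \<Rightarrow> real \<Rightarrow> ('i \<Rightarrow> nat) set" where
  "lattice_ball A L E = {n \<in> positive_lattice A. (\<Sum>j\<in>A. (pi * real (n j) / L)\<^sup>2) \<le> E}"

lemma finite_lattice_ball:
  assumes "finite A" "L > 0"
  shows "finite (lattice_ball A L E)"
proof -
  let ?K = "nat \<lceil>L\<^sup>2 * \<bar>E\<bar> / pi\<^sup>2\<rceil>"
  have "n j \<le> ?K" if n: "n \<in> lattice_ball A L E" and j: "j \<in> A" for n j
  proof -
    have "(pi * real (n j) / L)\<^sup>2 \<le> (\<Sum>j\<in>A. (pi * real (n j) / L)\<^sup>2)"
      using assms(1) j by (intro member_le_sum) auto
    also have "\<dots> \<le> E" using n by (simp add: lattice_ball_def)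
    also have "\<dots> \<le> \<bar>E\<bar>" by simp
    finally have "(real (n j))\<^sup>2 \<le> L\<^sup>2 * \<bar>E\<bar> / pi\<^sup>2"
      using assms(2) by (simp add: power_mult_distrib power_divide field_simps)
    moreover have "real (n j) \<le> (real (n j))\<^sup>2" by (cases "n j") (auto simp: power2_eq_square)
    ultimately have "real (n j) \<le> L\<^sup>2 * \<bar>E\<bar> / pi\<^sup>2" by linarith
    then show ?thesis by linarith
  qed
  then have "lattice_ball A L E \<subseteq> {n. \<forall>j. (j \<in> A \<longrightarrow> n j \<in> {..?K}) \<and> (j \<notin> A \<longrightarrow> n j = 0)}"
    by (auto simp: lattice_ball_def positive_lattice_def)
  then show ?thesis by (rule finite_subset) (intro finite_set_of_finite_funs assms(1) finite_atMost)
qed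

text \<open>
  Each lattice point owns the \<open>2 ^ card A\<close> unit cubes \<open>n j - 1 \<le> \<bar>y j\<bar> < n j\<close>; using all orthants at once
  makes the whole ball volume available.
\<close>

definition reflected_cell :: "'i set \<Rightarrow> ('i \<Rightarrow> nat) \<Rightarrow> ('i \<Rightarrow> real) set" where
  "reflected_cell A n = (\<Pi>\<^sub>E j\<in>A. {y. real (n j) - 1 \<le> \<bar>y\<bar> \<and> \<bar>y\<bar> < real (n j)})"

lemma reflected_interval:
  assumes "1 \<le> m"
  shows "{y::real. real m - 1 \<le> \<bar>y\<bar> \<and> \<bar>y\<bar> < real m} = {- real m<..<real m} - {- (real m - 1)<..<real m - 1}"
  using assms by auto

lemma emeasure_reflected_cell:
  assumes "finite A" "n \<in> positive_lattice A"
  shows "reflected_cell A n \<in> sets (Pi\<^sub>M A (\<lambda>_. lborel))"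
    and "emeasure (Pi\<^sub>M A (\<lambda>_. lborel)) (reflected_cell A n) = 2 ^ card A"
proof -
  interpret product_sigma_finite "\<lambda>_. lborel :: real measure" ..
  have s: "{y::real. real (n j) - 1 \<le> \<bar>y\<bar> \<and> \<bar>y\<bar> < real (n j)} \<in> sets lborel" if "j \<in> A" for j
    using assms(2) that by (subst reflected_interval) (auto simp: positive_lattice_def)
  have e: "emeasure lborel {y::real. real (n j) - 1 \<le> \<bar>y\<bar> \<and> \<bar>y\<bar> < real (n j)} = 2" if "j \<in> A" for j
  proof -
    have m: "1 \<le> n j" using assms(2) that by (simp add: positive_lattice_def)
    then have m': "1 \<le> real (n j)" by simp
    have "emeasure lborel ({- real (n j)<..<real (n j)} - {- (real (n j) - 1)<..<real (n j) - 1})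
        = emeasure lborel {- real (n j)<..<real (n j)} - emeasure lborel {- (real (n j) - 1)<..<real (n j) - 1}"
      by (rule emeasure_Diff) (use m' in auto)
    also have "\<dots> = ennreal (2 * real (n j)) - ennreal (2 * (real (n j) - 1))"
      using m' by (simp add: algebra_simps)
    also have "\<dots> = ennreal 2" using m' by (subst ennreal_minus) auto
    finally show ?thesis using reflected_interval[OF m] by simp
  qed
  show "reflected_cell A n \<in> sets (Pi\<^sub>M A (\<lambda>_. lborel))"
    unfolding reflected_cell_def by (rule sets_PiM_I_finite[OF assms(1)]) (use s in simp)
  have "emeasure (Pi\<^sub>M A (\<lambda>_. lborel)) (reflected_cell A n)
      = (\<Prod>j\<in>A. emeasure lborel {y::real. real (n j) - 1 \<le> \<bar>y\<bar> \<and> \<bar>y\<bar> < real (n j)})"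
    unfolding reflected_cell_def by (rule emeasure_PiM[OF assms(1) s])
  also have "\<dots> = (\<Prod>j\<in>A. 2)" using e by (intro prod.cong) auto
  finally show "emeasure (Pi\<^sub>M A (\<lambda>_. lborel)) (reflected_cell A n) = 2 ^ card A" by simp
qed

lemma reflected_cell_disjoint:
  assumes "n \<in> positive_lattice A" "m \<in> positive_lattice A" "n \<noteq> m"
  shows "reflected_cell A n \<inter> reflected_cell A m = {}"
proof (rule ccontr)
  assume "reflected_cell A n \<inter> reflected_cell A m \<noteq> {}"
  then obtain y where y: "y \<in> reflected_cell A n" "y \<in> reflected_cell A m" by blast
  have "n j = m j" for j
  proof (cases "j \<in> A")
    case True
    then have "real (n j) - 1 \<le> \<bar>y j\<bar>" "\<bar>y j\<bar> < real (n j)" "real (m j) - 1 \<le> \<bar>y j\<bar>" "\<bar>y j\<bar> < real (m j)"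
      using y unfolding reflected_cell_def by (auto dest!: PiE_mem[where x = j])
    then have "real (n j) < real (m j) + 1" "real (m j) < real (n j) + 1" by linarith+
    then show ?thesis by linarith
  next
    case False
    then show ?thesis using assms(1,2) by (simp add: positive_lattice_def)
  qed
  then show False using assms(3) by auto
qed

lemma emeasure_union_cells:
  assumes "finite A" "finite S" "S \<subseteq> positive_lattice A"
  shows "(\<Union>n\<in>S. reflected_cell A n) \<in> sets (Pi\<^sub>M A (\<lambda>_. lborel))"
    and "emeasure (Pi\<^sub>M A (\<lambda>_. lborel)) (\<Union>n\<in>S. reflected_cell A n) = ennreal (real (card S) * 2 ^ card A)"
proof -
  have sets: "reflected_cell A n \<in> sets (Pi\<^sub>M A (\<lambda>_. lborel))" if "n \<in> S" for n
    using emeasure_reflected_cell(1)[OF assms(1)] assms(3) that by blast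
  show "(\<Union>n\<in>S. reflected_cell A n) \<in> sets (Pi\<^sub>M A (\<lambda>_. lborel))"
    using sets assms(2) by (intro sets.finite_UN) auto
  have "emeasure (Pi\<^sub>M A (\<lambda>_. lborel)) (\<Union>n\<in>S. reflected_cell A n)
      = (\<Sum>n\<in>S. emeasure (Pi\<^sub>M A (\<lambda>_. lborel)) (reflected_cell A n))"
  proof (rule sum_emeasure[symmetric])
    show "disjoint_family_on (reflected_cell A) S"
      unfolding disjoint_family_on_def using assms(3) reflected_cell_disjoint by blast
  qed (use sets assms in auto)
  also have "\<dots> = (\<Sum>n\<in>S. 2 ^ card A)"
    using emeasure_reflected_cell(2)[OF assms(1)] assms(3) by (intro sum.cong) auto
  also have "\<dots> = ennreal (real (card S) * 2 ^ card A)"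
    by (simp add: ennreal_of_nat_eq_real_of_nat ennreal_mult'' flip: ennreal_power)
  finally show "emeasure (Pi\<^sub>M A (\<lambda>_. lborel)) (\<Union>n\<in>S. reflected_cell A n) = ennreal (real (card S) * 2 ^ card A)" .
qed

abbreviation euclid_ball :: "'i set \<Rightarrow> real \<Rightarrow> ('i \<Rightarrow> real) set" where
  "euclid_ball A r \<equiv> {f. sqrt (\<Sum>i\<in>A. (f i)\<^sup>2) \<le> r} \<inter> space (Pi\<^sub>M A (\<lambda>_. lborel))"

lemma euclid_ball_sets: "finite A \<Longrightarrow> euclid_ball A r \<in> sets (Pi\<^sub>M A (\<lambda>_. lborel))"
proof -
  assume "finite A"
  have "{f \<in> space (Pi\<^sub>M A (\<lambda>_. lborel :: real measure)). sqrt (\<Sum>i\<in>A. (f i)\<^sup>2) \<le> r} \<in> sets (Pi\<^sub>M A (\<lambda>_. lborel))"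
    by measurable
  then show ?thesis by (simp add: Int_def conj_commute)
qed

lemma lattice_ball_scaled:
  assumes "L > 0" "0 \<le> E" "n \<in> positive_lattice A"
  shows "n \<in> lattice_ball A L E \<longleftrightarrow> sqrt (\<Sum>j\<in>A. (real (n j))\<^sup>2) \<le> L * sqrt E / pi"
proof -
  have "(\<Sum>j\<in>A. (pi * real (n j) / L)\<^sup>2) = (pi / L)\<^sup>2 * (\<Sum>j\<in>A. (real (n j))\<^sup>2)"
    by (simp add: sum_distrib_left power_mult_distrib power_divide)
  moreover have "(pi / L)\<^sup>2 * S \<le> E \<longleftrightarrow> S \<le> (L * sqrt E / pi)\<^sup>2" for S
    using assms by (simp add: power_mult_distrib power_divide field_simps)
  ultimately have "n \<in> lattice_ball A L E \<longleftrightarrow> (\<Sum>j\<in>A. (real (n j))\<^sup>2) \<le> (L * sqrt E / pi)\<^sup>2"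
    using assms(3) by (simp add: lattice_ball_def)
  also have "\<dots> \<longleftrightarrow> sqrt (\<Sum>j\<in>A. (real (n j))\<^sup>2) \<le> L * sqrt E / pi"
    using assms by (subst real_sqrt_le_iff[symmetric]) (simp add: real_sqrt_abs)
  finally show ?thesis .
qed

text \<open>
  The volume of the ball of radius \<open>sqrt E\<close> in momentum space, divided by \<open>(2 * pi) ^ p\<close>: the density of states
  of the Laplacian in dimension \<open>p\<close>.
\<close>

definition weyl_density :: "nat \<Rightarrow> real \<Rightarrow> real" where
  "weyl_density p E = unit_ball_vol (real p) * (sqrt (max 0 E) / (2 * pi)) ^ p"

text \<open>The cells of the lattice points in a ball are disjoint and contained in the ball.\<close>

lemma card_lattice_ball_le:
  assumes "finite A" "A \<noteq> {}" "L > 0"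
  shows "real (card (lattice_ball A L E)) \<le> L ^ card A * weyl_density (card A) E"
proof (cases "E \<le> 0")
  case True
  have "lattice_ball A L E = {}"
  proof -
    have "0 < (\<Sum>j\<in>A. (pi * real (n j) / L)\<^sup>2)" if "n \<in> positive_lattice A" for n
      using that assms by (intro sum_pos) (fastforce simp: positive_lattice_def)+
    then show ?thesis using True by (force simp: lattice_ball_def)
  qed
  moreover have "card A > 0" using assms by (simp add: card_gt_0_iff)
  ultimately show ?thesis using True by (simp add: weyl_density_def zero_power)
next
  case False
  let ?r = "L * sqrt E / pi"
  have r: "?r > 0" using False assms by simp
  let ?S = "lattice_ball A L E"
  have S: "?S \<subseteq> positive_lattice A" by (auto simp: lattice_ball_def)
  note fin = finite_lattice_ball[OF assms(1,3), of E]
  have "(\<Union>n\<in>?S. reflected_cell A n) \<subseteq> euclid_ball A ?r"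
  proof safe
    fix n y assume n: "n \<in> ?S" and y: "y \<in> reflected_cell A n"
    have "(\<Sum>i\<in>A. (y i)\<^sup>2) \<le> (\<Sum>i\<in>A. (real (n i))\<^sup>2)"
    proof (rule sum_mono)
      fix i assume "i \<in> A"
      then have "\<bar>y i\<bar> \<le> real (n i)" using y by (auto simp: reflected_cell_def dest!: PiE_mem[where x = i])
      then show "(y i)\<^sup>2 \<le> (real (n i))\<^sup>2" using abs_le_square_iff[of "y i" "real (n i)"] by simp
    qed
    then have "sqrt (\<Sum>i\<in>A. (y i)\<^sup>2) \<le> sqrt (\<Sum>i\<in>A. (real (n i))\<^sup>2)" by simp
    also have "\<dots> \<le> ?r" using lattice_ball_scaled[OF assms(3), of E n A] n S False by auto
    finally show "sqrt (\<Sum>i\<in>A. (y i)\<^sup>2) \<le> ?r" .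
    show "y \<in> space (Pi\<^sub>M A (\<lambda>_. lborel))" using y by (auto simp: space_PiM reflected_cell_def PiE_iff)
  qed
  then have "emeasure (Pi\<^sub>M A (\<lambda>_. lborel)) (\<Union>n\<in>?S. reflected_cell A n)
      \<le> emeasure (Pi\<^sub>M A (\<lambda>_. lborel)) (euclid_ball A ?r)"
    by (intro emeasure_mono euclid_ball_sets assms(1))
  then have "ennreal (real (card ?S) * 2 ^ card A) \<le> ennreal (unit_ball_vol (real (card A)) * ?r ^ card A)"
    unfolding emeasure_union_cells(2)[OF assms(1) fin S] emeasure_cball_aux[OF assms(1) r] .
  then have "real (card ?S) * 2 ^ card A \<le> unit_ball_vol (real (card A)) * ?r ^ card A"
    using r by (subst (asm) ennreal_le_iff) auto
  then have "real (card ?S) \<le> unit_ball_vol (real (card A)) * ?r ^ card A / 2 ^ card A"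
    by (simp add: pos_le_divide_eq)
  also have "\<dots> = L ^ card A * weyl_density (card A) E"
    using False by (simp add: weyl_density_def power_mult_distrib power_divide max_def mult_ac)
  finally show ?thesis .
qed

text \<open>
  A point of the smaller ball lies in a cell whose lattice point is at most \<open>sqrt (card A)\<close> further out.
\<close>

lemma card_lattice_ball_ge:
  assumes "finite A" "L > 0" "E > 0" "sqrt (real (card A)) < L * sqrt E / pi"
  shows "unit_ball_vol (real (card A)) * ((L * sqrt E / pi - sqrt (real (card A))) / 2) ^ card A
    \<le> real (card (lattice_ball A L E))"
proof -
  let ?r = "L * sqrt E / pi"
  define s where "s = ?r - sqrt (real (card A))"
  have s: "s > 0" using assms(4) by (simp add: s_def)
  let ?S = "lattice_ball A L E"
  have S: "?S \<subseteq> positive_lattice A" by (auto simp: lattice_ball_def)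
  note fin = finite_lattice_ball[OF assms(1,2), of E]
  have "euclid_ball A s \<subseteq> (\<Union>n\<in>?S. reflected_cell A n)"
  proof
    fix y assume y: "y \<in> euclid_ball A s"
    define n where "n = (\<lambda>j. if j \<in> A then nat \<lfloor>\<bar>y j\<bar>\<rfloor> + 1 else 0)"
    have n: "n \<in> positive_lattice A" by (simp add: n_def positive_lattice_def)
    have "sqrt (\<Sum>j\<in>A. (real (n j))\<^sup>2) = L2_set (\<lambda>j. real (n j)) A" by (simp add: L2_set_def)
    also have "\<dots> \<le> L2_set (\<lambda>j. \<bar>y j\<bar> + 1) A"
      by (intro L2_set_mono) (auto simp: n_def)
    also have "\<dots> \<le> L2_set (\<lambda>j. \<bar>y j\<bar>) A + L2_set (\<lambda>j. 1) A" by (rule L2_set_triangle_ineq)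
    also have "\<dots> = sqrt (\<Sum>j\<in>A. (y j)\<^sup>2) + sqrt (real (card A))" by (simp add: L2_set_def)
    also have "\<dots> \<le> ?r" using y by (simp add: s_def)
    finally have "n \<in> ?S" using lattice_ball_scaled[OF assms(2) _ n] assms(3) by simp
    moreover have "y \<in> reflected_cell A n"
    proof -
      have "real (n j) - 1 \<le> \<bar>y j\<bar> \<and> \<bar>y j\<bar> < real (n j)" if "j \<in> A" for j
        using that by (simp add: n_def) linarith
      then show ?thesis using y by (auto simp: reflected_cell_def space_PiM PiE_iff)
    qed
    ultimately show "y \<in> (\<Union>n\<in>?S. reflected_cell A n)" by blast
  qed
  then have "emeasure (Pi\<^sub>M A (\<lambda>_. lborel)) (euclid_ball A s)
      \<le> emeasure (Pi\<^sub>M A (\<lambda>_. lborel)) (\<Union>n\<in>?S. reflected_cell A n)"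
    by (intro emeasure_mono emeasure_union_cells(1)[OF assms(1) fin S])
  then have "ennreal (unit_ball_vol (real (card A)) * s ^ card A) \<le> ennreal (real (card ?S) * 2 ^ card A)"
    unfolding emeasure_union_cells(2)[OF assms(1) fin S] emeasure_cball_aux[OF assms(1) s] .
  then have "unit_ball_vol (real (card A)) * s ^ card A \<le> real (card ?S) * 2 ^ card A"
    by (subst (asm) ennreal_le_iff) auto
  then show ?thesis by (simp add: s_def power_divide pos_divide_le_eq)
qed

lemma weyl_density_nonneg: "0 \<le> weyl_density p E"
  by (simp add: weyl_density_def)

lemma isCont_weyl_density: "isCont (weyl_density p) E"
  unfolding weyl_density_def by (intro continuous_intros) auto

theorem lattice_ball_asymptotics:
  assumes "finite A" "A \<noteq> {}"
  shows "((\<lambda>L. real (card (lattice_ball A L E)) / L ^ card A) \<longlongrightarrow> weyl_density (card A) E) at_top"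
proof (rule tendsto_sandwich)
  let ?p = "card A"
  let ?lower = "\<lambda>L. if E > 0 then unit_ball_vol (real ?p) * ((sqrt E / pi - sqrt (real ?p) / L) / 2) ^ ?p else 0"
  show "(?lower \<longlongrightarrow> weyl_density ?p E) at_top"
  proof (cases "E > 0")
    case True
    have "((\<lambda>L. sqrt (real ?p) / L) \<longlongrightarrow> 0) at_top"
      by (intro tendsto_divide_0[OF tendsto_const] filterlim_at_top_imp_at_infinity filterlim_ident)
    then have "((\<lambda>L. unit_ball_vol (real ?p) * ((sqrt E / pi - sqrt (real ?p) / L) / 2) ^ ?p)
        \<longlongrightarrow> unit_ball_vol (real ?p) * ((sqrt E / pi - 0) / 2) ^ ?p) at_top"
      by (intro tendsto_intros) auto
    then show ?thesis using True by (simp add: weyl_density_def max_def mult.commute)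
  next
    case False
    moreover have "?p > 0" using assms by (simp add: card_gt_0_iff)
    ultimately show ?thesis by (simp add: weyl_density_def max_def zero_power)
  qed
  show "((\<lambda>_. weyl_density ?p E) \<longlongrightarrow> weyl_density ?p E) at_top" by simp
  show "\<forall>\<^sub>F L in at_top. real (card (lattice_ball A L E)) / L ^ ?p \<le> weyl_density ?p E"
    using eventually_gt_at_top[of 0]
  proof eventually_elim
    case (elim L)
    then show ?case using card_lattice_ball_le[OF assms elim, of E] by (simp add: divide_le_eq mult.commute)
  qed
  show "\<forall>\<^sub>F L in at_top. ?lower L \<le> real (card (lattice_ball A L E)) / L ^ ?p"
    using eventually_gt_at_top[of "max 1 (sqrt (real ?p) * pi / sqrt E)"]
  proof eventually_elim
    case (elim L)
    then have L: "L > 0" by simp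
    show ?case
    proof (cases "E > 0")
      case True
      have "sqrt (real ?p) * pi / sqrt E < L" using elim by simp
      then have "sqrt (real ?p) * pi < L * sqrt E" using True by (simp add: pos_divide_less_eq)
      then have "sqrt (real ?p) < L * sqrt E / pi" by (simp add: pos_less_divide_eq)
      from card_lattice_ball_ge[OF assms(1) L True this]
      have "unit_ball_vol (real ?p) * ((L * sqrt E / pi - sqrt (real ?p)) / 2) ^ ?p \<le> real (card (lattice_ball A L E))" .
      moreover have "(L * sqrt E / pi - sqrt (real ?p)) / 2 = L * ((sqrt E / pi - sqrt (real ?p) / L) / 2)"
        using L by (simp add: field_simps)
      ultimately have "L ^ ?p * (unit_ball_vol (real ?p) * ((sqrt E / pi - sqrt (real ?p) / L) / 2) ^ ?p)
          \<le> real (card (lattice_ball A L E))"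
        by (simp only: power_mult_distrib mult.left_commute)
      then show ?thesis using True L by (simp add: pos_le_divide_eq mult.commute)
    qed (use L in simp)
  qed
qed

(* In what follows the dollar sign stands for vector components only. *)
no_notation fps_nth (infixl "$" 75)

section \<open>Completeness of the trigonometric system on the cube\<close>

text \<open>On a compact set a continuous map is a quotient map onto its image.\<close>

lemma continuous_factorization:
  fixes \<Theta> :: "'a::euclidean_space \<Rightarrow> 'b::euclidean_space" and \<psi> :: "'a \<Rightarrow> real"
  assumes K: "compact K" and \<Theta>: "continuous_on K \<Theta>" and \<psi>: "continuous_on K \<psi>"
    and fib: "\<And>x y. x \<in> K \<Longrightarrow> y \<in> K \<Longrightarrow> \<Theta> x = \<Theta> y \<Longrightarrow> \<psi> x = \<psi> y"
  obtains \<phi> where "continuous_on (\<Theta> ` K) \<phi>" "\<And>x. x \<in> K \<Longrightarrow> \<phi> (\<Theta> x) = \<psi> x"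
proof -
  define \<phi> where "\<phi> = (\<lambda>q. \<psi> (SOME x. x \<in> K \<and> \<Theta> x = q))"
  have \<phi>: "\<phi> (\<Theta> x) = \<psi> x" if "x \<in> K" for x
  proof -
    have "(SOME y. y \<in> K \<and> \<Theta> y = \<Theta> x) \<in> K \<and> \<Theta> (SOME y. y \<in> K \<and> \<Theta> y = \<Theta> x) = \<Theta> x"
      by (rule someI[of "\<lambda>y. y \<in> K \<and> \<Theta> y = \<Theta> x" x]) (use that in simp)
    then show ?thesis unfolding \<phi>_def using fib[of _ x] that by blast
  qed
  have "closed (\<phi> -` B \<inter> \<Theta> ` K)" if "closed B" for B
  proof -
    have "\<phi> -` B \<inter> \<Theta> ` K = \<Theta> ` (\<psi> -` B \<inter> K)" using \<phi> by auto
    moreover have "closed (\<psi> -` B \<inter> K)"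
      using continuous_on_closed_vimage[OF compact_imp_closed[OF K]] \<psi> that by blast
    then have "compact (\<psi> -` B \<inter> K)" using K by (metis closed_Int_compact inf.idem inf_assoc)
    then have "compact (\<Theta> ` (\<psi> -` B \<inter> K))"
      by (intro compact_continuous_image continuous_on_subset[OF \<Theta>]) auto
    ultimately show ?thesis by (simp add: compact_imp_closed)
  qed
  then have "continuous_on (\<Theta> ` K) \<phi>"
    using continuous_on_closed_vimage[OF compact_imp_closed[OF compact_continuous_image[OF \<Theta> K]]] by blast
  then show thesis using that \<phi> by blast
qed

lemma continuous_on_scaled_coordinate: "continuous_on S (\<lambda>x::real^'n::finite. c * x $ j / L)"
proof -
  have "continuous_on S (\<lambda>x::real^'n. (c / L) * x $ j)" by (intro continuous_intros)
  then show ?thesis by simp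
qed

text \<open>
  The \<open>n j\<close> are arbitrary integers, so that the system is invariant under shifts of the indices.
\<close>

definition trig :: "real \<Rightarrow> 'n \<Rightarrow> int \<Rightarrow> ('n \<Rightarrow> int) \<Rightarrow> real ^ 'n::finite \<Rightarrow> complex" where
  "trig L i1 m n x = (\<Prod>j\<in>UNIV. if j = i1 then cis (2 * pi * of_int m * x $ j / L)
      else complex_of_real (sin (pi * of_int (n j) * x $ j / L)))"

lemma continuous_trig: "continuous_on S (trig L i1 m n)"
proof -
  have "continuous_on S (\<lambda>x::real^'a. if j = i1 then cis (2 * pi * of_int m * x $ j / L)
      else complex_of_real (sin (pi * of_int (n j) * x $ j / L)))" for j
  proof -
    have "continuous_on S (\<lambda>x::real^'a. cis (2 * pi * of_int m * x $ j / L))"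
      by (intro continuous_on_cis continuous_on_scaled_coordinate)
    moreover have "continuous_on S (\<lambda>x::real^'a. complex_of_real (sin (pi * of_int (n j) * x $ j / L)))"
      by (intro continuous_on_of_real continuous_on_sin continuous_on_scaled_coordinate)
    ultimately show ?thesis by (cases "j = i1") simp_all
  qed
  then show ?thesis unfolding trig_def[abs_def] by (intro continuous_on_prod)
qed

lemma trig_times_cis:
  "trig L i1 m n x * cis (2 * pi * of_int l * x $ i1 / L) = trig L i1 (m + l) n x"
proof -
  have "trig L i1 k n x = cis (2 * pi * of_int k * x $ i1 / L)
      * (\<Prod>j\<in>UNIV - {i1}. complex_of_real (sin (pi * of_int (n j) * x $ j / L)))" for k
    unfolding trig_def by (subst prod.remove[of UNIV i1]) (auto intro!: prod.cong)
  then show ?thesis by (simp add: cis_mult add_divide_distrib distrib_left distrib_right mult_ac flip: cis_mult)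
qed

lemma trig_times_cos:
  assumes "j \<noteq> i1"
  shows "trig L i1 m n x * complex_of_real (cos (pi * x $ j / L))
      = (trig L i1 m (n(j := n j + 1)) x + trig L i1 m (n(j := n j - 1)) x) / 2"
proof -
  let ?R = "\<Prod>i\<in>UNIV - {j}. if i = i1 then cis (2 * pi * of_int m * x $ i / L)
      else complex_of_real (sin (pi * of_int (n i) * x $ i / L))"
  have split: "trig L i1 m (n(j := k)) x = complex_of_real (sin (pi * of_int k * x $ j / L)) * ?R" for k
  proof -
    have "(\<Prod>i\<in>UNIV - {j}. if i = i1 then cis (2 * pi * of_int m * x $ i / L)
      else complex_of_real (sin (pi * of_int ((n(j := k)) i) * x $ i / L))) = ?R"
      by (rule prod.cong) auto
    then show ?thesis unfolding trig_def by (subst prod.remove[of UNIV j]) (use assms in simp_all)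
  qed
  let ?t = "pi * x $ j / L"
  have arg: "pi * of_int k * x $ j / L = of_int k * ?t" for k by simp
  have "sin (k * t) * cos t = (sin ((k + 1) * t) + sin ((k - 1) * t)) / 2" for k t :: real
    by (simp add: distrib_right left_diff_distrib sin_add sin_diff)
  from this[of "of_int (n j)" ?t]
  have "sin (of_int (n j) * ?t) * cos ?t = (sin (of_int (n j + 1) * ?t) + sin (of_int (n j - 1) * ?t)) / 2"
    by (simp only: of_int_add of_int_diff of_int_1)
  from arg_cong[OF this, of complex_of_real]
  have e: "complex_of_real (sin (of_int (n j) * ?t)) * complex_of_real (cos ?t)
      = (complex_of_real (sin (of_int (n j + 1) * ?t)) + complex_of_real (sin (of_int (n j - 1) * ?t))) / 2"
    by (simp only: of_real_mult of_real_add of_real_divide of_real_numeral)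
  have "trig L i1 m n x = complex_of_real (sin (of_int (n j) * ?t)) * ?R"
    using split[of "n j"] unfolding fun_upd_triv arg .
  then have "trig L i1 m n x * complex_of_real (cos ?t)
      = (complex_of_real (sin (of_int (n j) * ?t)) * complex_of_real (cos ?t)) * ?R"
    by (simp only: mult_ac)
  then show ?thesis unfolding split arg e by (simp only: times_divide_eq_left distrib_right)
qed

text \<open>
  An integrable function orthogonal to all \<open>trig L i1 m n\<close> vanishes: its product with a fixed sine
  product is orthogonal to the algebra generated by \<open>cos (\<pi> x\<^sub>j / L)\<close> and \<open>exp (\<plusminus> 2 \<pi> i x\<^sub>1 / L)\<close>, to which the
  Stone-Weierstrass theorem applies.
\<close>

locale trig_orthogonal =
  fixes L :: real and i1 :: "'n::finite" and F :: "real ^ 'n \<Rightarrow> complex"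
  assumes L: "L > 0" and F: "integrable (cube_measure L) F"
    and orth: "\<And>m n. (\<integral>x. F x * trig L i1 m n x \<partial>cube_measure L) = 0"
begin

abbreviation "M \<equiv> cube_measure L :: (real ^ 'n) measure"

lemma integrable_mult_continuous:
  fixes h :: "real ^ 'n \<Rightarrow> complex"
  assumes f: "integrable M f" and h: "continuous_on UNIV h"
  shows "integrable M (\<lambda>x. f x * h x)"
proof -
  have "compact (h ` cube L)"
    by (rule compact_continuous_image[OF continuous_on_subset[OF h subset_UNIV] compact_cube])
  then have "bounded (h ` cube L)" by (rule compact_imp_bounded)
  then obtain B where "\<forall>y\<in>h ` cube L. norm y \<le> B" unfolding bounded_iff by blast
  then have B: "\<And>x. x \<in> cube L \<Longrightarrow> norm (h x) \<le> B" by blast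
  have [measurable]: "f \<in> borel_measurable M" using f by simp
  have [measurable]: "h \<in> borel_measurable M"
    by (rule borel_measurable_cube[OF continuous_on_subset[OF h subset_UNIV]])
  show ?thesis
  proof (rule Bochner_Integration.integrable_bound[OF integrable_mult_right[OF integrable_norm[OF f], of B]])
    show "AE x in M. norm (f x * h x) \<le> norm (B * norm (f x))"
    proof (rule AE_I2)
      fix x assume "x \<in> space M"
      then have b: "norm (h x) \<le> B" using B by simp
      have "norm (f x) * norm (h x) \<le> norm (f x) * B" by (intro mult_left_mono b) simp
      moreover have "0 \<le> B" using b norm_ge_zero order_trans by blast
      ultimately show "norm (f x * h x) \<le> norm (B * norm (f x))" by (simp add: norm_mult mult.commute)
    qed
  qed measurable
qed

definition annihilated :: "(real ^ 'n \<Rightarrow> complex) \<Rightarrow> bool" where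
  "annihilated h \<longleftrightarrow> continuous_on UNIV h \<and> (\<forall>m n. (\<integral>x. F x * (trig L i1 m n x * h x) \<partial>M) = 0)"

text \<open>
  The multipliers that preserve annihilation form an algebra; it contains \<open>cos (\<pi> x\<^sub>j / L)\<close>, which shifts
  \<open>n j\<close> by one, and \<open>exp (\<plusminus> 2 \<pi> i x\<^sub>1 / L)\<close>, which shift \<open>m\<close>.
\<close>

definition multiplier :: "(real ^ 'n \<Rightarrow> complex) \<Rightarrow> bool" where
  "multiplier a \<longleftrightarrow> continuous_on UNIV a \<and> (\<forall>h. annihilated h \<longrightarrow> annihilated (\<lambda>x. a x * h x))"

lemma integrable_trig:
  assumes "continuous_on UNIV h"
  shows "integrable M (\<lambda>x. F x * (trig L i1 m n x * h x))"
  by (intro integrable_mult_continuous F continuous_intros continuous_trig assms)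

lemma multiplier_add:
  assumes "multiplier a" "multiplier b"
  shows "multiplier (\<lambda>x. a x + b x)"
  unfolding multiplier_def
proof (intro conjI allI impI)
  show "continuous_on UNIV (\<lambda>x. a x + b x)" using assms by (auto simp: multiplier_def intro!: continuous_intros)
  fix h assume h: "annihilated h"
  then have ah: "annihilated (\<lambda>x. a x * h x)" and bh: "annihilated (\<lambda>x. b x * h x)"
    using assms by (auto simp: multiplier_def)
  then have c: "continuous_on UNIV (\<lambda>x. a x * h x)" "continuous_on UNIV (\<lambda>x. b x * h x)"
    by (auto simp: annihilated_def)
  have "(\<integral>x. F x * (trig L i1 m n x * ((a x + b x) * h x)) \<partial>M)
      = (\<integral>x. F x * (trig L i1 m n x * (a x * h x)) \<partial>M) + (\<integral>x. F x * (trig L i1 m n x * (b x * h x)) \<partial>M)" for m n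
    using Bochner_Integration.integral_add[OF integrable_trig[OF c(1)] integrable_trig[OF c(2)], of m n m n]
    by (simp add: algebra_simps)
  then show "annihilated (\<lambda>x. (a x + b x) * h x)"
    using ah bh continuous_on_add[OF c] by (simp add: annihilated_def distrib_right)
qed

lemma multiplier_mult:
  assumes "multiplier a" "multiplier b"
  shows "multiplier (\<lambda>x. a x * b x)"
  using assms by (auto simp: multiplier_def mult.assoc intro!: continuous_intros)

lemma multiplier_const: "multiplier (\<lambda>x. c)"
  unfolding multiplier_def
proof (intro conjI allI impI)
  fix h assume h: "annihilated h"
  have "(\<integral>x. F x * (trig L i1 m n x * (c * h x)) \<partial>M) = c * (\<integral>x. F x * (trig L i1 m n x * h x) \<partial>M)" for m n
    by (simp add: mult.left_commute[of _ c])
  then show "annihilated (\<lambda>x. c * h x)" using h by (auto simp: annihilated_def intro!: continuous_intros)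
qed simp

lemma multiplier_sum:
  assumes "\<And>i. i \<in> J \<Longrightarrow> multiplier (a i)"
  shows "multiplier (\<lambda>x. \<Sum>i\<in>J. a i x)"
  using assms by (induction J rule: infinite_finite_induct) (auto intro: multiplier_add multiplier_const)

lemma multiplier_cis: "multiplier (\<lambda>x. cis (2 * pi * of_int l * x $ i1 / L))"
  unfolding multiplier_def
proof (intro conjI allI impI)
  fix h assume h: "annihilated h"
  have e: "trig L i1 m n x * (cis (2 * pi * of_int l * x $ i1 / L) * h x) = trig L i1 (m + l) n x * h x" for m n x
    by (simp only: trig_times_cis mult.assoc[symmetric])
  show "annihilated (\<lambda>x. cis (2 * pi * of_int l * x $ i1 / L) * h x)"
    using h unfolding annihilated_def e
    by (intro conjI continuous_on_mult continuous_on_cis continuous_on_scaled_coordinate) blast+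
qed (rule continuous_on_cis[OF continuous_on_scaled_coordinate])

lemma multiplier_cos:
  assumes "j \<noteq> i1"
  shows "multiplier (\<lambda>x. complex_of_real (cos (pi * x $ j / L)))"
  unfolding multiplier_def
proof (intro conjI allI impI)
  fix h assume h: "annihilated h"
  then have ch: "continuous_on UNIV h" by (simp add: annihilated_def)
  have "(\<integral>x. F x * (trig L i1 m n x * (complex_of_real (cos (pi * x $ j / L)) * h x)) \<partial>M) = 0" for m n
  proof -
    let ?p = "\<lambda>x. F x * (trig L i1 m (n(j := n j + 1)) x * h x)" and ?q = "\<lambda>x. F x * (trig L i1 m (n(j := n j - 1)) x * h x)"
    have e: "F x * (trig L i1 m n x * (complex_of_real (cos (pi * x $ j / L)) * h x)) = (?p x + ?q x) / 2" for x
    proof -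
      have "F x * (trig L i1 m n x * (complex_of_real (cos (pi * x $ j / L)) * h x))
          = F x * ((trig L i1 m n x * complex_of_real (cos (pi * x $ j / L))) * h x)" by (simp only: mult.assoc)
      also have "\<dots> = (?p x + ?q x) / 2" unfolding trig_times_cos[OF assms] by (simp add: field_simps)
      finally show ?thesis .
    qed
    have "(\<integral>x. (?p x + ?q x) / 2 \<partial>M) = (integral\<^sup>L M ?p + integral\<^sup>L M ?q) / 2"
      using integrable_trig[OF ch] by simp
    also have "\<dots> = 0" using h by (simp add: annihilated_def)
    finally show ?thesis unfolding e .
  qed
  then show "annihilated (\<lambda>x. complex_of_real (cos (pi * x $ j / L)) * h x)"
    using ch unfolding annihilated_def
    by (intro conjI continuous_on_mult continuous_on_of_real continuous_on_cos continuous_on_scaled_coordinate) blast+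
qed (rule continuous_on_of_real[OF continuous_on_cos[OF continuous_on_scaled_coordinate]])

text \<open>
  The generators of the algebra; on the cube they separate points up to the identification of the faces
  \<open>x\<^sub>1 = 0\<close> and \<open>x\<^sub>1 = L\<close>.
\<close>

definition \<Theta> :: "real ^ 'n \<Rightarrow> (real ^ 'n) \<times> complex" where
  "\<Theta> x = ((\<chi> j. if j = i1 then 0 else cos (pi * x $ j / L)), cis (2 * pi * x $ i1 / L))"

lemma continuous_Theta: "continuous_on S \<Theta>"
proof -
  have "continuous_on S (\<lambda>x::real^'n. if j = i1 then 0 else cos (pi * x $ j / L))" for j
  proof -
    have "continuous_on S (\<lambda>x::real^'n. cos (pi * x $ j / L))"
      by (intro continuous_on_cos continuous_on_scaled_coordinate)
    then show ?thesis by (cases "j = i1") simp_all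
  qed
  then have "continuous_on S (\<lambda>x::real^'n. (\<chi> j. if j = i1 then 0 else cos (pi * x $ j / L)) :: real^'n)"
    by (rule continuous_on_vec_lambda)
  then show ?thesis
    unfolding \<Theta>_def[abs_def] by (intro continuous_on_Pair continuous_on_cis continuous_on_scaled_coordinate)
qed

lemma multiplier_Re_Im:
  "multiplier (\<lambda>x. complex_of_real (Re (cis (2 * pi * x $ i1 / L))))"
  "multiplier (\<lambda>x. complex_of_real (Im (cis (2 * pi * x $ i1 / L))))"
proof -
  have m: "multiplier (\<lambda>x. cis (2 * pi * x $ i1 / L))" "multiplier (\<lambda>x. cis (- (2 * pi * x $ i1 / L)))"
    using multiplier_cis[of 1] multiplier_cis[of "-1"] by simp_all
  have "multiplier (\<lambda>x. 1 / 2 * (cis (2 * pi * x $ i1 / L) + cis (- (2 * pi * x $ i1 / L))))"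
    by (intro multiplier_mult multiplier_const multiplier_add m)
  moreover have "1 / 2 * (cis t + cis (- t)) = complex_of_real (Re (cis t))" for t
    by (simp add: complex_eq_iff)
  ultimately show "multiplier (\<lambda>x. complex_of_real (Re (cis (2 * pi * x $ i1 / L))))" by (simp only:)
  have "multiplier (\<lambda>x. - \<i> / 2 * (cis (2 * pi * x $ i1 / L) + (- 1) * cis (- (2 * pi * x $ i1 / L))))"
    by (intro multiplier_mult multiplier_const multiplier_add m)
  moreover have "- \<i> / 2 * (cis t + (- 1) * cis (- t)) = complex_of_real (Im (cis t))" for t
    by (simp add: complex_eq_iff)
  ultimately show "multiplier (\<lambda>x. complex_of_real (Im (cis (2 * pi * x $ i1 / L))))" by (simp only:)
qed

lemma multiplier_polynomial:
  fixes p :: "(real ^ 'n) \<times> complex \<Rightarrow> real"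
  assumes "real_polynomial_function p"
  shows "multiplier (\<lambda>x. complex_of_real (p (\<Theta> x)))"
  using assms
proof (induction p rule: real_polynomial_function.induct)
  case (linear f)
  interpret f: bounded_linear f by fact
  define a where "a = (\<lambda>j. f (axis j 1, 0))"
  have expand: "f (v, z) = (\<Sum>j\<in>UNIV. v $ j * a j) + Re z * f (0, 1) + Im z * f (0, \<i>)" for v z
  proof -
    have "v = (\<Sum>j\<in>UNIV. v $ j *\<^sub>R axis j 1)" using basis_expansion[of v] by (simp add: scalar_mult_eq_scaleR)
    moreover have lin: "linear (\<lambda>v. f (v, 0))"
    proof (rule linearI)
      show "f (v + w, 0) = f (v, 0) + f (w, 0)" for v w by (simp flip: f.add)
      show "f (r *\<^sub>R v, 0) = r *\<^sub>R f (v, 0)" for r v using f.scaleR[of r "(v, 0)"] by simp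
    qed
    ultimately have 1: "f (v, 0) = (\<Sum>j\<in>UNIV. v $ j * a j)"
      using linear_sum[OF lin, of "\<lambda>j. v $ j *\<^sub>R axis j 1" UNIV] linear_scale[OF lin]
      by (simp add: a_def)
    have "(v, z) = (v, 0) + (Re z *\<^sub>R (0, 1) + Im z *\<^sub>R (0, \<i>))" by (simp add: complex_eq_iff)
    then have "f (v, z) = f (v, 0) + (f (Re z *\<^sub>R (0, 1)) + f (Im z *\<^sub>R (0, \<i>)))" by (simp only: f.add)
    then show ?thesis by (simp only: 1 f.scaleR real_scaleR_def add.assoc)
  qed
  have "multiplier (\<lambda>x. complex_of_real (if j = i1 then 0 else cos (pi * x $ j / L)) * complex_of_real (a j))" for j
    by (cases "j = i1") (auto intro!: multiplier_mult multiplier_const multiplier_cos)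
  then have "multiplier (\<lambda>x. \<Sum>j\<in>UNIV. complex_of_real (if j = i1 then 0 else cos (pi * x $ j / L)) * complex_of_real (a j))"
    by (rule multiplier_sum)
  then have "multiplier (\<lambda>x. (\<Sum>j\<in>UNIV. complex_of_real (if j = i1 then 0 else cos (pi * x $ j / L)) * complex_of_real (a j))
      + complex_of_real (Re (cis (2 * pi * x $ i1 / L))) * complex_of_real (f (0, 1))
      + complex_of_real (Im (cis (2 * pi * x $ i1 / L))) * complex_of_real (f (0, \<i>)))"
    by (rule multiplier_add[OF multiplier_add]; intro multiplier_mult multiplier_const multiplier_Re_Im)
  moreover have "f (\<Theta> x) = (\<Sum>j\<in>UNIV. (if j = i1 then 0 else cos (pi * x $ j / L)) * a j)
      + Re (cis (2 * pi * x $ i1 / L)) * f (0, 1) + Im (cis (2 * pi * x $ i1 / L)) * f (0, \<i>)" for x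
    unfolding \<Theta>_def by (subst expand) (simp only: vec_lambda_beta)
  ultimately show ?case by (simp only: of_real_add of_real_sum of_real_mult)
next
  case (const c)
  show ?case by (rule multiplier_const)
next
  case (add f g)
  then show ?case using multiplier_add[OF add.IH] by (simp only: of_real_add)
next
  case (mult f g)
  then show ?case using multiplier_mult[OF mult.IH] by (simp only: of_real_mult)
qed

text \<open>The sine product has no zero in the interior of the cube.\<close>

definition G :: "real ^ 'n \<Rightarrow> complex" where "G x = F x * trig L i1 0 (\<lambda>_. 1) x"

lemma G_integrable: "integrable M G"
  unfolding G_def by (intro integrable_mult_continuous F continuous_trig)

lemma annihilated_one: "annihilated (\<lambda>_. 1)"
  using orth by (simp add: annihilated_def)

text \<open>
  A function factoring through \<open>\<Theta>\<close> is a uniform limit of polynomials in the generators.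
\<close>

lemma integral_G_factored:
  fixes \<psi> :: "real ^ 'n \<Rightarrow> real"
  assumes \<psi>: "continuous_on UNIV \<psi>"
    and fib: "\<And>x y. x \<in> cube L \<Longrightarrow> y \<in> cube L \<Longrightarrow> \<Theta> x = \<Theta> y \<Longrightarrow> \<psi> x = \<psi> y"
  shows "(\<integral>x. G x * complex_of_real (\<psi> x) \<partial>M) = 0"
proof -
  obtain \<phi> where \<phi>: "continuous_on (\<Theta> ` cube L) \<phi>" "\<And>x. x \<in> cube L \<Longrightarrow> \<phi> (\<Theta> x) = \<psi> x"
    using continuous_factorization[OF compact_cube continuous_Theta continuous_on_subset[OF \<psi> subset_UNIV] fib] by blast
  have K: "compact (\<Theta> ` cube L)" by (rule compact_continuous_image[OF continuous_Theta compact_cube])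
  define I where "I = (\<integral>x. norm (G x) \<partial>M)"
  have I: "0 \<le> I" by (simp add: I_def)
  have "norm (\<integral>x. G x * complex_of_real (\<psi> x) \<partial>M) \<le> \<epsilon> * I" if \<epsilon>: "\<epsilon> > 0" for \<epsilon>
  proof -
    obtain p where p: "polynomial_function p" "\<And>q. q \<in> \<Theta> ` cube L \<Longrightarrow> norm (\<phi> q - p q) < \<epsilon>"
      using Stone_Weierstrass_polynomial_function[OF K \<phi>(1) \<epsilon>] by blast
    then have mp: "multiplier (\<lambda>x. complex_of_real (p (\<Theta> x)))"
      by (intro multiplier_polynomial) (simp add: real_polynomial_function_eq)
    then have "annihilated (\<lambda>x. complex_of_real (p (\<Theta> x)) * 1)"
      using annihilated_one unfolding multiplier_def by blast
    then have zero: "(\<integral>x. G x * complex_of_real (p (\<Theta> x)) \<partial>M) = 0"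
      by (simp add: annihilated_def G_def mult.assoc)
    have i1: "integrable M (\<lambda>x. G x * complex_of_real (\<psi> x))"
      by (intro integrable_mult_continuous G_integrable continuous_intros \<psi>)
    have i2: "integrable M (\<lambda>x. G x * complex_of_real (p (\<Theta> x)))"
      using mp by (intro integrable_mult_continuous G_integrable) (simp add: multiplier_def)
    have "(\<integral>x. G x * complex_of_real (\<psi> x) \<partial>M) = (\<integral>x. G x * complex_of_real (\<psi> x) - G x * complex_of_real (p (\<Theta> x)) \<partial>M)"
      using Bochner_Integration.integral_diff[OF i1 i2] zero by simp
    also have "norm \<dots> \<le> (\<integral>x. norm (G x * complex_of_real (\<psi> x) - G x * complex_of_real (p (\<Theta> x))) \<partial>M)"
      by (rule integral_norm_bound)
    also have "\<dots> \<le> (\<integral>x. \<epsilon> * norm (G x) \<partial>M)"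
    proof (rule integral_mono)
      fix x assume "x \<in> space M"
      then have x: "x \<in> cube L" by simp
      have "G x * complex_of_real (\<psi> x) - G x * complex_of_real (p (\<Theta> x)) = G x * complex_of_real (\<psi> x - p (\<Theta> x))"
        by (simp add: algebra_simps)
      then have "norm (G x * complex_of_real (\<psi> x) - G x * complex_of_real (p (\<Theta> x))) = norm (G x) * \<bar>\<psi> x - p (\<Theta> x)\<bar>"
        by (simp only: norm_mult norm_of_real)
      also have "\<dots> \<le> norm (G x) * \<epsilon>"
        using p(2)[of "\<Theta> x"] \<phi>(2)[OF x] x by (intro mult_left_mono) auto
      finally show "norm (G x * complex_of_real (\<psi> x) - G x * complex_of_real (p (\<Theta> x))) \<le> \<epsilon> * norm (G x)"
        by (simp add: mult.commute)
    qed (use G_integrable i1 i2 in auto)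
    finally show ?thesis by (simp add: I_def)
  qed
  then have *: "norm (\<integral>x. G x * complex_of_real (\<psi> x) \<partial>M) \<le> \<epsilon> * I" if "\<epsilon> > 0" for \<epsilon> using that by blast
  have "norm (\<integral>x. G x * complex_of_real (\<psi> x) \<partial>M) \<le> 0 + e" if "e > 0" for e
  proof -
    have "norm (\<integral>x. G x * complex_of_real (\<psi> x) \<partial>M) \<le> e / (I + 1) * I" using I that by (intro *) simp
    also have "\<dots> \<le> e" using I that by (simp add: field_simps)
    finally show ?thesis by simp
  qed
  then have "norm (\<integral>x. G x * complex_of_real (\<psi> x) \<partial>M) \<le> 0" by (rule field_le_epsilon)
  then show ?thesis by simp
qed

lemma Theta_fibre:
  assumes x: "x \<in> cube L" and y: "y \<in> cube L" and eq: "\<Theta> x = \<Theta> y"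
  shows "x = y \<or> (x $ i1 \<in> {0, L} \<and> y $ i1 \<in> {0, L})"
proof -
  have other: "x $ j = y $ j" if "j \<noteq> i1" for j
  proof -
    have "fst (\<Theta> x) $ j = fst (\<Theta> y) $ j" using eq by simp
    then have c: "cos (pi * x $ j / L) = cos (pi * y $ j / L)" using that by (simp add: \<Theta>_def)
    have r: "0 \<le> pi * v / L" "pi * v / L \<le> pi" if "0 \<le> v" "v \<le> L" for v
      using that L by (simp_all add: divide_le_eq)
    have v: "0 \<le> x $ j" "x $ j \<le> L" "0 \<le> y $ j" "y $ j \<le> L" using x y by (auto simp: cube_def)
    have "pi * x $ j / L = pi * y $ j / L"
      by (rule cos_inj_pi[OF r[OF v(1,2)] r[OF v(3,4)] c])
    then show ?thesis using L by simp
  qed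
  have "cis (2 * pi * x $ i1 / L) = cis (2 * pi * y $ i1 / L)" using eq by (simp add: \<Theta>_def)
  then have "sin (2 * pi * x $ i1 / L) = sin (2 * pi * y $ i1 / L) \<and> cos (2 * pi * x $ i1 / L) = cos (2 * pi * y $ i1 / L)"
    by (simp add: complex_eq_iff)
  then obtain k :: int where "2 * pi * x $ i1 / L = 2 * pi * y $ i1 / L + 2 * pi * of_int k"
    using sin_cos_eq_iff by blast
  then have "2 * pi * (x $ i1 / L) = 2 * pi * (y $ i1 / L + of_int k)" by (simp add: distrib_left)
  then have "x $ i1 / L = y $ i1 / L + of_int k" 
    by (rule mult_left_cancel[of "2 * pi", THEN iffD1, rotated]) simp
  then have k: "x $ i1 = y $ i1 + L * of_int k" using L by (simp add: field_simps)
  have b: "0 \<le> x $ i1" "x $ i1 \<le> L" "0 \<le> y $ i1" "y $ i1 \<le> L" using x y by (auto simp: cube_def)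
  have "L * of_int k \<le> L * 1" "L * of_int (- 1) \<le> L * of_int k" using k b by auto
  then have "real_of_int k \<le> 1" "real_of_int (- 1) \<le> of_int k"
    using L by (simp_all only: mult_le_cancel_left_pos)
  then have "k \<le> 1" "- 1 \<le> k" by (simp_all only: of_int_le_iff of_int_le_1_iff)
  then consider "k = 0" | "k = 1" | "k = -1" by linarith
  then show ?thesis
  proof cases
    case 1
    then have "x $ j = y $ j" for j using other k by (cases "j = i1") auto
    then show ?thesis by (simp add: vec_eq_iff)
  qed (use k b in auto)
qed

text \<open>
  Multiplied by \<open>s\<close>, every continuous function factors through \<open>\<Theta>\<close>, so that \<open>G s\<close> is orthogonal to all
  continuous functions.  It therefore has integral zero over closed sets, and by Dynkin's lemma over
  all Borel sets.
\<close>

lemma AE_F_zero: "AE x in M. F x = 0"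
proof -
  interpret finite_measure M by (rule finite_measure_cube)
  \<comment> \<open>\<open>s\<close> vanishes on the two faces identified by \<open>\<Theta>\<close>\<close>
  define s where "s = (\<lambda>x::real^'n. sin (pi * x $ i1 / L))"
  define f where "f = (\<lambda>x. G x * complex_of_real (s x))"
  have cs: "continuous_on S s" for S
    unfolding s_def by (intro continuous_on_sin continuous_on_scaled_coordinate)
  have f: "integrable M f"
    unfolding f_def by (intro integrable_mult_continuous G_integrable continuous_intros cs)
  have [measurable]: "f \<in> borel_measurable M" using f by simp
  have sets_M: "A \<in> sets M" if "A \<in> sets borel" "A \<subseteq> cube L" for A
    using that by (auto simp: cube_measure_def sets_restrict_space_iff)
  have ind_meas: "indicator A \<in> borel_measurable M" if "A \<in> sets borel" for A :: "(real^'n) set"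
    unfolding cube_measure_def using that by (intro measurable_restrict_space1) simp
  have closed0: "(\<integral>x. indicator C x *\<^sub>R f x \<partial>M) = 0" if C: "closed C" for C
  proof (cases "C = {}")
    case False
    \<comment> \<open>continuous cutoffs decreasing to the indicator of \<open>C\<close>\<close>
    define \<psi> where "\<psi> = (\<lambda>k x. max 0 (1 - real k * infdist x C))"
    have c\<psi>: "continuous_on UNIV (\<psi> k)" for k
      unfolding \<psi>_def by (intro continuous_intros)
    have zero: "(\<integral>x. f x * complex_of_real (\<psi> k x) \<partial>M) = 0" for k
    proof -
      have "(\<integral>x. G x * complex_of_real (s x * \<psi> k x) \<partial>M) = 0"
      proof (rule integral_G_factored)
        show "continuous_on UNIV (\<lambda>x. s x * \<psi> k x)" by (intro continuous_intros cs c\<psi>)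
        fix x y assume "x \<in> cube L" "y \<in> cube L" "\<Theta> x = \<Theta> y"
        from Theta_fibre[OF this] show "s x * \<psi> k x = s y * \<psi> k y"
          using L by (auto simp: s_def)
      qed
      then show ?thesis by (simp add: f_def mult.assoc)
    qed
    have "(\<lambda>k. \<integral>x. f x * complex_of_real (\<psi> k x) \<partial>M) \<longlonglongrightarrow> (\<integral>x. indicator C x *\<^sub>R f x \<partial>M)"
    proof (rule integral_dominated_convergence[where w = "\<lambda>x. norm (f x)"])
      show "(\<lambda>x. indicator C x *\<^sub>R f x) \<in> borel_measurable M"
        using ind_meas[of C] C by (intro borel_measurable_scaleR) auto
      show "(\<lambda>x. f x * complex_of_real (\<psi> k x)) \<in> borel_measurable M" for k
        using integrable_mult_continuous[OF f, of "\<lambda>x. complex_of_real (\<psi> k x)"] c\<psi>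
        by (auto intro!: continuous_intros)
      show "AE x in M. (\<lambda>k. f x * complex_of_real (\<psi> k x)) \<longlonglongrightarrow> indicator C x *\<^sub>R f x"
      proof (rule AE_I2)
        fix x
        have "(\<lambda>k. \<psi> k x) \<longlonglongrightarrow> indicator C x"
        proof (cases "x \<in> C")
          case True
          then show ?thesis by (simp add: \<psi>_def)
        next
          case False
          then have d: "0 < infdist x C"
            using infdist_pos_not_in_closed[OF C \<open>C \<noteq> {}\<close>] by blast
          obtain k0 :: nat where k0: "1 / infdist x C < real k0" using reals_Archimedean2 by blast
          have "\<psi> k x = 0" if "k0 \<le> k" for k
          proof -
            have "1 / infdist x C \<le> real k" using k0 that by linarith
            then have "1 \<le> real k * infdist x C" using d by (simp add: divide_le_eq)
            then show ?thesis by (simp add: \<psi>_def)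
          qed
          then have "\<forall>\<^sub>F k in sequentially. \<psi> k x = indicator C x"
            using False by (intro eventually_sequentiallyI[of k0]) simp
          then show ?thesis by (rule tendsto_eventually)
        qed
        then have "(\<lambda>k. f x * complex_of_real (\<psi> k x)) \<longlonglongrightarrow> f x * complex_of_real (indicator C x)"
          by (intro tendsto_intros)
        then show "(\<lambda>k. f x * complex_of_real (\<psi> k x)) \<longlonglongrightarrow> indicator C x *\<^sub>R f x"
          by (simp add: scaleR_conv_of_real mult.commute)
      qed
      show "AE x in M. norm (f x * complex_of_real (\<psi> k x)) \<le> norm (f x)" for k
      proof (rule AE_I2)
        fix x
        have "\<bar>\<psi> k x\<bar> \<le> 1" using infdist_nonneg[of x C] by (auto simp: \<psi>_def)
        then show "norm (f x * complex_of_real (\<psi> k x)) \<le> norm (f x)"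
          by (simp add: norm_mult mult_left_le)
      qed
    qed (use f in simp)
    then show ?thesis unfolding zero by (simp add: LIMSEQ_const_iff)
  qed simp
  have borel0: "(\<integral>x. indicator A x *\<^sub>R f x \<partial>M) = 0" if "A \<in> sets borel" for A
  proof -
    have "A \<in> sigma_sets UNIV (Collect closed)" using that by (simp add: borel_eq_closed)
    have stable: "Int_stable (Collect closed :: (real^'n) set set)" by (auto simp: Int_stable_def)
    have "Collect closed \<subseteq> Pow (UNIV :: (real^'n) set)" by simp
    from stable this \<open>A \<in> sigma_sets UNIV (Collect closed)\<close> show ?thesis
    proof (induction rule: sigma_sets_induct_disjoint)
      case (basic A)
      then show ?case using closed0 by simp
    next
      case empty
      show ?case by simp
    next
      case (compl A)
      then have A: "A \<in> sets borel" by (simp add: borel_eq_closed)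
      have iA: "integrable M (\<lambda>x. indicator A x *\<^sub>R f x)"
        by (rule Bochner_Integration.integrable_bound[OF f])
           (use ind_meas[OF A] in \<open>auto intro!: borel_measurable_scaleR split: split_indicator\<close>)
      have "(\<integral>x. indicator (UNIV - A) x *\<^sub>R f x \<partial>M) = (\<integral>x. f x - indicator A x *\<^sub>R f x \<partial>M)"
        by (intro Bochner_Integration.integral_cong) (auto split: split_indicator)
      also have "\<dots> = integral\<^sup>L M f - 0" using Bochner_Integration.integral_diff[OF f iA] compl by simp
      also have "integral\<^sup>L M f = 0" using closed0[OF closed_UNIV] by simp
      finally show ?case by simp
    next
      case (union A)
      have A: "A i \<in> sets borel" for i using union(2) by (auto simp: borel_eq_closed)
      have Ai: "A i \<inter> cube L \<in> sets M" for i using A by (intro sets_M) auto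
      have restrict: "(\<integral>x. indicator B x *\<^sub>R f x \<partial>M) = (LINT x:(B \<inter> cube L)|M. f x)" for B
        unfolding set_lebesgue_integral_def
        by (intro Bochner_Integration.integral_cong) (auto split: split_indicator)
      have "(LINT x:(\<Union>i. A i \<inter> cube L)|M. f x) = (\<Sum>i. (LINT x:(A i \<inter> cube L)|M. f x))"
      proof (rule lebesgue_integral_countable_add[OF Ai])
        show "(A i \<inter> cube L) \<inter> (A j \<inter> cube L) = {}" if "i \<noteq> j" for i j
          using union(1) that by (auto simp: disjoint_family_on_def)
        show "set_integrable M (\<Union>i. A i \<inter> cube L) f"
          unfolding set_integrable_def
          by (intro integrable_mult_indicator f sets.countable_nat_UN) (use Ai in blast)
      qed
      moreover have "(\<Union>i. A i \<inter> cube L) = (\<Union>(range A)) \<inter> cube L" by auto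
      ultimately show ?case using restrict union(3) by simp
    qed
  qed
  have "AE x in M. f x = 0"
  proof (rule density_zero[OF f])
    fix A assume "A \<in> sets M"
    then have "A \<in> sets borel" by (auto simp: cube_measure_def sets_restrict_space)
    then show "(LINT x:A|M. f x) = 0" using borel0 by (simp add: set_lebesgue_integral_def)
  qed
  moreover have "AE x in M. \<forall>j. 0 < x $ j \<and> x $ j < L"
  proof -
    let ?N = "cbox 0 (\<chi> i. L) - box 0 (\<chi> i. L) :: (real^'n) set"
    have "emeasure lborel ?N = emeasure lborel (cbox 0 (\<chi> i. L) :: (real^'n) set) - emeasure lborel (box 0 (\<chi> i. L) :: (real^'n) set)"
      by (rule emeasure_Diff) (auto simp: emeasure_lborel_box_eq box_subset_cbox)
    also have "\<dots> = 0" by (simp add: emeasure_lborel_box_eq emeasure_lborel_cbox_eq)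
    finally have "AE x in lborel. x \<notin> ?N" by (intro AE_not_in) (auto simp: null_sets_def)
    then have "AE x::real^'n in lborel. x \<in> cube L \<longrightarrow> (\<forall>j. 0 < x $ j \<and> x $ j < L)"
      by (rule eventually_mono) (auto simp: cube_eq_cbox mem_box_cart)
    then show ?thesis unfolding cube_measure_def by (simp add: AE_restrict_space_iff)
  qed
  ultimately show ?thesis
  proof eventually_elim
    case (elim x)
    have pos: "0 < sin (pi * x $ j / L)" for j
    proof (rule sin_gt_zero)
      show "0 < pi * x $ j / L" using elim(2) L by simp
      show "pi * x $ j / L < pi" using elim(2) L by (simp add: divide_less_eq)
    qed
    have nz: "(if j = i1 then cis (2 * pi * of_int 0 * x $ j / L)
      else complex_of_real (sin (pi * of_int 1 * x $ j / L))) \<noteq> 0" for j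
      using pos[of j] by simp
    have "trig L i1 0 (\<lambda>_. 1) x \<noteq> 0" unfolding trig_def using nz by (simp add: prod_zero_iff)
    moreover have "s x \<noteq> 0" using pos[of i1] by (simp add: s_def)
    ultimately show ?case using elim(1) by (simp add: f_def G_def)
  qed
qed

end

section \<open>Separated eigenfunctions\<close>

abbreviation quasi_momentum :: "real \<Rightarrow> int \<Rightarrow> real" where
  "quasi_momentum L m \<equiv> 2 * pi * of_int m / L"

text \<open>
  With the momentum \<open>\<xi> = 2 \<pi> m / L\<close> in direction \<open>x\<^sub>1\<close> the operator \<open>(D\<^sub>1 + x\<^sub>2)\<^sup>2 + D\<^sub>2\<^sup>2\<close> becomes
  \<open>(x\<^sub>2 + \<xi>)\<^sup>2 + D\<^sub>2\<^sup>2\<close> on \<open>[0, L]\<close>, an oscillator on the well \<open>[\<xi>, \<xi> + L]\<close>.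
\<close>

abbreviation landau_ev :: "real \<Rightarrow> int \<Rightarrow> nat \<Rightarrow> real" where
  "landau_ev L m k \<equiv> dirichlet_ev (quasi_momentum L m) (quasi_momentum L m + L) k"

text \<open>The \<open>k\<close>-th Dirichlet eigenfunction on \<open>[\<xi>, \<xi> + L]\<close>, moved to \<open>[0, L]\<close>.\<close>

definition well_fun :: "real \<Rightarrow> int \<Rightarrow> nat \<Rightarrow> complex \<Rightarrow> complex" where
  "well_fun L m k z = shoot (quasi_momentum L m) (landau_ev L m k) (z + of_real (quasi_momentum L m))"

text \<open>
  The factor \<open>h\<close> in direction \<open>i2\<close> is left open: besides the well functions, sines and their differences
  from eigenfunction expansions are put there.
\<close>

definition separated :: "real \<Rightarrow> 'n \<Rightarrow> 'n \<Rightarrow> int \<Rightarrow> (complex \<Rightarrow> complex) \<Rightarrow> ('n \<Rightarrow> nat) \<Rightarrow> 'n \<Rightarrow> complex \<Rightarrow> complex" where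
  "separated L i1 i2 m h n = (\<lambda>j. if j = i1 then (\<lambda>z. exp (\<i> * of_real (quasi_momentum L m) * z))
      else if j = i2 then h else (\<lambda>z. sin (of_real (pi * real (n j) / L) * z)))"

lemma well_fun_deriv:
  "(well_fun L m k has_field_derivative shoot' (quasi_momentum L m) (landau_ev L m k) (z + of_real (quasi_momentum L m))) (at z)"
proof -
  have "((\<lambda>z::complex. z + of_real (quasi_momentum L m)) has_field_derivative 1) (at z)"
    by (auto intro!: derivative_eq_intros)
  from DERIV_chain2[OF shoot_deriv this] show ?thesis unfolding well_fun_def[abs_def] by simp
qed

lemma well_fun_deriv2:
  "((\<lambda>z. shoot' (quasi_momentum L m) (landau_ev L m k) (z + of_real (quasi_momentum L m)))
      has_field_derivative ((z + of_real (quasi_momentum L m))\<^sup>2 - of_real (landau_ev L m k)) * well_fun L m k z) (at (z::complex))"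
proof -
  have "((\<lambda>z::complex. z + of_real (quasi_momentum L m)) has_field_derivative 1) (at z)"
    by (auto intro!: derivative_eq_intros)
  from DERIV_chain2[OF shoot'_deriv this] show ?thesis unfolding well_fun_def by simp
qed

lemma well_fun_entire: "well_fun L m k holomorphic_on UNIV"
  using well_fun_deriv field_differentiable_at_within by (force simp: holomorphic_on_def field_differentiable_def)

lemma deriv_well_fun:
  "deriv (deriv (well_fun L m k)) z = ((z + of_real (quasi_momentum L m))\<^sup>2 - of_real (landau_ev L m k)) * well_fun L m k z"
proof -
  have "deriv (well_fun L m k) = (\<lambda>z. shoot' (quasi_momentum L m) (landau_ev L m k) (z + of_real (quasi_momentum L m)))"
    using well_fun_deriv by (intro ext DERIV_imp_deriv)
  then show ?thesis using DERIV_imp_deriv[OF well_fun_deriv2] by simp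
qed

lemma well_fun_of_real:
  "well_fun L m k (of_real t) = of_real (shoot (quasi_momentum L m) (landau_ev L m k) (t + quasi_momentum L m))"
  unfolding well_fun_def by (simp only: of_real_add[symmetric] shoot_of_real)

lemma well_fun_boundary:
  assumes "L > 0"
  shows "well_fun L m k 0 = 0" "well_fun L m k (of_real L) = 0"
proof -
  show "well_fun L m k 0 = 0" using well_fun_of_real[of L m k 0] by simp
  show "well_fun L m k (of_real L) = 0"
    using well_fun_of_real[of L m k L] dirichlet_ev_boundary[of "quasi_momentum L m" "quasi_momentum L m + L" k] assms
    by (simp add: add.commute)
qed

lemma deriv_exp_linear: "deriv (\<lambda>z. exp (c * z)) = (\<lambda>z::complex. c * exp (c * z))"
  by (intro ext DERIV_imp_deriv) (auto intro!: derivative_eq_intros)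

lemma deriv_sin_linear: "deriv (deriv (\<lambda>z. sin (c * z))) = (\<lambda>z::complex. - (c\<^sup>2) * sin (c * z))"
proof -
  have "deriv (\<lambda>z. sin (c * z)) = (\<lambda>z::complex. c * cos (c * z))"
    by (intro ext DERIV_imp_deriv) (auto intro!: derivative_eq_intros)
  then show ?thesis
    by (simp only:) (intro ext DERIV_imp_deriv, auto intro!: derivative_eq_intros simp: power2_eq_square)
qed

lemma separated_entire:
  assumes "h holomorphic_on UNIV"
  shows "separated L i1 i2 m h n j holomorphic_on UNIV"
  unfolding separated_def using assms by (auto intro!: holomorphic_intros)

lemma deriv2_exp_linear: "deriv (deriv (\<lambda>z. exp (c * z))) z = c\<^sup>2 * exp (c * (z::complex))"
proof -
  have "deriv (\<lambda>z::complex. c * exp (c * z)) z = c\<^sup>2 * exp (c * z)"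
    by (intro DERIV_imp_deriv) (auto intro!: derivative_eq_intros simp: power2_eq_square)
  then show ?thesis by (simp only: deriv_exp_linear)
qed

lemma tensor_upd_scaled:
  assumes "\<And>z. h z = q z * g j z"
  shows "tensor (g(j := h)) x = q (complex_of_real (x $ j)) * tensor g x"
proof -
  have "tensor (g(j := k)) x = k (complex_of_real (x $ j)) * (\<Prod>i\<in>UNIV - {j}. g i (complex_of_real (x $ i)))" for k
  proof -
    have "(\<Prod>i\<in>UNIV - {j}. (g(j := k)) i (complex_of_real (x $ i))) = (\<Prod>i\<in>UNIV - {j}. g i (complex_of_real (x $ i)))"
      by (rule prod.cong) auto
    then show ?thesis unfolding tensor_def by (subst prod.remove[of UNIV j]) simp_all
  qed
  from this[of h] this[of "g j"] show ?thesis using assms by (simp add: mult.assoc)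
qed

lemma partial2_tensor:
  assumes "\<And>j. g j holomorphic_on UNIV" "\<And>z. deriv (deriv (g j)) z = q z * g j z"
  shows "partial j (partial j (tensor g)) x = q (complex_of_real (x $ j)) * tensor g x"
proof -
  have "(g(j := deriv (g j))) i holomorphic_on UNIV" for i
    using assms(1) by (auto intro: holomorphic_deriv)
  then have "partial j (partial j (tensor g)) = tensor (g(j := deriv (deriv (g j))))"
    by (simp add: partial_tensor[OF assms(1)] partial_tensor)
  then show ?thesis using tensor_upd_scaled[of "deriv (deriv (g j))" q g j x] assms(2) by simp
qed

locale landau_cube =
  fixes L :: real and i1 i2 :: "'n::finite"
  assumes L: "L > 0" and ne: "i1 \<noteq> i2"
begin

abbreviation "dirs \<equiv> UNIV - {i1, i2}"

abbreviation "sep m h n \<equiv> tensor (separated L i1 i2 m h n)"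

lemma landau_op_separated:
  "landau_op i1 i2 (sep m (well_fun L m k) n) x
    = of_real (landau_ev L m k + (\<Sum>j\<in>dirs. (pi * real (n j) / L)\<^sup>2)) * sep m (well_fun L m k) n x"
proof -
  let ?g = "separated L i1 i2 m (well_fun L m k) n"
  let ?\<xi> = "complex_of_real (quasi_momentum L m)" and ?y = "complex_of_real (x $ i2)"
  let ?T = "tensor ?g x"
  note hol = separated_entire[OF well_fun_entire, of L i1 i2 m L m k n]
  note sm = smooth_tensor[OF hol]
  have g1: "?g i1 = (\<lambda>z. exp (\<i> * ?\<xi> * z))" by (simp add: separated_def)
  have g2: "?g i2 = well_fun L m k" using ne by (simp add: separated_def)
  have p1: "partial i1 (tensor ?g) x = (\<i> * ?\<xi>) * ?T"
  proof -
    have "deriv (?g i1) z = (\<lambda>_. \<i> * ?\<xi>) z * ?g i1 z" for z unfolding g1 deriv_exp_linear by simp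
    from tensor_upd_scaled[of "deriv (?g i1)" "\<lambda>_. \<i> * ?\<xi>" ?g i1 x, OF this]
    show ?thesis by (simp add: partial_tensor[OF hol])
  qed
  have p11: "partial i1 (partial i1 (tensor ?g)) x = (\<lambda>_. (\<i> * ?\<xi>)\<^sup>2) (complex_of_real (x $ i1)) * ?T"
    by (rule partial2_tensor[OF hol]) (simp only: g1 deriv2_exp_linear)
  have p22: "partial i2 (partial i2 (tensor ?g)) x = ((?y + ?\<xi>)\<^sup>2 - of_real (landau_ev L m k)) * ?T"
    by (rule partial2_tensor[OF hol, where q = "\<lambda>z. (z + ?\<xi>)\<^sup>2 - of_real (landau_ev L m k)"])
       (simp only: g2 deriv_well_fun)
  have pj: "partial j (partial j (tensor ?g)) x = - complex_of_real ((pi * real (n j) / L)\<^sup>2) * ?T" if "j \<in> dirs" for j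
  proof -
    have gj: "?g j = (\<lambda>z. sin (of_real (pi * real (n j) / L) * z))" using that by (simp add: separated_def)
    have "partial j (partial j (tensor ?g)) x
        = (\<lambda>_. - (complex_of_real (pi * real (n j) / L))\<^sup>2) (complex_of_real (x $ j)) * ?T"
      by (rule partial2_tensor[OF hol]) (simp only: gj deriv_sin_linear)
    then show ?thesis by simp
  qed
  have U: "UNIV = insert i1 (insert i2 dirs)" by auto
  have "(\<Sum>j\<in>UNIV. partial j (partial j (tensor ?g)) x)
      = partial i1 (partial i1 (tensor ?g)) x + (partial i2 (partial i2 (tensor ?g)) x
        + (\<Sum>j\<in>dirs. partial j (partial j (tensor ?g)) x))"
    by (subst U) (use ne in simp)
  also have "(\<Sum>j\<in>dirs. partial j (partial j (tensor ?g)) x) = - of_real (\<Sum>j\<in>dirs. (pi * real (n j) / L)\<^sup>2) * ?T"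
    using pj by (simp add: sum_distrib_right sum_negf)
  finally have s: "(\<Sum>j\<in>UNIV. partial j (partial j (tensor ?g)) x)
      = (\<i> * ?\<xi>)\<^sup>2 * ?T + (((?y + ?\<xi>)\<^sup>2 - of_real (landau_ev L m k)) * ?T
        + - of_real (\<Sum>j\<in>dirs. (pi * real (n j) / L)\<^sup>2) * ?T)"
    unfolding p11 p22 .
  have gen: "- (a * T + (((y + b)\<^sup>2 - e) * T + - w * T)) - 2 * \<i> * y * (\<i> * b * T) + y\<^sup>2 * T = (e + w) * T"
    if "a = - (b\<^sup>2)" for a b y e w T :: complex
    unfolding that by (simp add: algebra_simps power2_eq_square)
  have a: "(\<i> * ?\<xi>)\<^sup>2 = - (?\<xi>\<^sup>2)" by (simp only: power_mult_distrib power2_i mult_minus1)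
  show ?thesis
    unfolding landau_op_smooth[OF sm ne] s p1 of_real_add by (rule gen[OF a])
qed

lemma exp_i_of_real: "exp (\<i> * complex_of_real a * complex_of_real t) = cis (a * t)"
  by (simp add: cis_conv_exp mult.assoc)

lemma sin_of_real_mult: "sin (complex_of_real a * complex_of_real t) = complex_of_real (sin (a * t))"
  by (simp only: of_real_mult[symmetric] sin_of_real)

lemma separated_core:
  assumes h: "h holomorphic_on UNIV" "h 0 = 0" "h (of_real L) = 0"
  shows "sep m h n \<in> landau_core i1 L"
proof -
  let ?g = "separated L i1 i2 m h n"
  note hol = separated_entire[OF h(1), of L i1 i2 m n]
  have per: "tensor ?g (x + axis i1 L) = tensor ?g x" for x
    unfolding tensor_def
  proof (rule prod.cong[OF refl])
    fix j
    show "?g j (complex_of_real ((x + axis i1 L) $ j)) = ?g j (complex_of_real (x $ j))"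
    proof (cases "j = i1")
      case True
      have "exp (\<i> * of_real (quasi_momentum L m) * of_real (x $ i1 + L))
          = exp (\<i> * of_real (quasi_momentum L m) * of_real (x $ i1)) * exp (\<i> * of_real (quasi_momentum L m * L))"
        by (simp add: distrib_left exp_add mult.assoc)
      also have "exp (\<i> * of_real (quasi_momentum L m * L)) = cis (quasi_momentum L m * L)"
        by (simp add: cis_conv_exp)
      also have "quasi_momentum L m * L = 2 * pi * of_int m" using L by simp
      also have "cis \<dots> = 1" by (rule cis_multiple_2pi) simp
      finally show ?thesis unfolding True by (simp add: separated_def axis_def)
    qed (simp add: axis_def)
  qed
  have bd: "tensor ?g x = 0" if "j \<noteq> i1" "x $ j = 0 \<or> x $ j = L" for x j
  proof -
    have "?g j (complex_of_real (x $ j)) = 0"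
    proof (cases "j = i2")
      case True
      then show ?thesis using that h ne by (auto simp: separated_def)
    next
      case False
      have "sin (complex_of_real (pi * real (n j) / L) * complex_of_real (x $ j)) = of_real (sin (pi * real (n j) / L * x $ j))"
        by (simp only: of_real_mult[symmetric] sin_of_real)
      also have "sin (pi * real (n j) / L * x $ j) = 0" using that L sin_npi[of "n j"] by (auto simp: mult.commute)
      finally show ?thesis using that False by (simp add: separated_def)
    qed
    then show ?thesis unfolding tensor_def by (intro prod_zero bexI[of _ j]) auto
  qed
  show ?thesis
    unfolding landau_core_def using smooth_tensor[where g = ?g, OF hol, unfolded smooth_def] per bd by blast
qed

abbreviation interval_integral :: "(real \<Rightarrow> complex) \<Rightarrow> complex" where
  "interval_integral f \<equiv> (\<integral>t. indicator {0..L} t *\<^sub>R f t \<partial>lborel)"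

lemma interval_integral_deriv:
  assumes "\<And>t. (F has_vector_derivative f t) (at t)" "continuous_on UNIV f"
  shows "interval_integral f = F L - F 0"
  by (rule integral_FTC_Icc)
     (use L assms in \<open>auto intro: has_vector_derivative_at_within continuous_on_subset\<close>)

lemma interval_integral_exp:
  "interval_integral (\<lambda>t. exp (\<i> * of_real (quasi_momentum L m) * of_real t) * cnj (exp (\<i> * of_real (quasi_momentum L m') * of_real t)))
    = (if m = m' then of_real L else 0)"
proof -
  define c where "c = 2 * pi * of_int (m - m') / L"
  have e: "exp (\<i> * of_real (quasi_momentum L m) * of_real t) * cnj (exp (\<i> * of_real (quasi_momentum L m') * of_real t))
      = cis (c * t)" for t
  proof -
    have "quasi_momentum L m * t + - (quasi_momentum L m' * t) = c * t"
      by (simp add: c_def diff_divide_distrib algebra_simps)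
    then show ?thesis unfolding exp_i_of_real cis_cnj cis_mult by (simp only:)
  qed
  show ?thesis
  proof (cases "m = m'")
    case True
    have "interval_integral (\<lambda>t. 1) = of_real L - of_real 0"
      by (rule interval_integral_deriv) (auto intro!: derivative_eq_intros)
    then show ?thesis unfolding e using True by (simp add: c_def)
  next
    case False
    then have c: "c \<noteq> 0" using L by (simp add: c_def)
    have "interval_integral (\<lambda>t. cis (c * t)) = cis (c * L) / (\<i> * of_real c) - cis (c * 0) / (\<i> * of_real c)"
    proof (rule interval_integral_deriv)
      have "((\<lambda>z. exp (\<i> * of_real c * z) / (\<i> * of_real c)) has_field_derivative exp (\<i> * of_real c * z)) (at z)" for z
        using c by (auto intro!: derivative_eq_intros)
      from has_vector_derivative_real_field[OF this]
      show "((\<lambda>t. cis (c * t) / (\<i> * of_real c)) has_vector_derivative cis (c * t)) (at t)" for t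
        by (simp add: cis_conv_exp mult.assoc)
    qed (intro continuous_intros)
    also have "c * L = 2 * pi * of_int (m - m')" using L by (simp add: c_def)
    also have "cis \<dots> = 1" by (simp add: cis_multiple_2pi)
    finally show ?thesis unfolding e using False by simp
  qed
qed

lemma interval_integral_of_real:
  assumes "continuous_on UNIV f"
  shows "interval_integral (\<lambda>t. complex_of_real (f t)) = of_real (integral {0..L} f)"
proof -
  have "interval_integral (\<lambda>t. complex_of_real (f t)) = of_real (\<integral>t. indicator {0..L} t *\<^sub>R f t \<partial>lborel)"
    by (subst integral_complex_of_real[symmetric]) (simp add: scaleR_conv_of_real)
  also have "(\<integral>t. indicator {0..L} t *\<^sub>R f t \<partial>lborel) = integral {0..L} f"
  proof -
    have "set_integrable lborel {0..L} f"
      unfolding set_integrable_def by (rule borel_integrable_compact[OF compact_Icc continuous_on_subset[OF assms]]) simp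
    from set_borel_integral_eq_integral(2)[OF this] show ?thesis by (simp add: set_lebesgue_integral_def)
  qed
  finally show ?thesis .
qed

lemma integral_cos_multiple:
  "interval_integral (\<lambda>t. complex_of_real (cos (pi * of_int p / L * t))) = (if p = 0 then of_real L else 0)"
proof (cases "p = 0")
  case True
  have "interval_integral (\<lambda>t. 1) = of_real L - of_real 0"
    by (rule interval_integral_deriv) (auto intro!: derivative_eq_intros)
  then show ?thesis using True by simp
next
  case False
  let ?c = "pi * of_int p / L"
  have c: "?c \<noteq> 0" using False L by simp
  have "interval_integral (\<lambda>t. complex_of_real (cos (?c * t)))
      = of_real (sin (?c * L) / ?c) - of_real (sin (?c * 0) / ?c)"
  proof (rule interval_integral_deriv)
    show "((\<lambda>t. complex_of_real (sin (?c * t) / ?c)) has_vector_derivative complex_of_real (cos (?c * t))) (at t)" for t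
    proof (rule bounded_linear.has_vector_derivative[OF bounded_linear_of_real])
      have "((\<lambda>t. sin (?c * t) / ?c) has_real_derivative cos (?c * t)) (at t)"
        using c by (auto intro!: derivative_eq_intros)
      then show "((\<lambda>t. sin (?c * t) / ?c) has_vector_derivative cos (?c * t)) (at t)"
        using has_real_derivative_iff_has_vector_derivative by blast
    qed
  qed (intro continuous_intros)
  moreover have "sin (?c * L) = 0"
    unfolding sin_zero_iff_int2 using L by (intro exI[of _ p]) simp
  ultimately show ?thesis using False by simp
qed

lemma interval_integral_sin:
  assumes "1 \<le> k" "1 \<le> l"
  shows "interval_integral (\<lambda>t. sin (of_real (pi * real k / L) * of_real t) * cnj (sin (of_real (pi * real l / L) * of_real t)))
    = (if k = l then of_real (L / 2) else 0)"
proof -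
  let ?C = "\<lambda>p t. complex_of_real (cos (pi * of_int p / L * t))"
  have e: "sin (complex_of_real (pi * real k / L) * of_real t) * cnj (sin (of_real (pi * real l / L) * of_real t))
      = (1 / 2) * ?C (int k - int l) t - (1 / 2) * ?C (int k + int l) t" for t
  proof -
    have "sin (pi * real k / L * t) * sin (pi * real l / L * t)
        = 1 / 2 * cos (pi * of_int (int k - int l) / L * t) - 1 / 2 * cos (pi * of_int (int k + int l) / L * t)"
      by (simp add: sin_times_sin diff_divide_distrib add_divide_distrib algebra_simps)
    from arg_cong[OF this, of complex_of_real] show ?thesis
      unfolding sin_of_real_mult complex_cnj_complex_of_real
      by (simp only: of_real_mult of_real_diff of_real_divide of_real_1 of_real_numeral)
  qed
  have i: "integrable lborel (\<lambda>t. indicator {0..L} t *\<^sub>R ((1 / 2) * ?C p t))" for p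
    by (rule borel_integrable_compact[OF compact_Icc]) (intro continuous_intros)
  have "interval_integral (\<lambda>t. (1 / 2) * ?C (int k - int l) t - (1 / 2) * ?C (int k + int l) t)
      = interval_integral (\<lambda>t. (1 / 2) * ?C (int k - int l) t) - interval_integral (\<lambda>t. (1 / 2) * ?C (int k + int l) t)"
    using Bochner_Integration.integral_diff[OF i[of "int k - int l"] i[of "int k + int l"]]
    by (simp only: scaleR_diff_right)
  also have "\<dots> = (1 / 2) * interval_integral (?C (int k - int l)) - (1 / 2) * interval_integral (?C (int k + int l))"
    by (simp only: mult_scaleR_right[symmetric] integral_mult_right_zero)
  finally show ?thesis unfolding e integral_cos_multiple using assms by auto
qed

lemma L2_inner_separated:
  assumes h: "h holomorphic_on UNIV" "h' holomorphic_on UNIV"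
    and n: "\<And>j. j \<in> dirs \<Longrightarrow> 1 \<le> n j" "\<And>j. j \<in> dirs \<Longrightarrow> 1 \<le> n' j"
  shows "L2_inner (cube_measure L) (sep m h n) (sep m' h' n')
    = (if m = m' then of_real L else 0) * interval_integral (\<lambda>t. h (of_real t) * cnj (h' (of_real t)))
      * (\<Prod>j\<in>dirs. if n j = n' j then of_real (L / 2) else 0)"
proof -
  have U: "UNIV = insert i1 (insert i2 dirs)" by auto
  have "L2_inner (cube_measure L) (sep m h n) (sep m' h' n')
      = (\<Prod>j\<in>UNIV. interval_integral (\<lambda>t. separated L i1 i2 m h n j (of_real t) * cnj (separated L i1 i2 m' h' n' j (of_real t))))"
    by (rule L2_inner_tensor) (intro separated_entire h)+
  also have "\<dots> = interval_integral (\<lambda>t. separated L i1 i2 m h n i1 (of_real t) * cnj (separated L i1 i2 m' h' n' i1 (of_real t)))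
      * (interval_integral (\<lambda>t. separated L i1 i2 m h n i2 (of_real t) * cnj (separated L i1 i2 m' h' n' i2 (of_real t)))
      * (\<Prod>j\<in>dirs. interval_integral (\<lambda>t. separated L i1 i2 m h n j (of_real t) * cnj (separated L i1 i2 m' h' n' j (of_real t)))))"
    by (subst U) (use ne in simp)
  also have "(\<Prod>j\<in>dirs. interval_integral (\<lambda>t. separated L i1 i2 m h n j (of_real t) * cnj (separated L i1 i2 m' h' n' j (of_real t))))
      = (\<Prod>j\<in>dirs. if n j = n' j then of_real (L / 2) else 0)"
  proof (rule prod.cong[OF refl])
    fix j assume j: "j \<in> dirs"
    then have "separated L i1 i2 m h n j = (\<lambda>z. sin (of_real (pi * real (n j) / L) * z))"
        "separated L i1 i2 m' h' n' j = (\<lambda>z. sin (of_real (pi * real (n' j) / L) * z))"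
      by (auto simp: separated_def)
    then show "interval_integral (\<lambda>t. separated L i1 i2 m h n j (of_real t) * cnj (separated L i1 i2 m' h' n' j (of_real t)))
        = (if n j = n' j then of_real (L / 2) else 0)"
      by (simp only: interval_integral_sin[OF n(1)[OF j] n(2)[OF j]])
  qed
  also have "separated L i1 i2 m h n i1 = (\<lambda>z. exp (\<i> * of_real (quasi_momentum L m) * z))" by (simp add: separated_def)
  also have "separated L i1 i2 m' h' n' i1 = (\<lambda>z. exp (\<i> * of_real (quasi_momentum L m') * z))" by (simp add: separated_def)
  also have "separated L i1 i2 m h n i2 = h" using ne by (simp add: separated_def)
  also have "separated L i1 i2 m' h' n' i2 = h'" using ne by (simp add: separated_def)
  finally show ?thesis unfolding interval_integral_exp by (simp only: mult.assoc)
qed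

lemma integral_well_shift:
  assumes "continuous_on UNIV f"
  shows "integral {0..L} (\<lambda>t. f (t + c)) = integral {c..c + L} (f :: real \<Rightarrow> real)"
proof -
  have "continuous_on {0 + c..L + c} f" using assms continuous_on_subset by blast
  from integral_shift[OF this] show ?thesis by (simp add: o_def add.commute)
qed

lemma continuous_shoot: "continuous_on S (shoot a E :: real \<Rightarrow> real)"
  by (intro continuous_at_imp_continuous_on ballI DERIV_isCont[OF shoot_deriv])

definition well_norm :: "int \<Rightarrow> nat \<Rightarrow> real" where
  "well_norm m k = shoot_inner (quasi_momentum L m) (quasi_momentum L m + L) (shoot (quasi_momentum L m) (landau_ev L m k)) k"

lemma well_norm_pos: "0 < well_norm m k"
  unfolding well_norm_def by (rule shoot_norm_pos) (use L in simp)

lemma interval_integral_well: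
  "interval_integral (\<lambda>t. well_fun L m k (of_real t) * cnj (well_fun L m l (of_real t)))
    = (if k = l then of_real (well_norm m k) else 0)"
proof -
  let ?\<xi> = "quasi_momentum L m"
  let ?f = "\<lambda>x. shoot ?\<xi> (landau_ev L m k) x * shoot ?\<xi> (landau_ev L m l) x :: real"
  have cf: "continuous_on UNIV ?f" by (intro continuous_intros continuous_shoot)
  have "interval_integral (\<lambda>t. well_fun L m k (of_real t) * cnj (well_fun L m l (of_real t)))
      = interval_integral (\<lambda>t. complex_of_real (?f (t + ?\<xi>)))"
    by (simp only: well_fun_of_real complex_cnj_complex_of_real of_real_mult)
  also have "\<dots> = of_real (integral {0..L} (\<lambda>t. ?f (t + ?\<xi>)))"
    by (rule interval_integral_of_real) (intro continuous_on_compose2[OF cf] continuous_intros, simp)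
  also have "integral {0..L} (\<lambda>t. ?f (t + ?\<xi>)) = integral {?\<xi>..?\<xi> + L} ?f" by (rule integral_well_shift[OF cf])
  finally show ?thesis using shoot_orthogonal[of ?\<xi> "?\<xi> + L" k l] L by (auto simp: well_norm_def)
qed

subsection \<open>The eigenbasis\<close>

definition landau_index :: "(int \<times> nat \<times> ('n \<Rightarrow> nat)) set" where
  "landau_index = {(m, k, n). n \<in> positive_lattice dirs}"

definition landau_eigenvalue :: "int \<times> nat \<times> ('n \<Rightarrow> nat) \<Rightarrow> real" where
  "landau_eigenvalue = (\<lambda>(m, k, n). landau_ev L m k + (\<Sum>j\<in>dirs. (pi * real (n j) / L)\<^sup>2))"

definition norm_const :: "int \<Rightarrow> nat \<Rightarrow> real" where
  "norm_const m k = 1 / sqrt (L * well_norm m k * (L / 2) ^ card dirs)"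

definition landau_eigenfun :: "int \<times> nat \<times> ('n \<Rightarrow> nat) \<Rightarrow> real ^ 'n \<Rightarrow> complex" where
  "landau_eigenfun = (\<lambda>(m, k, n) x. of_real (norm_const m k) * sep m (well_fun L m k) n x)"

lemma norm_const_power2: "(norm_const m k)\<^sup>2 * (L * well_norm m k * (L / 2) ^ card dirs) = 1" "0 < norm_const m k"
proof -
  have pos: "0 < L * well_norm m k * (L / 2) ^ card dirs" using L well_norm_pos by simp
  have gen: "(1 / sqrt X)\<^sup>2 * X = 1" "0 < 1 / sqrt X" if "0 < X" for X
    using that by (simp_all add: power_divide)
  show "(norm_const m k)\<^sup>2 * (L * well_norm m k * (L / 2) ^ card dirs) = 1" "0 < norm_const m k"
    unfolding norm_const_def by (rule gen[OF pos])+
qed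

lemma landau_orthonormal:
  assumes "\<alpha> \<in> landau_index" "\<beta> \<in> landau_index"
  shows "L2_inner (cube_measure L) (landau_eigenfun \<alpha>) (landau_eigenfun \<beta>) = (if \<alpha> = \<beta> then 1 else 0)"
proof -
  obtain m k n where \<alpha>: "\<alpha> = (m, k, n)" by (cases \<alpha>) auto
  obtain m' k' n' where \<beta>: "\<beta> = (m', k', n')" by (cases \<beta>) auto
  have n: "n \<in> positive_lattice dirs" and n': "n' \<in> positive_lattice dirs"
    using assms by (auto simp: \<alpha> \<beta> landau_index_def)
  let ?h = "well_fun L m k" and ?h' = "well_fun L m' k'"
  have "L2_inner (cube_measure L) (landau_eigenfun \<alpha>) (landau_eigenfun \<beta>)
      = of_real (norm_const m k) * (of_real (norm_const m' k') * L2_inner (cube_measure L) (sep m ?h n) (sep m' ?h' n'))"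
  proof -
    have "L2_inner (cube_measure L) (landau_eigenfun \<alpha>) (landau_eigenfun \<beta>)
        = of_real (norm_const m k) * L2_inner (cube_measure L) (sep m ?h n) (\<lambda>x. of_real (norm_const m' k') * sep m' ?h' n' x)"
      unfolding \<alpha> \<beta> landau_eigenfun_def by (simp add: L2_inner_scale_left)
    also have "L2_inner (cube_measure L) (sep m ?h n) (\<lambda>x. of_real (norm_const m' k') * sep m' ?h' n' x)
        = of_real (norm_const m' k') * L2_inner (cube_measure L) (sep m ?h n) (sep m' ?h' n')"
      by (subst (1 2) L2_inner_commute) (simp add: L2_inner_scale_left)
    finally show ?thesis .
  qed
  also have "L2_inner (cube_measure L) (sep m ?h n) (sep m' ?h' n')
    = (if m = m' then of_real L else 0) * interval_integral (\<lambda>t. ?h (of_real t) * cnj (?h' (of_real t)))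
      * (\<Prod>j\<in>dirs. if n j = n' j then of_real (L / 2) else 0)"
    by (rule L2_inner_separated[OF well_fun_entire well_fun_entire]) (use n n' in \<open>auto simp: positive_lattice_def\<close>)
  finally have eq: "L2_inner (cube_measure L) (landau_eigenfun \<alpha>) (landau_eigenfun \<beta>)
      = of_real (norm_const m k) * (of_real (norm_const m' k') * ((if m = m' then of_real L else 0)
        * interval_integral (\<lambda>t. ?h (of_real t) * cnj (?h' (of_real t)))
        * (\<Prod>j\<in>dirs. if n j = n' j then of_real (L / 2) else 0)))" .
  show ?thesis
  proof (cases "\<alpha> = \<beta>")
    case True
    then have same: "m' = m" "k' = k" "n' = n" by (auto simp: \<alpha> \<beta>)
    have "L2_inner (cube_measure L) (landau_eigenfun \<alpha>) (landau_eigenfun \<beta>)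
        = of_real ((norm_const m k)\<^sup>2 * (L * well_norm m k * (L / 2) ^ card dirs))"
      unfolding eq same interval_integral_well by (simp add: power2_eq_square)
    then have "L2_inner (cube_measure L) (landau_eigenfun \<alpha>) (landau_eigenfun \<beta>) = 1"
      by (simp only: norm_const_power2 of_real_1)
    then show ?thesis using True by simp
  next
    case False
    consider "m \<noteq> m'" | "m = m'" "k \<noteq> k'" | "n \<noteq> n'" using False by (auto simp: \<alpha> \<beta>)
    then have "L2_inner (cube_measure L) (landau_eigenfun \<alpha>) (landau_eigenfun \<beta>) = 0"
    proof cases
      case 1
      then show ?thesis unfolding eq by simp
    next
      case 2
      then show ?thesis unfolding eq by (simp add: interval_integral_well)
    next
      case 3
      then obtain j where "n j \<noteq> n' j" by auto
      moreover have "j \<in> dirs" using calculation n n' by (auto simp: positive_lattice_def)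
      ultimately have "(\<Prod>j\<in>dirs. if n j = n' j then complex_of_real (L / 2) else 0) = 0"
        by (intro prod_zero bexI[of _ j]) auto
      then show ?thesis unfolding eq by simp
    qed
    then show ?thesis using False by simp
  qed
qed

subsection \<open>Completeness of the eigenbasis\<close>

lemma separated_factor:
  "sep m h n x = h (complex_of_real (x $ i2)) * (\<Prod>j\<in>UNIV - {i2}. separated L i1 i2 m (\<lambda>_. 0) n j (complex_of_real (x $ j)))"
proof -
  have "(\<Prod>j\<in>UNIV - {i2}. separated L i1 i2 m h n j (complex_of_real (x $ j)))
      = (\<Prod>j\<in>UNIV - {i2}. separated L i1 i2 m (\<lambda>_. 0) n j (complex_of_real (x $ j)))"
    by (rule prod.cong) (auto simp: separated_def)
  then show ?thesis unfolding tensor_def by (subst prod.remove[of UNIV i2]) (use ne in \<open>simp_all add: separated_def\<close>)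
qed

lemma separated_L2:
  assumes "h holomorphic_on UNIV"
  shows "sep m h n \<in> L2_space (cube_measure L)"
  by (intro continuous_L2_cube smooth_continuous smooth_tensor separated_entire assms)

text \<open>
  The eigenfunctions with fixed \<open>m\<close> and \<open>n\<close> approximate every sine in the direction \<open>i2\<close>, by the
  one-dimensional completeness; the other factors only contribute a constant to the \<open>L\<^sup>2\<close> distance.
\<close>

lemma orthogonal_to_sines:
  assumes F: "F \<in> L2_space (cube_measure L)" and n: "n \<in> positive_lattice dirs"
    and orth: "\<And>k. L2_inner (cube_measure L) F (sep m (well_fun L m k) n) = 0"
  shows "L2_inner (cube_measure L) F (sep m (\<lambda>z. sin (of_real (pi * of_int l / L) * z)) n) = 0"
proof -
  let ?M = "cube_measure L :: (real ^ 'n) measure"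
  let ?\<xi> = "quasi_momentum L m"
  let ?g = "\<lambda>z::complex. sin (of_real (pi * of_int l / L) * z)"
  have g: "?g holomorphic_on UNIV" by (intro holomorphic_intros)
  have n1: "1 \<le> n j" if "j \<in> dirs" for j using n that by (auto simp: positive_lattice_def)
  define B where "B = L * (L / 2) ^ card dirs"
  have B: "B > 0" using L by (simp add: B_def)
  define f where "f = (\<lambda>y. sin (pi * of_int l / L * (y - ?\<xi>)))"
  define f' where "f' = (\<lambda>y. pi * of_int l / L * cos (pi * of_int l / L * (y - ?\<xi>)))"
  have f: "dirichlet_fun ?\<xi> (?\<xi> + L) f f'"
    unfolding dirichlet_fun_def
  proof (intro conjI allI)
    show "(f has_real_derivative f' x) (at x)" for x
      unfolding f_def f'_def by (rule derivative_eq_intros refl | simp)+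
    show "continuous_on UNIV f'" unfolding f'_def by (intro continuous_intros)
    have "sin (pi * of_int l / L * L) = 0"
      unfolding sin_zero_iff_int2 using L by (intro exI[of _ l]) simp
    then show "f (?\<xi> + L) = 0" by (simp add: f_def)
  qed (simp add: f_def)
  have small: "(norm (L2_inner ?M F (sep m ?g n)))\<^sup>2 \<le> (L2_norm ?M F)\<^sup>2 * B * \<epsilon>" if \<epsilon>: "\<epsilon> > 0" for \<epsilon>
  proof -
    obtain N c where Nc: "integral {?\<xi>..?\<xi> + L} (\<lambda>x. (f x - (\<Sum>k<N. c k * shoot ?\<xi> (landau_ev L m k) x))\<^sup>2) < \<epsilon>"
      using shoot_complete[OF _ f \<epsilon>] L by auto
    define h where "h = (\<lambda>z. \<Sum>k<N. complex_of_real (c k) * well_fun L m k z)"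
    have h: "h holomorphic_on UNIV" unfolding h_def by (intro holomorphic_intros well_fun_entire)
    define D where "D = (\<lambda>x. f x - (\<Sum>k<N. c k * shoot ?\<xi> (landau_ev L m k) x))"
    have cD: "continuous_on UNIV D"
      unfolding D_def using dirichlet_funD(2)[OF f] by (intro continuous_intros continuous_shoot) auto
    have gh: "(\<lambda>z. ?g z - h z) holomorphic_on UNIV" by (intro holomorphic_intros g h)
    have real: "?g (of_real t) - h (of_real t) = of_real (D (t + ?\<xi>))" for t
      unfolding h_def D_def f_def sin_of_real_mult well_fun_of_real by simp
    have "L2_inner ?M F (sep m h n) = (\<Sum>k<N. of_real (c k) * L2_inner ?M F (sep m (well_fun L m k) n))"
    proof -
      have "sep m h n = (\<lambda>x. \<Sum>k<N. complex_of_real (c k) * sep m (well_fun L m k) n x)"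
        unfolding separated_factor by (simp add: h_def sum_distrib_right mult.assoc)
      then have "L2_inner ?M F (sep m h n) = cnj (\<Sum>k<N. complex_of_real (c k) * L2_inner ?M (sep m (well_fun L m k) n) F)"
        by (subst L2_inner_commute)
           (simp add: L2_inner_sum_left[OF separated_L2[OF well_fun_entire] F])
      also have "\<dots> = (\<Sum>k<N. of_real (c k) * L2_inner ?M F (sep m (well_fun L m k) n))"
        by (simp add: L2_inner_commute[of ?M F])
      finally show ?thesis .
    qed
    then have zero: "L2_inner ?M F (sep m h n) = 0" using orth by simp
    have "sep m (\<lambda>z. ?g z - h z) n = (\<lambda>x. sep m ?g n x - sep m h n x)"
      unfolding separated_factor[of m _ n] by (simp add: left_diff_distrib)
    then have "L2_inner ?M F (sep m ?g n) = L2_inner ?M F (sep m (\<lambda>z. ?g z - h z) n)"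
      using L2_inner_diff_left[OF separated_L2[OF g] separated_L2[OF h] F, of m n m n] zero
      by (simp add: L2_inner_commute[of ?M F])
    then have "norm (L2_inner ?M F (sep m ?g n)) \<le> L2_norm ?M F * L2_norm ?M (sep m (\<lambda>z. ?g z - h z) n)"
      using L2_Cauchy_Schwarz[OF F separated_L2[OF gh]] by simp
    then have "(norm (L2_inner ?M F (sep m ?g n)))\<^sup>2 \<le> (L2_norm ?M F)\<^sup>2 * (L2_norm ?M (sep m (\<lambda>z. ?g z - h z) n))\<^sup>2"
      using power_mono[of _ _ 2] by (fastforce simp: power_mult_distrib)
    also have "(L2_norm ?M (sep m (\<lambda>z. ?g z - h z) n))\<^sup>2 = B * integral {?\<xi>..?\<xi> + L} (\<lambda>x. (D x)\<^sup>2)"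
    proof -
      have "complex_of_real ((L2_norm ?M (sep m (\<lambda>z. ?g z - h z) n))\<^sup>2)
          = of_real L * interval_integral (\<lambda>t. (?g (of_real t) - h (of_real t)) * cnj (?g (of_real t) - h (of_real t)))
            * (\<Prod>j\<in>dirs. of_real (L / 2))"
        unfolding L2_norm_power2_inner by (subst L2_inner_separated[OF gh gh n1 n1]) simp_all
      also have "interval_integral (\<lambda>t. (?g (of_real t) - h (of_real t)) * cnj (?g (of_real t) - h (of_real t)))
          = interval_integral (\<lambda>t. complex_of_real ((D (t + ?\<xi>))\<^sup>2))"
        unfolding real by (simp add: power2_eq_square)
      also have "\<dots> = of_real (integral {0..L} (\<lambda>t. (D (t + ?\<xi>))\<^sup>2))"
        by (rule interval_integral_of_real) (intro continuous_intros continuous_on_compose2[OF cD], auto)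
      also have "integral {0..L} (\<lambda>t. (D (t + ?\<xi>))\<^sup>2) = integral {?\<xi>..?\<xi> + L} (\<lambda>x. (D x)\<^sup>2)"
        by (rule integral_well_shift) (intro continuous_intros cD)
      finally have "complex_of_real ((L2_norm ?M (sep m (\<lambda>z. ?g z - h z) n))\<^sup>2)
          = of_real (B * integral {?\<xi>..?\<xi> + L} (\<lambda>x. (D x)\<^sup>2))"
        by (simp add: B_def)
      then show ?thesis by (simp only: of_real_eq_iff)
    qed
    also have "(L2_norm ?M F)\<^sup>2 * (B * integral {?\<xi>..?\<xi> + L} (\<lambda>x. (D x)\<^sup>2)) \<le> (L2_norm ?M F)\<^sup>2 * (B * \<epsilon>)"
      using Nc B by (intro mult_left_mono) (auto simp: D_def)
    finally show ?thesis by (simp add: mult.assoc)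
  qed
  define Q where "Q = (L2_norm ?M F)\<^sup>2 * B"
  have Q: "0 \<le> Q" using B by (simp add: Q_def)
  have "(norm (L2_inner ?M F (sep m ?g n)))\<^sup>2 \<le> 0 + e" if "e > 0" for e
  proof -
    have "(norm (L2_inner ?M F (sep m ?g n)))\<^sup>2 \<le> Q * (e / (Q + 1))"
      using small[of "e / (Q + 1)"] Q that by (simp add: Q_def)
    also have "\<dots> \<le> e" using Q that by (simp add: field_simps)
    finally show ?thesis by simp
  qed
  then have "(norm (L2_inner ?M F (sep m ?g n)))\<^sup>2 \<le> 0" by (rule field_le_epsilon)
  then show ?thesis by simp
qed

lemma cnj_trig: "cnj (trig L i1 m n x) = trig L i1 (- m) n x"
  unfolding trig_def cnj_prod by (intro prod.cong) (auto simp: cis_cnj)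

lemma trig_eq_separated:
  assumes "\<And>j. j \<in> dirs \<Longrightarrow> 0 \<le> l j"
  shows "trig L i1 m l x = sep m (\<lambda>z. sin (of_real (pi * of_int (l i2) / L) * z)) (\<lambda>j. if j \<in> dirs then nat (l j) else 0) x"
  unfolding trig_def tensor_def
proof (rule prod.cong[OF refl])
  fix j
  have arg: "pi * of_int k * x $ j / L = pi * of_int k / L * x $ j" for k by simp
  consider "j = i1" | "j = i2" | "j \<in> dirs" by auto
  then show "(if j = i1 then cis (2 * pi * of_int m * x $ j / L) else complex_of_real (sin (pi * of_int (l j) * x $ j / L)))
      = separated L i1 i2 m (\<lambda>z. sin (of_real (pi * of_int (l i2) / L) * z)) (\<lambda>j. if j \<in> dirs then nat (l j) else 0) j
          (complex_of_real (x $ j))"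
  proof cases
    case 1
    then show ?thesis unfolding separated_def by (simp only: if_True refl exp_i_of_real) simp
  next
    case 2
    then show ?thesis using ne unfolding arg separated_def by (simp only: if_False if_True refl sin_of_real_mult ne[symmetric])
  next
    case 3
    then have "real (nat (l j)) = of_int (l j)" using assms by simp
    moreover have "j \<noteq> i1" "j \<noteq> i2" "j \<in> dirs" using 3 by auto
    ultimately show ?thesis unfolding arg separated_def by (simp only: if_False if_True sin_of_real_mult)
  qed
qed

text \<open>
  Sine is odd, and where \<open>l j = 0\<close> both sides vanish, so that replacing it by \<open>1\<close> does no harm.
\<close>

lemma trig_abs:
  fixes l :: "'n \<Rightarrow> int"
  defines "l' \<equiv> \<lambda>j. if j \<in> dirs then max 1 \<bar>l j\<bar> else l j"
  shows "trig L i1 m l x = (\<Prod>j\<in>UNIV. if j \<in> dirs then of_int (sgn (l j)) else 1) * trig L i1 m l' x"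
  unfolding trig_def prod.distrib[symmetric]
proof (rule prod.cong[OF refl])
  fix j
  show "(if j = i1 then cis (2 * pi * of_int m * x $ j / L) else complex_of_real (sin (pi * of_int (l j) * x $ j / L)))
      = (if j \<in> dirs then of_int (sgn (l j)) else 1)
        * (if j = i1 then cis (2 * pi * of_int m * x $ j / L) else complex_of_real (sin (pi * of_int (l' j) * x $ j / L)))"
  proof (cases "j \<in> dirs")
    case True
    consider "l j = 0" | "l j > 0" | "l j < 0" by linarith
    then show ?thesis using True by cases (auto simp: l'_def max_def)
  qed (auto simp: l'_def)
qed

text \<open>
  Orthogonality to the eigenfunctions passes to the whole trigonometric system: sines in direction \<open>i2\<close>
  are limits of well functions, conjugation reverses the sign of \<open>m\<close>, and the signs of the other indices
  only produce a factor.
\<close>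

lemma landau_complete:
  assumes F: "F \<in> L2_space (cube_measure L)"
    and orth: "\<forall>\<alpha>\<in>landau_index. L2_inner (cube_measure L) F (landau_eigenfun \<alpha>) = 0"
  shows "AE x in cube_measure L. F x = 0"
proof -
  let ?M = "cube_measure L :: (real ^ 'n) measure"
  interpret finite_measure ?M by (rule finite_measure_cube)
  have o1: "L2_inner ?M F (sep m (well_fun L m k) n) = 0" if "n \<in> positive_lattice dirs" for m k n
  proof -
    have "(m, k, n) \<in> landau_index" using that by (simp add: landau_index_def)
    then have "L2_inner ?M F (landau_eigenfun (m, k, n)) = 0" using orth by blast
    then show ?thesis
      using norm_const_power2(2)[of m k] by (simp add: landau_eigenfun_def L2_inner_scale_right)
  qed
  have o2: "(\<integral>x. F x * trig L i1 m l x \<partial>?M) = 0" if "\<And>j. j \<in> dirs \<Longrightarrow> 1 \<le> l j" for m l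
  proof -
    let ?n = "\<lambda>j. if j \<in> dirs then nat (l j) else 0"
    have n: "?n \<in> positive_lattice dirs" using that by (force simp: positive_lattice_def)
    have "L2_inner ?M F (sep (- m) (\<lambda>z. sin (of_real (pi * of_int (l i2) / L) * z)) ?n) = 0"
      by (rule orthogonal_to_sines[OF F n o1[OF n]])
    moreover have "sep (- m) (\<lambda>z. sin (of_real (pi * of_int (l i2) / L) * z)) ?n x = cnj (trig L i1 m l x)" for x
      unfolding cnj_trig by (rule trig_eq_separated[symmetric]) (use that in force)
    ultimately show ?thesis by (simp add: L2_inner_def)
  qed
  have "trig_orthogonal L i1 F"
  proof
    show "L > 0" by (rule L)
    have "(\<lambda>_. 1) \<in> L2_space ?M" by (intro continuous_L2_cube continuous_intros)
    from L2_mult_integrable[OF F this] show "integrable ?M F" by simp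
    fix m and l :: "'n \<Rightarrow> int"
    let ?l = "\<lambda>j. if j \<in> dirs then max 1 \<bar>l j\<bar> else l j"
    let ?s = "\<Prod>j\<in>UNIV. if j \<in> dirs then of_int (sgn (l j)) else 1 :: complex"
    have "F x * trig L i1 m l x = ?s * (F x * trig L i1 m ?l x)" for x
      unfolding trig_abs[of m l x] by (simp only: mult.left_commute)
    then have "(\<integral>x. F x * trig L i1 m l x \<partial>?M) = ?s * (\<integral>x. F x * trig L i1 m ?l x \<partial>?M)"
      by (simp only: integral_mult_right_zero)
    also have "(\<integral>x. F x * trig L i1 m ?l x \<partial>?M) = 0" by (rule o2) simp
    finally show "(\<integral>x. F x * trig L i1 m l x \<partial>?M) = 0" by simp
  qed
  then show ?thesis by (rule trig_orthogonal.AE_F_zero)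
qed

subsection \<open>Counting the eigenvalues\<close>

lemma finite_quasi_momenta: "finite {m::int. a \<le> quasi_momentum L m \<and> quasi_momentum L m \<le> b}"
proof -
  have "{m::int. a \<le> quasi_momentum L m \<and> quasi_momentum L m \<le> b} = {\<lceil>a * L / (2 * pi)\<rceil>..\<lfloor>b * L / (2 * pi)\<rfloor>}"
    using L by (auto simp: ceiling_le_iff le_floor_iff field_simps)
  then show ?thesis by simp
qed

lemma card_quasi_momenta:
  assumes "a \<le> b"
  shows "real (card {m::int. a \<le> quasi_momentum L m \<and> quasi_momentum L m \<le> b}) \<le> (b - a) * L / (2 * pi) + 1"
    and "(b - a) * L / (2 * pi) - 1 \<le> real (card {m::int. a \<le> quasi_momentum L m \<and> quasi_momentum L m \<le> b})"
proof -
  let ?x = "a * L / (2 * pi)" and ?y = "b * L / (2 * pi)"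
  have eq: "{m::int. a \<le> quasi_momentum L m \<and> quasi_momentum L m \<le> b} = {\<lceil>?x\<rceil>..\<lfloor>?y\<rfloor>}"
    using L by (auto simp: ceiling_le_iff le_floor_iff field_simps)
  have xy: "?x \<le> ?y" using assms L by (intro divide_right_mono mult_right_mono) auto
  have d: "(b - a) * L / (2 * pi) = ?y - ?x" by (simp add: left_diff_distrib diff_divide_distrib)
  have "real (card {\<lceil>?x\<rceil>..\<lfloor>?y\<rfloor>}) = max 0 (of_int (\<lfloor>?y\<rfloor> - \<lceil>?x\<rceil> + 1))" by auto
  moreover have "of_int \<lfloor>?y\<rfloor> \<le> ?y" "?x \<le> of_int \<lceil>?x\<rceil>" "?y < of_int \<lfloor>?y\<rfloor> + 1" "of_int \<lceil>?x\<rceil> < ?x + 1"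
    by linarith+
  ultimately show "real (card {m::int. a \<le> quasi_momentum L m \<and> quasi_momentum L m \<le> b}) \<le> (b - a) * L / (2 * pi) + 1"
    "(b - a) * L / (2 * pi) - 1 \<le> real (card {m::int. a \<le> quasi_momentum L m \<and> quasi_momentum L m \<le> b})"
    unfolding eq d using xy by linarith+
qed

text \<open>
  A well with an eigenvalue up to \<open>E\<close> must reach into \<open>[- sqrt E, sqrt E]\<close>, and its eigenvalues are at
  least the Landau levels.
\<close>

lemma landau_index_upper:
  "{\<alpha>\<in>landau_index. landau_eigenvalue \<alpha> \<le> E}
    \<subseteq> {m. - L - sqrt (max 0 E) \<le> quasi_momentum L m \<and> quasi_momentum L m \<le> sqrt (max 0 E)}
      \<times> (SIGMA k:{..nat \<lceil>\<bar>E\<bar>\<rceil>}. lattice_ball dirs L (E - (2 * real k + 1)))"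
proof (rule subsetI)
  fix \<alpha> assume "\<alpha> \<in> {\<alpha>\<in>landau_index. landau_eigenvalue \<alpha> \<le> E}"
  then obtain m k n where \<alpha>: "\<alpha> = (m, k, n)" "n \<in> positive_lattice dirs"
      "landau_ev L m k + (\<Sum>j\<in>dirs. (pi * real (n j) / L)\<^sup>2) \<le> E"
    by (auto simp: landau_index_def landau_eigenvalue_def)
  let ?\<xi> = "quasi_momentum L m" and ?s = "sqrt (max 0 E)"
  have ev: "2 * real k + 1 \<le> landau_ev L m k" by (rule dirichlet_ev_ge) (use L in simp)
  have S: "0 \<le> (\<Sum>j\<in>dirs. (pi * real (n j) / L)\<^sup>2)" by (intro sum_nonneg) simp
  have "n \<in> lattice_ball dirs L (E - (2 * real k + 1))" using \<alpha> ev by (simp add: lattice_ball_def)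
  moreover have "k \<le> nat \<lceil>\<bar>E\<bar>\<rceil>" using \<alpha>(3) ev S by linarith
  moreover have "- L - ?s \<le> ?\<xi> \<and> ?\<xi> \<le> ?s"
  proof (rule ccontr)
    assume out: "\<not> (- L - ?s \<le> ?\<xi> \<and> ?\<xi> \<le> ?s)"
    have "E < landau_ev L m k"
    proof (rule dirichlet_ev_gt_potential)
      fix x assume x: "?\<xi> < x" "x < ?\<xi> + L"
      have "?s < \<bar>x\<bar>" using out x by auto
      moreover have "0 \<le> ?s" by simp
      ultimately have "?s\<^sup>2 < \<bar>x\<bar>\<^sup>2" by (intro power_strict_mono) auto
      then show "E < x\<^sup>2" by simp
    qed (use L in simp)
    then show False using \<alpha>(3) S by linarith
  qed
  ultimately show "\<alpha> \<in> {m. - L - ?s \<le> quasi_momentum L m \<and> quasi_momentum L m \<le> ?s}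
      \<times> (SIGMA k:{..nat \<lceil>\<bar>E\<bar>\<rceil>}. lattice_ball dirs L (E - (2 * real k + 1)))"
    unfolding \<alpha>(1) by simp
qed

text \<open>
  The wells that contain \<open>[- R, R]\<close> have their first eigenvalues within \<open>\<epsilon>\<close> of the Landau levels.
\<close>

lemma landau_index_lower:
  assumes "\<And>k a b. k \<le> K \<Longrightarrow> a \<le> - R \<Longrightarrow> R \<le> b \<Longrightarrow> dirichlet_ev a b k \<le> 2 * real k + 1 + \<epsilon>"
  shows "{m. R - L \<le> quasi_momentum L m \<and> quasi_momentum L m \<le> - R}
      \<times> (SIGMA k:{..K}. lattice_ball dirs L (E - \<epsilon> - (2 * real k + 1)))
    \<subseteq> {\<alpha>\<in>landau_index. landau_eigenvalue \<alpha> \<le> E}"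
proof (rule subsetI)
  fix \<alpha> assume "\<alpha> \<in> {m. R - L \<le> quasi_momentum L m \<and> quasi_momentum L m \<le> - R}
      \<times> (SIGMA k:{..K}. lattice_ball dirs L (E - \<epsilon> - (2 * real k + 1)))"
  then obtain m k n where \<alpha>: "\<alpha> = (m, k, n)"
    and m: "R - L \<le> quasi_momentum L m" "quasi_momentum L m \<le> - R" and k: "k \<in> {..K}"
    and n: "n \<in> lattice_ball dirs L (E - \<epsilon> - (2 * real k + 1))"
    by auto
  have "(m, k, n) \<in> landau_index" using n by (auto simp: landau_index_def lattice_ball_def)
  have "landau_ev L m k \<le> 2 * real k + 1 + \<epsilon>" by (rule assms) (use m k in auto)
  moreover have "(\<Sum>j\<in>dirs. (pi * real (n j) / L)\<^sup>2) \<le> E - \<epsilon> - (2 * real k + 1)"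
    using n by (auto simp: lattice_ball_def)
  ultimately have "landau_eigenvalue (m, k, n) \<le> E" by (simp add: landau_eigenvalue_def)
  with \<open>(m, k, n) \<in> landau_index\<close> show "\<alpha> \<in> {\<alpha>\<in>landau_index. landau_eigenvalue \<alpha> \<le> E}"
    unfolding \<alpha> by simp
qed

lemma finite_landau_index: "finite {\<alpha>\<in>landau_index. landau_eigenvalue \<alpha> \<le> E}"
  by (rule finite_subset[OF landau_index_upper])
     (intro finite_cartesian_product finite_quasi_momenta finite_SigmaI finite_atMost finite_lattice_ball L finite)

lemma landau_core_lincomb:
  assumes "\<And>i. i \<in> F \<Longrightarrow> f i \<in> landau_core i1 L"
  shows "(\<lambda>x. \<Sum>i\<in>F. c i * f i x) \<in> landau_core i1 L"
proof -
  have "smooth (\<lambda>x. \<Sum>i\<in>F. c i * f i x)" by (rule smooth_lincomb(1)) (use landau_coreD(1)[OF assms] in blast)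
  moreover have "(\<Sum>i\<in>F. c i * f i x) = 0" if "x \<in> cube L" "j \<noteq> i1" "x $ j = 0 \<or> x $ j = L" for x j
    using landau_coreD(3)[OF assms that] by simp
  ultimately show ?thesis
    using landau_coreD(2)[OF assms] unfolding landau_core_def smooth_def by auto
qed

lemma landau_eigenfun_core: "landau_eigenfun \<alpha> \<in> landau_core i1 L"
proof -
  obtain m k n where \<alpha>: "\<alpha> = (m, k, n)" by (cases \<alpha>) auto
  have "sep m (well_fun L m k) n \<in> landau_core i1 L"
    by (intro separated_core well_fun_entire well_fun_boundary L)
  from landau_core_lincomb[of "{0::nat}" "\<lambda>_. sep m (well_fun L m k) n" "\<lambda>_. of_real (norm_const m k)", OF this]
  show ?thesis by (simp add: \<alpha> landau_eigenfun_def)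
qed

lemma landau_op_eigenfun: "landau_op i1 i2 (landau_eigenfun \<alpha>) x = of_real (landau_eigenvalue \<alpha>) * landau_eigenfun \<alpha> x"
proof -
  obtain m k n where \<alpha>: "\<alpha> = (m, k, n)" by (cases \<alpha>) auto
  have "smooth (sep m (well_fun L m k) n)" by (intro smooth_tensor separated_entire well_fun_entire)
  from landau_op_lincomb[of "{0::nat}" "\<lambda>_. sep m (well_fun L m k) n" i1 i2 "\<lambda>_. of_real (norm_const m k)" x, OF this ne]
  show ?thesis
    by (simp add: \<alpha> landau_eigenfun_def landau_op_separated landau_eigenvalue_def del: of_real_add)
qed

theorem landau_counting_eq_card:
  "landau_counting i1 i2 L lam = of_nat (card {\<alpha>\<in>landau_index. landau_eigenvalue \<alpha> \<le> lam})"
proof -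
  have "orthonormal_eigensystem (cube_measure L) (landau_core i1 L) (landau_op i1 i2)
      landau_index landau_eigenfun landau_eigenvalue"
  proof (intro orthonormal_eigensystem.intro finite_measure_cube orthonormal_eigensystem_axioms.intro)
    show "\<psi> \<in> L2_space (cube_measure L)" if "\<psi> \<in> landau_core i1 L" for \<psi>
      using landau_coreD(1)[OF that] by (intro continuous_L2_cube smooth_continuous)
    show "landau_op i1 i2 \<psi> \<in> L2_space (cube_measure L)" if "\<psi> \<in> landau_core i1 L" for \<psi>
      using landau_coreD(1)[OF that] ne by (intro continuous_L2_cube smooth_landau_op_continuous)
    show "(\<lambda>x. \<Sum>\<alpha>\<in>F. c \<alpha> * landau_eigenfun \<alpha> x) \<in> landau_core i1 L" for F c
      by (rule landau_core_lincomb[OF landau_eigenfun_core])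
    show "landau_op i1 i2 (\<lambda>x. \<Sum>\<alpha>\<in>F. c \<alpha> * landau_eigenfun \<alpha> x) x
        = (\<Sum>\<alpha>\<in>F. c \<alpha> * of_real (landau_eigenvalue \<alpha>) * landau_eigenfun \<alpha> x)" for F c x
      using landau_op_lincomb[OF landau_coreD(1)[OF landau_eigenfun_core] ne]
      by (simp add: landau_op_eigenfun mult.assoc)
    show "L2_inner (cube_measure L) (landau_op i1 i2 \<psi>) (landau_eigenfun \<alpha>)
        = of_real (landau_eigenvalue \<alpha>) * L2_inner (cube_measure L) \<psi> (landau_eigenfun \<alpha>)"
      if "\<psi> \<in> landau_core i1 L" for \<psi> \<alpha>
      unfolding landau_symmetric[OF L ne that landau_eigenfun_core] landau_op_eigenfun[abs_def]
      by (simp add: L2_inner_scale_right)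
  qed (use landau_orthonormal landau_complete finite_landau_index in auto)
  from orthonormal_eigensystem.counting_function_eq_card[OF this] show ?thesis
    unfolding landau_counting_def landau_cube_graph_def .
qed

lemma card_landau_index_le:
  "real (card {\<alpha>\<in>landau_index. landau_eigenvalue \<alpha> \<le> E})
    \<le> ((L + 2 * sqrt (max 0 E)) * L / (2 * pi) + 1)
      * (\<Sum>k\<le>nat \<lceil>\<bar>E\<bar>\<rceil>. real (card (lattice_ball dirs L (E - (2 * real k + 1)))))"
proof -
  let ?s = "sqrt (max 0 E)"
  let ?M = "{m. - L - ?s \<le> quasi_momentum L m \<and> quasi_momentum L m \<le> ?s}"
  let ?S = "SIGMA k:{..nat \<lceil>\<bar>E\<bar>\<rceil>}. lattice_ball dirs L (E - (2 * real k + 1))"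
  have "card {\<alpha>\<in>landau_index. landau_eigenvalue \<alpha> \<le> E} \<le> card (?M \<times> ?S)"
    by (intro card_mono landau_index_upper finite_cartesian_product finite_quasi_momenta finite_SigmaI
        finite_atMost finite_lattice_ball L finite)
  also have "\<dots> = card ?M * (\<Sum>k\<le>nat \<lceil>\<bar>E\<bar>\<rceil>. card (lattice_ball dirs L (E - (2 * real k + 1))))"
    using L by (simp add: card_cartesian_product card_SigmaI finite_lattice_ball)
  finally have "real (card {\<alpha>\<in>landau_index. landau_eigenvalue \<alpha> \<le> E})
      \<le> real (card ?M) * (\<Sum>k\<le>nat \<lceil>\<bar>E\<bar>\<rceil>. real (card (lattice_ball dirs L (E - (2 * real k + 1)))))"
    by (simp only: of_nat_le_iff of_nat_mult of_nat_sum flip: of_nat_sum of_nat_mult)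
  also have "\<dots> \<le> ((L + 2 * ?s) * L / (2 * pi) + 1)
      * (\<Sum>k\<le>nat \<lceil>\<bar>E\<bar>\<rceil>. real (card (lattice_ball dirs L (E - (2 * real k + 1)))))"
  proof (rule mult_right_mono)
    have "0 \<le> ?s" by simp
    with L have le: "- L - ?s \<le> ?s" by linarith
    have d: "?s - (- L - ?s) = L + 2 * ?s" by simp
    show "real (card ?M) \<le> (L + 2 * ?s) * L / (2 * pi) + 1" using card_quasi_momenta(1)[OF le] unfolding d .
  qed (simp add: sum_nonneg)
  finally show ?thesis .
qed

lemma card_landau_index_ge:
  assumes "\<And>k a b. k \<le> K \<Longrightarrow> a \<le> - R \<Longrightarrow> R \<le> b \<Longrightarrow> dirichlet_ev a b k \<le> 2 * real k + 1 + \<epsilon>"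
    and "2 * R \<le> L"
  shows "((L - 2 * R) * L / (2 * pi) - 1) * (\<Sum>k\<le>K. real (card (lattice_ball dirs L (E - \<epsilon> - (2 * real k + 1)))))
    \<le> real (card {\<alpha>\<in>landau_index. landau_eigenvalue \<alpha> \<le> E})"
proof -
  let ?M = "{m. R - L \<le> quasi_momentum L m \<and> quasi_momentum L m \<le> - R}"
  let ?S = "SIGMA k:{..K}. lattice_ball dirs L (E - \<epsilon> - (2 * real k + 1))"
  have "((L - 2 * R) * L / (2 * pi) - 1) * (\<Sum>k\<le>K. real (card (lattice_ball dirs L (E - \<epsilon> - (2 * real k + 1)))))
      \<le> real (card ?M) * (\<Sum>k\<le>K. real (card (lattice_ball dirs L (E - \<epsilon> - (2 * real k + 1)))))"
  proof (rule mult_right_mono)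
    have le: "R - L \<le> - R" using assms(2) by simp
    have d: "- R - (R - L) = L - 2 * R" by simp
    show "(L - 2 * R) * L / (2 * pi) - 1 \<le> real (card ?M)" using card_quasi_momenta(2)[OF le] unfolding d .
  qed (simp add: sum_nonneg)
  also have "\<dots> = real (card ?M * (\<Sum>k\<le>K. card (lattice_ball dirs L (E - \<epsilon> - (2 * real k + 1)))))" by simp
  also have "card ?M * (\<Sum>k\<le>K. card (lattice_ball dirs L (E - \<epsilon> - (2 * real k + 1)))) = card (?M \<times> ?S)"
    using L by (simp add: card_cartesian_product card_SigmaI finite_lattice_ball)
  also have "\<dots> \<le> card {\<alpha>\<in>landau_index. landau_eigenvalue \<alpha> \<le> E}"
    by (intro card_mono finite_landau_index landau_index_lower assms(1))
  finally show ?thesis by simp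
qed

end

section \<open>The integrated density of states\<close>

text \<open>
  The contributions of the Landau levels \<open>0\<close> to \<open>K\<close>; the factor \<open>1 / (2 * pi)\<close> is the number of wells per unit
  area.
\<close>

definition level_sum :: "nat \<Rightarrow> nat \<Rightarrow> real \<Rightarrow> real" where
  "level_sum p K E = (\<Sum>k\<le>K. weyl_density p (E - (2 * real k + 1))) / (2 * pi)"

lemma level_sum_nonneg: "0 \<le> level_sum p K E"
  unfolding level_sum_def by (intro divide_nonneg_nonneg sum_nonneg weyl_density_nonneg) simp

lemma isCont_level_sum: "isCont (level_sum p K) E"
  unfolding level_sum_def
  by (intro continuous_intros isCont_o2[OF _ isCont_weyl_density] isCont_divide isCont_sum) auto

lemma uniform_well_radius:
  assumes "\<epsilon> > 0"
  shows "\<exists>R. \<forall>k\<le>K. \<forall>a b. a \<le> - R \<longrightarrow> R \<le> b \<longrightarrow> dirichlet_ev a b k \<le> 2 * real k + 1 + \<epsilon>"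
proof (induction K)
  case 0
  show ?case using dirichlet_ev_le[OF assms, of 0] by auto
next
  case (Suc K)
  obtain R where R: "\<forall>k\<le>K. \<forall>a b. a \<le> - R \<longrightarrow> R \<le> b \<longrightarrow> dirichlet_ev a b k \<le> 2 * real k + 1 + \<epsilon>"
    using Suc by blast
  obtain S where S: "\<forall>a b. a \<le> - S \<longrightarrow> S \<le> b \<longrightarrow> dirichlet_ev a b (Suc K) \<le> 2 * real (Suc K) + 1 + \<epsilon>"
    using dirichlet_ev_le[OF assms, of "Suc K"] by blast
  show ?case
  proof (intro exI[of _ "max R S"] allI impI)
    fix k a b assume k: "k \<le> Suc K" and a: "a \<le> - max R S" and b: "max R S \<le> b"
    have RS: "a \<le> - R" "R \<le> b" "a \<le> - S" "S \<le> b" using a b by linarith+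
    show "dirichlet_ev a b k \<le> 2 * real k + 1 + \<epsilon>"
    proof (cases "k = Suc K")
      case True
      then show ?thesis using S RS(3,4) by blast
    next
      case False
      then have "k \<le> K" using k by simp
      then show ?thesis using R RS(1,2) by blast
    qed
  qed
qed

text \<open>The first factor is a number of wells divided by \<open>L\<^sup>2\<close>.\<close>

lemma level_count_tendsto:
  assumes "finite A" "A \<noteq> {}"
  shows "((\<lambda>L. ((L + c) * L / (2 * pi) + e) / L\<^sup>2
      * (\<Sum>k\<le>K. real (card (lattice_ball A L (E - (2 * real k + 1)))) / L ^ card A)) \<longlongrightarrow> level_sum (card A) K E) at_top"
proof -
  have inv: "((\<lambda>L::real. inverse L) \<longlongrightarrow> 0) at_top"
    by (rule tendsto_inverse_0_at_top) (rule filterlim_ident)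
  have "((\<lambda>L. 1 / (2 * pi) + c / (2 * pi) * inverse L + e * (inverse L * inverse L))
      \<longlongrightarrow> 1 / (2 * pi) + c / (2 * pi) * 0 + e * (0 * 0)) at_top"
    by (intro tendsto_intros inv)
  moreover have "\<forall>\<^sub>F L in at_top. 1 / (2 * pi) + c / (2 * pi) * inverse L + e * (inverse L * inverse L)
      = ((L + c) * L / (2 * pi) + e) / L\<^sup>2"
    using eventually_gt_at_top[of 0]
  proof eventually_elim
    case (elim L)
    have "((L + c) * L / (2 * pi) + e) / (L * L) = (L * L * (1 / (2 * pi)) + L * (c / (2 * pi)) + e) / (L * L)"
      by (simp add: distrib_right add_divide_distrib mult.commute)
    also have "\<dots> = 1 / (2 * pi) + c / (2 * pi) * inverse L + e * (inverse L * inverse L)"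
    proof -
      have "(L * L * a + L * b + e) / (L * L) = a + b * inverse L + e * (inverse L * inverse L)" for a b
        using elim by (simp add: field_simps)
      then show ?thesis .
    qed
    finally show ?case unfolding power2_eq_square by (rule sym)
  qed
  ultimately have "((\<lambda>L. ((L + c) * L / (2 * pi) + e) / L\<^sup>2) \<longlongrightarrow> 1 / (2 * pi) + c / (2 * pi) * 0 + e * (0 * 0)) at_top"
    by (rule Lim_transform_eventually)
  then have "((\<lambda>L. ((L + c) * L / (2 * pi) + e) / L\<^sup>2) \<longlongrightarrow> 1 / (2 * pi)) at_top"
    by (simp only: mult_zero_right add_0_right)
  have "((\<lambda>L. ((L + c) * L / (2 * pi) + e) / L\<^sup>2
      * (\<Sum>k\<le>K. real (card (lattice_ball A L (E - (2 * real k + 1)))) / L ^ card A))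
    \<longlongrightarrow> 1 / (2 * pi) * (\<Sum>k\<le>K. weyl_density (card A) (E - (2 * real k + 1)))) at_top"
    by (intro tendsto_mult[OF \<open>(_ \<longlongrightarrow> 1 / (2 * pi)) at_top\<close>] tendsto_sum lattice_ball_asymptotics assms)
  then show ?thesis by (simp only: level_sum_def times_divide_eq_left mult_1)
qed

text \<open>
  The upper bound for the number of eigenvalues has the right limit.  The lower bound loses an energy
  \<open>\<epsilon>\<close>, which is recovered by the continuity of the Weyl densities in the energy.
\<close>

theorem landau_density_limit:
  fixes i1 i2 :: "'n::finite"
  assumes ne: "i1 \<noteq> i2" and d: "CARD('n) \<ge> 3"
  shows "((\<lambda>L. landau_counting i1 i2 L lam / ennreal (L ^ CARD('n)))
    \<longlongrightarrow> ennreal (level_sum (CARD('n) - 2) (nat \<lceil>\<bar>lam\<bar>\<rceil>) lam)) at_top"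
proof -
  let ?A = "UNIV - {i1, i2} :: 'n set" and ?K = "nat \<lceil>\<bar>lam\<bar>\<rceil>"
  have cA: "card ?A = CARD('n) - 2" using ne by (simp add: card_Diff_subset)
  then have cA2: "CARD('n) = 2 + card ?A" and "card ?A \<noteq> 0" using d by linarith+
  then have A: "finite ?A" "?A \<noteq> {}" by (simp, metis card.empty)
  define N where "N L = enn2real (landau_counting i1 i2 L lam)" for L
  \<comment> \<open>the normalised number of admissible pairs \<open>(k, n)\<close>\<close>
  define S where "S L E = (\<Sum>k\<le>?K. real (card (lattice_ball ?A L (E - (2 * real k + 1)))) / L ^ card ?A)" for L E
  have S: "(\<Sum>k\<le>?K. real (card (lattice_ball ?A L (E - (2 * real k + 1))))) = L ^ card ?A * S L E" if "L > 0" for L E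
    using that by (simp add: S_def sum_distrib_left)
  have upper: "N L / L ^ CARD('n) \<le> ((L + 2 * sqrt (max 0 lam)) * L / (2 * pi) + 1) / L\<^sup>2 * S L lam" if L: "L > 0" for L
  proof -
    interpret landau_cube L i1 i2 using L ne by unfold_locales
    have "N L \<le> ((L + 2 * sqrt (max 0 lam)) * L / (2 * pi) + 1) * (L ^ card ?A * S L lam)"
      using card_landau_index_le[of lam] unfolding N_def landau_counting_eq_card S[OF L] by simp
    then show ?thesis using L unfolding cA2 power_add by (simp add: field_simps power2_eq_square)
  qed
  have lower: "\<exists>R. \<forall>L>0. 2 * R \<le> L \<longrightarrow>
      ((L + (- 2 * R)) * L / (2 * pi) + - 1) / L\<^sup>2 * S L (lam - \<epsilon>) \<le> N L / L ^ CARD('n)" if eps: "\<epsilon> > 0" for \<epsilon>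
  proof -
    obtain R where R: "\<forall>k\<le>?K. \<forall>a b. a \<le> - R \<longrightarrow> R \<le> b \<longrightarrow> dirichlet_ev a b k \<le> 2 * real k + 1 + \<epsilon>"
      using uniform_well_radius[OF eps, of ?K] by blast
    have "((L + (- 2 * R)) * L / (2 * pi) + - 1) / L\<^sup>2 * S L (lam - \<epsilon>) \<le> N L / L ^ CARD('n)" if LR: "L > 0" "2 * R \<le> L" for L
    proof -
      interpret landau_cube L i1 i2 using LR ne by unfold_locales
      have "((L - 2 * R) * L / (2 * pi) - 1) * (L ^ card ?A * S L (lam - \<epsilon>)) \<le> N L"
        using card_landau_index_ge[of ?K R \<epsilon> lam] R LR(2) unfolding N_def landau_counting_eq_card S[OF LR(1)] by simp
      then have "((L - 2 * R) * L / (2 * pi) - 1) * (L ^ card ?A * S L (lam - \<epsilon>)) / (L\<^sup>2 * L ^ card ?A)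
          \<le> N L / (L\<^sup>2 * L ^ card ?A)"
        by (rule divide_right_mono) (use LR in simp)
      moreover have "q * (L ^ card ?A * S L (lam - \<epsilon>)) / (L\<^sup>2 * L ^ card ?A) = q / L\<^sup>2 * S L (lam - \<epsilon>)" for q
        using LR by simp
      ultimately show ?thesis unfolding cA2 power_add by simp
    qed
    then show ?thesis by blast
  qed
  have lim: "((\<lambda>L. N L / L ^ CARD('n)) \<longlongrightarrow> level_sum (card ?A) ?K lam) at_top"
  proof (rule order_tendstoI)
    fix b assume "level_sum (card ?A) ?K lam < b"
    from order_tendstoD(2)[OF level_count_tendsto[OF A] this]
    have "\<forall>\<^sub>F L in at_top. ((L + 2 * sqrt (max 0 lam)) * L / (2 * pi) + 1) / L\<^sup>2 * S L lam < b"
      unfolding S_def .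
    then show "\<forall>\<^sub>F L in at_top. N L / L ^ CARD('n) < b"
      using eventually_gt_at_top[of 0] by eventually_elim (rule le_less_trans[OF upper])
  next
    fix a assume a: "a < level_sum (card ?A) ?K lam"
    have "((\<lambda>\<epsilon>. level_sum (card ?A) ?K (lam - \<epsilon>)) \<longlongrightarrow> level_sum (card ?A) ?K lam) (at_right 0)"
      by (rule isCont_tendsto_compose[OF isCont_level_sum]) (auto intro!: tendsto_eq_intros)
    from eventually_happens'[OF _ eventually_conj[OF order_tendstoD(1)[OF this a] eventually_at_right_less]]
    obtain \<epsilon> where \<epsilon>: "a < level_sum (card ?A) ?K (lam - \<epsilon>)" "0 < \<epsilon>" by auto
    obtain R where R: "\<forall>L>0. 2 * R \<le> L \<longrightarrow>
      ((L + (- 2 * R)) * L / (2 * pi) + - 1) / L\<^sup>2 * S L (lam - \<epsilon>) \<le> N L / L ^ CARD('n)"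
      using lower[OF \<epsilon>(2)] by blast
    from order_tendstoD(1)[OF level_count_tendsto[OF A] \<epsilon>(1)]
    have "\<forall>\<^sub>F L in at_top. a < ((L + (- 2 * R)) * L / (2 * pi) + - 1) / L\<^sup>2 * S L (lam - \<epsilon>)"
      unfolding S_def .
    then show "\<forall>\<^sub>F L in at_top. a < N L / L ^ CARD('n)"
      using eventually_gt_at_top[of 0] eventually_ge_at_top[of "2 * R"]
    proof eventually_elim
      case (elim L)
      show ?case by (rule less_le_trans[OF elim(1)]) (use R elim(2,3) in blast)
    qed
  qed
  have "\<forall>\<^sub>F L in at_top. landau_counting i1 i2 L lam / ennreal (L ^ CARD('n)) = ennreal (N L / L ^ CARD('n))"
    using eventually_gt_at_top[of 0]
  proof eventually_elim
    case (elim L)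
    interpret landau_cube L i1 i2 using elim ne by unfold_locales
    have c: "landau_counting i1 i2 L lam = ennreal (N L)"
      unfolding N_def landau_counting_eq_card by (simp add: ennreal_of_nat_eq_real_of_nat)
    have "0 \<le> N L" by (simp add: N_def)
    then show ?case unfolding c by (rule divide_ennreal) (use elim in simp)
  qed
  then have "\<forall>\<^sub>F L in at_top. ennreal (N L / L ^ CARD('n)) = landau_counting i1 i2 L lam / ennreal (L ^ CARD('n))"
    by eventually_elim (rule sym)
  from Lim_transform_eventually[OF tendsto_ennrealI[OF lim] this] show ?thesis unfolding cA .
qed

section \<open>The lattice slices of the paraboloid\<close>

text \<open>The degenerate ball is a null set, as there is at least one dimension.\<close>

lemma emeasure_euclid_ball:
  assumes "finite A" "A \<noteq> {}" "0 \<le> r"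
  shows "emeasure (Pi\<^sub>M A (\<lambda>_. lborel)) (euclid_ball A r) = ennreal (unit_ball_vol (real (card A)) * r ^ card A)"
proof (cases "r = 0")
  case True
  have "euclid_ball A 0 \<subseteq> Pi\<^sub>E A (\<lambda>_. {0})"
  proof
    fix y assume y: "y \<in> euclid_ball A 0"
    have "(\<Sum>i\<in>A. (y i)\<^sup>2) = 0" using y sum_nonneg[of A "\<lambda>i. (y i)\<^sup>2"] by simp
    then have "\<forall>i\<in>A. y i = 0" using assms(1) by (simp add: sum_nonneg_eq_0_iff)
    moreover have "y \<in> extensional A" using y by (auto simp: space_PiM PiE_iff)
    ultimately show "y \<in> Pi\<^sub>E A (\<lambda>_. {0})" unfolding PiE_iff by blast
  qed
  then have "emeasure (Pi\<^sub>M A (\<lambda>_. lborel)) (euclid_ball A 0) \<le> emeasure (Pi\<^sub>M A (\<lambda>_. lborel :: real measure)) (Pi\<^sub>E A (\<lambda>_. {0}))"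
    by (rule emeasure_mono) (rule sets_PiM_I_finite[OF assms(1)], simp)
  also have "\<dots> = (\<Prod>i\<in>A. emeasure (lborel :: real measure) {0})"
  proof -
    interpret product_sigma_finite "\<lambda>_. lborel :: real measure" by unfold_locales
    show ?thesis by (rule emeasure_PiM[OF assms(1)]) simp
  qed
  also have "\<dots> = 0" using assms(1,2) by (simp add: card_gt_0_iff)
  finally show ?thesis using True assms(1,2) by (simp add: card_gt_0_iff)
next
  case False
  then show ?thesis using assms by (intro emeasure_cball_aux) auto
qed

text \<open>The slice at height \<open>z 0\<close> is a ball of radius \<open>sqrt (\<rho> - z 0)\<close>.\<close>

lemma paraboloid_slice_volume:
  assumes "2 \<le> n" "z \<in> {..<1} \<rightarrow>\<^sub>E UNIV"
  shows "measure (Pi\<^sub>M {1..<n} (\<lambda>_. lborel)) {y \<in> {1..<n} \<rightarrow>\<^sub>E UNIV. merge {..<1} {1..<n} (z, y) \<in> Omega n \<rho>}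
    = (if 0 \<le> z 0 then unit_ball_vol (real (n - 1)) * sqrt (max 0 (\<rho> - z 0)) ^ (n - 1) else 0)"
    (is "measure ?M ?S = _")
proof -
  have "merge {..<1} {1..<n} (z, y) \<in> Omega n \<rho> \<longleftrightarrow> 0 \<le> z 0 \<and> (\<Sum>i=1..<n. (y i)\<^sup>2) \<le> \<rho> - z 0" for y
  proof -
    have m1: "merge {..<1} {1..<n} (z, y) \<in> {..<n} \<rightarrow>\<^sub>E UNIV"
      using assms(1) by (auto simp: PiE_iff merge_def extensional_def)
    have m2: "(\<Sum>i=1..<n. (merge {..<1} {1..<n} (z, y) i)\<^sup>2) = (\<Sum>i=1..<n. (y i)\<^sup>2)"
      by (rule sum.cong) (auto simp: merge_def)
    have m3: "merge {..<1} {1..<n} (z, y) 0 = z 0" by (simp add: merge_def)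
    have "z 0 \<le> \<rho> - (\<Sum>i=1..<n. (y i)\<^sup>2) \<longleftrightarrow> (\<Sum>i=1..<n. (y i)\<^sup>2) \<le> \<rho> - z 0" by linarith
    then show ?thesis unfolding Omega_def mem_Collect_eq m2 m3 by (simp only: m1 simp_thms)
  qed
  then have S: "?S = {y \<in> {1..<n} \<rightarrow>\<^sub>E UNIV. 0 \<le> z 0 \<and> (\<Sum>i=1..<n. (y i)\<^sup>2) \<le> \<rho> - z 0}" by (simp only:)
  have nn: "0 \<le> (\<Sum>i=1..<n. (y i)\<^sup>2)" for y :: "nat \<Rightarrow> real" by (intro sum_nonneg) simp
  show ?thesis
  proof (cases "0 \<le> z 0 \<and> z 0 \<le> \<rho>")
    case True
    then have r: "0 \<le> sqrt (\<rho> - z 0)" by simp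
    have "?S = euclid_ball {1..<n} (sqrt (\<rho> - z 0))"
      unfolding S using True by (auto simp: space_PiM)
    then have "emeasure ?M ?S = ennreal (unit_ball_vol (real (n - 1)) * sqrt (\<rho> - z 0) ^ (n - 1))"
      using emeasure_euclid_ball[OF _ _ r, of "{1..<n}"] assms(1) by simp
    then show ?thesis using True r by (simp add: measure_def max_def)
  next
    case False
    have E: "?S = {}"
    proof -
      have "\<not> (0 \<le> z 0 \<and> (\<Sum>i=1..<n. (y i)\<^sup>2) \<le> \<rho> - z 0)" for y using nn[of y] False by linarith
      then show ?thesis unfolding S by blast
    qed
    show ?thesis unfolding E measure_empty using False assms(1) by (auto simp: max_def)
  qed
qed

lemma P_one_eq:
  assumes n: "2 \<le> n" and K: "\<rho> \<le> real K"
  shows "P \<rho> n 1 = (\<Sum>k\<le>K. unit_ball_vol (real (n - 1)) * sqrt (max 0 (\<rho> - real k)) ^ (n - 1))"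
proof -
  let ?v = "\<lambda>t. if 0 \<le> t then unit_ball_vol (real (n - 1)) * sqrt (max 0 (\<rho> - t)) ^ (n - 1) else 0"
  let ?c = "\<lambda>k::nat. (\<lambda>i::nat\<in>{..<1}. real k)"
  have inj: "inj_on ?c {..K}"
  proof (rule inj_onI)
    fix k l assume "?c k = ?c l"
    from fun_cong[OF this, of 0] show "k = l" by simp
  qed
  have "P \<rho> n 1 = (\<Sum>\<^sub>\<infinity>z \<in> {..<1::nat} \<rightarrow>\<^sub>E \<int>. ?v (z 0))"
    unfolding P_def
  proof (rule infsum_cong)
    fix z assume "z \<in> {..<1::nat} \<rightarrow>\<^sub>E (\<int> :: real set)"
    then have "z \<in> {..<1} \<rightarrow>\<^sub>E UNIV" by (auto simp: PiE_iff)
    from paraboloid_slice_volume[OF n this, of \<rho>]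
    show "measure (Pi\<^sub>M {1..<n} (\<lambda>_. lborel)) {y \<in> {1..<n} \<rightarrow>\<^sub>E UNIV. merge {..<1} {1..<n} (z, y) \<in> Omega n \<rho>} = ?v (z 0)" .
  qed
  also have "\<dots> = (\<Sum>\<^sub>\<infinity>z \<in> ?c ` {..K}. ?v (z 0))"
  proof (rule infsum_cong_neutral)
    fix z assume "z \<in> ({..<1} \<rightarrow>\<^sub>E \<int>) - ?c ` {..K}"
    then have z: "z \<in> {..<1} \<rightarrow>\<^sub>E \<int>" "z \<notin> ?c ` {..K}" by auto
    obtain m where m: "z 0 = of_int m" using z(1) by (auto simp: PiE_iff elim: Ints_cases)
    show "?v (z 0) = 0"
    proof (cases "0 \<le> m")
      case True
      have "z = ?c (nat m)"
      proof
        fix i show "z i = ?c (nat m) i"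
          using z(1) m True by (cases "i = 0") (auto simp: PiE_iff extensional_def)
      qed
      then have "\<not> nat m \<le> K" using z(2) by blast
      then have "max 0 (\<rho> - z 0) = 0" using K m True by linarith
      then show ?thesis using n by simp
    qed (simp add: m)
  qed auto
  also have "\<dots> = (\<Sum>k\<le>K. ?v (?c k 0))"
    unfolding infsum_finite[OF finite_imageI[OF finite_atMost]] by (subst sum.reindex[OF inj]) (simp only: o_def)
  finally show ?thesis by simp
qed

text \<open>
  Since \<open>lam - (2 * k + 1)\<close> is twice \<open>\<rho> - k\<close>, each Weyl density is the same multiple of the volume of a slice.
\<close>

lemma level_sum_eq_P:
  assumes d: "3 \<le> d"
  shows "level_sum (d - 2) (nat \<lceil>\<bar>lam\<bar>\<rceil>) lam
    = 2 powr (- (real d / 2)) * pi powr (1 - real d) * P ((lam - 1) / 2) (d - 1) 1"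
proof -
  obtain p where p: "d = p + 2" "1 \<le> p" using d by (auto intro: that[of "d - 2"])
  let ?K = "nat \<lceil>\<bar>lam\<bar>\<rceil>" and ?\<rho> = "(lam - 1) / 2"
  have half: "sqrt 2 / 2 = (2::real) powr (- (1 / 2))"
    by (simp add: powr_minus powr_half_sqrt field_simps)
  have "sqrt 2 / (2 * pi) = (sqrt 2 / 2) * (1 / pi)" by simp
  also have "\<dots> = 2 powr (- (1 / 2)) * pi powr (- 1)" unfolding half by (simp only: powr_neg_one pi_gt_zero)
  finally have base: "sqrt 2 / (2 * pi) = 2 powr (- (1 / 2)) * pi powr (- 1)" .
  have pw: "(a powr b) ^ p = a powr (b * real p)" if "a > 0" for a b :: real
    using that by (simp add: powr_powr flip: powr_realpow)
  have twopi: "2 * pi = 2 powr 1 * pi powr 1" by simp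
  have ex: "- (1 / 2) * real p - 1 = - (real d / 2)" "- 1 * real p - 1 = 1 - real d"
    unfolding p(1) by (simp_all add: field_simps)
  have "(sqrt 2 / (2 * pi)) ^ p = 2 powr (- (1 / 2) * real p) * pi powr (- 1 * real p)"
    unfolding base power_mult_distrib by (subst (1 2) pw) simp_all
  then have "(sqrt 2 / (2 * pi)) ^ p / (2 * pi) = 2 powr (- (1 / 2) * real p - 1) * pi powr (- 1 * real p - 1)"
    unfolding powr_diff by (simp only: twopi times_divide_times_eq)
  then have const: "(sqrt 2 / (2 * pi)) ^ p / (2 * pi) = 2 powr (- (real d / 2)) * pi powr (1 - real d)"
    unfolding ex .
  have weyl: "weyl_density p (lam - (2 * real k + 1))
      = (sqrt 2 / (2 * pi)) ^ p * (unit_ball_vol (real p) * sqrt (max 0 (?\<rho> - real k)) ^ p)" for k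
  proof -
    have "max 0 (lam - (2 * real k + 1)) = 2 * max 0 (?\<rho> - real k)" by (auto simp: max_def field_simps)
    then show ?thesis
      unfolding weyl_density_def by (simp add: real_sqrt_mult power_mult_distrib power_divide)
  qed
  have "P ?\<rho> (d - 1) 1 = (\<Sum>k\<le>?K. unit_ball_vol (real p) * sqrt (max 0 (?\<rho> - real k)) ^ p)"
  proof -
    have "?\<rho> \<le> \<bar>lam\<bar>" by (simp add: field_simps)
    also have "\<dots> \<le> real ?K" by (rule real_nat_ceiling_ge)
    finally have "?\<rho> \<le> real ?K" .
    from P_one_eq[OF _ this, of "d - 1"] show ?thesis using p by simp
  qed
  moreover have "level_sum p ?K lam
      = (sqrt 2 / (2 * pi)) ^ p / (2 * pi) * (\<Sum>k\<le>?K. unit_ball_vol (real p) * sqrt (max 0 (?\<rho> - real k)) ^ p)"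
    unfolding level_sum_def weyl sum_distrib_left[symmetric] by simp
  ultimately show ?thesis unfolding const using p(1) by simp
qed

lemma level_sum_below_bottom:
  assumes "E < 1" "1 \<le> p"
  shows "level_sum p K E = 0"
proof -
  have "max 0 (E - (2 * real k + 1)) = 0" for k using assms(1) by simp
  then show ?thesis using assms(2) unfolding level_sum_def weyl_density_def by simp
qed

theorem proposition1p5:
  fixes i1 i2 :: "'n::finite" and d :: nat and lam :: real
  assumes "CARD('n) = d" and "d \<ge> 3" and "i1 \<noteq> i2"
  shows "has_landau_ids i1 i2 lam
           (if lam \<ge> 1
            then 2 powr (- (real d / 2)) * pi powr (1 - real d) * P ((lam - 1) / 2) (d - 1) 1
            else 0)"
proof -
  let ?c = "level_sum (d - 2) (nat \<lceil>\<bar>lam\<bar>\<rceil>) lam"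
  have eq: "(if lam \<ge> 1 then 2 powr (- (real d / 2)) * pi powr (1 - real d) * P ((lam - 1) / 2) (d - 1) 1 else 0) = ?c"
  proof (cases "1 \<le> lam")
    case False
    then show ?thesis using level_sum_below_bottom[of lam "d - 2"] assms(2) by simp
  next
    case True
    then show ?thesis unfolding level_sum_eq_P[OF assms(2)] by (simp only: if_True)
  qed
  show ?thesis
    unfolding eq has_landau_ids_def
    using landau_density_limit[OF assms(3), of lam] level_sum_nonneg[of "d - 2"] assms(1,2) by simp
qed

end
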